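(* Let $p\ge2$. For $(X_0,V_0)\in\mathcal X_p(0,1)$ let $X(t):=\mathsf P_{\mathcal K}(X_0+tV_0)$, $t\ge0$ (equivalently, $X$ is the unique strong solution of $\frac{d}{dt}X\in-\partial I_{\mathcal K}(X)+V_0$, $X(0)=X_0$; equivalently, the unique strong solution of $t\frac{d}{dt}X(t)\in-\partial I_{\mathcal K}(X(t))+X(t)-X_0$ with $\lim_{t\downarrow0}t^{-1}(X(t)-X_0)=V_0$ in $L^2(0,1)$), and let $V(t):=\frac{d^+}{dt}X(t)$. Then the time-dependent transformations $\mathsf S_t:(X_0,V_0)\mapsto(X(t),V(t))$, $t\ge0$, map $\mathcal X_p(0,1)$ into $\mathcal X_p(0,1)$ and define a right-continuous semigroup in $\mathcal X_p(0,1)$, satisfying $$(X(t),V(t))=\mathsf S_t(X_0,V_0)\quad\Longleftrightarrow\quad(\rho_t,\rho_tv_t)=\mathscr S_t(\rho_0,\rho_0v_0),$$ where $\rho_t=(X(t))_\#\lambda$ and $V(t)=v_t\circ X(t)$ for $t\ge 0$.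
   Context: $\lambda$ is Lebesgue measure on $(0,1)$ and $\#$ denotes push-forward. $\mathcal K\subset L^2(0,1)$ is the closed convex cone of (essentially) nondecreasing functions, identified with their right-continuous representatives; $\mathsf P_{\mathcal K}$ is the $L^2(0,1)$-projection onto $\mathcal K$; $I_{\mathcal K}$ is its indicator function, with $\partial I_{\mathcal K}(X)=\{\xi\in L^2(0,1):\int_0^1\xi(z-X)\,dw\le0\ \forall z\in\mathcal K\}$ for $X\in\mathcal K$. For $X\in\mathcal K$, $\mathcal H_X\subset L^2(0,1)$ is the closed subspace of functions essentially constant in each open interval where $X$ is constant (equivalently of the form $v\circ X$ with $v$ Borel). $\mathcal X_p(0,1):=\{(X,V)\in L^p(0,1)\times L^p(0,1):X\in\mathcal K,\ V=v\circ X\in\mathcal H_X\}$, with the product distance of $L^p(0,1)\times L^p(0,1)$. $\frac{d^+}{dt}$ is the right derivative. Strong solutions are locally absolutely continuous curves in $L^2(0,1)$ satisfying the inclusion for a.e. $t>0$. A right-continuous semigroup means $\mathsf S_{s+t}=\mathsf S_s\circ\mathsf S_t$ and $t\mapsto\mathsf S_t(X_0,V_0)$ is right-continuous. For a Borel probability measure $\rho$ on $\mathbb R$, $X_\rho(w):=\inf\{x:\rho((-\infty,x])>w\}$, $w\in(0,1)$. $\mathcal P_p(\mathbb R)$: Borel probability measures with finite $p$-moment, with the $L^p$-Wasserstein distance $W_p$. $\mathcal M(\mathbb R)$: signed Borel measures with finite total variation; weak convergence is in duality with bounded continuous functions. $\mathcal V_p(\mathbb R):=\{\mu=(\rho,\rho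 v)\in\mathcal P_p(\mathbb R)\times\mathcal M(\mathbb R):v\in L^p(\mathbb R,\rho)\}$ with the distance $D_p^p(\mu^1,\mu^2):=W_p^p(\rho^1,\rho^2)+\int_0^1|v^1(X_{\rho^1}(w))-v^2(X_{\rho^2}(w))|^p\,dw$. Semigroup $\mathscr S_t$. On the $D_p$-dense set $\hat{\mathcal V}(\mathbb R)$ of discrete data $\mu=(\sum_{i=1}^Nm_i\delta_{x_i},\sum_{i=1}^Nm_iv_i\delta_{x_i})$ ($m_i>0$, $\sum m_i=1$, $x_1<\dots<x_N$, $v_i\in\mathbb R$), $\mathscr S_t[\mu]:=(\sum_im_i\delta_{x_i(t)},\sum_im_iv_i(t)\delta_{x_i(t)})$, where $x_i(t)$ are continuous, piecewise linear, ordered trajectories with right-continuous piecewise constant velocities $v_i(t)$ (right derivatives of $x_i$), $x_i(0)=x_i$, $v_i(0)=v_i$; the sets $J_i(t):=\{j:x_j(t)=x_i(t)\}$ are nondecreasing in $t$; velocities are constant between the finitely many collision times $t_k$ (times at which some $J_i$ grows), and $v_i(t_k+)=\sum_{j\in J_i(t_k)}m_jv_j(t_k-)/\sum_{j\in J_i(t_k)}m_j$. On $\mathcal V_p(\mathbb R)$, $p\ge2$, $\mathscr S_t$ is the unique extension which is strongly-weakly continuous, i.e. such that if $D_p(\mu^n,\mu)\to0$, $\mathscr S_t[\mu^n]=(\rho^n_t,\rho^n_tv^n_t)$, $\mathscr S_t[\mu]=(\rho_t,\rho_tv_t)$, then $W_p(\rho^n_t,\rho_t)\to0$ and $\rho^n_tv^n_t\rightharpoonup\rho_tv_t$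 weakly in $\mathcal M(\mathbb R)$. *)

theory Defs
  imports "HOL-Probability.Probability"
begin

section \<open>Lebesgue spaces\<close>

text \<open>
  Elements of \<open>L\<^sup>p\<close> are represented by functions; equality of elements is equality almost
  everywhere.  The exponent \<open>p\<close> is a finite real number.
\<close>

definition Lp :: "real \<Rightarrow> 'a measure \<Rightarrow> ('a \<Rightarrow> real) set" where
  "Lp p M = {f \<in> borel_measurable M. integrable M (\<lambda>x. \<bar>f x\<bar> powr p)}"

definition Lp_norm :: "real \<Rightarrow> 'a measure \<Rightarrow> ('a \<Rightarrow> real) \<Rightarrow> real" where
  "Lp_norm p M f = (\<integral>x. \<bar>f x\<bar> powr p \<partial>M) powr (1 / p)"

definition leb01 :: "real measure" where
  "leb01 = restrict_space lborel {0<..<1}"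

definition ae_eq :: "(real \<Rightarrow> real) \<Rightarrow> (real \<Rightarrow> real) \<Rightarrow> bool" where
  "ae_eq f g \<longleftrightarrow> (AE w in leb01. f w = g w)"

abbreviation L2 :: "(real \<Rightarrow> real) set" where
  "L2 \<equiv> Lp 2 leb01"

abbreviation L2_dist :: "(real \<Rightarrow> real) \<Rightarrow> (real \<Rightarrow> real) \<Rightarrow> real" where
  "L2_dist f g \<equiv> Lp_norm 2 leb01 (\<lambda>w. f w - g w)"


section \<open>The cone of nondecreasing functions\<close>

definition cone_K :: "(real \<Rightarrow> real) set" where
  "cone_K = {X \<in> L2. \<exists>Z. mono_on {0<..<1} Z \<and> ae_eq X Z}"

text \<open>
  The projection of \<open>Y\<close> is represented by its right-continuous nondecreasing version.  The
  condition below depends only on the class of \<open>Y\<close>, so that almost everywhere equal functions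
  have the same projection.
\<close>

definition proj_K :: "(real \<Rightarrow> real) \<Rightarrow> real \<Rightarrow> real" where
  "proj_K Y = (SOME X. X \<in> cone_K \<and> mono_on {0<..<1} X \<and>
      (\<forall>w\<in>{0<..<1}. continuous (at_right w) X) \<and>
      (\<forall>Z\<in>cone_K. L2_dist Y X \<le> L2_dist Y Z))"

definition subdiff_I_K :: "(real \<Rightarrow> real) \<Rightarrow> (real \<Rightarrow> real) set" where
  "subdiff_I_K X = {\<xi> \<in> L2. X \<in> cone_K \<and>
      (\<forall>Z\<in>cone_K. (\<integral>w. \<xi> w * (Z w - X w) \<partial>leb01) \<le> 0)}"

text \<open>
  For \<open>X\<close> in the cone, the open intervals on which \<open>X\<close> is almost everywhere constant are those on
  which its right-continuous version is constant.
\<close>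

definition H_space :: "(real \<Rightarrow> real) \<Rightarrow> (real \<Rightarrow> real) set" where
  "H_space X = {V \<in> L2. \<forall>a b. 0 \<le> a \<and> a < b \<and> b \<le> 1 \<longrightarrow>
      (\<exists>c. AE w in leb01. w \<in> {a<..<b} \<longrightarrow> X w = c) \<longrightarrow>
      (\<exists>c. AE w in leb01. w \<in> {a<..<b} \<longrightarrow> V w = c)}"

definition X_space :: "real \<Rightarrow> ((real \<Rightarrow> real) \<times> (real \<Rightarrow> real)) set" where
  "X_space p = {(X, V). X \<in> Lp p leb01 \<and> V \<in> Lp p leb01 \<and> X \<in> cone_K \<and> V \<in> H_space X \<and>
      (\<exists>v\<in>borel_measurable borel. ae_eq V (v \<circ> X))}"

definition X_dist ::
  "real \<Rightarrow> (real \<Rightarrow> real) \<times> (real \<Rightarrow> real) \<Rightarrow> (real \<Rightarrow> real) \<times> (real \<Rightarrow> real) \<Rightarrow> real" where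
  "X_dist p = (\<lambda>(X1, V1) (X2, V2).
      (Lp_norm p leb01 (\<lambda>w. X1 w - X2 w) powr p +
       Lp_norm p leb01 (\<lambda>w. V1 w - V2 w) powr p) powr (1 / p))"


section \<open>Curves in \<open>L\<^sup>2(0,1)\<close> and strong solutions\<close>

text \<open>
  \<open>has_L2_deriv Y D t F\<close>: the difference quotients of \<open>Y\<close> at \<open>t\<close> converge strongly to \<open>D\<close> as
  the increment tends to 0 along \<open>F\<close>, where \<open>F\<close> is \<open>at 0\<close> for the derivative and
  \<open>at_right 0\<close> for the right derivative.
\<close>

definition has_L2_deriv ::
  "(real \<Rightarrow> real \<Rightarrow> real) \<Rightarrow> (real \<Rightarrow> real) \<Rightarrow> real \<Rightarrow> real filter \<Rightarrow> bool" where
  "has_L2_deriv Y D t F \<longleftrightarrow> D \<in> L2 \<and>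
      ((\<lambda>h. L2_dist (\<lambda>w. (Y (t + h) w - Y t w) / h) D) \<longlongrightarrow> 0) F"

definition L2_right_deriv :: "(real \<Rightarrow> real \<Rightarrow> real) \<Rightarrow> real \<Rightarrow> real \<Rightarrow> real" where
  "L2_right_deriv Y t = (SOME D. has_L2_deriv Y D t (at_right 0))"

definition loc_abs_cont_L2 :: "(real \<Rightarrow> real \<Rightarrow> real) \<Rightarrow> bool" where
  "loc_abs_cont_L2 Y \<longleftrightarrow> (\<forall>t\<ge>0. Y t \<in> L2) \<and>
      (\<forall>T>0. \<forall>\<epsilon>>0. \<exists>\<delta>>0. \<forall>(n::nat) a b.
        (\<forall>i<n. 0 \<le> a i \<and> a i \<le> b i \<and> b i \<le> T) \<and>
        disjoint_family_on (\<lambda>i. {a i<..<b i}) {..<n} \<and> (\<Sum>i<n. b i - a i) < \<delta> \<longrightarrow>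
        (\<Sum>i<n. L2_dist (Y (b i)) (Y (a i))) < \<epsilon>)"

text \<open>
  The inclusions \<open>Y' \<in> - \<partial>I\<^sub>K(Y) + V0\<close> and \<open>t Y' \<in> - \<partial>I\<^sub>K(Y) + Y - X0\<close> are solved for the
  element of the subdifferential.
\<close>

definition strong_solution_cauchy ::
  "(real \<Rightarrow> real) \<Rightarrow> (real \<Rightarrow> real) \<Rightarrow> (real \<Rightarrow> real \<Rightarrow> real) \<Rightarrow> bool" where
  "strong_solution_cauchy X0 V0 Y \<longleftrightarrow> loc_abs_cont_L2 Y \<and> ae_eq (Y 0) X0 \<and>
      (AE t in lborel. 0 < t \<longrightarrow>
        (\<exists>D. has_L2_deriv Y D t (at 0) \<and> (\<lambda>w. V0 w - D w) \<in> subdiff_I_K (Y t)))"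

definition strong_solution_scaled ::
  "(real \<Rightarrow> real) \<Rightarrow> (real \<Rightarrow> real) \<Rightarrow> (real \<Rightarrow> real \<Rightarrow> real) \<Rightarrow> bool" where
  "strong_solution_scaled X0 V0 Y \<longleftrightarrow> loc_abs_cont_L2 Y \<and>
      (AE t in lborel. 0 < t \<longrightarrow>
        (\<exists>D. has_L2_deriv Y D t (at 0) \<and>
          (\<lambda>w. Y t w - X0 w - t * D w) \<in> subdiff_I_K (Y t))) \<and>
      ((\<lambda>t. L2_dist (\<lambda>w. (Y t w - X0 w) / t) V0) \<longlongrightarrow> 0) (at_right 0)"

definition unique_curve ::
  "((real \<Rightarrow> real \<Rightarrow> real) \<Rightarrow> bool) \<Rightarrow> (real \<Rightarrow> real \<Rightarrow> real) \<Rightarrow> bool" where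
  "unique_curve P X \<longleftrightarrow> P X \<and> (\<forall>Y. P Y \<longrightarrow> (\<forall>t\<ge>0. ae_eq (Y t) (X t)))"


section \<open>The Lagrangian flow\<close>

definition lag_X :: "(real \<Rightarrow> real) \<Rightarrow> (real \<Rightarrow> real) \<Rightarrow> real \<Rightarrow> real \<Rightarrow> real" where
  "lag_X X0 V0 t = proj_K (\<lambda>w. X0 w + t * V0 w)"

definition lag_V :: "(real \<Rightarrow> real) \<Rightarrow> (real \<Rightarrow> real) \<Rightarrow> real \<Rightarrow> real \<Rightarrow> real" where
  "lag_V X0 V0 t = L2_right_deriv (lag_X X0 V0) t"

definition lag_flow ::
  "real \<Rightarrow> (real \<Rightarrow> real) \<times> (real \<Rightarrow> real) \<Rightarrow> (real \<Rightarrow> real) \<times> (real \<Rightarrow> real)" where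
  "lag_flow t = (\<lambda>(X0, V0). (lag_X X0 V0 t, lag_V X0 V0 t))"

definition pair_ae_eq ::
  "(real \<Rightarrow> real) \<times> (real \<Rightarrow> real) \<Rightarrow> (real \<Rightarrow> real) \<times> (real \<Rightarrow> real) \<Rightarrow> bool" where
  "pair_ae_eq Z Z' \<longleftrightarrow> ae_eq (fst Z) (fst Z') \<and> ae_eq (snd Z) (snd Z')"

definition right_continuous_semigroup ::
  "real \<Rightarrow> (real \<Rightarrow> (real \<Rightarrow> real) \<times> (real \<Rightarrow> real) \<Rightarrow> (real \<Rightarrow> real) \<times> (real \<Rightarrow> real)) \<Rightarrow> bool" where
  "right_continuous_semigroup p S \<longleftrightarrow>
      (\<forall>Z\<in>X_space p. \<forall>s\<ge>0. \<forall>t\<ge>0. pair_ae_eq (S (s + t) Z) (S s (S t Z))) \<and>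
      (\<forall>Z\<in>X_space p. \<forall>t\<ge>0. ((\<lambda>r. X_dist p (S r Z) (S t Z)) \<longlongrightarrow> 0) (at_right t))"


section \<open>Measures on the line\<close>

text \<open>
  A signed Borel measure is represented by its set function, set to zero outside the Borel sets.
\<close>

definition signed_measures :: "(real set \<Rightarrow> real) set" where
  "signed_measures = {m. (\<forall>A. A \<notin> sets borel \<longrightarrow> m A = 0) \<and>
      (\<forall>A::nat \<Rightarrow> real set. range A \<subseteq> sets borel \<longrightarrow> disjoint_family A \<longrightarrow>
        (\<lambda>i. m (A i)) sums m (\<Union>i. A i)) \<and>
      (\<exists>C. \<forall>P. finite P \<longrightarrow> P \<subseteq> sets borel \<longrightarrow> disjoint P \<longrightarrow> (\<Sum>A\<in>P. \<bar>m A\<bar>) \<le> C)}"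

definition momentum :: "real measure \<Rightarrow> (real \<Rightarrow> real) \<Rightarrow> real set \<Rightarrow> real" where
  "momentum \<rho> v A = (if A \<in> sets borel then set_lebesgue_integral \<rho> A v else 0)"

definition P_space :: "real \<Rightarrow> real measure set" where
  "P_space p = {\<rho>. prob_space \<rho> \<and> sets \<rho> = sets borel \<and> integrable \<rho> (\<lambda>x. \<bar>x\<bar> powr p)}"

definition couplings :: "real measure \<Rightarrow> real measure \<Rightarrow> (real \<times> real) measure set" where
  "couplings \<rho>1 \<rho>2 = {\<gamma>. prob_space \<gamma> \<and> sets \<gamma> = sets borel \<and>
      distr \<gamma> borel fst = \<rho>1 \<and> distr \<gamma> borel snd = \<rho>2}"

definition W_dist :: "real \<Rightarrow> real measure \<Rightarrow> real measure \<Rightarrow> real" where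
  "W_dist p \<rho>1 \<rho>2 =
      (INF \<gamma>\<in>couplings \<rho>1 \<rho>2. \<integral>z. \<bar>fst z - snd z\<bar> powr p \<partial>\<gamma>) powr (1 / p)"

definition quantile :: "real measure \<Rightarrow> real \<Rightarrow> real" where
  "quantile \<rho> w = Inf {x. measure \<rho> {..x} > w}"

definition V_space :: "real \<Rightarrow> (real measure \<times> (real set \<Rightarrow> real)) set" where
  "V_space p = {(\<rho>, momentum \<rho> v) | \<rho> v.
      \<rho> \<in> P_space p \<and> v \<in> Lp p \<rho> \<and> momentum \<rho> v \<in> signed_measures}"

text \<open>
  The density \<open>v\<close> of \<open>\<mu> = (\<rho>, \<rho>v)\<close>, which is determined by \<open>\<mu>\<close> up to a \<open>\<rho>\<close>-null set.
  Its composition with the quantile function of \<open>\<rho>\<close> is determined almost everywhere, so the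
  notions below do not depend on the choice.
\<close>

definition velocity :: "real measure \<times> (real set \<Rightarrow> real) \<Rightarrow> real \<Rightarrow> real" where
  "velocity \<mu> = (SOME v. v \<in> borel_measurable borel \<and> integrable (fst \<mu>) v \<and>
      snd \<mu> = momentum (fst \<mu>) v)"

definition D_dist ::
  "real \<Rightarrow> real measure \<times> (real set \<Rightarrow> real) \<Rightarrow> real measure \<times> (real set \<Rightarrow> real) \<Rightarrow> real" where
  "D_dist p \<mu>1 \<mu>2 = (W_dist p (fst \<mu>1) (fst \<mu>2) powr p +
      (\<integral>w. \<bar>velocity \<mu>1 (quantile (fst \<mu>1) w) - velocity \<mu>2 (quantile (fst \<mu>2) w)\<bar> powr p \<partial>leb01))
        powr (1 / p)"

text \<open>
  The integral of \<open>\<phi>\<close> against the signed measure \<open>\<rho>v\<close> is the integral of \<open>\<phi> v\<close> against \<open>\<rho>\<close>.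
\<close>

definition weak_momentum_conv ::
  "(nat \<Rightarrow> real measure \<times> (real set \<Rightarrow> real)) \<Rightarrow> real measure \<times> (real set \<Rightarrow> real) \<Rightarrow> bool" where
  "weak_momentum_conv \<mu>n \<mu> \<longleftrightarrow> (\<forall>\<phi>. continuous_on UNIV \<phi> \<and> bounded (range \<phi>) \<longrightarrow>
      (\<lambda>n. \<integral>x. \<phi> x * velocity (\<mu>n n) x \<partial>fst (\<mu>n n))
        \<longlonglongrightarrow> (\<integral>x. \<phi> x * velocity \<mu> x \<partial>fst \<mu>))"


section \<open>Sticky particles\<close>

definition discrete_data :: "nat \<Rightarrow> (nat \<Rightarrow> real) \<Rightarrow> (nat \<Rightarrow> real) \<Rightarrow> bool" where
  "discrete_data N m x \<longleftrightarrow> (\<forall>i<N. 0 < m i) \<and> (\<Sum>i<N. m i) = 1 \<and> strict_mono_on {..<N} x"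

text \<open>
  The pair of \<open>\<Sum>i<N. m\<^sub>i \<delta>\<^sub>x\<^sub>i\<close> (the image under \<open>x\<close> of the measure on indices with masses
  \<open>m\<close>) and \<open>\<Sum>i<N. m\<^sub>i v\<^sub>i \<delta>\<^sub>x\<^sub>i\<close>.
\<close>

definition discrete_pair ::
  "nat \<Rightarrow> (nat \<Rightarrow> real) \<Rightarrow> (nat \<Rightarrow> real) \<Rightarrow> (nat \<Rightarrow> real) \<Rightarrow> real measure \<times> (real set \<Rightarrow> real)" where
  "discrete_pair N m x v =
     (distr (point_measure {..<N} (\<lambda>i. ennreal (m i))) borel x,
      \<lambda>A. if A \<in> sets borel then \<Sum>i<N. m i * v i * indicator A (x i) else 0)"

definition cluster :: "nat \<Rightarrow> (nat \<Rightarrow> real \<Rightarrow> real) \<Rightarrow> nat \<Rightarrow> real \<Rightarrow> nat set" where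
  "cluster N xt i t = {j. j < N \<and> xt j t = xt i t}"

text \<open>
  For trajectories with nondecreasing clusters these are the times at which some cluster grows;
  there are at most finitely many of them, since each pair of particles meets for the first time
  at most once.
\<close>

definition collision_times :: "nat \<Rightarrow> (nat \<Rightarrow> real \<Rightarrow> real) \<Rightarrow> real set" where
  "collision_times N xt = {t. 0 < t \<and> (\<exists>i<N. \<exists>j\<in>cluster N xt i t.
      \<forall>s. 0 \<le> s \<and> s < t \<longrightarrow> j \<notin> cluster N xt i s)}"

definition sticky_evolution ::
  "nat \<Rightarrow> (nat \<Rightarrow> real) \<Rightarrow> (nat \<Rightarrow> real) \<Rightarrow> (nat \<Rightarrow> real) \<Rightarrow>
   (nat \<Rightarrow> real \<Rightarrow> real) \<Rightarrow> (nat \<Rightarrow> real \<Rightarrow> real) \<Rightarrow> bool" where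
  "sticky_evolution N m x v xt vt \<longleftrightarrow>
     (\<forall>i<N. xt i 0 = x i \<and> vt i 0 = v i \<and> continuous_on {0..} (xt i) \<and>
        (\<forall>t\<ge>0. (xt i has_real_derivative vt i t) (at_right t) \<and> continuous (at_right t) (vt i))) \<and>
     (\<forall>t\<ge>0. \<forall>i<N. \<forall>j<N. i \<le> j \<longrightarrow> xt i t \<le> xt j t) \<and>
     (\<forall>i<N. \<forall>s t. 0 \<le> s \<and> s \<le> t \<longrightarrow> cluster N xt i s \<subseteq> cluster N xt i t) \<and>
     (\<forall>i<N. \<forall>a b. 0 \<le> a \<and> a < b \<and> {a<..<b} \<inter> collision_times N xt = {} \<longrightarrow>
        (\<exists>c. \<forall>t\<in>{a<..<b}. vt i t = c)) \<and>
     (\<forall>t\<in>collision_times N xt. \<forall>i<N.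
        vt i t = (\<Sum>j\<in>cluster N xt i t. m j * Lim (at_left t) (vt j))
                   / (\<Sum>j\<in>cluster N xt i t. m j))"

definition sticky_semigroup_on ::
  "real \<Rightarrow> (real \<Rightarrow> real measure \<times> (real set \<Rightarrow> real) \<Rightarrow> real measure \<times> (real set \<Rightarrow> real)) \<Rightarrow> bool" where
  "sticky_semigroup_on p S \<longleftrightarrow>
     (\<forall>t\<ge>0. \<forall>\<mu>\<in>V_space p. S t \<mu> \<in> V_space p) \<and>
     (\<forall>N m x v xt vt. discrete_data N m x \<and> sticky_evolution N m x v xt vt \<longrightarrow>
        (\<forall>t\<ge>0. S t (discrete_pair N m x v) =
          discrete_pair N m (\<lambda>i. xt i t) (\<lambda>i. vt i t))) \<and>
     (\<forall>t\<ge>0. \<forall>\<mu>n. \<forall>\<mu>\<in>V_space p. (\<forall>n. \<mu>n n \<in> V_space p) \<and>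
        (\<lambda>n. D_dist p (\<mu>n n) \<mu>) \<longlonglongrightarrow> 0 \<longrightarrow>
        (\<lambda>n. W_dist p (fst (S t (\<mu>n n))) (fst (S t \<mu>))) \<longlonglongrightarrow> 0 \<and>
        weak_momentum_conv (\<lambda>n. S t (\<mu>n n)) (S t \<mu>))"

text \<open>
  By density of the discrete data the three conditions determine \<open>S t \<mu>\<close> for \<open>t \<ge> 0\<close> and
  \<open>\<mu> \<in> V_space p\<close>; only these values are used.
\<close>

definition sticky_semigroup ::
  "real \<Rightarrow> real \<Rightarrow> real measure \<times> (real set \<Rightarrow> real) \<Rightarrow> real measure \<times> (real set \<Rightarrow> real)" where
  "sticky_semigroup p = (SOME S. sticky_semigroup_on p S)"

end

theory Submission
  imports Defs
begin

text \<open>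
  In \<open>L\<^sup>2(0,1)\<close> the projection onto \<open>H\<^sub>X\<close> averages over the intervals on which \<open>X\<close> is constant.
  It maps the cone \<open>K\<close> into itself and, by Chebyshev's inequality, decreases the scalar product of
  elements of \<open>K\<close>.  These two facts imply that \<open>X(t) = P\<^sub>K(X\<^sub>0 + t V\<^sub>0)\<close> lies in
  \<open>H\<^sub>X\<^sub>(\<^sub>s\<^sub>)\<close> for \<open>s \<le> t\<close> and can be restarted, \<open>X(t) = P\<^sub>K(X(s) + (t - s) V\<^sub>0)\<close>.  The
  difference quotients from \<open>s\<close> then have a quadratic decrement, so that the right derivative
  \<open>V(s)\<close> exists; it is the projection of \<open>V\<^sub>0\<close> onto \<open>H\<^sub>X\<^sub>(\<^sub>s\<^sub>)\<close>, which gives the semigroup property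
  and, with \<open>L\<^sup>p\<close> bounds that do not increase in time, right continuity.  Uniqueness of strong
  solutions is the monotonicity of the subdifferential.

  The pairs \<open>(X, V)\<close> correspond to the pairs \<open>(\<rho>, \<rho>v)\<close> through quantile functions.  The flow of
  measures induced in this way is strongly-weakly continuous, because a momentum at time \<open>t\<close> can be
  tested against the initial velocity: \<open>\<integral> \<phi>(X(t)) V(t) = \<integral> \<phi>(X(t)) V\<^sub>0\<close>.  On step functions it is
  the sticky particle evolution, since the average of the velocities at a collision is the
  projection onto \<open>H\<^sub>X\<close>.  As discrete data are dense, it is the semigroup of measures.
\<close>

section \<open>Projections onto closed convex cones\<close>

text \<open>The obstacle: in a Hilbert space a metric projection onto a convex set need not be
  directionally differentiable, and a curve of projections of a ray need not be restartable from its
  own values. The locale \<open>sticky_cone\<close> isolates what makes both true here, so that the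
  dynamics rest on inner products alone. L^p is not treated as a space of its own:
  \<open>Np p\<close> is a functional on the Hilbert space, with infinite values allowed, lower
  semicontinuous there and contracted by the projection. Velocities do not depend continuously on
  the data, since a nearby datum may collide slightly later; hence continuity is strong for
  positions and only weak for momenta. \<open>proj_K\<close>, the right derivative,
  \<open>velocity\<close> and \<open>sticky_semigroup\<close> are choices by \<open>SOME\<close>:
  each needs an existence proof before it can be computed. A sticky evolution is not built collision
  by collision but read off from the projected flow of a step function; collisions are counted only
  in the converse direction, where a given evolution is identified with that flow.\<close>

lemma parallelogram_midpoint:
  fixes y z w :: "'a::real_inner"
  shows "(norm (z - w))\<^sup>2 = 2 * (norm (y - z))\<^sup>2 + 2 * (norm (y - w))\<^sup>2
     - 4 * (norm (y - (1/2) *\<^sub>R (z + w)))\<^sup>2"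
  by (simp add: power2_norm_eq_inner inner_diff_left inner_diff_right inner_add_left
      inner_add_right inner_commute field_simps)

lemma power2_norm_diff:
  fixes x y :: "'a::real_inner"
  shows "(norm (x - y))\<^sup>2 = (norm x)\<^sup>2 - 2 * inner x y + (norm y)\<^sup>2"
  by (simp add: power2_norm_eq_inner inner_diff_left inner_diff_right inner_commute)

text \<open>Classical: along a minimizing sequence the midpoints stay in \<open>C\<close>, hence at
  distance at least \<open>d\<close> from \<open>y\<close>, and the parallelogram identity bounds
  the distance of two members by their excess over \<open>d\<close>.\<close>

lemma closed_convex_nearest_exists:
  fixes C :: "'a::{real_inner,complete_space} set"
  assumes "closed C" "convex C" "C \<noteq> {}"
  shows "\<exists>p\<in>C. \<forall>z\<in>C. norm (y - p) \<le> norm (y - z)"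
proof -
  define d where "d = Inf ((\<lambda>z. norm (y - z)) ` C)"
  have bdd: "bdd_below ((\<lambda>z. norm (y - z)) ` C)" by (rule bdd_belowI[of _ 0]) auto
  have dle: "d \<le> norm (y - z)" if "z \<in> C" for z
    unfolding d_def using bdd that by (auto intro: cInf_lower)
  have d0: "0 \<le> d" unfolding d_def using assms(3) by (intro cInf_greatest) auto
  have ex: "\<exists>z\<in>C. norm (y - z) < d + inverse (real (Suc n))" for n
  proof -
    have "Inf ((\<lambda>z. norm (y - z)) ` C) < d + inverse (real (Suc n))" unfolding d_def by simp
    then show ?thesis using assms(3) bdd by (subst (asm) cInf_less_iff) auto
  qed
  then obtain z where zC: "\<And>n. z n \<in> C" and zd: "\<And>n. norm (y - z n) < d + inverse (real (Suc n))"
    by metis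
  have lim: "(\<lambda>n. norm (y - z n)) \<longlonglongrightarrow> d"
  proof (rule tendsto_sandwich[of "\<lambda>_. d"])
    show "(\<lambda>n. d + inverse (real (Suc n))) \<longlonglongrightarrow> d"
      using tendsto_add[OF tendsto_const LIMSEQ_inverse_real_of_nat, of d] by simp
  qed (use dle zC zd in \<open>auto intro!: always_eventually less_imp_le\<close>)
  have mid: "(norm (z m - z n))\<^sup>2 \<le> 2 * ((norm (y - z m))\<^sup>2 - d\<^sup>2) + 2 * ((norm (y - z n))\<^sup>2 - d\<^sup>2)" for m n
  proof -
    have "(1/2) *\<^sub>R (z m + z n) \<in> C"
      using convexD[OF assms(2) zC[of m] zC[of n], of "1/2" "1/2"] by (simp add: scaleR_add_right)
    then have "d\<^sup>2 \<le> (norm (y - (1/2) *\<^sub>R (z m + z n)))\<^sup>2" using dle d0 by (intro power_mono)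
    then show ?thesis using parallelogram_midpoint[of "z m" "z n" y] by simp
  qed
  have "Cauchy z"
  proof (rule metric_CauchyI)
    fix e :: real assume e: "0 < e"
    have "(\<lambda>n. (norm (y - z n))\<^sup>2 - d\<^sup>2) \<longlonglongrightarrow> 0"
      using tendsto_diff[OF tendsto_power[OF lim, of 2] tendsto_const[of "d\<^sup>2"]] by simp
    then have "\<forall>\<^sub>F n in sequentially. (norm (y - z n))\<^sup>2 - d\<^sup>2 < e\<^sup>2 / 4"
      using e by (intro order_tendstoD(2)) auto
    then obtain M where M: "\<And>n. n \<ge> M \<Longrightarrow> (norm (y - z n))\<^sup>2 - d\<^sup>2 < e\<^sup>2 / 4"
      by (auto simp: eventually_sequentially)
    show "\<exists>M. \<forall>m\<ge>M. \<forall>n\<ge>M. dist (z m) (z n) < e"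
    proof (intro exI allI impI)
      fix m n assume "M \<le> m" "M \<le> n"
      then have "(norm (z m - z n))\<^sup>2 < e\<^sup>2" using mid[of m n] M[of m] M[of n] by simp
      then show "dist (z m) (z n) < e" using e by (simp add: dist_norm power2_less_imp_less)
    qed
  qed
  then obtain p where p: "z \<longlonglongrightarrow> p" using Cauchy_convergent convergent_def by blast
  have "p \<in> C" using closed_sequentially[OF assms(1) _ p] zC by blast
  moreover have "norm (y - p) = d"
    by (rule LIMSEQ_unique[OF tendsto_norm[OF tendsto_diff[OF tendsto_const p]] lim])
  ultimately show ?thesis using dle by auto
qed

definition closed_cone :: "'a::real_normed_vector set \<Rightarrow> bool" where
  "closed_cone K \<longleftrightarrow> closed K \<and> 0 \<in> K \<and> (\<forall>x\<in>K. \<forall>y\<in>K. x + y \<in> K) \<and> (\<forall>x\<in>K. \<forall>c\<ge>0. c *\<^sub>R x \<in> K)"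

text \<open>For \<open>x\<close> in a cone the inequality \<open>inner \<xi> (z - x) \<le> 0\<close>
  on \<open>K\<close> splits into these two conditions, by testing with z = 0 and z = 2 x. The split
  form makes orthogonality to \<open>x\<close> available as an equation.\<close>

definition normal_cone :: "'a::real_inner set \<Rightarrow> 'a \<Rightarrow> 'a set" where
  "normal_cone K x = {\<xi>. inner \<xi> x = 0 \<and> (\<forall>z\<in>K. inner \<xi> z \<le> 0)}"

text \<open>Defined by the optimality condition instead of minimal distance. For a subspace the
  normal vectors are the orthogonal ones, so the same constant serves as orthogonal projection onto
  \<open>H x\<close>.\<close>

definition proj :: "'a::real_inner set \<Rightarrow> 'a \<Rightarrow> 'a" where
  "proj K y = (THE p. p \<in> K \<and> y - p \<in> normal_cone K p)"

lemma normal_coneD: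
  assumes "\<xi> \<in> normal_cone K x"
  shows "inner \<xi> x = 0" "z \<in> K \<Longrightarrow> inner \<xi> z \<le> 0"
  using assms by (auto simp: normal_cone_def)

lemma normal_cone_add: "\<xi> \<in> normal_cone K x \<Longrightarrow> \<eta> \<in> normal_cone K x \<Longrightarrow> \<xi> + \<eta> \<in> normal_cone K x"
  by (simp add: normal_cone_def inner_add_left add_nonpos_nonpos)

lemma normal_cone_scaleR: "\<xi> \<in> normal_cone K x \<Longrightarrow> 0 \<le> c \<Longrightarrow> c *\<^sub>R \<xi> \<in> normal_cone K x"
  by (auto simp: normal_cone_def mult_nonneg_nonpos)

lemma normal_cone_closed:
  assumes "(f \<longlongrightarrow> \<xi>) F" "(g \<longlongrightarrow> x) F" "F \<noteq> bot" "\<forall>\<^sub>F t in F. f t \<in> normal_cone K (g t)"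
  shows "\<xi> \<in> normal_cone K x"
proof -
  have "((\<lambda>t. inner (f t) (g t)) \<longlongrightarrow> inner \<xi> x) F" by (intro tendsto_inner assms)
  moreover have "\<forall>\<^sub>F t in F. inner (f t) (g t) = 0"
    using assms(4) by eventually_elim (auto dest: normal_coneD)
  ultimately have "((\<lambda>t. 0) \<longlongrightarrow> inner \<xi> x) F" by (rule Lim_transform_eventually)
  then have "inner \<xi> x = 0" using assms(3) tendsto_const_iff by metis
  moreover have "inner \<xi> z \<le> 0" if "z \<in> K" for z
  proof (rule tendsto_upperbound[OF _ _ assms(3)])
    show "((\<lambda>t. inner (f t) z) \<longlongrightarrow> inner \<xi> z) F" by (intro tendsto_intros assms)
    show "\<forall>\<^sub>F t in F. inner (f t) z \<le> 0" using assms(4) by eventually_elim (use that in \<open>auto dest: normal_coneD\<close>)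
  qed
  ultimately show ?thesis by (auto simp: normal_cone_def)
qed

lemma closed_cone_subspace: "subspace S \<Longrightarrow> closed S \<Longrightarrow> closed_cone S"
  by (auto simp: closed_cone_def subspace_def)

context
  fixes K :: "'a::{real_inner,complete_space} set"
  assumes cone: "closed_cone K"
begin

lemma proj_exists: "\<exists>p\<in>K. y - p \<in> normal_cone K p"
proof -
  have K: "closed K" "0 \<in> K" "\<And>x y. x \<in> K \<Longrightarrow> y \<in> K \<Longrightarrow> x + y \<in> K"
    "\<And>x c. x \<in> K \<Longrightarrow> 0 \<le> c \<Longrightarrow> c *\<^sub>R x \<in> K" using cone by (auto simp: closed_cone_def)
  have "convex K" by (auto intro!: convexI K)
  then obtain p where p: "p \<in> K" "\<And>z. z \<in> K \<Longrightarrow> norm (y - p) \<le> norm (y - z)"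
    using closed_convex_nearest_exists[of K y] K(1,2) by (metis empty_iff)
  \<comment> \<open>First-order condition along an admissible direction \<open>z\<close>: the square
    is expanded and divided by \<open>e\<close>.\<close>
  have vi: "2 * inner (y - p) z \<le> e * (norm z)\<^sup>2" if "0 < e" "p + e *\<^sub>R z \<in> K" for z e
  proof -
    have "(norm (y - p))\<^sup>2 \<le> (norm ((y - p) - e *\<^sub>R z))\<^sup>2"
      using p(2)[OF that(2)] by (intro power_mono) (auto simp: algebra_simps)
    also have "\<dots> = (norm (y - p))\<^sup>2 - e * (2 * inner (y - p) z) + e * (e * (norm z)\<^sup>2)"
      by (subst power2_norm_diff) (simp add: power_mult_distrib power2_eq_square)
    finally have "e * (2 * inner (y - p) z) \<le> e * (e * (norm z)\<^sup>2)" by linarith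
    then show ?thesis using that(1) by simp
  qed
  have small: "a \<le> 0" if "\<And>e. 0 < e \<Longrightarrow> e < 1 \<Longrightarrow> 2 * a \<le> e * b" for a b :: real
  proof -
    have "((\<lambda>e. e * b) \<longlongrightarrow> 0 * b) (at_right 0)" by (intro tendsto_intros)
    moreover have "\<forall>\<^sub>F e in at_right 0. 2 * a \<le> e * b"
      using that by (auto simp: eventually_at_right_field intro!: exI[of _ 1])
    ultimately have "2 * a \<le> 0 * b" by (intro tendsto_lowerbound) auto
    then show ?thesis by simp
  qed
  have "inner (y - p) z \<le> 0" if "z \<in> K" for z
    by (rule small[of _ "(norm z)\<^sup>2"], rule vi) (simp_all add: K(3,4) p(1) that)
  \<comment> \<open>The direction \<open>- p\<close> is admissible for e < 1, as p - e p = (1 - e)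
    p; together with the direction \<open>p\<close> it gives orthogonality to
    \<open>p\<close>.\<close>
  moreover have "inner (y - p) (- p) \<le> 0"
  proof (rule small)
    fix e :: real assume "0 < e" "e < 1"
    then show "2 * inner (y - p) (- p) \<le> e * (norm (- p))\<^sup>2"
      using vi[of e "- p"] K(4)[OF p(1), of "1 - e"] by (simp add: algebra_simps)
  qed
  ultimately have "y - p \<in> normal_cone K p" using p(1) by (simp add: normal_cone_def order_antisym)
  then show ?thesis using p by blast
qed

lemma normal_cone_proj_unique:
  assumes "p \<in> K" "y - p \<in> normal_cone K p" "q \<in> K" "y - q \<in> normal_cone K q"
  shows "p = q"
proof -
  have "inner (p - q) (p - q) = inner (y - q) p - inner (y - q) q - inner (y - p) p + inner (y - p) q"
    by (simp add: inner_diff_left inner_diff_right)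
  also have "\<dots> \<le> 0"
    using normal_coneD(1)[OF assms(2)] normal_coneD(1)[OF assms(4)]
      normal_coneD(2)[OF assms(2) assms(3)] normal_coneD(2)[OF assms(4) assms(1)] by linarith
  finally have "inner (p - q) (p - q) = 0" using inner_ge_zero[of "p - q"] by linarith
  then show ?thesis by simp
qed

lemma proj_in: "proj K y \<in> K" and proj_normal: "y - proj K y \<in> normal_cone K (proj K y)"
proof -
  have "\<exists>!p. p \<in> K \<and> y - p \<in> normal_cone K p" using proj_exists[of y] normal_cone_proj_unique[of _ y] by (auto simp: Bex_def Ex1_def)
  from theI'[OF this] show "proj K y \<in> K" "y - proj K y \<in> normal_cone K (proj K y)"
    unfolding proj_def by auto
qed

lemma proj_eqI: "p \<in> K \<Longrightarrow> y - p \<in> normal_cone K p \<Longrightarrow> proj K y = p"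
  by (rule normal_cone_proj_unique[OF proj_in proj_normal])

lemma proj_id: "x \<in> K \<Longrightarrow> proj K x = x"
  by (rule proj_eqI) (auto simp: normal_cone_def)

lemma normal_cone_monotone:
  assumes "p \<in> K" "q \<in> K" "\<xi> \<in> normal_cone K p" "\<eta> \<in> normal_cone K q"
  shows "0 \<le> inner (\<xi> - \<eta>) (p - q)"
  using assms normal_coneD(1)[of \<xi> K p] normal_coneD(1)[of \<eta> K q]
    normal_coneD(2)[of \<xi> K p q] normal_coneD(2)[of \<eta> K q p] by (simp add: inner_diff_left inner_diff_right)

lemma proj_nonexpansive: "norm (proj K a - proj K b) \<le> norm (a - b)"
proof -
  let ?d = "proj K a - proj K b"
  have "0 \<le> inner ((a - proj K a) - (b - proj K b)) ?d"
    by (intro normal_cone_monotone proj_in proj_normal)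
  then have "(norm ?d)\<^sup>2 \<le> inner (a - b) ?d"
    by (simp add: power2_norm_eq_inner inner_diff_left inner_diff_right algebra_simps)
  also have "\<dots> \<le> norm (a - b) * norm ?d" by (rule norm_cauchy_schwarz)
  finally show ?thesis by (cases "norm ?d = 0") (auto simp: power2_eq_square)
qed

lemma proj_nearest: assumes "z \<in> K" shows "norm (y - proj K y) \<le> norm (y - z)"
proof -
  let ?p = "proj K y"
  have "inner (y - ?p) (?p - z) \<ge> 0"
    using normal_coneD[OF proj_normal[of y]] assms by (simp add: inner_diff_right)
  moreover have "(norm (y - z))\<^sup>2 = (norm (y - ?p))\<^sup>2 + 2 * inner (y - ?p) (?p - z) + (norm (?p - z))\<^sup>2"
    by (simp add: power2_norm_eq_inner inner_diff_left inner_diff_right inner_commute)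
  ultimately have "(norm (y - ?p))\<^sup>2 \<le> (norm (y - z))\<^sup>2" by simp
  then show ?thesis by (rule power2_le_imp_le) simp
qed

lemma nearest_imp_proj:
  assumes "p \<in> K" "\<And>z. z \<in> K \<Longrightarrow> norm (y - p) \<le> norm (y - z)"
  shows "p = proj K y"
proof -
  let ?q = "proj K y"
  have "norm (y - p) = norm (y - ?q)" using assms proj_in proj_nearest by (metis order_antisym)
  then have "(norm (y - p))\<^sup>2 = (norm (y - ?q))\<^sup>2" by simp
  moreover have "(norm (y - p))\<^sup>2 = (norm (y - ?q))\<^sup>2 + 2 * inner (y - ?q) (?q - p) + (norm (?q - p))\<^sup>2"
    by (simp add: power2_norm_eq_inner inner_diff_left inner_diff_right inner_commute)
  moreover have "inner (y - ?q) (?q - p) \<ge> 0"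
    using normal_coneD[OF proj_normal[of y]] assms by (simp add: inner_diff_right)
  ultimately have "(norm (?q - p))\<^sup>2 \<le> 0" by linarith
  then show ?thesis by simp
qed

lemma proj_scaleR: assumes "0 \<le> c" shows "proj K (c *\<^sub>R y) = c *\<^sub>R proj K y"
proof (rule proj_eqI)
  show "c *\<^sub>R proj K y \<in> K" using cone assms proj_in by (auto simp: closed_cone_def)
  show "c *\<^sub>R y - c *\<^sub>R proj K y \<in> normal_cone K (c *\<^sub>R proj K y)"
    using normal_cone_scaleR[OF proj_normal assms, of y]
    by (auto simp: normal_cone_def scaleR_diff_right)
qed

end

lemma proj_subspace_orthogonal:
  fixes S :: "'a::{real_inner,complete_space} set"
  assumes "subspace S" "closed S" "u \<in> S"
  shows "inner (y - proj S y) u = 0"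
proof -
  have "y - proj S y \<in> normal_cone S (proj S y)"
    using assms by (intro proj_normal closed_cone_subspace)
  then have "inner (y - proj S y) u \<le> 0" "inner (y - proj S y) (- u) \<le> 0"
    using assms(3) subspace_neg[OF assms(1,3)] by (blast dest: normal_coneD)+
  then show ?thesis by simp
qed

section \<open>The flow driven by a cone of monotone type\<close>

text \<open>Read from right to left: as h decreases to s, \<open>\<phi> h\<close> increases and
  stays bounded, so its differences, and with them those of \<open>g\<close>, become small.\<close>

lemma right_limit_of_quadratic_decrement:
  fixes g :: "real \<Rightarrow> 'a::{real_inner,complete_space}"
  assumes dec: "\<And>h k. s < h \<Longrightarrow> h \<le> k \<Longrightarrow> (norm (g h - g k))\<^sup>2 \<le> \<phi> h - \<phi> k"
    and bdd: "\<And>h. s < h \<Longrightarrow> \<phi> h \<le> B"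
  shows "\<exists>l. (g \<longlongrightarrow> l) (at_right s)"
proof -
  define u where "u n = s + inverse (real (Suc n))" for n
  have u: "s < u n" for n by (simp add: u_def)
  have u_anti: "u n \<le> u m" if "m \<le> n" for m n using that by (simp add: u_def)
  have u_lim: "u \<longlonglongrightarrow> s"
    using tendsto_add[OF tendsto_const LIMSEQ_inverse_real_of_nat, of s] by (simp add: u_def[abs_def])
  have mono: "\<phi> k \<le> \<phi> h" if "s < h" "h \<le> k" for h k
    using dec[OF that] zero_le_power2[of "norm (g h - g k)"] by linarith
  have "incseq (\<lambda>n. \<phi> (u n))" unfolding incseq_def using mono u u_anti by blast
  then obtain L where L: "(\<lambda>n. \<phi> (u n)) \<longlonglongrightarrow> L" "\<And>n. \<phi> (u n) \<le> L"
    using incseq_convergent[of "\<lambda>n. \<phi> (u n)" B] bdd u by blast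
  have "Cauchy (\<lambda>n. g (u n))"
  proof (rule metric_CauchyI)
    fix e :: real assume e: "0 < e"
    then obtain M where M: "\<And>n. n \<ge> M \<Longrightarrow> L - e\<^sup>2 < \<phi> (u n)"
      using order_tendstoD(1)[OF L(1), of "L - e\<^sup>2"] by (auto simp: eventually_sequentially)
    have "norm (g (u m) - g (u n)) < e" if "M \<le> m" "m \<le> n" for m n
    proof -
      have "(norm (g (u n) - g (u m)))\<^sup>2 \<le> \<phi> (u n) - \<phi> (u m)" using that by (intro dec u u_anti)
      also have "\<dots> < e\<^sup>2" using M[OF that(1)] L(2)[of n] by linarith
      finally show ?thesis using e by (simp add: norm_minus_commute power2_less_imp_less)
    qed
    then show "\<exists>M. \<forall>m\<ge>M. \<forall>n\<ge>M. dist (g (u m)) (g (u n)) < e"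
      unfolding dist_norm by (metis nle_le norm_minus_commute)
  qed
  then obtain l where l: "(\<lambda>n. g (u n)) \<longlonglongrightarrow> l" using Cauchy_convergent convergent_def by blast
  \<comment> \<open>The bound \<open>dec\<close> with one argument sent to s along \<open>u\<close>;
    it turns convergence along \<open>u\<close> into the full right limit.\<close>
  have est: "(norm (g h - l))\<^sup>2 \<le> L - \<phi> h" if h: "s < h" for h
  proof (rule LIMSEQ_le)
    show "(\<lambda>n. (norm (g h - g (u n)))\<^sup>2) \<longlonglongrightarrow> (norm (g h - l))\<^sup>2" by (intro tendsto_intros l)
    show "(\<lambda>n. \<phi> (u n) - \<phi> h) \<longlonglongrightarrow> L - \<phi> h" by (intro tendsto_intros L)
    obtain M where "\<And>n. n \<ge> M \<Longrightarrow> u n < h"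
      using order_tendstoD(2)[OF u_lim h] by (auto simp: eventually_sequentially)
    then show "\<exists>N. \<forall>n\<ge>N. (norm (g h - g (u n)))\<^sup>2 \<le> \<phi> (u n) - \<phi> h"
      using dec[OF u] by (metis less_imp_le norm_minus_commute)
  qed
  have "(g \<longlongrightarrow> l) (at_right s)"
  proof (rule tendstoI)
    fix e :: real assume e: "0 < e"
    then obtain n where n: "L - e\<^sup>2 < \<phi> (u n)"
      using eventually_happens[OF order_tendstoD(1)[OF L(1), of "L - e\<^sup>2"]] by auto
    have "dist (g h) l < e" if "s < h" "h < u n" for h
    proof -
      have "(norm (g h - l))\<^sup>2 < e\<^sup>2" using est[OF that(1)] mono[of h "u n"] that n by simp
      then show ?thesis using e by (simp add: dist_norm power2_less_imp_less)
    qed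
    then show "\<forall>\<^sub>F h in at_right s. dist (g h) l < e"
      using u[of n] by (auto simp: eventually_at_right_field)
  qed
  then show ?thesis ..
qed

definition flow :: "'a::real_inner set \<Rightarrow> 'a \<Rightarrow> 'a \<Rightarrow> real \<Rightarrow> 'a" where
  "flow K x v t = proj K (x + t *\<^sub>R v)"

text \<open>\<open>Lim\<close> is meaningful only where the limit exists; \<open>Q_tendsto\<close>
  provides this for nonnegative times.\<close>

definition flow_vel :: "'a::real_inner set \<Rightarrow> 'a \<Rightarrow> 'a \<Rightarrow> real \<Rightarrow> 'a" where
  "flow_vel K x v t = Lim (at_right 0) (\<lambda>h. (1/h) *\<^sub>R (flow K x v (t + h) - flow K x v t))"

text \<open>
  For the cone of nondecreasing functions \<open>H x\<close> is the space of functions of the form \<open>v \<circ> x\<close>, and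
  \<open>proj (H x)\<close> averages over the intervals on which \<open>x\<close> is constant; the last assumption is then
  Chebyshev's inequality on these intervals.
\<close>

locale sticky_cone =
  fixes K :: "'a::{real_inner,complete_space} set" and H :: "'a \<Rightarrow> 'a set"
  assumes cone: "closed_cone K"
    and H_subspace: "x \<in> K \<Longrightarrow> subspace (H x)"
    and H_closed: "x \<in> K \<Longrightarrow> closed (H x)"
    and H_self: "x \<in> K \<Longrightarrow> x \<in> H x"
    and H_mono: "x \<in> K \<Longrightarrow> y \<in> K \<Longrightarrow> y \<in> H x \<Longrightarrow> H y \<subseteq> H x"
    and normal_orthogonal: "x \<in> K \<Longrightarrow> \<xi> \<in> normal_cone K x \<Longrightarrow> u \<in> H x \<Longrightarrow> inner \<xi> u = 0"
    and proj_H_in: "x \<in> K \<Longrightarrow> z \<in> K \<Longrightarrow> proj (H x) z \<in> K"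
    and proj_H_polar: "x \<in> K \<Longrightarrow> z \<in> K \<Longrightarrow> u \<in> K \<Longrightarrow> inner (proj (H x) z - z) u \<le> 0"
begin

lemma K_add: "x \<in> K \<Longrightarrow> y \<in> K \<Longrightarrow> x + y \<in> K" and K_scaleR: "x \<in> K \<Longrightarrow> 0 \<le> c \<Longrightarrow> c *\<^sub>R x \<in> K"
  using cone by (auto simp: closed_cone_def)

lemmas proj_K_in = proj_in[OF cone] and proj_K_normal = proj_normal[OF cone]

lemma proj_H_mem: "x \<in> K \<Longrightarrow> proj (H x) y \<in> H x"
  by (intro proj_in closed_cone_subspace H_subspace H_closed)

lemma proj_H_orth: "x \<in> K \<Longrightarrow> u \<in> H x \<Longrightarrow> inner (proj (H x) y) u = inner y u"
  using proj_subspace_orthogonal[OF H_subspace H_closed, of x u y] by (simp add: inner_diff_left)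

text \<open>Averaging cannot increase the distance to \<open>w\<close>: w - ?e lies in
  \<open>H y\<close> and is orthogonal to ?e - ?u. As the average \<open>?e\<close> stays in
  \<open>K\<close>, minimality forces ?e = ?u.\<close>

lemma proj_K_H:
  assumes y: "y \<in> K" and w: "w \<in> H y"
  shows "proj K w \<in> H y"
proof -
  let ?u = "proj K w" and ?e = "proj (H y) (proj K w)"
  have "inner (?e - ?u) (w - ?e) = 0"
    using proj_H_orth[OF y subspace_diff[OF H_subspace[OF y] w proj_H_mem[OF y, of ?u]], of ?u]
    by (simp add: inner_diff_left)
  moreover have "(norm (w - ?u))\<^sup>2 = (norm (w - ?e))\<^sup>2 + 2 * inner (?e - ?u) (w - ?e) + (norm (?e - ?u))\<^sup>2"
    by (simp add: power2_norm_eq_inner inner_diff_left inner_diff_right inner_commute)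
  ultimately have "(norm (w - ?e))\<^sup>2 \<le> (norm (w - ?u))\<^sup>2" by simp
  then have "norm (w - ?e) \<le> norm (w - ?u)" by (rule power2_le_imp_le) simp
  then have "?e = ?u"
    using proj_nearest[OF cone, of _ w] by (intro nearest_imp_proj cone proj_H_in y proj_K_in) (rule order_trans)
  then show ?thesis using proj_H_mem[OF y] by metis
qed

text \<open>The corrections \<open>\<xi>\<close> and ?e - z are nonpositive on \<open>K\<close> and
  orthogonal to \<open>H y\<close>, so they only enlarge the normal vector at the projection of y1 -
  ?e, which lies in \<open>H y\<close> by \<open>proj_K_H\<close>. This serves the restart, where
  the argument differs from \<open>H y\<close> by a normal vector and an element of
  \<open>K\<close>.\<close>

lemma proj_K_perturbed:
  assumes y: "y \<in> K" and "y1 \<in> H y" and \<xi>: "\<xi> \<in> normal_cone K y" and z: "z \<in> K"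
  shows "proj K (y1 + \<xi> - z) \<in> H y"
proof -
  let ?e = "proj (H y) z"
  let ?w = "proj K (y1 - ?e)"
  have w: "?w \<in> H y" by (intro proj_K_H y subspace_diff H_subspace assms proj_H_mem)
  note n = proj_K_normal[of "y1 - ?e"]
  have split: "y1 + \<xi> - z - ?w = (y1 - ?e - ?w) + \<xi> + (?e - z)" by simp
  have "proj K (y1 + \<xi> - z) = ?w"
  proof (rule proj_eqI[OF cone proj_K_in])
    have "inner (y1 + \<xi> - z - ?w) ?w = 0"
      unfolding split using normal_coneD(1)[OF n] normal_orthogonal[OF y \<xi> w] proj_H_orth[OF y w, of z]
      by (simp add: inner_diff_left inner_add_left)
    moreover have "inner (y1 + \<xi> - z - ?w) u \<le> 0" if "u \<in> K" for u
      unfolding split inner_add_left[of _ _ u]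
      using normal_coneD(2)[OF n that] normal_coneD(2)[OF \<xi> that] proj_H_polar[OF y z that] by linarith
    ultimately show "y1 + \<xi> - z - ?w \<in> normal_cone K ?w" by (simp add: normal_cone_def)
  qed
  then show ?thesis using w by simp
qed

text \<open>Call b larger than a when inner (a - b) u \<le> 0 for all u in \<open>K\<close>. The
  projection is the least element of \<open>K\<close> above \<open>a\<close>; for nondecreasing
  functions its primitive is the greatest convex minorant of that of \<open>a\<close>, whence the
  name. Averaging \<open>u\<close> over \<open>H ?p\<close> makes its pairings with \<open>a\<close>
  and \<open>?p\<close> equal, and \<open>proj_H_polar\<close> removes the average again.\<close>

lemma proj_K_greatest:
  assumes y: "y \<in> K" and pol: "\<And>u. u \<in> K \<Longrightarrow> inner (a - y) u \<le> 0" and u: "u \<in> K"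
  shows "inner (proj K a - y) u \<le> 0"
proof -
  let ?p = "proj K a"
  let ?E = "proj (H ?p)"
  have p: "?p \<in> K" by (rule proj_K_in)
  have "inner ?p u = inner (?E u) ?p" using proj_H_orth[OF p H_self[OF p], of u] by (simp add: inner_commute)
  also have "\<dots> = inner a (?E u)"
    using normal_orthogonal[OF p proj_K_normal proj_H_mem[OF p, of u]]
    by (simp add: inner_diff_left inner_commute)
  also have "\<dots> \<le> inner y (?E u)" using pol[OF proj_H_in[OF p u]] by (simp add: inner_diff_left)
  also have "\<dots> = inner (?E u) (?E y)"
    using proj_H_orth[OF p proj_H_mem[OF p, of u], of y] by (simp add: inner_commute)
  also have "\<dots> = inner (?E y) u"
    using proj_H_orth[OF p proj_H_mem[OF p, of y], of u] by (simp add: inner_commute)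
  also have "\<dots> \<le> inner y u" using proj_H_polar[OF p y u] by (simp add: inner_diff_left)
  finally show ?thesis by (simp add: inner_diff_left)
qed

section \<open>The projected curve, its restart and its right derivative\<close>

context
  fixes x v assumes x: "x \<in> K" and v: "v \<in> H x"
begin

abbreviation "X \<equiv> flow K x v"
abbreviation "V \<equiv> flow_vel K x v"

lemma flow_in: "X t \<in> K" by (simp add: flow_def proj_K_in)

lemma flow_0: "X 0 = x" by (simp add: flow_def proj_id cone x)

lemma flow_residual: "x + t *\<^sub>R v - X t \<in> normal_cone K (X t)" unfolding flow_def by (rule proj_K_normal)

lemma flow_norm_diff: "norm (X t - X s) \<le> \<bar>t - s\<bar> * norm v"
proof -
  have "x + t *\<^sub>R v - (x + s *\<^sub>R v) = (t - s) *\<^sub>R v" by (simp add: scaleR_diff_left)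
  then show ?thesis
    using proj_nonexpansive[OF cone, of "x + t *\<^sub>R v" "x + s *\<^sub>R v"] by (simp add: flow_def)
qed

lemma flow_tendsto: "(X \<longlongrightarrow> X s) (at s within S)"
proof (rule Lim_null[THEN iffD2], rule Lim_null_comparison)
  show "\<forall>\<^sub>F t in at s within S. norm (X t - X s) \<le> \<bar>t - s\<bar> * norm v" by (simp add: flow_norm_diff)
  show "((\<lambda>t. \<bar>t - s\<bar> * norm v) \<longlongrightarrow> 0) (at s within S)" by (auto intro!: tendsto_eq_intros)
qed

text \<open>\<open>v\<close> need not lie in \<open>H (X s)\<close>. It is eliminated through the
  residual: v = (?\<xi> + X s - x) / s, which expresses the argument by X s, a normal vector and a
  subtracted multiple of \<open>x\<close>, as in \<open>proj_K_perturbed\<close>. At s = 0, where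
  the division fails, v is in \<open>H x\<close> by assumption.\<close>

lemma flow_restart_in_H:
  assumes "0 \<le> s" "s \<le> t"
  shows "proj K (X s + (t - s) *\<^sub>R v) \<in> H (X s)"
proof (cases "s = 0")
  case True
  then show ?thesis
    using proj_K_H[OF x, of "x + t *\<^sub>R v"] subspace_add[OF H_subspace[OF x] H_self[OF x]]
      subspace_scale[OF H_subspace[OF x] v] by (simp add: flow_0)
next
  case False
  then have s: "0 < s" using assms by simp
  let ?\<xi> = "x + s *\<^sub>R v - X s"
  have "((t - s) / s) *\<^sub>R ?\<xi> = ((t - s) / s) *\<^sub>R x + (t - s) *\<^sub>R v - ((t - s) / s) *\<^sub>R X s"
    using s by (simp add: scaleR_add_right scaleR_diff_right)
  then have "X s + (t - s) *\<^sub>R v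
      = (X s + ((t - s) / s) *\<^sub>R X s) + ((t - s) / s) *\<^sub>R ?\<xi> - ((t - s) / s) *\<^sub>R x"
    by simp
  also have "proj K \<dots> \<in> H (X s)"
    using assms s
    by (intro proj_K_perturbed flow_in normal_cone_scaleR flow_residual K_scaleR x
        subspace_add subspace_scale H_subspace H_self) auto
  finally show ?thesis .
qed

text \<open>The residual at time s stays normal at the later point: it is nonpositive on
  \<open>K\<close>, and orthogonal to the new point because that lies in \<open>H (X s)\<close>.
  Hence residuals add.\<close>

lemma flow_restart:
  assumes "0 \<le> s" "s \<le> t"
  shows "X t = proj K (X s + (t - s) *\<^sub>R v)"
proof -
  let ?z = "proj K (X s + (t - s) *\<^sub>R v)"
  have "proj K (x + t *\<^sub>R v) = ?z"
  proof (rule proj_eqI[OF cone proj_K_in])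
    have eq: "x + t *\<^sub>R v - ?z = (X s + (t - s) *\<^sub>R v - ?z) + (x + s *\<^sub>R v - X s)"
      by (simp add: algebra_simps)
    have "inner (x + s *\<^sub>R v - X s) ?z = 0"
      by (rule normal_orthogonal[OF flow_in flow_residual flow_restart_in_H[OF assms]])
    then have "x + s *\<^sub>R v - X s \<in> normal_cone K ?z"
      using normal_coneD(2)[OF flow_residual] by (simp add: normal_cone_def)
    then show "x + t *\<^sub>R v - ?z \<in> normal_cone K ?z"
      unfolding eq by (intro normal_cone_add proj_K_normal)
  qed
  then show ?thesis by (simp add: flow_def)
qed

lemma flow_in_H:
  assumes "0 \<le> s" "s \<le> t"
  shows "X t \<in> H (X s)"
  by (subst flow_restart[OF assms]) (rule flow_restart_in_H[OF assms])

definition "Q s t = (1 / (t - s)) *\<^sub>R (X t - X s)"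

lemma Q_normal:
  assumes "0 \<le> s" "s < t"
  shows "v - Q s t \<in> normal_cone K (X t)"
proof -
  have "X s + (t - s) *\<^sub>R v - X t \<in> normal_cone K (X t)"
    using proj_K_normal[of "X s + (t - s) *\<^sub>R v"] flow_restart[of s t] assms by simp
  from normal_cone_scaleR[OF this, of "1 / (t - s)"]
  have "(1 / (t - s)) *\<^sub>R (X s + (t - s) *\<^sub>R v - X t) \<in> normal_cone K (X t)" using assms by simp
  also have "(1 / (t - s)) *\<^sub>R (X s + (t - s) *\<^sub>R v - X t) = v - Q s t"
    using assms by (simp add: Q_def scaleR_diff_right scaleR_add_right)
  finally show ?thesis .
qed

lemma Q_in_H: "0 \<le> s \<Longrightarrow> s < t \<Longrightarrow> Q s t \<in> H (X s)"
  unfolding Q_def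
  by (intro subspace_scale subspace_diff H_subspace flow_in H_self flow_in_H) auto

text \<open>Motion with the velocity v - w leaves \<open>X s\<close> fixed, as this vector is normal
  there; nonexpansiveness compares the true motion with this one. It is used with w = v, with w = V
  s and with the candidate for the right limit of \<open>V\<close>.\<close>

lemma norm_Q_le:
  assumes "0 \<le> s" "s < t" "v - w \<in> normal_cone K (X s)"
  shows "norm (Q s t) \<le> norm w"
proof -
  have "proj K (X s + (t - s) *\<^sub>R (v - w)) = X s"
    using assms normal_cone_scaleR[OF assms(3), of "t - s"] by (intro proj_eqI[OF cone flow_in]) auto
  then have "norm (X t - X s) \<le> norm ((X s + (t - s) *\<^sub>R v) - (X s + (t - s) *\<^sub>R (v - w)))"
    using proj_nonexpansive[OF cone, of "X s + (t - s) *\<^sub>R v" "X s + (t - s) *\<^sub>R (v - w)"]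
      flow_restart[of s t] assms by simp
  also have "\<dots> = (t - s) * norm w"
    using assms(2) by (simp add: scaleR_diff_right)
  finally show ?thesis using assms by (simp add: Q_def divide_le_eq mult.commute)
qed

text \<open>Monotonicity of normal vectors between \<open>X t\<close> and \<open>X r\<close>, both
  written from \<open>X s\<close>, gives inner (?a - ?b) ?b \<ge> 0, which is equivalent to the
  claim.\<close>

lemma Q_decrement:
  assumes s: "0 \<le> s" "s < t" "t \<le> r"
  shows "(norm (Q s t - Q s r))\<^sup>2 \<le> (norm (Q s t))\<^sup>2 - (norm (Q s r))\<^sup>2"
proof (cases "t = r")
  case False
  let ?a = "Q s t" and ?b = "Q s r"
  have Xt: "X t = X s + (t - s) *\<^sub>R ?a" and Xr: "X r = X s + (r - s) *\<^sub>R ?b" using assms by (auto simp: Q_def)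
  have "0 \<le> inner ((v - ?a) - (v - ?b)) (X t - X r)"
    using assms by (intro normal_cone_monotone[OF cone flow_in flow_in] Q_normal) auto
  also have "\<dots> = inner (?b - ?a) ((t - s) *\<^sub>R (?a - ?b) - (r - t) *\<^sub>R ?b)"
    by (simp add: Xt Xr algebra_simps)
  also have "\<dots> = (r - t) * inner (?a - ?b) ?b - (t - s) * (norm (?a - ?b))\<^sup>2"
    by (simp add: power2_norm_eq_inner inner_diff_left inner_diff_right inner_commute algebra_simps)
  finally have "0 \<le> (r - t) * inner (?a - ?b) ?b"
    using mult_nonneg_nonneg[OF _ zero_le_power2[of "norm (?a - ?b)"], of "t - s"] s by linarith
  then have "0 \<le> inner (?a - ?b) ?b" using False s by (simp add: zero_le_mult_iff)
  then show ?thesis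
    unfolding power2_norm_diff inner_diff_left by (simp add: power2_norm_eq_inner)
qed simp

lemma Q_tendsto:
  assumes s: "0 \<le> s"
  shows "(Q s \<longlongrightarrow> V s) (at_right s)"
proof -
  have "\<exists>l. (Q s \<longlongrightarrow> l) (at_right s)"
  proof (rule right_limit_of_quadratic_decrement)
    fix h k :: real assume "s < h" "h \<le> k"
    then show "(norm (Q s h - Q s k))\<^sup>2 \<le> (norm (Q s h))\<^sup>2 - (norm (Q s k))\<^sup>2"
      using Q_decrement s by simp
  next
    fix h :: real assume "s < h"
    then have "norm (Q s h) \<le> norm v" using norm_Q_le[of s h v] s normal_coneD(2)
      by (simp add: normal_cone_def)
    then show "(norm (Q s h))\<^sup>2 \<le> (norm v)\<^sup>2" by (intro power_mono) auto
  qed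
  then obtain l where l: "(Q s \<longlongrightarrow> l) (at_right s)" ..
  then have "((\<lambda>h. (1/h) *\<^sub>R (X (s + h) - X s)) \<longlongrightarrow> l) (at_right 0)"
    by (subst (asm) filterlim_at_right_to_0) (simp add: Q_def add.commute)
  then have "V s = l" unfolding flow_vel_def by (intro tendsto_Lim) auto
  then show ?thesis using l by simp
qed

lemma flow_right_derivative:
  assumes "0 \<le> s"
  shows "((\<lambda>h. (1/h) *\<^sub>R (X (s + h) - X s)) \<longlongrightarrow> V s) (at_right 0)"
  using Q_tendsto[OF assms] by (subst (asm) filterlim_at_right_to_0) (simp add: Q_def add.commute)

lemma flow_vel_in_H: assumes s: "0 \<le> s" shows "V s \<in> H (X s)"
proof (rule Lim_in_closed_set[OF H_closed[OF flow_in] _ _ Q_tendsto[OF s]])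
  show "\<forall>\<^sub>F t in at_right s. Q s t \<in> H (X s)"
    using Q_in_H s by (auto simp: eventually_at_right_field intro!: exI[of _ "s + 1"])
qed simp

lemma flow_vel_normal: assumes s: "0 \<le> s" shows "v - V s \<in> normal_cone K (X s)"
proof (rule normal_cone_closed)
  show "((\<lambda>t. v - Q s t) \<longlongrightarrow> v - V s) (at_right s)" by (intro tendsto_intros Q_tendsto s)
  show "(X \<longlongrightarrow> X s) (at_right s)" by (rule flow_tendsto)
  show "\<forall>\<^sub>F t in at_right s. v - Q s t \<in> normal_cone K (X t)"
    using Q_normal s by (auto simp: eventually_at_right_field intro!: exI[of _ "s + 1"])
qed simp

lemma flow_vel_orth: "0 \<le> s \<Longrightarrow> u \<in> H (X s) \<Longrightarrow> inner (V s) u = inner v u"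
  using normal_orthogonal[OF flow_in flow_vel_normal, of s u] by (simp add: inner_diff_left)

lemma flow_vel_0: "V 0 = v"
proof -
  have "v - V 0 \<in> H x" using flow_vel_in_H[of 0] by (auto simp: flow_0 v intro: subspace_diff[OF H_subspace[OF x]])
  then have "inner (v - V 0) (v - V 0) = 0"
    using flow_vel_orth[of 0 "v - V 0"] by (simp add: flow_0 inner_diff_left)
  then show ?thesis by simp
qed

text \<open>The discarded part v - V s is normal at \<open>X s\<close> and orthogonal to
  \<open>H (X s)\<close>, hence to the new point, so it does not affect the projection. Thus the
  present velocity, and no longer \<open>v\<close>, determines the future.\<close>

lemma flow_semigroup_vel:
  assumes "0 \<le> s" "s \<le> t"
  shows "X t = proj K (X s + (t - s) *\<^sub>R V s)"
proof -
  let ?z = "proj K (X s + (t - s) *\<^sub>R V s)"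
  have z: "?z \<in> H (X s)"
    by (intro proj_K_H flow_in subspace_add subspace_scale H_subspace H_self flow_vel_in_H assms)
  have "v - V s \<in> normal_cone K ?z"
    using normal_coneD(2)[OF flow_vel_normal[OF assms(1)]]
      normal_orthogonal[OF flow_in flow_vel_normal[OF assms(1)] z] by (simp add: normal_cone_def)
  then have "(X s + (t - s) *\<^sub>R V s - ?z) + (t - s) *\<^sub>R (v - V s) \<in> normal_cone K ?z"
    using assms by (intro normal_cone_add proj_K_normal normal_cone_scaleR) auto
  then have "X s + (t - s) *\<^sub>R v - ?z \<in> normal_cone K ?z" by (simp add: algebra_simps)
  then have "proj K (X s + (t - s) *\<^sub>R v) = ?z" by (intro proj_eqI[OF cone proj_K_in])
  then show ?thesis using flow_restart[OF assms] by simp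
qed

lemma H_flow_antimono: "0 \<le> s \<Longrightarrow> s \<le> t \<Longrightarrow> H (X t) \<subseteq> H (X s)"
  by (intro H_mono flow_in flow_in_H)

text \<open>\<open>H (X t)\<close> is contained in \<open>H (X s)\<close>, so \<open>V t\<close> is
  the orthogonal projection of \<open>V s\<close> onto it, and this is Pythagoras.\<close>

lemma flow_vel_decrement:
  assumes "0 \<le> s" "s \<le> t"
  shows "(norm (V s - V t))\<^sup>2 = (norm (V s))\<^sup>2 - (norm (V t))\<^sup>2"
proof -
  have t: "V t \<in> H (X t)" "V t \<in> H (X s)"
    using flow_vel_in_H[of t] H_flow_antimono[OF assms] assms by auto
  then have "inner (V s) (V t) = inner (V t) (V t)"
    using flow_vel_orth[of s "V t"] flow_vel_orth[of t "V t"] assms by simp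
  then show ?thesis unfolding power2_norm_diff by (simp add: power2_norm_eq_inner)
qed

lemma norm_flow_vel_antimono:
  assumes "0 \<le> s" "s \<le> t"
  shows "norm (V t) \<le> norm (V s)"
proof (rule power2_le_imp_le)
  show "(norm (V t))\<^sup>2 \<le> (norm (V s))\<^sup>2"
    using flow_vel_decrement[OF assms] zero_le_power2[of "norm (V s - V t)"] by linarith
qed simp

text \<open>The limit \<open>l\<close> exists by the decrement of the norms. Closedness of the
  normal cone admits it in \<open>norm_Q_le\<close>, so \<open>V s\<close> is no longer than
  \<open>l\<close>; Pythagoras in the limit then leaves no room for a difference.\<close>

lemma flow_vel_right_continuous:
  assumes s: "0 \<le> s"
  shows "(V \<longlongrightarrow> V s) (at_right s)"
proof -
  have ev: "\<forall>\<^sub>F t in at_right s. s < t" by (auto simp: eventually_at_right_field intro!: exI[of _ "s + 1"])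
  have "\<exists>l. (V \<longlongrightarrow> l) (at_right s)"
  proof (rule right_limit_of_quadratic_decrement[where \<phi> = "\<lambda>t. (norm (V t))\<^sup>2"])
    fix h k :: real assume "s < h" "h \<le> k"
    then show "(norm (V h - V k))\<^sup>2 \<le> (norm (V h))\<^sup>2 - (norm (V k))\<^sup>2"
      using flow_vel_decrement[of h k] s by simp
  next
    fix h :: real assume "s < h"
    then show "(norm (V h))\<^sup>2 \<le> (norm (V s))\<^sup>2"
      using norm_flow_vel_antimono[of s h] s by (intro power_mono) auto
  qed
  then obtain l where l: "(V \<longlongrightarrow> l) (at_right s)" ..
  have nl: "v - l \<in> normal_cone K (X s)"
  proof (rule normal_cone_closed)
    show "((\<lambda>t. v - V t) \<longlongrightarrow> v - l) (at_right s)" by (intro tendsto_intros l)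
    show "(X \<longlongrightarrow> X s) (at_right s)" by (rule flow_tendsto)
    show "\<forall>\<^sub>F t in at_right s. v - V t \<in> normal_cone K (X t)"
      using ev by eventually_elim (use s flow_vel_normal in auto)
  qed simp
  have "\<forall>\<^sub>F t in at_right s. norm (Q s t) \<le> norm l"
    using ev by eventually_elim (rule norm_Q_le[OF s _ nl])
  then have "norm (V s) \<le> norm l"
    by (rule tendsto_upperbound[OF tendsto_norm[OF Q_tendsto[OF s]]]) simp
  moreover have "(norm (V s - l))\<^sup>2 = (norm (V s))\<^sup>2 - (norm l)\<^sup>2"
  proof (rule tendsto_unique[OF trivial_limit_at_right_real])
    show "((\<lambda>t. (norm (V s - V t))\<^sup>2) \<longlongrightarrow> (norm (V s - l))\<^sup>2) (at_right s)" by (intro tendsto_intros l)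
    have "((\<lambda>t. (norm (V s))\<^sup>2 - (norm (V t))\<^sup>2) \<longlongrightarrow> (norm (V s))\<^sup>2 - (norm l)\<^sup>2) (at_right s)"
      by (intro tendsto_intros l)
    moreover have "\<forall>\<^sub>F t in at_right s. (norm (V s))\<^sup>2 - (norm (V t))\<^sup>2 = (norm (V s - V t))\<^sup>2"
      using ev by eventually_elim (use s flow_vel_decrement in auto)
    ultimately show "((\<lambda>t. (norm (V s - V t))\<^sup>2) \<longlongrightarrow> (norm (V s))\<^sup>2 - (norm l)\<^sup>2) (at_right s)"
      by (rule Lim_transform_eventually)
  qed
  ultimately have "(norm (V s - l))\<^sup>2 \<le> 0" by (simp add: power_mono)
  then show ?thesis using l by simp
qed

text \<open>The left quotient \<open>Q s t\<close> has the projection \<open>V t\<close> onto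
  \<open>H (X t)\<close>, and its norm is at most that of \<open>V s\<close>; so its distance from
  \<open>V t\<close> is controlled by the drop of the norm of the velocity. Only jumps of this
  nonincreasing function can obstruct.\<close>

lemma flow_two_sided_derivative:
  assumes t: "0 < t" and cont: "isCont (\<lambda>s. norm (V s)) t"
  shows "((\<lambda>h. (1/h) *\<^sub>R (X (t + h) - X t)) \<longlongrightarrow> V t) (at 0)"
proof -
  have est: "(norm (Q s t - V t))\<^sup>2 \<le> (norm (V s))\<^sup>2 - (norm (V t))\<^sup>2" if s: "0 \<le> s" "s < t" for s
  proof -
    have Vt: "V t \<in> H (X t)" using flow_vel_in_H t by simp
    have "inner (Q s t) (V t) = inner v (V t)"
      using normal_orthogonal[OF flow_in Q_normal[OF s] Vt] by (simp add: inner_diff_left)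
    moreover have "inner v (V t) = inner (V t) (V t)" using flow_vel_orth[OF _ Vt] t by simp
    moreover have "(norm (Q s t))\<^sup>2 \<le> (norm (V s))\<^sup>2"
      using norm_Q_le[OF s flow_vel_normal[OF s(1)]] by (intro power_mono) auto
    ultimately show ?thesis unfolding power2_norm_diff by (simp add: power2_norm_eq_inner)
  qed
  have "((\<lambda>s. Q s t - V t) \<longlongrightarrow> 0) (at_left t)"
  proof (rule tendsto_norm_zero_cancel, rule tendsto_0_le[where K = 1])
    have l: "((\<lambda>s. norm (V s)) \<longlongrightarrow> norm (V t)) (at_left t)"
      using cont by (simp add: isCont_def filterlim_at_split)
    have "((\<lambda>s. sqrt ((norm (V s))\<^sup>2 - (norm (V t))\<^sup>2)) \<longlongrightarrow> sqrt ((norm (V t))\<^sup>2 - (norm (V t))\<^sup>2)) (at_left t)"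
      by (rule tendsto_real_sqrt[OF tendsto_diff[OF tendsto_power[OF l] tendsto_const]])
    then show "((\<lambda>s. sqrt ((norm (V s))\<^sup>2 - (norm (V t))\<^sup>2)) \<longlongrightarrow> 0) (at_left t)" by simp
    have "norm (norm (Q s t - V t)) \<le> norm (sqrt ((norm (V s))\<^sup>2 - (norm (V t))\<^sup>2)) * 1" if "0 \<le> s" "s < t" for s
      using real_le_rsqrt[OF est[OF that]] by simp
    then show "\<forall>\<^sub>F s in at_left t. norm (norm (Q s t - V t)) \<le> norm (sqrt ((norm (V s))\<^sup>2 - (norm (V t))\<^sup>2)) * 1"
      using t by (auto simp: eventually_at_left_field intro!: exI[of _ 0])
  qed
  then have "((\<lambda>s. Q s t) \<longlongrightarrow> V t) (at_left t)" by (simp add: Lim_null[symmetric])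
  moreover have "filterlim (\<lambda>h. t + h) (at_left t) (at_left 0)"
    by (auto simp: filterlim_at eventually_at_left_field intro!: tendsto_eq_intros exI[of _ "-1"])
  ultimately have "((\<lambda>h. Q (t + h) t) \<longlongrightarrow> V t) (at_left 0)" by (rule filterlim_compose)
  moreover have "Q (t + h) t = (1/h) *\<^sub>R (X (t + h) - X t)" for h
    unfolding Q_def by (metis (no_types, lifting) add_diff_cancel_left' minus_diff_eq minus_divide_right
        scaleR_minus_left scaleR_minus_right)
  ultimately have "((\<lambda>h. (1/h) *\<^sub>R (X (t + h) - X t)) \<longlongrightarrow> V t) (at_left 0)" by simp
  then show ?thesis using flow_right_derivative[of t] t by (simp add: filterlim_at_split)
qed

lemma countable_discont_norm_flow_vel: "countable {t. 0 < t \<and> \<not> isCont (\<lambda>s. norm (V s)) t}"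
proof -
  \<comment> \<open>The sign makes it nondecreasing; \<open>max 0\<close> extends it constantly to
    negative times.\<close>
  let ?f = "\<lambda>t. - norm (V (max 0 t))"
  have "mono ?f" by (intro monoI) (simp add: norm_flow_vel_antimono)
  then have "countable {t. \<not> isCont ?f t}" by (rule mono_ctble_discont)
  moreover have "isCont (\<lambda>s. norm (V s)) t" if "0 < t" "isCont ?f t" for t
  proof -
    have "\<forall>\<^sub>F s in nhds t. 0 < s" using order_tendstoD(1)[OF filterlim_ident \<open>0 < t\<close>] by simp
    then have "\<forall>\<^sub>F s in nhds t. norm (V s) = - ?f s" by eventually_elim simp
    then show ?thesis using isCont_minus[OF that(2)] by (subst isCont_cong) auto
  qed
  ultimately show ?thesis by (elim countable_subset[rotated]) auto
qed

text \<open>By homogeneity X t / t is the projection of x / t + v. Adding (1/s - 1/t) x to it gives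
  an element of \<open>K\<close> above x / s + v in the order of \<open>proj_K_greatest\<close>,
  hence above the least such element X s / s.\<close>

lemma scaled_residual_decreasing:
  assumes s: "0 < s" "s \<le> t" and u: "u \<in> K"
  shows "inner ((1/t) *\<^sub>R (x + t *\<^sub>R v - X t) - (1/s) *\<^sub>R (x + s *\<^sub>R v - X s)) u \<le> 0"
proof -
  have scale: "proj K ((1/r) *\<^sub>R x + v) = (1/r) *\<^sub>R X r" if "0 < r" for r
  proof -
    have "(1/r) *\<^sub>R x + v = (1/r) *\<^sub>R (x + r *\<^sub>R v)" using that by (simp add: scaleR_add_right)
    then show ?thesis using proj_scaleR[OF cone, of "1/r" "x + r *\<^sub>R v"] that by (simp add: flow_def)
  qed
  let ?z = "(1/s - 1/t) *\<^sub>R x"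
  have z: "?z \<in> K" using s by (intro K_scaleR x) (simp add: frac_le)
  have t: "0 < t" using s by simp
  have "inner (proj K ((1/s) *\<^sub>R x + v) - ((1/t) *\<^sub>R X t + ?z)) u \<le> 0"
  proof (rule proj_K_greatest[OF _ _ u])
    show "(1/t) *\<^sub>R X t + ?z \<in> K" using t by (intro K_add z K_scaleR flow_in) simp
    fix w assume w: "w \<in> K"
    have "(1/s) *\<^sub>R x + v - ((1/t) *\<^sub>R X t + ?z) = (1/t) *\<^sub>R (x + t *\<^sub>R v - X t)"
      using t by (simp add: algebra_simps)
    then show "inner ((1/s) *\<^sub>R x + v - ((1/t) *\<^sub>R X t + ?z)) w \<le> 0"
      using normal_coneD(2)[OF normal_cone_scaleR[OF flow_residual, of "1/t" t] w] t by simp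
  qed
  moreover have "proj K ((1/s) *\<^sub>R x + v) - ((1/t) *\<^sub>R X t + ?z)
      = (1/t) *\<^sub>R (x + t *\<^sub>R v - X t) - (1/s) *\<^sub>R (x + s *\<^sub>R v - X s)"
    unfolding scale[OF s(1)] using s t by (simp add: algebra_simps)
  ultimately show ?thesis by simp
qed

text \<open>X t - x - t V t is t squared times the right derivative of the scaled residual (x + t v
  - X t) / t, whose difference quotients are nonpositive on \<open>K\<close> by
  \<open>scaled_residual_decreasing\<close>.\<close>

lemma flow_scaled_normal:
  assumes t: "0 < t"
  shows "X t - x - t *\<^sub>R V t \<in> normal_cone K (X t)"
proof -
  let ?\<xi> = "x + t *\<^sub>R v - X t"
  have eq: "X t - x - t *\<^sub>R V t = t *\<^sub>R (v - V t) - ?\<xi>" by (simp add: algebra_simps)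
  have "inner (X t - x - t *\<^sub>R V t) u \<le> 0" if u: "u \<in> K" for u
    unfolding eq
  proof (rule tendsto_upperbound)
    show "((\<lambda>r. inner (t *\<^sub>R (v - Q t r) - ?\<xi>) u) \<longlongrightarrow> inner (t *\<^sub>R (v - V t) - ?\<xi>) u) (at_right t)"
      using t by (intro tendsto_intros Q_tendsto) simp
    have "inner (t *\<^sub>R (v - Q t r) - ?\<xi>) u \<le> 0" if r: "t < r" for r
    proof -
      have Xr: "X r = X t + (r - t) *\<^sub>R Q t r" using r by (simp add: Q_def)
      have "(1/r) *\<^sub>R (x + r *\<^sub>R v - X r) - (1/t) *\<^sub>R ?\<xi> = ((r - t) / (r * t)) *\<^sub>R (t *\<^sub>R (v - Q t r) - ?\<xi>)"
      proof -
        have "(r * t) *\<^sub>R ((1/r) *\<^sub>R (x + r *\<^sub>R v - X r) - (1/t) *\<^sub>R ?\<xi>)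
           = t *\<^sub>R (x + r *\<^sub>R v - X r) - r *\<^sub>R ?\<xi>"
          using r t by (simp add: scaleR_diff_right)
        also have "\<dots> = (r - t) *\<^sub>R (t *\<^sub>R (v - Q t r) - ?\<xi>)"
          unfolding Xr by (simp add: algebra_simps)
        also have "\<dots> = (r * t) *\<^sub>R (((r - t) / (r * t)) *\<^sub>R (t *\<^sub>R (v - Q t r) - ?\<xi>))"
          using r t by simp
        finally show ?thesis using r t by (simp only: scaleR_cancel_left) auto
      qed
      then have "((r - t) / (r * t)) * inner (t *\<^sub>R (v - Q t r) - ?\<xi>) u \<le> 0"
        using scaled_residual_decreasing[OF t less_imp_le[OF r] u] by simp
      then show ?thesis using r t by (simp add: mult_le_0_iff divide_le_0_iff)
    qed
    then show "\<forall>\<^sub>F r in at_right t. inner (t *\<^sub>R (v - Q t r) - ?\<xi>) u \<le> 0"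
      by (auto simp: eventually_at_right_field intro!: exI[of _ "t + 1"])
  qed simp
  moreover have "inner (X t - x - t *\<^sub>R V t) (X t) = 0"
    unfolding eq using normal_coneD(1)[OF flow_vel_normal, of t] normal_coneD(1)[OF flow_residual, of t] t
    by (simp add: inner_diff_left inner_scaleR_left)
  ultimately show ?thesis by (simp add: normal_cone_def)
qed

end

end

section \<open>Uniqueness of absolutely continuous solutions\<close>

definition fine_intervals :: "real \<Rightarrow> real \<Rightarrow> real \<Rightarrow> nat \<Rightarrow> (nat \<Rightarrow> real) \<Rightarrow> (nat \<Rightarrow> real) \<Rightarrow> bool" where
  "fine_intervals a b d n l r \<longleftrightarrow> (\<forall>i<n. a \<le> l i \<and> l i \<le> r i \<and> r i \<le> b) \<and>
     disjoint_family_on (\<lambda>i. {l i<..<r i}) {..<n} \<and> (\<Sum>i<n. r i - l i) < d"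

text \<open>
  Cousin's lemma: on a fine tagged division the intervals tagged outside \<open>N\<close> contribute little by
  differentiability, those tagged in \<open>N\<close> by absolute continuity.
\<close>

lemma nonincreasing_if_abs_cont:
  fixes g :: "real \<Rightarrow> real"
  assumes ab: "a \<le> b" and N: "N \<in> null_sets lborel"
    and der: "\<And>t. t \<in> {a..b} \<Longrightarrow> t \<notin> N \<Longrightarrow> \<exists>D\<le>0. (g has_real_derivative D) (at t)"
    and ac: "\<And>e. 0 < e \<Longrightarrow> \<exists>d>0. \<forall>n l r. fine_intervals a b d n l r \<longrightarrow> (\<Sum>i<n. g (r i) - g (l i)) < e"
  shows "g b \<le> g a"
proof (rule field_le_epsilon)
  fix e0 :: real assume e0: "0 < e0"
  \<comment> \<open>The intervals tagged outside \<open>N\<close> will contribute at most e (b - a),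
    those tagged in \<open>N\<close> at most e, together \<open>e0\<close>.\<close>
  define e where "e = e0 / (b - a + 1)"
  have e: "0 < e" using e0 ab by (simp add: e_def)
  obtain d where d: "0 < d" and dP: "\<And>n l r. fine_intervals a b d n l r \<Longrightarrow> (\<Sum>i<n. g (r i) - g (l i)) < e"
    using ac[OF e] by blast
  \<comment> \<open>The open cover of \<open>N\<close> is shorter than the \<open>d\<close> of
    absolute continuity, so nonoverlapping intervals inside it satisfy the hypothesis of
    \<open>dP\<close>.\<close>
  obtain U where U: "open U" "N \<subseteq> U" "emeasure lborel (U - N) < d"
    using outer_regular_lborel[of N d] N d by (auto simp: null_sets_def)
  have "emeasure lborel U < d"
    using emeasure_Diff_null_set[OF N, of U] U by simp
  have loc: "\<exists>\<rho>>0. (t \<in> N \<longrightarrow> ball t \<rho> \<subseteq> U) \<and> (t \<notin> N \<longrightarrow> (\<forall>u v. u \<le> t \<and> t \<le> v \<and> u \<in> ball t \<rho> \<and> v \<in> ball t \<rho> \<longrightarrow>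
      g v - g u \<le> e * (v - u)))" if t: "t \<in> {a..b}" for t
  proof (cases "t \<in> N")
    case True
    then show ?thesis using U(1,2) by (metis open_contains_ball subsetD)
  next
    case False
    obtain D where D: "D \<le> 0" "(g has_real_derivative D) (at t)" using der[OF t False] by blast
    obtain \<rho> where \<rho>: "0 < \<rho>" "\<And>y. norm (y - t) < \<rho> \<Longrightarrow> norm (g y - g t - D * (y - t)) \<le> e * norm (y - t)"
      using D(2) e unfolding has_field_derivative_def has_derivative_at_alt by blast
    have "g v - g u \<le> e * (v - u)" if "u \<le> t" "t \<le> v" "u \<in> ball t \<rho>" "v \<in> ball t \<rho>" for u v
    proof -
      have "\<bar>g v - g t - D * (v - t)\<bar> \<le> e * (v - t)" "\<bar>g u - g t - D * (u - t)\<bar> \<le> e * (t - u)"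
        using \<rho>(2)[of v] \<rho>(2)[of u] that by (simp_all add: dist_real_def abs_of_nonpos)
      moreover have "D * (v - t) \<le> 0" "0 \<le> D * (u - t)"
        using D(1) that by (auto simp: mult_nonpos_nonneg mult_nonpos_nonpos)
      ultimately have "g v - g u \<le> e * (v - t) + e * (t - u)" by linarith
      then show ?thesis by (simp add: algebra_simps)
    qed
    then show ?thesis using \<rho>(1) False by blast
  qed
  have "\<forall>t. \<exists>\<rho>. 0 < \<rho> \<and> (t \<in> {a..b} \<longrightarrow> (t \<in> N \<longrightarrow> ball t \<rho> \<subseteq> U) \<and>
      (t \<notin> N \<longrightarrow> (\<forall>u v. u \<le> t \<and> t \<le> v \<and> u \<in> ball t \<rho> \<and> v \<in> ball t \<rho> \<longrightarrow> g v - g u \<le> e * (v - u))))"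
    (is "\<forall>t. \<exists>\<rho>. ?P t \<rho>")
  proof
    fix t show "\<exists>\<rho>. ?P t \<rho>"
    proof (cases "t \<in> {a..b}")
      case True from loc[OF this] show ?thesis by (elim exE conjE) (rule exI, intro conjI impI, assumption, (drule (1) mp, assumption)+)
    next
      \<comment> \<open>\<open>gauge\<close> quantifies over all reals; outside the interval any
        radius serves.\<close>
      case False then show ?thesis by (intro exI[of _ 1] conjI impI zero_less_one) (rule FalseE, erule notE, assumption)+
    qed
  qed
  from choice[OF this] obtain \<rho> where all: "\<And>t. ?P t (\<rho> t)" by blast
  have \<rho>: "t \<in> N \<Longrightarrow> ball t (\<rho> t) \<subseteq> U"
    "t \<notin> N \<Longrightarrow> u \<le> t \<Longrightarrow> t \<le> v \<Longrightarrow> u \<in> ball t (\<rho> t) \<Longrightarrow> v \<in> ball t (\<rho> t) \<Longrightarrow> g v - g u \<le> e * (v - u)"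
    if "t \<in> {a..b}" for t u v
    using all[of t] that by simp_all
  have "0 < \<rho> t" for t using all[of t] by simp
  then have "gauge (\<lambda>t. ball t (\<rho> t))" by (auto simp: gauge_def)
  then obtain p where p: "p tagged_division_of {a..b}" and fine: "(\<lambda>t. ball t (\<rho> t)) fine p"
    by (rule fine_division_exists_real)
  have pK: "Inf K \<le> x \<and> x \<le> Sup K \<and> a \<le> Inf K \<and> Sup K \<le> b \<and> K = {Inf K..Sup K} \<and> x \<in> {a..b} \<and> K \<subseteq> ball x (\<rho> x)"
    if xK: "(x, K) \<in> p" for x K
  proof -
    obtain u v where K: "K = {u..v}" using tagged_division_ofD(4)[OF p xK] by auto
    have x: "x \<in> K" "K \<subseteq> {a..b}" using tagged_division_ofD(2,3)[OF p xK] by auto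
    then have "u \<le> v" using K by auto
    moreover have "K \<subseteq> ball x (\<rho> x)" using fine xK by (auto simp: fine_def)
    ultimately show ?thesis using K x by auto
  qed
  define p2 where "p2 = {(x, K) \<in> p. x \<in> N}"
  have fin: "finite p" "finite p2" using tagged_division_ofD(1)[OF p] finite_subset[of p2 p] by (auto simp: p2_def)
  obtain n and h :: "nat \<Rightarrow> real \<times> real set" where h: "bij_betw h {..<n} p2"
    using ex_bij_betw_nat_finite[OF fin(2)] by (auto simp: atLeast0LessThan)
  have hp: "h i \<in> p" "fst (h i) \<in> N" if "i < n" for i using bij_betwE[OF h] that by (auto simp: p2_def case_prod_beta)
  let ?l = "\<lambda>i. Inf (snd (h i))" and ?r = "\<lambda>i. Sup (snd (h i))"
  have hK: "a \<le> ?l i \<and> ?l i \<le> ?r i \<and> ?r i \<le> b" "snd (h i) = {?l i..?r i}" "snd (h i) \<subseteq> U" if "i < n" for i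
  proof -
    from hp[OF that] have hi: "(fst (h i), snd (h i)) \<in> p" by simp
    note q = pK[OF hi]
    show "a \<le> ?l i \<and> ?l i \<le> ?r i \<and> ?r i \<le> b" using q by linarith
    show "snd (h i) = {?l i..?r i}" using q by blast
    show "snd (h i) \<subseteq> U" using q \<rho>(1)[of "fst (h i)"] hp(2)[OF that] by blast
  qed
  have disj: "disjoint_family_on (\<lambda>i. {?l i<..<?r i}) {..<n}"
    unfolding disjoint_family_on_def
  proof safe
    fix i j x assume ij: "i < n" "j < n" "i \<noteq> j" and x: "x \<in> {?l i<..<?r i}" "x \<in> {?l j<..<?r j}"
    have "h i \<noteq> h j" using h ij by (auto simp: bij_betw_def inj_on_def)
    then have "interior (snd (h i)) \<inter> interior (snd (h j)) = {}"
      using tagged_division_ofD(5)[OF p, of "fst (h i)" "snd (h i)" "fst (h j)" "snd (h j)"] hp ij by auto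
    then have "{?l i<..<?r i} \<inter> {?l j<..<?r j} = {}"
      using interior_atLeastAtMost_real[of "?l i" "?r i"] interior_atLeastAtMost_real[of "?l j" "?r j"]
        hK(2)[OF ij(1)] hK(2)[OF ij(2)] by simp
    then show "x \<in> {}" using x by blast
  qed
  have len: "(\<Sum>i<n. ?r i - ?l i) < d"
  proof -
    have "ennreal (\<Sum>i<n. ?r i - ?l i) = (\<Sum>i<n. emeasure lborel {?l i<..<?r i})"
      using hK(1) by (subst sum_ennreal[symmetric]) auto
    also have "\<dots> = emeasure lborel (\<Union>i<n. {?l i<..<?r i})"
      using disj by (intro sum_emeasure) auto
    also have "\<dots> \<le> emeasure lborel U"
      proof (rule emeasure_mono)
      show "(\<Union>i<n. {?l i<..<?r i}) \<subseteq> U"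
      proof (rule UN_least)
        fix i assume "i \<in> {..<n}"
        then have "{?l i..?r i} \<subseteq> U" using hK(2,3)[of i] by simp
        then show "{?l i<..<?r i} \<subseteq> U" by force
      qed
    qed (use U(1) in simp)
    also have "\<dots> < d" by fact
    finally show ?thesis by (subst (asm) ennreal_less_iff) (auto intro!: sum_nonneg simp: hK(1))
  qed
  have s2: "(\<Sum>(x,K)\<in>p2. g (Sup K) - g (Inf K)) < e"
  proof -
    have "(\<Sum>(x,K)\<in>p2. g (Sup K) - g (Inf K)) = (\<Sum>i<n. g (?r i) - g (?l i))"
      by (subst sum.reindex_bij_betw[OF h, symmetric]) (simp add: case_prod_beta)
    also have "\<dots> < e" using hK(1) disj len by (intro dP) (simp add: fine_intervals_def)
    finally show ?thesis .
  qed
  have s1: "(\<Sum>(x,K)\<in>p - p2. g (Sup K) - g (Inf K)) \<le> e * (b - a)"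
  proof -
    have "(\<Sum>(x,K)\<in>p - p2. g (Sup K) - g (Inf K)) \<le> (\<Sum>(x,K)\<in>p - p2. e * (Sup K - Inf K))"
    proof (rule sum_mono, clarify)
      fix x K assume "(x, K) \<in> p" "(x, K) \<notin> p2"
      then have x: "x \<notin> N" and K: "(x, K) \<in> p" by (auto simp: p2_def)
      note q = pK[OF K]
      have "Inf K \<le> Sup K" using q by linarith
      have Keq: "K = {Inf K..Sup K}" using q by blast
      from \<open>Inf K \<le> Sup K\<close> have "Inf K \<in> {Inf K..Sup K}" "Sup K \<in> {Inf K..Sup K}" by simp_all
      then have "Inf K \<in> K" "Sup K \<in> K" unfolding Keq[symmetric] .
      then show "g (Sup K) - g (Inf K) \<le> e * (Sup K - Inf K)"
        using q by (intro \<rho>(2)[OF _ x]) blast+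
    qed
    also have "\<dots> \<le> (\<Sum>(x,K)\<in>p. e * (Sup K - Inf K))"
      proof (intro sum_mono2 fin)
      fix z assume "z \<in> p - (p - p2)"
      then have "(fst z, snd z) \<in> p" by simp
      from pK[OF this] show "0 \<le> (case z of (x, K) \<Rightarrow> e * (Sup K - Inf K))"
        using e by (simp add: case_prod_beta)
    qed auto
    also have "\<dots> = e * (b - a)"
      using additive_tagged_division_1[OF ab p, of "\<lambda>x. x"] by (simp add: case_prod_beta flip: sum_distrib_left)
    finally show ?thesis .
  qed
  have "g b - g a = (\<Sum>(x,K)\<in>p - p2. g (Sup K) - g (Inf K)) + (\<Sum>(x,K)\<in>p2. g (Sup K) - g (Inf K))"
    using additive_tagged_division_1[OF ab p, of g] sum.subset_diff[of p2 p "\<lambda>(x,K). g (Sup K) - g (Inf K)"] fin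
    by (auto simp: p2_def)
  also have "\<dots> \<le> e * (b - a) + e" using s1 s2 by linarith
  also have "\<dots> = e * (b - a + 1)" by (simp add: algebra_simps)
  also have "\<dots> = e0" using ab by (simp add: e_def)
  finally show "g b \<le> g a + e0" by simp
qed

definition abs_cont_curve :: "(real \<Rightarrow> 'a::real_normed_vector) \<Rightarrow> bool" where
  "abs_cont_curve y \<longleftrightarrow> (\<forall>T>0. \<forall>e>0. \<exists>d>0. \<forall>n a b. fine_intervals 0 T d n a b
      \<longrightarrow> (\<Sum>i<n. norm (y (b i) - y (a i))) < e)"

lemma abs_cont_curve_continuous:
  assumes "abs_cont_curve y" "0 < T"
  shows "continuous_on {0..T} y"
proof (rule continuous_onI)
  fix s e :: real assume s: "s \<in> {0..T}" and e: "0 < e"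
  obtain d where d: "0 < d" "\<And>n a b. fine_intervals 0 T d n a b \<Longrightarrow> (\<Sum>i<n. norm (y (b i) - y (a i))) < e"
    using assms e unfolding abs_cont_curve_def by blast
  have one: "norm (y v - y u) < e" if "0 \<le> u" "u \<le> v" "v \<le> T" "v - u < d" for u v
    using d(2)[of 1 "\<lambda>_. u" "\<lambda>_. v"] that by (auto simp: fine_intervals_def disjoint_family_on_def)
  have "dist (y t) (y s) \<le> e" if "t \<in> {0..T}" "dist t s < d" for t
  proof (cases "s \<le> t")
    case True then show ?thesis using one[of s t] that s by (simp add: dist_norm dist_real_def)
  next
    case False then show ?thesis using one[of t s] that s by (simp add: dist_norm dist_real_def norm_minus_commute)
  qed
  then show "\<exists>d>0. \<forall>x'\<in>{0..T}. dist x' s < d \<longrightarrow> dist (y x') (y s) \<le> e" using d(1) by blast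
qed

text \<open>\<open>g\<close> inherits absolute continuity from two curves at once; the tolerance is
  split as e / (2 C) for each of them.\<close>

lemma abs_cont_curve_control:
  fixes y1 :: "real \<Rightarrow> 'a::real_normed_vector" and y2 :: "real \<Rightarrow> 'b::real_normed_vector" and g :: "real \<Rightarrow> real"
  assumes y: "abs_cont_curve y1" "abs_cont_curve y2" and a: "0 \<le> a" and b: "0 < b" and C: "0 < C"
    and g: "\<And>u v. a \<le> u \<Longrightarrow> u \<le> v \<Longrightarrow> v \<le> b \<Longrightarrow> g v - g u \<le> C * (norm (y1 v - y1 u) + norm (y2 v - y2 u))"
    and e: "0 < e"
  shows "\<exists>d>0. \<forall>n l r. fine_intervals a b d n l r \<longrightarrow> (\<Sum>i<n. g (r i) - g (l i)) < e"
proof -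
  have e': "0 < e / (2 * C)" using e C by simp
  obtain d1 where d1: "0 < d1" "\<And>n l r. fine_intervals 0 b d1 n l r
      \<Longrightarrow> (\<Sum>i<n. norm (y1 (r i) - y1 (l i))) < e / (2 * C)"
    using y(1) b e' unfolding abs_cont_curve_def by blast
  obtain d2 where d2: "0 < d2" "\<And>n l r. fine_intervals 0 b d2 n l r
      \<Longrightarrow> (\<Sum>i<n. norm (y2 (r i) - y2 (l i))) < e / (2 * C)"
    using y(2) b e' unfolding abs_cont_curve_def by blast
  show ?thesis
  proof (intro exI[of _ "min d1 d2"] conjI allI impI, goal_cases)
    case 1 show ?case using d1 d2 by simp
  next
    case (2 n l r)
    then have lr: "fine_intervals 0 b d1 n l r" "fine_intervals 0 b d2 n l r"
      using a by (force simp: fine_intervals_def)+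
    have "(\<Sum>i<n. g (r i) - g (l i)) \<le> (\<Sum>i<n. C * (norm (y1 (r i) - y1 (l i)) + norm (y2 (r i) - y2 (l i))))"
      using 2 by (intro sum_mono g) (auto simp: fine_intervals_def)
    also have "\<dots> = C * ((\<Sum>i<n. norm (y1 (r i) - y1 (l i))) + (\<Sum>i<n. norm (y2 (r i) - y2 (l i))))"
      by (simp add: sum_distrib_left[symmetric] sum.distrib)
    also have "\<dots> < C * (e / (2 * C) + e / (2 * C))"
      using C d1(2)[OF lr(1)] d2(2)[OF lr(2)] by (intro mult_strict_left_mono add_strict_mono) auto
    also have "\<dots> = e" using C by simp
    finally show ?case .
  qed
qed

lemma power2_norm_diff_le:
  fixes p q :: "'a::real_normed_vector"
  assumes "norm p \<le> M" "norm q \<le> M"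
  shows "(norm p)\<^sup>2 - (norm q)\<^sup>2 \<le> 2 * M * norm (p - q)"
proof -
  have "(norm p)\<^sup>2 - (norm q)\<^sup>2 = (norm p + norm q) * (norm p - norm q)" by (simp add: power2_eq_square algebra_simps)
  also have "\<dots> \<le> (norm p + norm q) * norm (p - q)" by (intro mult_left_mono norm_triangle_ineq2) simp
  also have "\<dots> \<le> (2 * M) * norm (p - q)" using assms by (intro mult_right_mono) auto
  finally show ?thesis .
qed

lemma has_real_derivative_power2_norm:
  fixes w :: "real \<Rightarrow> 'a::real_inner"
  assumes "(w has_vector_derivative w') (at t)"
  shows "((\<lambda>t. (norm (w t))\<^sup>2) has_real_derivative 2 * inner (w t) w') (at t)"
proof -
  have "((\<lambda>t. inner (w t) (w t)) has_derivative (\<lambda>h. inner (w t) (h *\<^sub>R w') + inner (h *\<^sub>R w') (w t))) (at t)"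
    using assms unfolding has_vector_derivative_def by (intro has_derivative_inner)
  then show ?thesis
    unfolding has_field_derivative_def power2_norm_eq_inner
    by (rule has_derivative_eq_rhs) (simp add: fun_eq_iff inner_commute)
qed

lemma abs_cont_curves_bounded:
  assumes "abs_cont_curve y1" "abs_cont_curve y2" "0 < b"
  shows "\<exists>M>0. \<forall>t\<in>{0..b}. norm (y1 t - y2 t) \<le> M"
proof -
  have "bounded ((\<lambda>t. y1 t - y2 t) ` {0..b})"
    using assms by (intro compact_imp_bounded compact_continuous_image continuous_on_diff
        abs_cont_curve_continuous) auto
  then show ?thesis by (auto simp: bounded_pos)
qed

text \<open>Monotonicity of normal vectors gives the squared distance of two solutions a nonpositive
  derivative almost everywhere, and absolute continuity makes that conclusive.\<close>

lemma gradient_solutions_unique: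
  fixes y1 y2 :: "real \<Rightarrow> 'a::{real_inner,complete_space}"
  assumes cone: "closed_cone K" and ac: "abs_cont_curve y1" "abs_cont_curve y2" and init: "y1 0 = y2 0"
    and sol: "\<And>y. y = y1 \<or> y = y2 \<Longrightarrow> AE t in lborel. 0 < t \<longrightarrow>
        (\<exists>D. (y has_vector_derivative D) (at t) \<and> y t \<in> K \<and> v - D \<in> normal_cone K (y t))"
    and b: "0 \<le> b"
  shows "y1 b = y2 b"
proof (cases "b = 0")
  case False
  then have b: "0 < b" using b by simp
  define g where "g t = (norm (y1 t - y2 t))\<^sup>2" for t
  have "AE t in lborel. t \<noteq> (0::real)" by (rule AE_lborel_singleton)
  with sol[of y1] sol[of y2] have "AE t in lborel. 0 \<le> t \<longrightarrow> (\<exists>D\<le>0. (g has_real_derivative D) (at t))"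
  proof (simp, elim AE_mp, intro AE_I2 impI, goal_cases)
    case (1 t)
    then obtain D1 D2 where D: "(y1 has_vector_derivative D1) (at t)" "y1 t \<in> K" "v - D1 \<in> normal_cone K (y1 t)"
       "(y2 has_vector_derivative D2) (at t)" "y2 t \<in> K" "v - D2 \<in> normal_cone K (y2 t)" by force
    have "(g has_real_derivative 2 * inner (y1 t - y2 t) (D1 - D2)) (at t)"
      unfolding g_def by (intro has_real_derivative_power2_norm has_vector_derivative_diff D)
    moreover have "0 \<le> inner ((v - D1) - (v - D2)) (y1 t - y2 t)" by (rule normal_cone_monotone[OF cone D(2,5,3,6)])
    then have "2 * inner (y1 t - y2 t) (D1 - D2) \<le> 0"
      by (simp add: inner_commute inner_diff_left inner_diff_right)
    ultimately show ?case by blast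
  qed
  then obtain N where N: "N \<in> null_sets lborel" "\<And>t. 0 \<le> t \<Longrightarrow> t \<notin> N \<Longrightarrow> \<exists>D\<le>0. (g has_real_derivative D) (at t)"
    by (elim AE_E3) force
  obtain M where M: "0 < M" "\<And>t. t \<in> {0..b} \<Longrightarrow> norm (y1 t - y2 t) \<le> M"
    using abs_cont_curves_bounded[OF ac b] by blast
  have ctrl: "g t - g s \<le> 2 * M * (norm (y1 t - y1 s) + norm (y2 t - y2 s))" if "0 \<le> s" "s \<le> t" "t \<le> b" for s t
  proof -
    have "g t - g s \<le> 2 * M * norm ((y1 t - y2 t) - (y1 s - y2 s))"
      unfolding g_def using that by (intro power2_norm_diff_le M) auto
    also have "\<dots> \<le> 2 * M * (norm (y1 t - y1 s) + norm (y2 t - y2 s))"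
        using M(1) norm_triangle_ineq4[of "y1 t - y1 s" "y2 t - y2 s"]
        by (intro mult_left_mono) (auto simp: algebra_simps)
    finally show ?thesis .
  qed
  have "g b \<le> g 0"
    by (rule nonincreasing_if_abs_cont[OF _ N(1)], use b in simp, use N(2) in simp,
        rule abs_cont_curve_control[OF ac order_refl b _ ctrl]) (use M(1) in simp_all)
  then show ?thesis by (simp add: g_def init)
qed (simp add: init)

text \<open>With w = y1 - y2, monotonicity bounds t inner w w' by the square of norm w: growth like
  t, which the quotient by t squared absorbs. This quotient is controlled only away from 0; its
  limit there vanishes because both difference quotients tend to the same \<open>v\<close>.\<close>

lemma scaled_solutions_unique:
  fixes y1 y2 :: "real \<Rightarrow> 'a::{real_inner,complete_space}"
  assumes cone: "closed_cone K" and ac: "abs_cont_curve y1" "abs_cont_curve y2"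
    and sol: "\<And>y. y = y1 \<or> y = y2 \<Longrightarrow> AE t in lborel. 0 < t \<longrightarrow>
        (\<exists>D. (y has_vector_derivative D) (at t) \<and> y t \<in> K \<and> y t - x - t *\<^sub>R D \<in> normal_cone K (y t))"
    and init: "\<And>y. y = y1 \<or> y = y2 \<Longrightarrow> ((\<lambda>t. (1/t) *\<^sub>R (y t - x)) \<longlongrightarrow> v) (at_right 0)"
    and b: "0 < b"
  shows "y1 b = y2 b"
proof -
  define g where "g t = (norm (y1 t - y2 t))\<^sup>2 / t\<^sup>2" for t
  have "AE t in lborel. t \<noteq> (0::real)" by (rule AE_lborel_singleton)
  with sol[of y1] sol[of y2] have "AE t in lborel. 0 < t \<longrightarrow> (\<exists>D\<le>0. (g has_real_derivative D) (at t))"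
  proof (simp, elim AE_mp, intro AE_I2 impI, goal_cases)
    case (1 t)
    then obtain D1 D2 where D: "(y1 has_vector_derivative D1) (at t)" "y1 t \<in> K" "y1 t - x - t *\<^sub>R D1 \<in> normal_cone K (y1 t)"
       "(y2 has_vector_derivative D2) (at t)" "y2 t \<in> K" "y2 t - x - t *\<^sub>R D2 \<in> normal_cone K (y2 t)" by force
    let ?w = "y1 t - y2 t"
    let ?D = "(2 * inner ?w (D1 - D2) * t\<^sup>2 - (norm ?w)\<^sup>2 * (2 * t)) / (t\<^sup>2 * t\<^sup>2)"
    have "((\<lambda>t. (norm (y1 t - y2 t))\<^sup>2) has_real_derivative 2 * inner ?w (D1 - D2)) (at t)"
      by (intro has_real_derivative_power2_norm has_vector_derivative_diff D)
    moreover have "((\<lambda>t. t\<^sup>2) has_real_derivative 2 * t) (at t)" by (auto intro!: derivative_eq_intros)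
    ultimately have "(g has_real_derivative ?D) (at t)"
      unfolding g_def using 1 by (intro DERIV_divide) auto
    moreover have "0 \<le> inner ((y1 t - x - t *\<^sub>R D1) - (y2 t - x - t *\<^sub>R D2)) ?w"
      by (rule normal_cone_monotone[OF cone D(2,5,3,6)])
    then have "0 \<le> (norm ?w)\<^sup>2 - t * inner ?w (D1 - D2)"
      by (simp add: power2_norm_eq_inner inner_commute inner_diff_left inner_diff_right algebra_simps)
    then have "2 * t * (t * inner ?w (D1 - D2)) \<le> 2 * t * (norm ?w)\<^sup>2"
      using 1 by (intro mult_left_mono) auto
    then have "?D \<le> 0" using 1 by (simp add: divide_le_0_iff power2_eq_square algebra_simps)
    ultimately show ?case by blast
  qed
  then obtain N where N: "N \<in> null_sets lborel" "\<And>t. 0 < t \<Longrightarrow> t \<notin> N \<Longrightarrow> \<exists>D\<le>0. (g has_real_derivative D) (at t)"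
    by (elim AE_E3) force
  obtain M where M: "0 < M" "\<And>t. t \<in> {0..b} \<Longrightarrow> norm (y1 t - y2 t) \<le> M"
    using abs_cont_curves_bounded[OF ac b] by blast
  have mono: "g b \<le> g a" if a: "0 < a" "a \<le> b" for a
  proof -
    have ctrl: "g t - g s \<le> (2 * M / a\<^sup>2) * (norm (y1 t - y1 s) + norm (y2 t - y2 s))"
      if st: "a \<le> s" "s \<le> t" "t \<le> b" for s t
    proof -
      have s2: "a\<^sup>2 \<le> s\<^sup>2" using st a by (intro power_mono) auto
      have "g t \<le> (norm (y1 t - y2 t))\<^sup>2 / s\<^sup>2"
        unfolding g_def using st a by (intro divide_left_mono power_mono) auto
      then have "g t - g s \<le> ((norm (y1 t - y2 t))\<^sup>2 - (norm (y1 s - y2 s))\<^sup>2) / s\<^sup>2"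
        by (simp add: g_def diff_divide_distrib)
      also have "\<dots> \<le> (2 * M * norm ((y1 t - y2 t) - (y1 s - y2 s))) / s\<^sup>2"
        using st a by (intro divide_right_mono power2_norm_diff_le M) auto
      also have "\<dots> \<le> (2 * M * norm ((y1 t - y2 t) - (y1 s - y2 s))) / a\<^sup>2"
        using st a M(1) s2 by (intro divide_left_mono) auto
      also have "\<dots> = (2 * M / a\<^sup>2) * norm ((y1 t - y1 s) - (y2 t - y2 s))" by (simp add: algebra_simps)
      also have "\<dots> \<le> (2 * M / a\<^sup>2) * (norm (y1 t - y1 s) + norm (y2 t - y2 s))"
        using M(1) by (intro mult_left_mono norm_triangle_ineq4) auto
      finally show ?thesis .
    qed
    show ?thesis
      by (rule nonincreasing_if_abs_cont[OF a(2) N(1)], use a N(2) in simp,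
        rule abs_cont_curve_control[OF ac _ b _ ctrl]) (use a M(1) in simp_all)
  qed
  have "g b \<le> 0"
  proof (rule tendsto_lowerbound)
    have "((\<lambda>t. (norm ((1/t) *\<^sub>R (y1 t - x) - (1/t) *\<^sub>R (y2 t - x)))\<^sup>2) \<longlongrightarrow> (norm (v - v))\<^sup>2) (at_right 0)"
      by (intro tendsto_intros init) auto
    then show "((\<lambda>t. (norm ((1/t) *\<^sub>R (y1 t - x) - (1/t) *\<^sub>R (y2 t - x)))\<^sup>2) \<longlongrightarrow> 0) (at_right 0)" by simp
    have "g b \<le> (norm ((1/t) *\<^sub>R (y1 t - x) - (1/t) *\<^sub>R (y2 t - x)))\<^sup>2" if "0 < t" "t < b" for t
    proof -
      have "(1/t) *\<^sub>R (y1 t - x) - (1/t) *\<^sub>R (y2 t - x) = (1/t) *\<^sub>R (y1 t - y2 t)" by (simp add: scaleR_diff_right)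
      then show ?thesis using mono[of t] that by (simp add: g_def power_divide)
    qed
    then show "\<forall>\<^sub>F t in at_right 0. g b \<le> (norm ((1/t) *\<^sub>R (y1 t - x) - (1/t) *\<^sub>R (y2 t - x)))\<^sup>2"
      using b by (auto simp: eventually_at_right_field)
  qed simp
  then show ?thesis using b by (simp add: g_def divide_le_0_iff)
qed

section \<open>The Hilbert space of square integrable functions on the unit interval\<close>

lemma space_leb01 [simp]: "space leb01 = {0<..<1}"
  by (simp add: leb01_def space_restrict_space)

lemma sets_leb01: "sets leb01 = sets (restrict_space borel {0<..<1})"
  by (simp add: leb01_def sets_restrict_space)

lemma emeasure_leb01: "A \<in> sets borel \<Longrightarrow> A \<subseteq> {0<..<1} \<Longrightarrow> emeasure leb01 A = emeasure lborel A"
  by (simp add: leb01_def emeasure_restrict_space)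

lemma prob_space_leb01: "prob_space leb01"
proof
  have "emeasure leb01 (space leb01) = emeasure lborel {0<..<1::real}"
    by (simp add: emeasure_leb01)
  then show "emeasure leb01 (space leb01) = 1" by simp
qed

interpretation leb01: prob_space leb01 by (rule prob_space_leb01)

lemma borel_measurable_leb01: "f \<in> borel_measurable borel \<Longrightarrow> f \<in> borel_measurable leb01"
  by (simp add: leb01_def measurable_restrict_space1)

lemma mono_on_measurable_leb01: "mono_on {0<..<1} (f :: real \<Rightarrow> real) \<Longrightarrow> f \<in> borel_measurable leb01"
  by (subst measurable_cong_sets[OF sets_leb01 refl]) (rule borel_measurable_mono_on_fnc)

lemma L2_iff: "f \<in> L2 \<longleftrightarrow> f \<in> borel_measurable leb01 \<and> integrable leb01 (\<lambda>w. (f w)\<^sup>2)"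
  by (simp add: Lp_def)

lemma L2_measurable: "f \<in> L2 \<Longrightarrow> f \<in> borel_measurable leb01"
  by (simp add: L2_iff)

lemma L2_mult_integrable:
  assumes "f \<in> L2" "g \<in> L2" shows "integrable leb01 (\<lambda>w. f w * g w)"
proof (rule Bochner_Integration.integrable_bound)
  show "integrable leb01 (\<lambda>w. (f w)\<^sup>2 + (g w)\<^sup>2)" using assms by (simp add: L2_iff)
  have "\<bar>a * b\<bar> \<le> \<bar>a\<^sup>2 + b\<^sup>2\<bar>" for a b :: real
  proof -
    have "2 * (\<bar>a\<bar> * \<bar>b\<bar>) \<le> a\<^sup>2 + b\<^sup>2" using sum_squares_bound[of "\<bar>a\<bar>" "\<bar>b\<bar>"] by (simp add: mult.assoc)
    moreover have "0 \<le> \<bar>a\<bar> * \<bar>b\<bar>" by simp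
    ultimately have "\<bar>a\<bar> * \<bar>b\<bar> \<le> a\<^sup>2 + b\<^sup>2" by linarith
    then show ?thesis by (simp add: abs_mult)
  qed
  then show "AE w in leb01. norm (f w * g w) \<le> norm ((f w)\<^sup>2 + (g w)\<^sup>2)" by simp
qed (use assms L2_measurable in measurable)

lemma L2_bound:
  assumes "f \<in> borel_measurable leb01" "g \<in> L2" "AE w in leb01. \<bar>f w\<bar> \<le> \<bar>g w\<bar>"
  shows "f \<in> L2"
proof -
  have "integrable leb01 (\<lambda>w. (f w)\<^sup>2)"
    by (rule Bochner_Integration.integrable_bound[of _ "\<lambda>w. (g w)\<^sup>2"])
      (use assms in \<open>auto simp: L2_iff abs_le_square_iff\<close>)
  then show ?thesis using assms by (simp add: L2_iff)
qed

lemma L2_const: "(\<lambda>_. c) \<in> L2" by (simp add: L2_iff)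

lemma L2_add: "f \<in> L2 \<Longrightarrow> g \<in> L2 \<Longrightarrow> (\<lambda>w. f w + g w) \<in> L2"
  using L2_mult_integrable[of f g] by (auto simp: L2_iff power2_sum mult.assoc)

lemma L2_cmult: "f \<in> L2 \<Longrightarrow> (\<lambda>w. c * f w) \<in> L2"
  by (auto simp: L2_iff power_mult_distrib)

lemma L2_uminus: "f \<in> L2 \<Longrightarrow> (\<lambda>w. - f w) \<in> L2"
  using L2_cmult[of f "-1"] by simp

lemma L2_diff: "f \<in> L2 \<Longrightarrow> g \<in> L2 \<Longrightarrow> (\<lambda>w. f w - g w) \<in> L2"
  using L2_add[OF _ L2_uminus, of f g] by simp

lemma L2_divide: "f \<in> L2 \<Longrightarrow> (\<lambda>w. f w / c) \<in> L2"
  using L2_cmult[of f "1/c"] by simp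

lemma L2_integrable: "f \<in> L2 \<Longrightarrow> integrable leb01 f"
  using L2_mult_integrable[OF _ L2_const[of 1]] by simp

lemma L2_bounded: "f \<in> borel_measurable leb01 \<Longrightarrow> (\<And>w. \<bar>f w\<bar> \<le> c) \<Longrightarrow> f \<in> L2"
  by (rule L2_bound[OF _ L2_const[of c]]) (auto intro!: AE_I2 order_trans[OF _ abs_ge_self])

lemma L2_cong_AE: "f \<in> L2 \<Longrightarrow> g \<in> borel_measurable leb01 \<Longrightarrow> ae_eq f g \<Longrightarrow> g \<in> L2"
  by (rule L2_bound) (auto simp: ae_eq_def)

lemma ae_eq_refl [simp]: "ae_eq f f" by (simp add: ae_eq_def)
lemma ae_eq_sym: "ae_eq f g \<Longrightarrow> ae_eq g f" by (auto simp: ae_eq_def)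
lemma ae_eq_trans [trans]: "ae_eq f g \<Longrightarrow> ae_eq g h \<Longrightarrow> ae_eq f h" by (auto simp: ae_eq_def)

\<comment> \<open>Classes of functions become a type so that the abstract results, stated for types
  of class \<open>complete_space\<close>, apply to them. The quotient is partial: functions outside
  \<open>L2\<close> represent nothing.\<close>
quotient_type l2 = "real \<Rightarrow> real" / partial: "\<lambda>f g. f \<in> L2 \<and> g \<in> L2 \<and> ae_eq f g"
  morphisms rep_l2 cls
proof (rule part_equivpI)
  show "\<exists>x. x \<in> L2 \<and> x \<in> L2 \<and> ae_eq x x" using L2_const[of 0] by auto
qed (auto intro!: sympI transpI intro: ae_eq_sym ae_eq_trans)

lemma rep_l2_in [simp]: "rep_l2 u \<in> L2"
  using Quotient3_rep_reflp[OF Quotient3_l2] by blast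

lemma cls_rep [simp]: "cls (rep_l2 u) = u"
  using Quotient3_abs_rep[OF Quotient3_l2] .

lemma cls_eq_iff: "f \<in> L2 \<Longrightarrow> g \<in> L2 \<Longrightarrow> cls f = cls g \<longleftrightarrow> ae_eq f g"
  using Quotient3_rel[OF Quotient3_l2, of f g] by auto

lemma rep_cls: "f \<in> L2 \<Longrightarrow> ae_eq (rep_l2 (cls f)) f"
  using cls_eq_iff[of "rep_l2 (cls f)" f] by simp

instantiation l2 :: real_inner
begin

lift_definition zero_l2 :: l2 is "\<lambda>_. 0" by (simp add: L2_const)
lift_definition plus_l2 :: "l2 \<Rightarrow> l2 \<Rightarrow> l2" is "\<lambda>f g w. f w + g w"
  by (auto simp: ae_eq_def intro!: L2_add)
lift_definition minus_l2 :: "l2 \<Rightarrow> l2 \<Rightarrow> l2" is "\<lambda>f g w. f w - g w"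
  by (auto simp: ae_eq_def intro!: L2_diff)
lift_definition uminus_l2 :: "l2 \<Rightarrow> l2" is "\<lambda>f w. - f w"
  by (auto simp: ae_eq_def intro!: L2_uminus)
lift_definition scaleR_l2 :: "real \<Rightarrow> l2 \<Rightarrow> l2" is "\<lambda>c f w. c * f w"
  by (auto simp: ae_eq_def intro!: L2_cmult)
lift_definition inner_l2 :: "l2 \<Rightarrow> l2 \<Rightarrow> real" is "\<lambda>f g. \<integral>w. f w * g w \<partial>leb01"
proof (rule integral_cong_AE)
  fix f1 f2 g1 g2 assume fg: "f1 \<in> L2 \<and> f2 \<in> L2 \<and> ae_eq f1 f2" "g1 \<in> L2 \<and> g2 \<in> L2 \<and> ae_eq g1 g2"
  then have [measurable]: "f1 \<in> borel_measurable leb01" "f2 \<in> borel_measurable leb01"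
      "g1 \<in> borel_measurable leb01" "g2 \<in> borel_measurable leb01" by (auto intro: L2_measurable)
  show "(\<lambda>w. f1 w * g1 w) \<in> borel_measurable leb01" "(\<lambda>w. f2 w * g2 w) \<in> borel_measurable leb01"
    by measurable
  show "AE w in leb01. f1 w * g1 w = f2 w * g2 w"
    using fg by (auto simp: ae_eq_def elim: eventually_elim2)
qed
definition norm_l2 :: "l2 \<Rightarrow> real" where "norm_l2 u = sqrt (inner u u)"
definition dist_l2 :: "l2 \<Rightarrow> l2 \<Rightarrow> real" where "dist_l2 u v = norm (u - v)"
definition sgn_l2 :: "l2 \<Rightarrow> l2" where "sgn_l2 u = inverse (norm u) *\<^sub>R u"
definition uniformity_l2 :: "(l2 \<times> l2) filter"
  where "uniformity_l2 = (INF e\<in>{0 <..}. principal {(x, y). dist x y < e})"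
definition open_l2 :: "l2 set \<Rightarrow> bool"
  where "open_l2 U = (\<forall>x\<in>U. \<forall>\<^sub>F (x', y) in uniformity. x' = x \<longrightarrow> y \<in> U)"

instance
proof
  fix a b c :: l2 and r s :: real
  show "a + b + c = a + (b + c)" by transfer (auto intro!: L2_add simp: add.assoc)
  show "a + b = b + a" by transfer (auto intro!: L2_add simp: add.commute)
  show "0 + a = a" by transfer simp
  show "- a + a = 0" by transfer (simp add: L2_const)
  show "a - b = a + - b" by transfer (auto intro!: L2_diff)
  show "r *\<^sub>R (a + b) = r *\<^sub>R a + r *\<^sub>R b" by transfer (auto intro!: L2_add L2_cmult simp: distrib_left)
  show "(r + s) *\<^sub>R a = r *\<^sub>R a + s *\<^sub>R a" by transfer (auto intro!: L2_add L2_cmult simp: distrib_right)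
  show "r *\<^sub>R s *\<^sub>R a = (r * s) *\<^sub>R a" by transfer (auto intro!: L2_cmult simp: mult.assoc)
  show "1 *\<^sub>R a = a" by transfer simp
  show "dist a b = norm (a - b)" by (rule dist_l2_def)
  show "sgn a = inverse (norm a) *\<^sub>R a" by (rule sgn_l2_def)
  show "uniformity = (INF e\<in>{0 <..}. principal {(x, y :: l2). dist x y < e})" by (rule uniformity_l2_def)
  show "open U = (\<forall>x\<in>U. \<forall>\<^sub>F (x', y) in uniformity. x' = x \<longrightarrow> y \<in> U)" for U :: "l2 set" by (rule open_l2_def)
  show "norm a = sqrt (inner a a)" by (rule norm_l2_def)
  show "inner a b = inner b a" by transfer (simp add: mult.commute)
  show "inner (a + b) c = inner a c + inner b c"
  proof transfer
    fix f g h assume "f \<in> L2 \<and> f \<in> L2 \<and> ae_eq f f" "g \<in> L2 \<and> g \<in> L2 \<and> ae_eq g g" "h \<in> L2 \<and> h \<in> L2 \<and> ae_eq h h"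
    then show "(\<integral>w. (f w + g w) * h w \<partial>leb01) = (\<integral>w. f w * h w \<partial>leb01) + (\<integral>w. g w * h w \<partial>leb01)"
      by (simp add: distrib_right L2_mult_integrable)
  qed
  show "inner (r *\<^sub>R a) b = r * inner a b" by transfer (simp add: mult.assoc)
  show "0 \<le> inner a a" by transfer simp
  show "inner a a = 0 \<longleftrightarrow> a = 0"
  proof transfer
    fix f assume f: "f \<in> L2 \<and> f \<in> L2 \<and> ae_eq f f"
    have "integrable leb01 (\<lambda>w. f w * f w)" using f by (simp add: L2_mult_integrable)
    then have "(\<integral>w. f w * f w \<partial>leb01) = 0 \<longleftrightarrow> (AE w in leb01. f w * f w = 0)"
      by (intro integral_nonneg_eq_0_iff_AE) auto
    then show "((\<integral>w. f w * f w \<partial>leb01) = 0) = (f \<in> L2 \<and> (\<lambda>_. 0) \<in> L2 \<and> ae_eq f (\<lambda>_. 0))"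
      using f by (auto simp: ae_eq_def L2_const)
  qed
qed

end

lemma cls_add: "f \<in> L2 \<Longrightarrow> g \<in> L2 \<Longrightarrow> cls f + cls g = cls (\<lambda>w. f w + g w)"
  by (rule plus_l2.abs_eq) auto
lemma cls_diff: "f \<in> L2 \<Longrightarrow> g \<in> L2 \<Longrightarrow> cls f - cls g = cls (\<lambda>w. f w - g w)"
  by (rule minus_l2.abs_eq) auto
lemma cls_scaleR: "f \<in> L2 \<Longrightarrow> c *\<^sub>R cls f = cls (\<lambda>w. c * f w)"
  by (rule scaleR_l2.abs_eq) auto
lemma cls_zero: "0 = cls (\<lambda>_. 0)"
  by (rule zero_l2.abs_eq)
lemma inner_cls: "f \<in> L2 \<Longrightarrow> g \<in> L2 \<Longrightarrow> inner (cls f) (cls g) = (\<integral>w. f w * g w \<partial>leb01)"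
  by (rule inner_l2.abs_eq) auto

lemma power2_norm_cls: "f \<in> L2 \<Longrightarrow> (norm (cls f))\<^sup>2 = (\<integral>w. (f w)\<^sup>2 \<partial>leb01)"
  unfolding power2_norm_eq_inner by (simp add: inner_cls power2_eq_square)

lemma L2_norm_cls: "f \<in> L2 \<Longrightarrow> Lp_norm 2 leb01 f = norm (cls f)"
  using power2_norm_cls[of f] by (simp add: Lp_norm_def powr_half_sqrt real_sqrt_unique)

lemma L2_dist_cls: "f \<in> L2 \<Longrightarrow> g \<in> L2 \<Longrightarrow> L2_dist f g = norm (cls f - cls g)"
  by (simp add: L2_norm_cls L2_diff cls_diff)

lemma integral_abs_le_norm:
  assumes "f \<in> L2" shows "(\<integral>w. \<bar>f w\<bar> \<partial>leb01) \<le> norm (cls f)"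
proof -
  have a: "(\<lambda>w. \<bar>f w\<bar>) \<in> L2" by (rule L2_bound[OF _ assms]) (use L2_measurable[OF assms] in auto)
  have "(\<integral>w. \<bar>f w\<bar> \<partial>leb01) = inner (cls (\<lambda>w. \<bar>f w\<bar>)) (cls (\<lambda>_. 1))" using a by (simp add: inner_cls L2_const)
  also have "\<dots> \<le> norm (cls (\<lambda>w. \<bar>f w\<bar>)) * norm (cls (\<lambda>_. 1))" by (rule norm_cauchy_schwarz)
  also have "norm (cls (\<lambda>_. 1)) = 1"
    using power2_norm_cls[OF L2_const[of 1]] leb01.prob_space by (simp add: power2_eq_1_iff) (metis norm_ge_zero neg_0_le_iff_le not_one_le_zero)
  also have "norm (cls (\<lambda>w. \<bar>f w\<bar>)) = norm (cls f)"
    by (rule power2_eq_imp_eq) (simp_all add: power2_norm_cls[OF a] power2_norm_cls[OF assms])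
  finally show ?thesis by simp
qed

text \<open>On a probability space the L^1 norm is bounded by the L^2 norm, so the increments are
  summable in L^1 and the telescoping series converges absolutely almost everywhere.\<close>

lemma fast_cauchy_AE_limit:
  fixes f :: "nat \<Rightarrow> real \<Rightarrow> real"
  assumes f: "\<And>n. f n \<in> L2" and fast: "\<And>n. norm (cls (f (Suc n)) - cls (f n)) \<le> (1/2)^n"
  shows "\<exists>g\<in>borel_measurable leb01. AE w in leb01. (\<lambda>n. f n w) \<longlonglongrightarrow> g w"
proof -
  note [measurable] = L2_measurable[OF f]
  let ?d = "\<lambda>n w. \<bar>f (Suc n) w - f n w\<bar>"
  have le: "(\<integral>\<^sup>+ w. ?d n w \<partial>leb01) \<le> ennreal ((1/2)^n)" for n
  proof -
    have d: "(\<lambda>w. f (Suc n) w - f n w) \<in> L2" by (intro L2_diff f)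
    have "(\<integral>\<^sup>+ w. ?d n w \<partial>leb01) = ennreal (\<integral>w. ?d n w \<partial>leb01)"
      using L2_integrable[OF d] by (intro nn_integral_eq_integral) auto
    also have "\<dots> \<le> ennreal ((1/2)^n)"
      using integral_abs_le_norm[OF d] fast[of n] by (intro ennreal_leI) (simp add: cls_diff f)
    finally show ?thesis .
  qed
  have "(\<integral>\<^sup>+ w. (\<Sum>n. ennreal (?d n w)) \<partial>leb01) = (\<Sum>n. \<integral>\<^sup>+ w. ?d n w \<partial>leb01)"
    by (intro nn_integral_suminf) measurable
  also have "\<dots> \<le> (\<Sum>n. ennreal ((1/2)^n))" by (intro suminf_le le) auto
  also have "\<dots> = ennreal (\<Sum>n. (1/2)^n)" by (intro suminf_ennreal2) auto
  also have "\<dots> < \<infinity>" by simp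
  finally have "AE w in leb01. (\<Sum>n. ennreal (?d n w)) \<noteq> \<infinity>"
    by (intro nn_integral_noteq_infinite) (auto simp: less_top)
  then have conv: "AE w in leb01. convergent (\<lambda>n. f n w)"
  proof eventually_elim
    fix w assume "(\<Sum>n. ennreal (?d n w)) \<noteq> \<infinity>"
    then have "summable (\<lambda>n. ?d n w)" by (intro summable_suminf_not_top) auto
    then have "summable (\<lambda>n. f (Suc n) w - f n w)" by (rule summable_rabs_cancel)
    then have "convergent (\<lambda>n. \<Sum>i<n. f (Suc i) w - f i w)" by (simp add: summable_iff_convergent)
    then have "convergent (\<lambda>n. f n w - f 0 w)" by (subst (asm) sum_lessThan_telescope)
    then show "convergent (\<lambda>n. f n w)" by (simp add: convergent_diff_const_right_iff)
  qed
  show ?thesis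
  proof (rule bexI[of _ "\<lambda>w. lim (\<lambda>n. f n w)"])
    show "AE w in leb01. (\<lambda>n. f n w) \<longlonglongrightarrow> lim (\<lambda>n. f n w)"
      using conv by eventually_elim (simp add: convergent_LIMSEQ_iff)
  qed measurable
qed

text \<open>Fatou in the second index of the Cauchy differences: g - f n is square integrable, with
  norm at most the Cauchy bound.\<close>

lemma L2_limit_of_AE_limit:
  fixes f :: "nat \<Rightarrow> real \<Rightarrow> real"
  assumes f: "\<And>n. f n \<in> L2" and [measurable]: "g \<in> borel_measurable leb01"
    and lim: "AE w in leb01. (\<lambda>n. f n w) \<longlonglongrightarrow> g w"
    and cauchy: "Cauchy (\<lambda>n. cls (f n))"
  shows "g \<in> L2" "(\<lambda>n. cls (f n)) \<longlonglongrightarrow> cls g"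
proof -
  note [measurable] = L2_measurable[OF f]
  have fatou: "(\<integral>\<^sup>+ w. ennreal ((g w - f n w)\<^sup>2) \<partial>leb01) \<le> ennreal (e\<^sup>2)"
    if e: "\<And>m. m \<ge> n \<Longrightarrow> norm (cls (f m) - cls (f n)) \<le> e" for n e
  proof -
    have "0 \<le> e" using e[of n] by simp
    have "(\<integral>\<^sup>+ w. ennreal ((g w - f n w)\<^sup>2) \<partial>leb01) = (\<integral>\<^sup>+ w. liminf (\<lambda>m. ennreal ((f m w - f n w)\<^sup>2)) \<partial>leb01)"
    proof (rule nn_integral_cong_AE, use lim in eventually_elim)
      fix w assume "(\<lambda>m. f m w) \<longlonglongrightarrow> g w"
      then have "(\<lambda>m. ennreal ((f m w - f n w)\<^sup>2)) \<longlonglongrightarrow> ennreal ((g w - f n w)\<^sup>2)"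
        by (intro tendsto_ennrealI tendsto_intros)
      then show "ennreal ((g w - f n w)\<^sup>2) = liminf (\<lambda>m. ennreal ((f m w - f n w)\<^sup>2))"
        by (intro lim_imp_Liminf[symmetric]) auto
    qed
    also have "\<dots> \<le> liminf (\<lambda>m. \<integral>\<^sup>+ w. ennreal ((f m w - f n w)\<^sup>2) \<partial>leb01)"
      by (intro nn_integral_liminf) measurable
    also have "\<dots> \<le> ennreal (e\<^sup>2)"
    proof (rule order_trans[OF Liminf_le_Limsup Limsup_bounded], simp, rule eventually_sequentiallyI[of n])
      fix m assume m: "n \<le> m"
      have d: "(\<lambda>w. f m w - f n w) \<in> L2" by (intro L2_diff f)
      have "(\<integral>\<^sup>+ w. ennreal ((f m w - f n w)\<^sup>2) \<partial>leb01) = ennreal (\<integral>w. (f m w - f n w)\<^sup>2 \<partial>leb01)"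
        using d by (intro nn_integral_eq_integral) (auto simp: L2_iff)
      also have "\<dots> = ennreal ((norm (cls (f m) - cls (f n)))\<^sup>2)"
        using power2_norm_cls[OF d] by (simp add: cls_diff f)
      also have "\<dots> \<le> ennreal (e\<^sup>2)" using e[OF m] by (intro ennreal_leI power_mono) auto
      finally show "(\<integral>\<^sup>+ w. ennreal ((f m w - f n w)\<^sup>2) \<partial>leb01) \<le> ennreal (e\<^sup>2)" .
    qed
    finally show ?thesis .
  qed
  have diff: "(\<lambda>w. g w - f n w) \<in> L2" if e: "\<And>m. m \<ge> n \<Longrightarrow> norm (cls (f m) - cls (f n)) \<le> e" for n e
    using fatou[OF e] by (auto simp: L2_iff integrable_iff_bounded intro: le_less_trans)
  obtain M where M: "\<And>m. m \<ge> M \<Longrightarrow> norm (cls (f m) - cls (f M)) \<le> 1"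
    using metric_CauchyD[OF cauchy zero_less_one] by (force simp: dist_norm intro: less_imp_le)
  have "(\<lambda>w. (g w - f M w) + f M w) \<in> L2" by (intro L2_add diff[OF M] f)
  then show g: "g \<in> L2" by simp
  show "(\<lambda>n. cls (f n)) \<longlonglongrightarrow> cls g"
  proof (rule metric_LIMSEQ_I)
    fix e :: real assume e: "0 < e"
    obtain N where N: "\<And>m n. m \<ge> N \<Longrightarrow> n \<ge> N \<Longrightarrow> norm (cls (f m) - cls (f n)) \<le> e / 2"
      using metric_CauchyD[OF cauchy, of "e / 2"] e by (force simp: dist_norm intro: less_imp_le)
    have "dist (cls (f n)) (cls g) < e" if n: "N \<le> n" for n
    proof -
      have d: "(\<lambda>w. g w - f n w) \<in> L2" by (intro L2_diff g f)
      have "ennreal ((norm (cls g - cls (f n)))\<^sup>2) = (\<integral>\<^sup>+ w. ennreal ((g w - f n w)\<^sup>2) \<partial>leb01)"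
        unfolding cls_diff[OF g f] using power2_norm_cls[OF d] d by (subst nn_integral_eq_integral) (auto simp: L2_iff)
      also have "\<dots> \<le> ennreal ((e/2)\<^sup>2)" using N n by (intro fatou) auto
      finally have "(norm (cls g - cls (f n)))\<^sup>2 \<le> (e/2)\<^sup>2" by simp
      then have "norm (cls g - cls (f n)) \<le> e/2" by (rule power2_le_imp_le) (use e in simp)
      then show ?thesis using e by (simp add: dist_norm norm_minus_commute)
    qed
    then show "\<exists>no. \<forall>n\<ge>no. dist (cls (f n)) (cls g) < e" by blast
  qed
qed

lemma Cauchy_fast_subseq:
  fixes u :: "nat \<Rightarrow> 'a::real_normed_vector"
  assumes "Cauchy u"
  shows "\<exists>r. strict_mono r \<and> (\<forall>n. norm (u (r (Suc n)) - u (r n)) \<le> (1/2)^n)"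
proof -
  obtain M where M: "\<And>n i j. i \<ge> M n \<Longrightarrow> j \<ge> M n \<Longrightarrow> dist (u i) (u j) < (1/2)^n"
  proof -
    have "\<forall>n. \<exists>M. \<forall>i\<ge>M. \<forall>j\<ge>M. dist (u i) (u j) < (1/2)^n"
      using metric_CauchyD[OF assms] by simp
    from choice[OF this] show ?thesis using that by blast
  qed
  have "\<exists>r. \<forall>n. M n \<le> r n \<and> r n < r (Suc n)"
  proof (rule dependent_nat_choice)
    show "\<exists>x. M 0 \<le> x" by blast
    show "\<exists>y. M (Suc n) \<le> y \<and> x < y" for x n by (rule exI[of _ "max (M (Suc n)) (Suc x)"]) auto
  qed
  then obtain r where r: "\<And>n. M n \<le> r n" "\<And>n. r n < r (Suc n)" by blast
  have "norm (u (r (Suc n)) - u (r n)) \<le> (1/2)^n" for n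
    using M[of n "r (Suc n)" "r n"] r(1)[of n] r(2)[of n] by (simp add: dist_norm)
  then show ?thesis using r(2) strict_mono_Suc_iff by blast
qed

instance l2 :: complete_space
proof
  fix u :: "nat \<Rightarrow> l2" assume u: "Cauchy u"
  obtain r where r: "strict_mono r" "\<And>n. norm (u (r (Suc n)) - u (r n)) \<le> (1/2)^n"
    using Cauchy_fast_subseq[OF u] by blast
  let ?f = "\<lambda>n. rep_l2 (u (r n))"
  obtain g where g: "g \<in> borel_measurable leb01" "AE w in leb01. (\<lambda>n. ?f n w) \<longlonglongrightarrow> g w"
    using fast_cauchy_AE_limit[of ?f] r(2) by auto
  have "Cauchy (\<lambda>n. cls (?f n))" using Cauchy_subseq_Cauchy[OF u r(1)] by (simp add: o_def)
  from L2_limit_of_AE_limit(2)[OF _ g this] have "(u \<circ> r) \<longlonglongrightarrow> cls g" by (simp add: o_def)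
  then have "u \<longlonglongrightarrow> cls g" by (rule Cauchy_converges_subseq[OF u r(1), unfolded o_def[symmetric]])
  then show "convergent u" by (auto simp: convergent_def)
qed

lemma l2_convergent_AE_subseq:
  assumes "u \<longlonglongrightarrow> x"
  shows "\<exists>r. strict_mono r \<and> (AE w in leb01. (\<lambda>n. rep_l2 (u (r n)) w) \<longlonglongrightarrow> rep_l2 x w)"
proof -
  have u: "Cauchy u" using assms by (rule LIMSEQ_imp_Cauchy)
  obtain r where r: "strict_mono r" "\<And>n. norm (u (r (Suc n)) - u (r n)) \<le> (1/2)^n"
    using Cauchy_fast_subseq[OF u] by blast
  let ?f = "\<lambda>n. rep_l2 (u (r n))"
  obtain g where g: "g \<in> borel_measurable leb01" "AE w in leb01. (\<lambda>n. ?f n w) \<longlonglongrightarrow> g w"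
    using fast_cauchy_AE_limit[of ?f] r(2) by auto
  have "Cauchy (\<lambda>n. cls (?f n))" using Cauchy_subseq_Cauchy[OF u r(1)] by (simp add: o_def)
  note l = L2_limit_of_AE_limit[OF _ g this]
  have "(\<lambda>n. u (r n)) \<longlonglongrightarrow> x" using LIMSEQ_subseq_LIMSEQ[OF assms r(1)] by (simp add: o_def)
  then have "cls g = x" using l(2) by (simp add: LIMSEQ_unique)
  then have "ae_eq (rep_l2 x) g" using rep_cls[OF l(1)] by auto
  with g(2) have "AE w in leb01. (\<lambda>n. ?f n w) \<longlonglongrightarrow> rep_l2 x w"
    unfolding ae_eq_def by eventually_elim simp
  then show ?thesis using r(1) by blast
qed

section \<open>The cone of nondecreasing functions\<close>

definition K2 :: "l2 set" where "K2 = cls ` cone_K"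

text \<open>The square integrable functions measurable with respect to the sigma-algebra generated
  by \<open>x\<close>, expressed by a Borel factor. Changing the representative of \<open>x\<close>
  on a null set does not change the set.\<close>

definition H2 :: "l2 \<Rightarrow> l2 set" where
  "H2 x = {u. \<exists>v\<in>borel_measurable borel. ae_eq (rep_l2 u) (v \<circ> rep_l2 x)}"

lemma cone_K_L2: "X \<in> cone_K \<Longrightarrow> X \<in> L2" by (simp add: cone_K_def)

lemma cls_in_K2: "f \<in> L2 \<Longrightarrow> mono_on {0<..<1} f \<Longrightarrow> cls f \<in> K2"
  unfolding K2_def cone_K_def by (intro imageI) (auto intro: exI[of _ f])

lemma K2_E:
  assumes "u \<in> K2"
  obtains Z where "mono_on {0<..<1} Z" "Z \<in> L2" "u = cls Z" "ae_eq (rep_l2 u) Z"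
proof -
  obtain X Z where X: "X \<in> L2" "u = cls X" "mono_on {0<..<1} Z" "ae_eq X Z"
    using assms by (auto simp: K2_def cone_K_def)
  have Z: "Z \<in> L2" using L2_cong_AE[OF X(1) mono_on_measurable_leb01[OF X(3)] X(4)] .
  then have "u = cls Z" using X cls_eq_iff by auto
  with that[OF X(3) Z] rep_cls[OF Z] show ?thesis by simp
qed

lemma cls_K2_iff: "f \<in> L2 \<Longrightarrow> cls f \<in> K2 \<longleftrightarrow> f \<in> cone_K"
proof
  assume f: "f \<in> L2" and "cls f \<in> K2"
  then obtain Z where "mono_on {0<..<1} Z" "Z \<in> L2" "cls f = cls Z" by (elim K2_E)
  then show "f \<in> cone_K" using f by (auto simp: cone_K_def cls_eq_iff)
qed (auto simp: K2_def)

lemma AE_leb01_ex: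
  assumes "AE w in leb01. P w" "0 \<le> a" "a < b" "b \<le> 1"
  shows "\<exists>w. a < w \<and> w < b \<and> P w"
proof (rule ccontr)
  assume no: "\<not> ?thesis"
  have "AE w in leb01. w \<notin> {a<..<b}" using assms(1) by eventually_elim (use no in auto)
  moreover have eq: "{w \<in> space leb01. \<not> w \<notin> {a<..<b}} = {a<..<b}" using assms by auto
  moreover have "{a<..<b} \<in> sets leb01" using assms by (auto simp: sets_leb01 sets_restrict_space_iff)
  ultimately have "emeasure leb01 {a<..<b} = 0" using AE_iff_null[of leb01 "\<lambda>w. w \<notin> {a<..<b}"] by auto
  moreover have "emeasure leb01 {a<..<b} = ennreal (b - a)" using assms by (subst emeasure_leb01) auto
  ultimately show False using assms by simp
qed

text \<open>The extension is a supremum over the points of \<open>S\<close> to the left. Full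
  measure puts points of \<open>S\<close> on both sides of every w, which makes the supremum range
  over a nonempty bounded set.\<close>

lemma ae_mono_extension:
  assumes S: "AE w in leb01. w \<in> S" and mono: "\<And>w w'. w \<in> S \<Longrightarrow> w' \<in> S \<Longrightarrow> 0 < w \<Longrightarrow> w \<le> w' \<Longrightarrow> w' < 1 \<Longrightarrow> f w \<le> f w'"
  shows "\<exists>Z. mono_on {0<..<1} Z \<and> ae_eq f Z"
proof -
  define A where "A w = {w' \<in> S. 0 < w' \<and> w' \<le> w}" for w
  define Z where "Z w = Sup (f ` A w)" for w :: real
  have ne: "A w \<noteq> {}" if "0 < w" "w < 1" for w
    using AE_leb01_ex[OF S, of 0 w] that by (auto simp: A_def intro: less_imp_le)
  have bdd: "bdd_above (f ` A w)" if w: "0 < w" "w < 1" for w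
  proof -
    obtain w1 where "w < w1" "w1 < 1" "w1 \<in> S" using AE_leb01_ex[OF S, of w 1] w by auto
    then show ?thesis by (intro bdd_aboveI[of _ "f w1"]) (auto simp: A_def intro!: mono)
  qed
  have "mono_on {0<..<1} Z"
    unfolding Z_def by (intro mono_onI cSup_subset_mono bdd image_mono) (auto simp: ne, auto simp: A_def)
  moreover have "ae_eq f Z"
    unfolding ae_eq_def using S AE_space
  proof eventually_elim
    fix w assume w: "w \<in> S" "w \<in> space leb01"
    show "f w = Z w"
      unfolding Z_def
      by (rule cSup_eq_maximum[symmetric]) (use w in \<open>auto simp: A_def intro: mono\<close>)
  qed
  ultimately show ?thesis by blast
qed

lemma K2_closed_cone: "closed_cone K2"
  unfolding closed_cone_def
proof (intro conjI ballI allI impI)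
  show "closed K2"
    unfolding closed_sequential_limits
  proof (intro allI impI, elim conjE)
    fix u x assume u: "\<forall>n. u n \<in> K2" and lim: "u \<longlonglongrightarrow> x"
    have "\<forall>n. \<exists>Z. mono_on {0<..<1} Z \<and> ae_eq (rep_l2 (u n)) Z" using u by (metis K2_E)
    from choice[OF this] obtain Z where Z: "\<And>n. mono_on {0<..<1} (Z n)" "\<And>n. ae_eq (rep_l2 (u n)) (Z n)" by blast
    obtain r where r: "strict_mono r" "AE w in leb01. (\<lambda>n. rep_l2 (u (r n)) w) \<longlonglongrightarrow> rep_l2 x w"
      using l2_convergent_AE_subseq[OF lim] by blast
    \<comment> \<open>The order of two values passes to the limit where the monotone representatives
      converge, a set of full measure; \<open>ae_mono_extension\<close> does the rest.\<close>
    let ?S = "{w. (\<lambda>n. Z (r n) w) \<longlonglongrightarrow> rep_l2 x w}"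
    have "AE w in leb01. \<forall>n. rep_l2 (u (r n)) w = Z (r n) w"
      using Z(2) by (subst AE_all_countable) (auto simp: ae_eq_def)
    with r(2) have S: "AE w in leb01. w \<in> ?S" by eventually_elim simp
    have "\<exists>Z. mono_on {0<..<1} Z \<and> ae_eq (rep_l2 x) Z"
    proof (rule ae_mono_extension[OF S])
      fix w w' assume w: "w \<in> ?S" "w' \<in> ?S" "0 < w" "w \<le> w'" "w' < 1"
      show "rep_l2 x w \<le> rep_l2 x w'"
      proof (rule LIMSEQ_le)
        show "(\<lambda>n. Z (r n) w) \<longlonglongrightarrow> rep_l2 x w" "(\<lambda>n. Z (r n) w') \<longlonglongrightarrow> rep_l2 x w'" using w by auto
        show "\<exists>N. \<forall>n\<ge>N. Z (r n) w \<le> Z (r n) w'" using w mono_onD[OF Z(1), of w w'] by auto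
      qed
    qed
    then have "cls (rep_l2 x) \<in> K2" by (subst cls_K2_iff) (auto simp: cone_K_def)
    then show "x \<in> K2" by simp
  qed
  show "0 \<in> K2" unfolding cls_zero by (intro cls_in_K2 L2_const) (auto intro: mono_onI)
  fix x assume "x \<in> K2"
  then obtain Z where Z: "mono_on {0<..<1} Z" "Z \<in> L2" "x = cls Z" by (rule K2_E)
  show "c *\<^sub>R x \<in> K2" if "0 \<le> c" for c
    unfolding Z(3) cls_scaleR[OF Z(2)]
    by (intro cls_in_K2 L2_cmult Z mono_onI mult_left_mono that mono_onD[OF Z(1)])
  fix y assume "y \<in> K2"
  then obtain W where W: "mono_on {0<..<1} W" "W \<in> L2" "y = cls W" by (rule K2_E)
  show "x + y \<in> K2"
    unfolding Z(3) W(3) cls_add[OF Z(2) W(2)]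
    by (intro cls_in_K2 L2_add Z W mono_onI add_mono mono_onD[OF Z(1)] mono_onD[OF W(1)])
qed

lemma H2_I: "f \<in> L2 \<Longrightarrow> v \<in> borel_measurable borel \<Longrightarrow> ae_eq f (v \<circ> rep_l2 x) \<Longrightarrow> cls f \<in> H2 x"
  unfolding H2_def using ae_eq_trans[OF rep_cls] by blast

lemma comp_rep_measurable: "v \<in> borel_measurable borel \<Longrightarrow> v \<circ> rep_l2 x \<in> borel_measurable leb01"
  using measurable_comp[OF L2_measurable[OF rep_l2_in]] .

lemma H2_comp: "v \<in> borel_measurable borel \<Longrightarrow> v \<circ> rep_l2 x \<in> L2 \<Longrightarrow> cls (v \<circ> rep_l2 x) \<in> H2 x"
  by (rule H2_I) auto

lemma H2_bounded_comp:
  assumes "v \<in> borel_measurable borel" "\<And>t. \<bar>v t\<bar> \<le> c"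
  shows "v \<circ> rep_l2 x \<in> L2" "cls (v \<circ> rep_l2 x) \<in> H2 x"
proof -
  show "v \<circ> rep_l2 x \<in> L2" by (rule L2_bounded[where c = c]) (auto intro: comp_rep_measurable assms)
  then show "cls (v \<circ> rep_l2 x) \<in> H2 x" by (intro H2_comp assms)
qed

lemma H2_self: "x \<in> H2 x" by (auto simp: H2_def intro!: bexI[of _ id])

lemma H2_mono:
  assumes "y \<in> H2 x" shows "H2 y \<subseteq> H2 x"
proof
  fix u assume "u \<in> H2 y"
  then obtain v where v: "v \<in> borel_measurable borel" "ae_eq (rep_l2 u) (v \<circ> rep_l2 y)" by (auto simp: H2_def)
  obtain w where w: "w \<in> borel_measurable borel" "ae_eq (rep_l2 y) (w \<circ> rep_l2 x)" using assms by (auto simp: H2_def)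
  have "ae_eq (rep_l2 u) ((v \<circ> w) \<circ> rep_l2 x)"
    using v(2) w(2) unfolding ae_eq_def by eventually_elim simp
  then show "u \<in> H2 x" using measurable_comp[OF w(1) v(1)] by (auto simp: H2_def)
qed

lemma H2_subspace: "subspace (H2 x)"
  unfolding subspace_def
proof (intro conjI ballI allI)
  show "0 \<in> H2 x" unfolding cls_zero by (rule H2_I[of _ "\<lambda>_. 0"]) (auto simp: L2_const ae_eq_def)
  fix u assume "u \<in> H2 x"
  then obtain v where v: "v \<in> borel_measurable borel" "ae_eq (rep_l2 u) (v \<circ> rep_l2 x)" by (auto simp: H2_def)
  show "c *\<^sub>R u \<in> H2 x" for c
  proof -
    have "cls (\<lambda>w. c * rep_l2 u w) \<in> H2 x"
      by (rule H2_I[of _ "\<lambda>t. c * v t"]) (use v in \<open>auto simp: ae_eq_def L2_cmult\<close>)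
    then show ?thesis using cls_scaleR[of "rep_l2 u" c] by simp
  qed
  fix u' assume "u' \<in> H2 x"
  then obtain v' where v': "v' \<in> borel_measurable borel" "ae_eq (rep_l2 u') (v' \<circ> rep_l2 x)" by (auto simp: H2_def)
  have "ae_eq (\<lambda>w. rep_l2 u w + rep_l2 u' w) ((\<lambda>t. v t + v' t) \<circ> rep_l2 x)"
    using v(2) v'(2) unfolding ae_eq_def by eventually_elim simp
  then have "cls (\<lambda>w. rep_l2 u w + rep_l2 u' w) \<in> H2 x"
    by (intro H2_I[of _ "\<lambda>t. v t + v' t"] L2_add borel_measurable_add v v') auto
  then show "u + u' \<in> H2 x" using cls_add[of "rep_l2 u" "rep_l2 u'"] by simp
qed

lemma H2_closed: "closed (H2 x)"
  unfolding closed_sequential_limits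
proof (intro allI impI, elim conjE)
  fix u l assume u: "\<forall>n. u n \<in> H2 x" and lim: "u \<longlonglongrightarrow> l"
  have "\<forall>n. \<exists>v. v \<in> borel_measurable borel \<and> ae_eq (rep_l2 (u n)) (v \<circ> rep_l2 x)" using u by (auto simp: H2_def)
  from choice[OF this] obtain v where v: "\<And>n. v n \<in> borel_measurable borel" "\<And>n. ae_eq (rep_l2 (u n)) (v n \<circ> rep_l2 x)"
    by blast
  obtain r where r: "strict_mono r" "AE w in leb01. (\<lambda>n. rep_l2 (u (r n)) w) \<longlonglongrightarrow> rep_l2 l w"
    using l2_convergent_AE_subseq[OF lim] by blast
  have "AE w in leb01. \<forall>n. rep_l2 (u (r n)) w = v (r n) (rep_l2 x w)"
    using v(2) by (subst AE_all_countable) (auto simp: ae_eq_def)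
  \<comment> \<open>The factor of the limit is the limit of the factors; \<open>lim\<close> is Borel
    even where they diverge, and \<open>rep_l2 x\<close> avoids such points almost
    everywhere.\<close>
  with r(2) have "ae_eq (rep_l2 l) ((\<lambda>t. lim (\<lambda>n. v (r n) t)) \<circ> rep_l2 x)"
    unfolding ae_eq_def by eventually_elim (auto dest: limI)
  moreover have "(\<lambda>t. lim (\<lambda>n. v (r n) t)) \<in> borel_measurable borel" using v(1) by measurable
  ultimately show "l \<in> H2 x" by (auto simp: H2_def)
qed

section \<open>Normal vectors integrate to zero over level sets\<close>

lemma inner_cls_rep: "f \<in> L2 \<Longrightarrow> inner u (cls f) = (\<integral>w. rep_l2 u w * f w \<partial>leb01)"
  using inner_cls[of "rep_l2 u" f] by simp

text \<open>\<open>\<theta> n\<close> is a ramp at c of slope n + 1. Hence X plus and X minus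
  \<theta> n (X) / (n + 1) are both nondecreasing, which forces equality when \<open>\<xi>\<close>
  is tested; the ramps tend to the indicator of {c<..}.\<close>

lemma normal_cone_orth_upper_level:
  assumes x: "x \<in> K2" and \<xi>: "\<xi> \<in> normal_cone K2 x"
  shows "(\<integral>w. rep_l2 \<xi> w * indicator {c<..} (rep_l2 x w) \<partial>leb01) = 0"
proof -
  obtain X where X: "mono_on {0<..<1} X" "X \<in> L2" "x = cls X" "ae_eq (rep_l2 x) X" using x by (rule K2_E)
  note [measurable] = L2_measurable[OF X(2)] L2_measurable[OF rep_l2_in]
  define \<theta> where "\<theta> n t = max 0 (min 1 (real (Suc n) * (t - c)))" for n t
  have \<theta>_bound: "\<bar>\<theta> n t\<bar> \<le> 1" for n t by (auto simp: \<theta>_def)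
  have [measurable]: "\<theta> n \<in> borel_measurable borel" for n unfolding \<theta>_def by measurable
  have \<theta>_diff: "\<theta> n s \<le> \<theta> n t \<and> \<theta> n t - \<theta> n s \<le> real (Suc n) * (t - s)" if "s \<le> t" for n s t
  proof -
    have "real (Suc n) * (s - c) \<le> real (Suc n) * (t - c)" using that by (intro mult_left_mono) auto
    moreover have "real (Suc n) * (t - s) = real (Suc n) * (t - c) - real (Suc n) * (s - c)" by (simp add: algebra_simps)
    ultimately show ?thesis unfolding \<theta>_def by linarith
  qed
  have zero: "(\<integral>w. rep_l2 \<xi> w * \<theta> n (X w) \<partial>leb01) = 0" for n
  proof -
    let ?f = "\<lambda>w. (1 / real (Suc n)) * \<theta> n (X w)"
    have f: "?f \<in> L2" by (intro L2_cmult L2_bounded[where c = 1] \<theta>_bound) measurable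
    have "cls (\<lambda>w. X w + ?f w) \<in> K2" "cls (\<lambda>w. X w - ?f w) \<in> K2"
    proof -
      have d: "?f s \<le> ?f t \<and> ?f t - ?f s \<le> X t - X s" if "s \<in> {0<..<1}" "t \<in> {0<..<1}" "s \<le> t" for s t
      proof -
        have "X s \<le> X t" using mono_onD[OF X(1)] that by blast
        then have "0 \<le> \<theta> n (X t) - \<theta> n (X s)" "(\<theta> n (X t) - \<theta> n (X s)) / real (Suc n) \<le> X t - X s"
          using \<theta>_diff[of "X s" "X t" n] by (simp_all add: divide_le_eq mult.commute)
        moreover have "?f t - ?f s = (\<theta> n (X t) - \<theta> n (X s)) / real (Suc n)" by (simp add: diff_divide_distrib)
        moreover have "0 \<le> (\<theta> n (X t) - \<theta> n (X s)) / real (Suc n)" using calculation(1) by simp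
        ultimately show ?thesis by linarith
      qed
      show "cls (\<lambda>w. X w + ?f w) \<in> K2" "cls (\<lambda>w. X w - ?f w) \<in> K2"
        using d mono_onD[OF X(1)] by (intro cls_in_K2 L2_add L2_diff f X(2) mono_onI; smt (verit))+
    qed
    then have "inner \<xi> (x + cls ?f) \<le> 0" "inner \<xi> (x - cls ?f) \<le> 0"
      unfolding X(3) cls_add[OF X(2) f] cls_diff[OF X(2) f] by (auto intro: normal_coneD(2)[OF \<xi>])
    then have "inner \<xi> (cls ?f) = 0"
      using normal_coneD(1)[OF \<xi>] by (simp add: inner_add_right inner_diff_right)
    then have "(1 / real (Suc n)) * (\<integral>w. rep_l2 \<xi> w * \<theta> n (X w) \<partial>leb01) = 0"
      by (simp only: inner_cls_rep[OF f] mult.left_commute[of _ "1 / real (Suc n)"] integral_mult_right_zero)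
    then show ?thesis by simp
  qed
  have "(\<lambda>n. \<integral>w. rep_l2 \<xi> w * \<theta> n (X w) \<partial>leb01) \<longlonglongrightarrow> (\<integral>w. rep_l2 \<xi> w * indicator {c<..} (rep_l2 x w) \<partial>leb01)"
  proof (rule integral_dominated_convergence[where w = "\<lambda>w. \<bar>rep_l2 \<xi> w\<bar>"])
    show "integrable leb01 (\<lambda>w. \<bar>rep_l2 \<xi> w\<bar>)" using L2_integrable[OF rep_l2_in] by simp
    show "AE w in leb01. norm (rep_l2 \<xi> w * \<theta> n (X w)) \<le> \<bar>rep_l2 \<xi> w\<bar>" for n
      using mult_left_mono[OF \<theta>_bound abs_ge_zero] by (simp add: abs_mult)
    show "AE w in leb01. (\<lambda>n. rep_l2 \<xi> w * \<theta> n (X w)) \<longlonglongrightarrow> rep_l2 \<xi> w * indicator {c<..} (rep_l2 x w)"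
      using X(4) unfolding ae_eq_def
    proof eventually_elim
      fix w assume w: "rep_l2 x w = X w"
      have "(\<lambda>n. \<theta> n (X w)) \<longlonglongrightarrow> indicator {c<..} (X w)"
      proof (cases "c < X w")
        case True
        obtain N where N: "1 / (X w - c) < real N" using reals_Archimedean2 by blast
        have "\<theta> n (X w) = 1" if "N \<le> n" for n
        proof -
          have "1 < real N * (X w - c)" using N True by (simp add: field_simps)
          also have "\<dots> \<le> real (Suc n) * (X w - c)" using that True by (intro mult_right_mono) auto
          finally show ?thesis by (simp add: \<theta>_def)
        qed
        then show ?thesis using True by (intro tendsto_eventually eventually_sequentiallyI[of N]) auto
      next
        case False
        then have "real (Suc n) * (X w - c) \<le> 0" for n by (intro mult_nonneg_nonpos) auto
        then have "\<theta> n (X w) = 0" for n unfolding \<theta>_def by (simp only: max_def min_def) (smt (verit))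
        then show ?thesis using False by simp
      qed
      then show "(\<lambda>n. rep_l2 \<xi> w * \<theta> n (X w)) \<longlonglongrightarrow> rep_l2 \<xi> w * indicator {c<..} (rep_l2 x w)"
        unfolding w by (intro tendsto_mult tendsto_const)
    qed
  qed measurable
  then show ?thesis by (simp add: zero LIMSEQ_const_iff)
qed

text \<open>Half-lines form an intersection-stable generator of the Borel sets, and the vanishing
  total handles complements.\<close>

lemma integral_level_sets_zero:
  fixes f X :: "'a \<Rightarrow> real"
  assumes f: "integrable M f" and [measurable]: "X \<in> borel_measurable M"
    and total: "(\<integral>w. f w \<partial>M) = 0" and level: "\<And>c. (\<integral>w. f w * indicator {c<..} (X w) \<partial>M) = 0" and B: "B \<in> sets borel"
  shows "(\<integral>w. f w * indicator B (X w) \<partial>M) = 0"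
proof -
  note [measurable] = borel_measurable_integrable[OF f]
  have int: "integrable M (\<lambda>w. f w * indicator B (X w))" if [measurable]: "B \<in> sets borel" for B
    by (rule Bochner_Integration.integrable_bound[OF f]) (auto simp: indicator_def)
  have Int: "Int_stable (range (greaterThan :: real \<Rightarrow> _))"
  proof (rule Int_stableI)
    fix A B :: "real set" assume "A \<in> range greaterThan" "B \<in> range greaterThan"
    then obtain a b where "A = {a<..}" "B = {b<..}" by blast
    then have "A \<inter> B = {max a b<..}" by auto
    then show "A \<inter> B \<in> range greaterThan" by blast
  qed
  have "range greaterThan \<subseteq> Pow (UNIV :: real set)" "B \<in> sigma_sets UNIV (range greaterThan)"
    using B by (simp_all add: borel_Ioi)
  with Int show ?thesis
  proof (induction rule: sigma_sets_induct_disjoint)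
    case (compl A)
    then have [measurable]: "A \<in> sets borel" by (simp add: borel_Ioi)
    have "(\<integral>w. f w * indicator (UNIV - A) (X w) \<partial>M) = (\<integral>w. f w - f w * indicator A (X w) \<partial>M)"
      by (intro Bochner_Integration.integral_cong) (auto simp: indicator_def)
    also have "\<dots> = 0" using compl int[of A] f by (simp add: total)
    finally show ?case .
  next
    case (union A)
    then have A: "\<And>i. A i \<in> sets borel" by (auto simp: borel_Ioi)
    then have [measurable]: "\<And>i. A i \<in> sets borel" .
    let ?A = "\<lambda>i. X -` A i \<inter> space M"
    have "(\<integral>w. f w * indicator (\<Union>i. A i) (X w) \<partial>M) = (LINT w:(\<Union>i. ?A i)|M. f w)"
      unfolding set_lebesgue_integral_def by (intro Bochner_Integration.integral_cong) (auto simp: indicator_def)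
    also have "\<dots> = (\<Sum>i. LINT w:?A i|M. f w)"
    proof (rule lebesgue_integral_countable_add)
      show "?A i \<in> sets M" for i by measurable
      show "?A i \<inter> ?A j = {}" if "i \<noteq> j" for i j using union(1) that by (auto simp: disjoint_family_on_def)
      show "set_integrable M (\<Union>i. ?A i) f"
        unfolding set_integrable_def
      proof (rule integrable_mult_indicator[OF _ f])
        show "(\<Union>i. ?A i) \<in> sets M" by measurable
      qed
    qed
    finally have sum: "(\<integral>w. f w * indicator (\<Union>i. A i) (X w) \<partial>M) = (\<Sum>i. LINT w:?A i|M. f w)" .
    have "(LINT w:?A i|M. f w) = (\<integral>w. f w * indicator (A i) (X w) \<partial>M)" for i
      unfolding set_lebesgue_integral_def by (intro Bochner_Integration.integral_cong) (auto simp: indicator_def)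
    then show ?case unfolding sum using union by simp
  qed (use level in auto)
qed

lemma normal_cone_orth_level_sets:
  assumes x: "x \<in> K2" and \<xi>: "\<xi> \<in> normal_cone K2 x" and B: "B \<in> sets borel"
  shows "(\<integral>w. rep_l2 \<xi> w * indicator B (rep_l2 x w) \<partial>leb01) = 0"
proof (rule integral_level_sets_zero[OF L2_integrable[OF rep_l2_in] L2_measurable[OF rep_l2_in] _ normal_cone_orth_upper_level[OF x \<xi>] B])
  \<comment> \<open>Constants of both signs are nondecreasing, so \<open>\<xi>\<close> has mean
    zero.\<close>
  have "cls (\<lambda>_. 1) \<in> K2" "cls (\<lambda>_. -1) \<in> K2" by (auto intro!: cls_in_K2 L2_const mono_onI)
  from this[THEN normal_coneD(2)[OF \<xi>]] show "(\<integral>w. rep_l2 \<xi> w \<partial>leb01) = 0" by (simp add: inner_cls_rep L2_const)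
qed

section \<open>Averaging over the intervals where x is constant\<close>

lemma proj_H2_mem: "proj (H2 x) y \<in> H2 x"
  by (intro proj_in closed_cone_subspace H2_subspace H2_closed)

lemma proj_H2_orth: "u \<in> H2 x \<Longrightarrow> inner (proj (H2 x) y) u = inner y u"
  using proj_subspace_orthogonal[OF H2_subspace H2_closed, of u x y] by (simp add: inner_diff_left)

lemma proj_H2_integral:
  assumes B: "B \<in> sets borel"
  shows "(\<integral>w. rep_l2 (proj (H2 x) y) w * indicator B (rep_l2 x w) \<partial>leb01)
    = (\<integral>w. rep_l2 y w * indicator B (rep_l2 x w) \<partial>leb01)"
proof -
  have "(indicator B :: real \<Rightarrow> real) \<in> borel_measurable borel" using B by measurable
  note h = H2_bounded_comp[OF this, of 1 x]
  show ?thesis using proj_H2_orth[OF h(2)] h(1) by (simp add: inner_cls_rep indicator_def)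
qed

lemma AE_zero_on_level_set:
  assumes f: "f \<in> L2" and B: "{w \<in> space leb01. P w} \<in> sets leb01" and pos: "AE w in leb01. P w \<longrightarrow> 0 < f w"
    and zero: "(\<integral>w. f w * indicator {w. P w} w \<partial>leb01) = 0"
  shows "AE w in leb01. \<not> P w"
proof -
  note [measurable] = L2_measurable[OF f]
  have m: "(\<lambda>w. f w * indicator {w. P w} w) \<in> borel_measurable leb01"
  proof (rule measurable_cong[THEN iffD1])
    show "f w * indicator {w \<in> space leb01. P w} w = f w * indicator {w. P w} w" if "w \<in> space leb01" for w
      using that by (simp add: indicator_def)
    show "(\<lambda>w. f w * indicator {w \<in> space leb01. P w} w) \<in> borel_measurable leb01"
      using B by (intro borel_measurable_times L2_measurable f borel_measurable_indicator)
  qed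
  have "integrable leb01 (\<lambda>w. f w * indicator {w. P w} w)"
    by (rule Bochner_Integration.integrable_bound[OF L2_integrable[OF f] m]) (auto simp: indicator_def)
  moreover have "AE w in leb01. 0 \<le> f w * indicator {w. P w} w"
    using pos by eventually_elim (auto simp: indicator_def)
  ultimately have "AE w in leb01. f w * indicator {w. P w} w = 0" using integral_nonneg_eq_0_iff_AE zero by blast
  with pos show ?thesis by eventually_elim (auto simp: indicator_def)
qed


text \<open>Write the average as g(X). For a level c, the supremum q of Z over X \<le> c separates
  the values of Z on X \<le> c from those on X > c. The average cannot cross q, for otherwise the
  difference of \<open>z\<close> and \<open>?e\<close> would have a strict sign on a level set over
  which its integral vanishes. Rational levels separate any two values of X.\<close>

lemma proj_H2_in_K2:
  assumes x: "x \<in> K2" and z: "z \<in> K2"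
  shows "proj (H2 x) z \<in> K2"
proof -
  let ?e = "proj (H2 x) z"
  obtain X where X: "mono_on {0<..<1} X" "X \<in> L2" "ae_eq (rep_l2 x) X" using x by (rule K2_E)
  obtain Z where Z: "mono_on {0<..<1} Z" "Z \<in> L2" "ae_eq (rep_l2 z) Z" using z by (rule K2_E)
  obtain g where g: "g \<in> borel_measurable borel" "ae_eq (rep_l2 ?e) (g \<circ> rep_l2 x)"
    using proj_H2_mem[of x z] by (auto simp: H2_def)
  note [measurable] = g(1) L2_measurable[OF rep_l2_in]
  have orth: "(\<integral>w. (rep_l2 z w - rep_l2 ?e w) * indicator B (rep_l2 x w) \<partial>leb01) = 0" if [measurable]: "B \<in> sets borel" for B
  proof -
    have "integrable leb01 (\<lambda>w. rep_l2 u w * indicator B (rep_l2 x w))" for u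
      by (rule Bochner_Integration.integrable_bound[OF L2_integrable[OF rep_l2_in[of u]]]) (auto simp: indicator_def)
    then show ?thesis using proj_H2_integral[OF that, of x z] by (simp add: left_diff_distrib)
  qed
  have d1: "(\<lambda>w. rep_l2 z w - rep_l2 ?e w) \<in> L2" and d2: "(\<lambda>w. rep_l2 ?e w - rep_l2 z w) \<in> L2"
    by (simp_all add: L2_diff)
  have cut: "\<exists>q. AE w in leb01. (c < X w \<longrightarrow> q \<le> g (X w)) \<and> (X w \<le> c \<longrightarrow> g (X w) \<le> q)"
    if ex: "\<exists>w\<in>{0<..<1}. X w \<le> c" "\<exists>w\<in>{0<..<1}. c < X w" for c
  proof -
    let ?L = "{w\<in>{0<..<1}. X w \<le> c}"
    define q where "q = Sup (Z ` ?L)"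
    have LU: "Z w \<le> Z w'" if "w \<in> ?L" "w' \<in> {0<..<1}" "c < X w'" for w w'
    proof -
      have "w \<le> w'"
      proof (rule ccontr)
        assume "\<not> w \<le> w'"
        then have "X w' \<le> X w" using that by (intro mono_onD[OF X(1)]) auto
        then show False using that by simp
      qed
      then show ?thesis using that by (intro mono_onD[OF Z(1)]) auto
    qed
    have up: "q \<le> Z w" if "w \<in> {0<..<1}" "c < X w" for w
      unfolding q_def using ex(1) LU that by (intro cSup_least) auto
    have low: "Z w \<le> q" if "w \<in> {0<..<1}" "X w \<le> c" for w
    proof -
      obtain w0 where "w0 \<in> {0<..<1}" "c < X w0" using ex(2) by blast
      then have "bdd_above (Z ` ?L)" by (intro bdd_aboveI2[of _ _ "Z w0"] LU) auto
      then show ?thesis unfolding q_def using that by (intro cSup_upper) auto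
    qed
    have "AE w in leb01. \<not> rep_l2 x w \<in> {t. c < t \<and> g t < q}"
    proof (rule AE_zero_on_level_set[OF d1])
      show "AE w in leb01. rep_l2 x w \<in> {t. c < t \<and> g t < q} \<longrightarrow> 0 < rep_l2 z w - rep_l2 ?e w"
        using X(3) Z(3) g(2) AE_space unfolding ae_eq_def
        by eventually_elim (use up in force)
      show "(\<integral>w. (rep_l2 z w - rep_l2 ?e w) * indicator {w. rep_l2 x w \<in> {t. c < t \<and> g t < q}} w \<partial>leb01) = 0"
        using orth[of "{t. c < t \<and> g t < q}"] by (simp add: indicator_def)
    qed measurable
    moreover have "AE w in leb01. \<not> rep_l2 x w \<in> {t. t \<le> c \<and> q < g t}"
    proof (rule AE_zero_on_level_set[OF d2])
      show "AE w in leb01. rep_l2 x w \<in> {t. t \<le> c \<and> q < g t} \<longrightarrow> 0 < rep_l2 ?e w - rep_l2 z w"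
        using X(3) Z(3) g(2) AE_space unfolding ae_eq_def
        by eventually_elim (use low in force)
      have "(\<integral>w. (rep_l2 ?e w - rep_l2 z w) * indicator {w. rep_l2 x w \<in> {t. t \<le> c \<and> q < g t}} w \<partial>leb01)
        = (\<integral>w. - ((rep_l2 z w - rep_l2 ?e w) * indicator {t. t \<le> c \<and> q < g t} (rep_l2 x w)) \<partial>leb01)"
        by (intro Bochner_Integration.integral_cong) (auto simp: indicator_def)
      also have "\<dots> = 0" using orth[of "{t. t \<le> c \<and> q < g t}"] by simp
      finally show "(\<integral>w. (rep_l2 ?e w - rep_l2 z w) * indicator {w. rep_l2 x w \<in> {t. t \<le> c \<and> q < g t}} w \<partial>leb01) = 0" .
    qed measurable
    ultimately have "AE w in leb01. (c < X w \<longrightarrow> q \<le> g (X w)) \<and> (X w \<le> c \<longrightarrow> g (X w) \<le> q)"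
      using X(3) unfolding ae_eq_def by eventually_elim (auto simp: not_less)
    then show ?thesis by (rule exI)
  qed
  \<comment> \<open>Levels with values of \<open>X\<close> on both sides; only for these is the
    separating value defined by a nonempty bounded supremum.\<close>
  define G where "G c \<longleftrightarrow> (\<exists>w\<in>{0<..<1}. X w \<le> c) \<and> (\<exists>w\<in>{0<..<1}. c < X w)" for c
  have "\<exists>q. G c \<longrightarrow> (AE w in leb01. (c < X w \<longrightarrow> q \<le> g (X w)) \<and> (X w \<le> c \<longrightarrow> g (X w) \<le> q))" for c
    using cut[of c] by (cases "G c") (simp_all add: G_def)
  then obtain q where q: "\<And>c. G c \<Longrightarrow> AE w in leb01. (c < X w \<longrightarrow> q c \<le> g (X w)) \<and> (X w \<le> c \<longrightarrow> g (X w) \<le> q c)"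
    by metis
  define S where "S = {w. rep_l2 ?e w = g (X w) \<and> (\<forall>c\<in>\<rat>. G c \<longrightarrow> (c < X w \<longrightarrow> q c \<le> g (X w)) \<and> (X w \<le> c \<longrightarrow> g (X w) \<le> q c))}"
  have "AE w in leb01. \<forall>c\<in>\<rat>. G c \<longrightarrow> (c < X w \<longrightarrow> q c \<le> g (X w)) \<and> (X w \<le> c \<longrightarrow> g (X w) \<le> q c)"
  proof (subst AE_ball_countable[OF countable_rat], intro ballI)
    fix c show "AE w in leb01. G c \<longrightarrow> (c < X w \<longrightarrow> q c \<le> g (X w)) \<and> (X w \<le> c \<longrightarrow> g (X w) \<le> q c)"
      using q[of c] by (cases "G c") (simp, simp)
  qed
  then have S: "AE w in leb01. w \<in> S"
    using g(2) X(3) unfolding ae_eq_def by eventually_elim (auto simp: S_def)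
  have "\<exists>Z. mono_on {0<..<1} Z \<and> ae_eq (rep_l2 ?e) Z"
  proof (rule ae_mono_extension[OF S])
    fix w w' assume w: "w \<in> S" "w' \<in> S" "0 < w" "w \<le> w'" "w' < 1"
    have "X w \<le> X w'" using w by (intro mono_onD[OF X(1)]) auto
    show "rep_l2 ?e w \<le> rep_l2 ?e w'"
    proof (cases "X w = X w'")
      case True then show ?thesis using w by (simp add: S_def)
    next
      case False
      then obtain c where c: "c \<in> \<rat>" "X w < c" "c < X w'" using \<open>X w \<le> X w'\<close> Rats_dense_in_real[of "X w" "X w'"] by auto
      have "w \<in> {0<..<1}" "w' \<in> {0<..<1}" using w by auto
      then have "G c" using c less_imp_le[OF c(2)] unfolding G_def by blast
      then have "g (X w) \<le> q c" "q c \<le> g (X w')" using w c unfolding S_def by auto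
      then show ?thesis using w by (simp add: S_def)
    qed
  qed
  then have "cls (rep_l2 ?e) \<in> K2" by (subst cls_K2_iff) (auto simp: cone_K_def)
  then show ?thesis by simp
qed

lemma integral_indicator_integrable:
  assumes f: "f \<in> L2" and S: "S \<inter> {0<..<1} \<in> sets leb01"
  shows "integrable leb01 (\<lambda>w. f w * indicator S w)"
proof -
  have "integrable leb01 (\<lambda>w. indicator (S \<inter> {0<..<1}) w *\<^sub>R f w)"
    by (rule integrable_mult_indicator[OF S L2_integrable[OF f]])
  then show ?thesis by (rule Bochner_Integration.integrable_cong[THEN iffD1, rotated -1]) (auto simp: indicator_def)
qed

text \<open>Up to one point, the set where c \<le> U is empty, the whole interval or the tail beyond
  its infimum.\<close>

lemma upset_integral_nonpos:
  fixes U :: "real \<Rightarrow> real"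
  assumes \<xi>: "\<xi> \<in> L2" and tot: "(\<integral>w. \<xi> w \<partial>leb01) = 0"
    and tail: "\<And>a. 0 < a \<Longrightarrow> a < 1 \<Longrightarrow> (\<integral>w. \<xi> w * indicator {a<..} w \<partial>leb01) \<le> 0"
    and U: "mono_on {0<..<1} U"
  shows "(\<integral>w. \<xi> w * indicator {w. c \<le> U w} w \<partial>leb01) \<le> 0"
proof -
  have [measurable]: "(\<lambda>w. w) \<in> borel_measurable leb01" by (rule borel_measurable_leb01) simp
  note [measurable] = L2_measurable[OF \<xi>] mono_on_measurable_leb01[OF U]
  let ?S = "{w\<in>{0<..<1}. c \<le> U w}"
  define a where "a = Inf ?S"
  consider "?S = {}" | "?S \<noteq> {}" "a = 0" | "?S \<noteq> {}" "0 < a"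
    using cInf_greatest[of ?S 0] by (fastforce simp: a_def)
  then show ?thesis
  proof cases
    case 1
    then have "(\<integral>w. \<xi> w * indicator {w. c \<le> U w} w \<partial>leb01) = (\<integral>w. 0 \<partial>leb01)"
      by (intro Bochner_Integration.integral_cong) (auto simp: indicator_def)
    then show ?thesis by simp
  next
    case 2
    have "c \<le> U w" if "w \<in> {0<..<1}" for w
    proof -
      have "\<exists>w'\<in>?S. w' < w" using cInf_lessD[of ?S w] 2 that by (auto simp: a_def)
      then obtain w' where "w' \<in> ?S" "w' < w" by blast
      then show ?thesis using mono_onD[OF U, of w' w] that by auto
    qed
    then have "(\<integral>w. \<xi> w * indicator {w. c \<le> U w} w \<partial>leb01) = (\<integral>w. \<xi> w \<partial>leb01)"
      by (intro Bochner_Integration.integral_cong) (auto simp: indicator_def)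
    then show ?thesis by (simp add: tot)
  next
    case 3
    have bdd: "bdd_below ?S" by (rule bdd_belowI[of _ 0]) auto
    obtain s where s: "s \<in> ?S" using 3 by blast
    then have "a \<le> s" unfolding a_def by (intro cInf_lower bdd)
    then have a1: "a < 1" using s by auto
    have above: "c \<le> U w" if w: "a < w" "w < 1" for w
    proof -
      have "\<exists>w'\<in>?S. w' < w" using cInf_lessD[of ?S w] 3 w by (auto simp: a_def)
      then obtain w' where "w' \<in> ?S" "w' < w" by blast
      then show ?thesis using mono_onD[OF U, of w' w] w by auto
    qed
    have below: "\<not> c \<le> U w" if "0 < w" "w < a" for w
      using cInf_lower[OF _ bdd, of w] that a1 by (auto simp: a_def)
    have "AE w in leb01. w \<noteq> a"
      using AE_lborel_singleton[of a] unfolding leb01_def by (subst AE_restrict_space_iff) auto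
    then have "AE w in leb01. \<xi> w * indicator {w. c \<le> U w} w = \<xi> w * indicator {a<..} w"
      using AE_space by eventually_elim (use above below in \<open>force simp: indicator_def\<close>)
    then have "(\<integral>w. \<xi> w * indicator {w. c \<le> U w} w \<partial>leb01) = (\<integral>w. \<xi> w * indicator {a<..} w \<partial>leb01)"
      by (intro integral_cong_AE) measurable
    then show ?thesis using tail[OF 3(2) a1] by simp
  qed
qed

text \<open>There are floor y + L integers k with -L < k \<le> y; so the floor is, up to a constant,
  a finite sum of indicators of the conditions k \<le> y.\<close>

lemma floor_eq_sum_levels:
  fixes y :: real assumes "\<bar>y\<bar> \<le> real L"
  shows "of_int \<lfloor>y\<rfloor> = (\<Sum>k\<in>{- int L<..int L}. indicator {..y} (of_int k)) - real L"
proof -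
  have b: "- int L \<le> \<lfloor>y\<rfloor>" "\<lfloor>y\<rfloor> \<le> int L" using assms by linarith+
  have "(\<Sum>k\<in>{- int L<..int L}. indicator {..y} (real_of_int k)) = (\<Sum>k\<in>{- int L<..\<lfloor>y\<rfloor>}. 1 :: real)"
  proof (rule sum.mono_neutral_cong_right)
    show "{- int L<..\<lfloor>y\<rfloor>} \<subseteq> {- int L<..int L}" using b by auto
    show "\<forall>i\<in>{- int L<..int L} - {- int L<..\<lfloor>y\<rfloor>}. indicator {..y} (real_of_int i) = (0::real)"
      by (auto simp: le_floor_iff indicator_def)
    show "indicator {..y} (real_of_int k) = (1::real)" if "k \<in> {- int L<..\<lfloor>y\<rfloor>}" for k
      using that by (auto simp: le_floor_iff indicator_def)
  qed simp
  also have "\<dots> = real_of_int (\<lfloor>y\<rfloor> + int L)" using b by simp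
  finally show ?thesis by simp
qed

text \<open>A layer-cake argument. For bounded W, floor (n W) is a sum of indicators of superlevel
  sets up to a constant; the constant integrates to zero against \<open>\<xi>\<close>, and the
  discretisation costs at most 1/n times the L^1 norm of \<open>\<xi>\<close>. Truncation of
  \<open>U\<close> reduces the general case to this one.\<close>

lemma mono_integral_nonpos:
  assumes \<xi>: "\<xi> \<in> L2" and tot: "(\<integral>w. \<xi> w \<partial>leb01) = 0"
    and tail: "\<And>a. 0 < a \<Longrightarrow> a < 1 \<Longrightarrow> (\<integral>w. \<xi> w * indicator {a<..} w \<partial>leb01) \<le> 0"
    and U: "mono_on {0<..<1} U" and U2: "U \<in> L2"
  shows "(\<integral>w. \<xi> w * U w \<partial>leb01) \<le> 0"
proof -
  have [measurable]: "(\<lambda>w. w) \<in> borel_measurable leb01" by (rule borel_measurable_leb01) simp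
  note [measurable] = L2_measurable[OF \<xi>] L2_measurable[OF U2]
  have bounded: "(\<integral>w. \<xi> w * W w \<partial>leb01) \<le> 0" if W: "mono_on {0<..<1} W" and B: "\<And>w. \<bar>W w\<bar> \<le> real M" for W and M :: nat
  proof -
    have [measurable]: "W \<in> borel_measurable leb01" by (rule mono_on_measurable_leb01[OF W])
    have int: "integrable leb01 (\<lambda>w. \<xi> w * W w)"
      by (intro L2_mult_integrable \<xi> L2_bounded[OF _ B]) measurable
    define A where "A = (\<integral>w. \<bar>\<xi> w\<bar> \<partial>leb01)"
    have est: "(\<integral>w. \<xi> w * W w \<partial>leb01) \<le> A / real n" if n: "0 < n" for n :: nat
    proof -
      let ?F = "\<lambda>w. of_int \<lfloor>real n * W w\<rfloor> :: real"
      let ?I = "\<lambda>k w. indicator {w. real_of_int k / real n \<le> W w} w :: real"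
      have F: "?F w = (\<Sum>k\<in>{- int (n * M)<..int (n * M)}. ?I k w) - real (n * M)" for w
      proof -
        have "\<bar>real n * W w\<bar> \<le> real (n * M)" using B[of w] by (simp add: abs_mult mult_left_mono)
        from floor_eq_sum_levels[OF this] show ?thesis
          using n by (simp add: indicator_def divide_le_eq mult.commute)
      qed
      have Iint: "integrable leb01 (\<lambda>w. \<xi> w * ?I k w)" for k
        by (rule integral_indicator_integrable[OF \<xi>]) measurable
      have "(\<integral>w. \<xi> w * ?F w \<partial>leb01) = (\<integral>w. (\<Sum>k\<in>{- int (n * M)<..int (n * M)}. \<xi> w * ?I k w) - real (n * M) * \<xi> w \<partial>leb01)"
        unfolding F by (intro Bochner_Integration.integral_cong) (auto simp: right_diff_distrib sum_distrib_left)
      also have "\<dots> = (\<Sum>k\<in>{- int (n * M)<..int (n * M)}. \<integral>w. \<xi> w * ?I k w \<partial>leb01) - real (n * M) * (\<integral>w. \<xi> w \<partial>leb01)"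
        using L2_integrable[OF \<xi>] Bochner_Integration.integrable_sum[OF Iint]
        by (subst Bochner_Integration.integral_diff) (auto simp only: Bochner_Integration.integral_sum[OF Iint] integral_mult_right_zero intro: integrable_mult_right)
      also have "\<dots> \<le> 0" unfolding tot by (simp, intro sum_nonpos upset_integral_nonpos[OF \<xi> tot tail W])
      finally have F0: "(\<integral>w. \<xi> w * ?F w \<partial>leb01) \<le> 0" .
      have "(\<integral>w. \<xi> w * W w \<partial>leb01) \<le> (\<integral>w. (1 / real n) * (\<xi> w * ?F w) + (1 / real n) * \<bar>\<xi> w\<bar> \<partial>leb01)"
      proof (rule integral_mono[OF int])
        have "integrable leb01 (\<lambda>w. \<xi> w * ?F w)"
          unfolding F right_diff_distrib sum_distrib_left
          by (intro Bochner_Integration.integrable_diff Bochner_Integration.integrable_sum Iint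
              integrable_mult_left L2_integrable[OF \<xi>])
        then show "integrable leb01 (\<lambda>w. (1 / real n) * (\<xi> w * ?F w) + (1 / real n) * \<bar>\<xi> w\<bar>)"
          using L2_integrable[OF \<xi>] by auto
        fix w
        have "\<bar>real n * W w - ?F w\<bar> \<le> 1" by linarith
        then have "\<xi> w * (real n * W w - ?F w) \<le> \<bar>\<xi> w\<bar> * 1"
          by (metis abs_ge_self abs_ge_zero abs_mult mult_left_mono order_trans)
        then have "\<xi> w * (real n * W w) \<le> \<xi> w * ?F w + \<bar>\<xi> w\<bar>" by (simp add: right_diff_distrib)
        then show "\<xi> w * W w \<le> (1 / real n) * (\<xi> w * ?F w) + (1 / real n) * \<bar>\<xi> w\<bar>"
          using n by (simp add: field_simps)
      qed
      also have "\<dots> = (1 / real n) * (\<integral>w. \<xi> w * ?F w \<partial>leb01) + A / real n"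
      proof -
        have "integrable leb01 (\<lambda>w. \<xi> w * ?F w)"
          unfolding F right_diff_distrib sum_distrib_left
          by (intro Bochner_Integration.integrable_diff Bochner_Integration.integrable_sum Iint
              integrable_mult_left L2_integrable[OF \<xi>])
        then show ?thesis using L2_integrable[OF \<xi>] by (subst Bochner_Integration.integral_add) (auto simp: A_def)
      qed
      also have "\<dots> \<le> A / real n" using F0 by (simp add: divide_le_0_iff)
      finally show ?thesis .
    qed
    have "(\<lambda>n. A / real (Suc n)) \<longlonglongrightarrow> 0" using LIMSEQ_Suc[OF lim_const_over_n[of A]] by simp
    then show ?thesis
      by (rule tendsto_lowerbound) (use est[OF zero_less_Suc] in \<open>blast intro: always_eventually\<close>, simp)
  qed
  let ?c = "\<lambda>M w. max (- real M) (min (real M) (U w))"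
  have "(\<lambda>M. \<integral>w. \<xi> w * ?c M w \<partial>leb01) \<longlonglongrightarrow> (\<integral>w. \<xi> w * U w \<partial>leb01)"
  proof (rule integral_dominated_convergence[where w = "\<lambda>w. \<bar>\<xi> w * U w\<bar>"])
    show "integrable leb01 (\<lambda>w. \<bar>\<xi> w * U w\<bar>)" using L2_mult_integrable[OF \<xi> U2] by simp
    show "AE w in leb01. (\<lambda>M. \<xi> w * ?c M w) \<longlonglongrightarrow> \<xi> w * U w"
    proof (rule AE_I2)
      fix w
      obtain N where N: "\<bar>U w\<bar> \<le> real N" using real_arch_simple by blast
      have "\<xi> w * ?c M w = \<xi> w * U w" if "N \<le> M" for M
      proof -
        have "\<bar>U w\<bar> \<le> real M" using N that by linarith
        then show ?thesis by (simp add: abs_le_iff max_def min_def)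
      qed
      then show "(\<lambda>M. \<xi> w * ?c M w) \<longlonglongrightarrow> \<xi> w * U w"
        by (intro tendsto_eventually eventually_sequentiallyI[of N])
    qed
    show "AE w in leb01. norm (\<xi> w * ?c M w) \<le> \<bar>\<xi> w * U w\<bar>" for M
      by (intro AE_I2) (auto simp: abs_mult intro!: mult_left_mono)
  qed measurable
  moreover have "(\<integral>w. \<xi> w * ?c M w \<partial>leb01) \<le> 0" for M
  proof (rule bounded[where M = M])
    show "mono_on {0<..<1} (?c M)" by (intro mono_onI max.mono min.mono mono_onD[OF U]) auto
  qed auto
  ultimately show ?thesis by (intro tendsto_upperbound) auto
qed

text \<open>By \<open>mono_integral_nonpos\<close> it suffices to test with tails {a<..}. The part
  with X > X a is a level set and contributes zero. On the fibre X = X a the difference is ?m - Z,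
  nonincreasing with integral zero, so its part to the right of a is nonpositive.\<close>

lemma proj_H2_polar:
  assumes x: "x \<in> K2" and z: "z \<in> K2" and u: "u \<in> K2"
  shows "inner (proj (H2 x) z - z) u \<le> 0"
proof -
  let ?e = "proj (H2 x) z"
  obtain X where X: "mono_on {0<..<1} X" "X \<in> L2" "ae_eq (rep_l2 x) X" using x by (rule K2_E)
  obtain Z where Z: "mono_on {0<..<1} Z" "Z \<in> L2" "z = cls Z" "ae_eq (rep_l2 z) Z" using z by (rule K2_E)
  obtain U where U: "mono_on {0<..<1} U" "U \<in> L2" "u = cls U" using u by (rule K2_E)
  obtain g where g: "g \<in> borel_measurable borel" "ae_eq (rep_l2 ?e) (g \<circ> rep_l2 x)"
    using proj_H2_mem[of x z] by (auto simp: H2_def)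
  note [measurable] = g(1) L2_measurable[OF rep_l2_in] L2_measurable[OF X(2)] L2_measurable[OF Z(2)]
  define \<xi> where "\<xi> w = rep_l2 ?e w - Z w" for w
  have \<xi>: "\<xi> \<in> L2" unfolding \<xi>_def by (intro L2_diff Z) simp
  note [measurable] = L2_measurable[OF \<xi>]
  have level: "(\<integral>w. \<xi> w * indicator B (X w) \<partial>leb01) = 0" if [measurable]: "B \<in> sets borel" for B
  proof -
    have i: "integrable leb01 (\<lambda>w. rep_l2 u w * indicator B (rep_l2 x w))" for u
      by (rule Bochner_Integration.integrable_bound[OF L2_integrable[OF rep_l2_in[of u]]]) (auto simp: indicator_def)
    have "(\<integral>w. \<xi> w * indicator B (X w) \<partial>leb01)
      = (\<integral>w. rep_l2 ?e w * indicator B (rep_l2 x w) - rep_l2 z w * indicator B (rep_l2 x w) \<partial>leb01)"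
    proof (rule integral_cong_AE)
      show "AE w in leb01. \<xi> w * indicator B (X w) = rep_l2 ?e w * indicator B (rep_l2 x w) - rep_l2 z w * indicator B (rep_l2 x w)"
        using X(3) Z(4) unfolding ae_eq_def by eventually_elim (simp add: \<xi>_def left_diff_distrib)
    qed measurable
    then show ?thesis using proj_H2_integral[OF that, of x z] i by simp
  qed
  have "(\<integral>w. \<xi> w * U w \<partial>leb01) \<le> 0"
  proof (rule mono_integral_nonpos[OF \<xi> _ _ U(1,2)])
    show "(\<integral>w. \<xi> w \<partial>leb01) = 0" using level[of UNIV] by simp
    fix a :: real assume a: "0 < a" "a < 1"
    let ?x = "X a"
    let ?m = "g ?x"
    let ?R = "\<lambda>w. \<xi> w * indicator {w. X w = ?x \<and> a < w} w" and ?L = "\<lambda>w. \<xi> w * indicator {w. X w = ?x \<and> w \<le> a} w"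
    have [measurable]: "(\<lambda>w. w) \<in> borel_measurable leb01" by (rule borel_measurable_leb01) simp
    have R: "integrable leb01 ?R" by (rule integral_indicator_integrable[OF \<xi>]) measurable
    have L: "integrable leb01 ?L" by (rule integral_indicator_integrable[OF \<xi>]) measurable
    have up: "integrable leb01 (\<lambda>w. \<xi> w * indicator {?x<..} (X w))"
      by (rule Bochner_Integration.integrable_bound[OF L2_integrable[OF \<xi>]]) (auto simp: indicator_def)
    have split: "(\<integral>w. \<xi> w * indicator {a<..} w \<partial>leb01) = (\<integral>w. ?R w \<partial>leb01)"
    proof -
      have "(\<integral>w. \<xi> w * indicator {a<..} w \<partial>leb01) = (\<integral>w. \<xi> w * indicator {?x<..} (X w) + ?R w \<partial>leb01)"
      proof (intro Bochner_Integration.integral_cong refl)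
        fix w assume w: "w \<in> space leb01"
        have "X w \<le> ?x" if "w \<le> a" using mono_onD[OF X(1), of w a] that w a by auto
        moreover have "?x \<le> X w" if "a \<le> w" using mono_onD[OF X(1), of a w] that w a by auto
        ultimately show "\<xi> w * indicator {a<..} w = \<xi> w * indicator {?x<..} (X w) + ?R w"
          by (cases "a < w") (auto simp: indicator_def)
      qed
      then show ?thesis using level[of "{?x<..}"] up R by simp
    qed
    have fiber: "(\<integral>w. ?R w \<partial>leb01) + (\<integral>w. ?L w \<partial>leb01) = 0"
    proof -
      have "(\<integral>w. ?R w \<partial>leb01) + (\<integral>w. ?L w \<partial>leb01) = (\<integral>w. ?R w + ?L w \<partial>leb01)" using R L by simp
      also have "\<dots> = (\<integral>w. \<xi> w * indicator {?x} (X w) \<partial>leb01)"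
        by (intro Bochner_Integration.integral_cong) (auto simp: indicator_def)
      finally show ?thesis using level[of "{?x}"] by simp
    qed
    have val: "AE w in leb01. X w = ?x \<longrightarrow> \<xi> w = ?m - Z w"
      using X(3) g(2) unfolding ae_eq_def by eventually_elim (simp add: \<xi>_def)
    \<comment> \<open>If \<open>?m\<close> is at most \<open>Z a\<close> the right part is
      nonpositive pointwise; otherwise the left part is nonnegative, and the two parts
      cancel.\<close>
    show "(\<integral>w. \<xi> w * indicator {a<..} w \<partial>leb01) \<le> 0"
    proof (cases "?m \<le> Z a")
      case True
      have "AE w in leb01. ?R w \<le> 0"
        using val AE_space
      proof eventually_elim
        fix w assume "X w = ?x \<longrightarrow> \<xi> w = ?m - Z w" "w \<in> space leb01"
        then show "?R w \<le> 0" using True mono_onD[OF Z(1), of a w] a by (auto simp: indicator_def)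
      qed
      then have "(\<integral>w. ?R w \<partial>leb01) \<le> (\<integral>w. 0 \<partial>leb01)" by (intro integral_mono_AE R) auto
      then show ?thesis using split by simp
    next
      case False
      have "AE w in leb01. 0 \<le> ?L w"
        using val AE_space
      proof eventually_elim
        fix w assume "X w = ?x \<longrightarrow> \<xi> w = ?m - Z w" "w \<in> space leb01"
        then show "0 \<le> ?L w" using False mono_onD[OF Z(1), of w a] a by (auto simp: indicator_def)
      qed
      then have "(\<integral>w. 0 \<partial>leb01) \<le> (\<integral>w. ?L w \<partial>leb01)" by (intro integral_mono_AE L) auto
      then show ?thesis using split fiber by simp
    qed
  qed
  moreover have "?e - z = cls \<xi>" unfolding \<xi>_def Z(3) using cls_diff[of "rep_l2 ?e" Z] Z by simp
  ultimately show ?thesis by (simp add: U(3) inner_cls \<xi> U(2))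
qed

text \<open>The orthogonal projection of \<open>\<xi>\<close> is a function g of x whose integral
  over every level set vanishes, in particular where g > 0 and where g < 0; so it is zero.\<close>

lemma normal_cone_orth_H2:
  assumes x: "x \<in> K2" and \<xi>: "\<xi> \<in> normal_cone K2 x" and u: "u \<in> H2 x"
  shows "inner \<xi> u = 0"
proof -
  let ?e = "proj (H2 x) \<xi>"
  obtain g where g: "g \<in> borel_measurable borel" "ae_eq (rep_l2 ?e) (g \<circ> rep_l2 x)"
    using proj_H2_mem[of x \<xi>] by (auto simp: H2_def)
  note [measurable] = g(1) L2_measurable[OF rep_l2_in]
  have level: "(\<integral>w. rep_l2 ?e w * indicator B (rep_l2 x w) \<partial>leb01) = 0" if "B \<in> sets borel" for B
    using proj_H2_integral[OF that] normal_cone_orth_level_sets[OF x \<xi> that] by simp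
  have "AE w in leb01. \<not> 0 < g (rep_l2 x w)"
  proof (rule AE_zero_on_level_set[OF rep_l2_in[of ?e]])
    show "AE w in leb01. 0 < g (rep_l2 x w) \<longrightarrow> 0 < rep_l2 ?e w"
      using g(2) unfolding ae_eq_def by eventually_elim simp
    show "(\<integral>w. rep_l2 ?e w * indicator {w. 0 < g (rep_l2 x w)} w \<partial>leb01) = 0"
      using level[of "{t. 0 < g t}"] by (simp add: indicator_def)
  qed measurable
  moreover have "AE w in leb01. \<not> g (rep_l2 x w) < 0"
  proof (rule AE_zero_on_level_set[OF L2_uminus[OF rep_l2_in[of ?e]]])
    show "AE w in leb01. g (rep_l2 x w) < 0 \<longrightarrow> 0 < - rep_l2 ?e w"
      using g(2) unfolding ae_eq_def by eventually_elim simp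
    show "(\<integral>w. - rep_l2 ?e w * indicator {w. g (rep_l2 x w) < 0} w \<partial>leb01) = 0"
      using level[of "{t. g t < 0}"] by (simp add: indicator_def)
  qed measurable
  ultimately have "ae_eq (rep_l2 ?e) (\<lambda>_. 0)"
    using g(2) unfolding ae_eq_def by eventually_elim simp
  then have "?e = 0" using cls_eq_iff[of "rep_l2 ?e" "\<lambda>_. 0"] by (simp add: L2_const cls_zero)
  then show ?thesis using proj_H2_orth[OF u, of \<xi>] by simp
qed

interpretation sticky: sticky_cone K2 H2
  by unfold_locales (auto intro: K2_closed_cone H2_subspace H2_closed H2_self normal_cone_orth_H2
      proj_H2_in_K2 proj_H2_polar dest: H2_mono)

section \<open>Integral norms\<close>

text \<open>The odd extension of the power. p times \<open>spow (p - 1)\<close> is the derivative of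
  the p-th power of the absolute value, and \<open>spow p\<close> trades L^p convergence for L^1
  convergence.\<close>

definition spow :: "real \<Rightarrow> real \<Rightarrow> real" where
  "spow q x = sgn x * \<bar>x\<bar> powr q"

lemma abs_spow: "\<bar>spow q x\<bar> = \<bar>x\<bar> powr q"
  by (cases "x = 0") (auto simp: spow_def abs_mult)

lemma spow_minus: "spow q (- x) = - spow q x"
  by (simp add: spow_def)

lemma spow_nonneg_eq: "0 \<le> x \<Longrightarrow> spow q x = x powr q"
  by (cases "x = 0") (auto simp: spow_def)

lemma powr_split: assumes "0 \<le> x" "1 \<le> (p::real)" shows "x powr p = x powr (p - 1) * x"
  using powr_mult_base[OF assms(1), of "p - 1"] by (simp add: mult.commute)

lemma powr_superadditive:
  assumes "0 \<le> x" "0 \<le> y" "1 \<le> (p::real)"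
  shows "x powr p + y powr p \<le> (x + y) powr p"
proof -
  have "x powr p + y powr p = x powr (p - 1) * x + y powr (p - 1) * y" using assms by (simp add: powr_split)
  also have "\<dots> \<le> (x + y) powr (p - 1) * x + (x + y) powr (p - 1) * y"
    using assms by (intro add_mono mult_right_mono powr_mono2) auto
  also have "\<dots> = (x + y) powr p" using assms by (simp add: powr_split distrib_left)
  finally show ?thesis .
qed

lemma powr_add_le:
  assumes "0 \<le> x" "0 \<le> y" "0 \<le> (p::real)"
  shows "(x + y) powr p \<le> 2 powr p * (x powr p + y powr p)"
proof -
  have "(x + y) powr p \<le> (2 * max x y) powr p" using assms by (intro powr_mono2) auto
  also have "\<dots> = 2 powr p * max x y powr p" using assms by (simp add: powr_mult)
  also have "\<dots> \<le> 2 powr p * (x powr p + y powr p)"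
    by (intro mult_left_mono) (auto simp: max_def)
  finally show ?thesis .
qed

text \<open>For equal signs this is superadditivity of the power. For opposite signs the absolute
  values add, and the constant is that of \<open>powr_add_le\<close>.\<close>

lemma abs_diff_powr_le_spow:
  assumes p: "1 \<le> (p::real)"
  shows "\<bar>a - b\<bar> powr p \<le> 2 powr p * \<bar>spow p a - spow p b\<bar>"
proof -
  have same: "\<bar>a - b\<bar> powr p \<le> 2 powr p * \<bar>spow p a - spow p b\<bar>" if "0 \<le> b" "b \<le> a" for a b :: real
  proof -
    have "(a - b) powr p \<le> a powr p - b powr p" using powr_superadditive[of "a - b" b p] that p by simp
    also have "\<dots> \<le> 2 powr p * (a powr p - b powr p)"
      using ge_one_powr_ge_zero[of 2 p] p powr_mono2[of p b a] that by (simp add: mult_le_cancel_right1)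
    finally show ?thesis using that powr_mono2[of p b a] p by (simp add: spow_nonneg_eq)
  qed
  have opp: "\<bar>a - b\<bar> powr p \<le> 2 powr p * \<bar>spow p a - spow p b\<bar>" if "b \<le> 0" "0 \<le> a" for a b :: real
  proof -
    have "spow p b = - ((- b) powr p)" using spow_minus[of p "- b"] that by (simp add: spow_nonneg_eq)
    then have "\<bar>spow p a - spow p b\<bar> = a powr p + (- b) powr p" using that by (simp add: spow_nonneg_eq)
    then show ?thesis using powr_add_le[of a "- b" p] that p by simp
  qed
  have ord: "\<bar>a - b\<bar> powr p \<le> 2 powr p * \<bar>spow p a - spow p b\<bar>" if "b \<le> a" for a b :: real
  proof -
    consider "0 \<le> b" | "b \<le> 0" "0 \<le> a" | "a \<le> 0" by linarith
    then show ?thesis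
    proof cases
      case 3
      then have "\<bar>- b - - a\<bar> powr p \<le> 2 powr p * \<bar>spow p (- b) - spow p (- a)\<bar>" using that by (intro same) auto
      then show ?thesis by (simp add: spow_minus abs_minus_commute)
    qed (use same opp that in auto)
  qed
  show ?thesis
    using ord[of b a] ord[of a b] by (cases "b \<le> a") (auto simp: abs_minus_commute)
qed

lemma continuous_spow: assumes "0 < q" shows "isCont (spow q) x"
proof -
  consider "0 < x" | "x < 0" | "x = 0" by linarith
  then show ?thesis
  proof cases
    case 1
    then have "\<forall>\<^sub>F y in nhds x. 0 < y" by (rule order_tendstoD[OF filterlim_ident])
    then have "\<forall>\<^sub>F y in nhds x. spow q y = y powr q" by eventually_elim (simp add: spow_nonneg_eq)
    then show ?thesis using 1 by (subst isCont_cong) (auto intro!: continuous_intros)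
  next
    case 2
    then have "\<forall>\<^sub>F y in nhds x. y < 0" by (rule order_tendstoD[OF filterlim_ident])
    then have "\<forall>\<^sub>F y in nhds x. spow q y = - ((- y) powr q)"
      by eventually_elim (simp add: spow_def)
    then show ?thesis using 2 by (subst isCont_cong) (auto intro!: continuous_intros)
  next
    case 3
    have "((\<lambda>y. \<bar>y\<bar> powr q) \<longlongrightarrow> \<bar>0\<bar> powr q) (at (0::real))"
      using assms by (intro tendsto_powr2 tendsto_intros) auto
    then have "((\<lambda>y. \<bar>spow q y\<bar>) \<longlongrightarrow> 0) (at 0)" by (simp add: abs_spow)
    then have "((\<lambda>y. spow q y) \<longlongrightarrow> 0) (at 0)"
      by (rule tendsto_rabs_zero_cancel)
    moreover have "spow q 0 = 0" by (simp add: spow_def)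
    ultimately show ?thesis using 3 by (simp add: isCont_def)
  qed
qed

lemma spow_measurable [measurable]: "spow q \<in> borel_measurable borel"
  unfolding spow_def by measurable

text \<open>Scheffe's lemma applied to the signed p-th powers, whose L^1 norms are the p-th moments;
  \<open>abs_diff_powr_le_spow\<close> returns to L^p.\<close>

lemma riesz_convergence:
  fixes f :: "nat \<Rightarrow> 'a \<Rightarrow> real"
  assumes p: "1 \<le> p" and [measurable]: "\<And>n. f n \<in> borel_measurable M" "g \<in> borel_measurable M"
    and int: "\<And>n. integrable M (\<lambda>x. \<bar>f n x\<bar> powr p)" "integrable M (\<lambda>x. \<bar>g x\<bar> powr p)"
    and lim: "AE x in M. (\<lambda>n. f n x) \<longlonglongrightarrow> g x"
    and le: "limsup (\<lambda>n. \<integral>\<^sup>+ x. \<bar>f n x\<bar> powr p \<partial>M) \<le> (\<integral>\<^sup>+ x. \<bar>g x\<bar> powr p \<partial>M)"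
  shows "(\<lambda>n. \<integral>\<^sup>+ x. \<bar>f n x - g x\<bar> powr p \<partial>M) \<longlonglongrightarrow> 0"
proof -
  have i: "integrable M (\<lambda>x. spow p (h x))" if "h \<in> borel_measurable M" "integrable M (\<lambda>x. \<bar>h x\<bar> powr p)" for h
    by (rule Bochner_Integration.integrable_bound[OF that(2)]) (use that(1) in \<open>auto simp: abs_spow\<close>)
  have "(\<lambda>n. \<integral>\<^sup>+ x. norm (spow p (f n x) - spow p (g x)) \<partial>M) \<longlonglongrightarrow> 0"
  proof (rule Scheffe_lemma1)
    show "AE x in M. (\<lambda>n. spow p (f n x)) \<longlonglongrightarrow> spow p (g x)"
      using lim by eventually_elim (use p in \<open>auto intro!: isCont_tendsto_compose[OF continuous_spow]\<close>)
    show "limsup (\<lambda>n. \<integral>\<^sup>+ x. ennreal (norm (spow p (f n x))) \<partial>M) \<le> (\<integral>\<^sup>+ x. ennreal (norm (spow p (g x))) \<partial>M)"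
      using le by (simp add: abs_spow)
  qed (use i int in auto)
  then have "(\<lambda>n. ennreal (2 powr p) * (\<integral>\<^sup>+ x. norm (spow p (f n x) - spow p (g x)) \<partial>M)) \<longlonglongrightarrow> ennreal (2 powr p) * 0"
    by (intro ennreal_tendsto_cmult) auto
  then have up: "(\<lambda>n. ennreal (2 powr p) * (\<integral>\<^sup>+ x. norm (spow p (f n x) - spow p (g x)) \<partial>M)) \<longlonglongrightarrow> 0" by simp
  have le2: "(\<integral>\<^sup>+ x. \<bar>f n x - g x\<bar> powr p \<partial>M) \<le> ennreal (2 powr p) * (\<integral>\<^sup>+ x. norm (spow p (f n x) - spow p (g x)) \<partial>M)" for n
  proof -
    have "(\<integral>\<^sup>+ x. \<bar>f n x - g x\<bar> powr p \<partial>M) \<le> (\<integral>\<^sup>+ x. ennreal (2 powr p) * norm (spow p (f n x) - spow p (g x)) \<partial>M)"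
      using abs_diff_powr_le_spow[OF p] by (intro nn_integral_mono) (simp add: ennreal_mult'[symmetric] ennreal_leI)
    then show ?thesis by (simp add: nn_integral_cmult)
  qed
  show ?thesis by (rule tendsto_sandwich[OF _ always_eventually[OF allI[OF le2]] tendsto_const up]) simp
qed

text \<open>The p-th power of the L^p norm, with values in \<open>ennreal\<close> so that it is
  defined on all of L^2; finiteness is membership in L^p.\<close>

definition Np :: "real \<Rightarrow> l2 \<Rightarrow> ennreal" where
  "Np p u = (\<integral>\<^sup>+ w. ennreal (\<bar>rep_l2 u w\<bar> powr p) \<partial>leb01)"

lemma Np_cong_AE: "ae_eq (rep_l2 u) f \<Longrightarrow> Np p u = (\<integral>\<^sup>+ w. ennreal (\<bar>f w\<bar> powr p) \<partial>leb01)"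
  unfolding Np_def ae_eq_def by (intro nn_integral_cong_AE) (erule eventually_mono, simp)

lemma Np_cls: "f \<in> L2 \<Longrightarrow> Np p (cls f) = (\<integral>\<^sup>+ w. ennreal (\<bar>f w\<bar> powr p) \<partial>leb01)"
  by (rule Np_cong_AE[OF rep_cls])

lemma rep_add: "ae_eq (rep_l2 (u + v)) (\<lambda>w. rep_l2 u w + rep_l2 v w)"
  using rep_cls[OF L2_add, of "rep_l2 u" "rep_l2 v"] cls_add[of "rep_l2 u" "rep_l2 v"] by simp
lemma rep_diff: "ae_eq (rep_l2 (u - v)) (\<lambda>w. rep_l2 u w - rep_l2 v w)"
  using rep_cls[OF L2_diff, of "rep_l2 u" "rep_l2 v"] cls_diff[of "rep_l2 u" "rep_l2 v"] by simp
lemma rep_scaleR: "ae_eq (rep_l2 (c *\<^sub>R u)) (\<lambda>w. c * rep_l2 u w)"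
  using rep_cls[OF L2_cmult, of "rep_l2 u" c] cls_scaleR[of "rep_l2 u" c] by simp

lemma Np_scaleR: "Np p (c *\<^sub>R u) = ennreal (\<bar>c\<bar> powr p) * Np p u"
proof -
  note [measurable] = L2_measurable[OF rep_l2_in]
  show ?thesis
    unfolding Np_cong_AE[OF rep_scaleR] unfolding Np_def
    by (subst nn_integral_cmult[symmetric]) (auto simp: abs_mult powr_mult ennreal_mult intro!: nn_integral_cong)
qed

text \<open>Lower semicontinuity, by Fatou along an almost everywhere convergent
  subsequence.\<close>

lemma Np_fatou:
  assumes lim: "u \<longlonglongrightarrow> x" and le: "\<And>n. Np p (u n) \<le> C" and p: "0 < p"
  shows "Np p x \<le> C"
proof -
  note [measurable] = L2_measurable[OF rep_l2_in]
  obtain r where r: "AE w in leb01. (\<lambda>n. rep_l2 (u (r n)) w) \<longlonglongrightarrow> rep_l2 x w"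
    using l2_convergent_AE_subseq[OF lim] by blast
  have "Np p x = (\<integral>\<^sup>+ w. liminf (\<lambda>n. ennreal (\<bar>rep_l2 (u (r n)) w\<bar> powr p)) \<partial>leb01)"
    unfolding Np_def
  proof (rule nn_integral_cong_AE, use r in eventually_elim)
    fix w assume l: "(\<lambda>n. rep_l2 (u (r n)) w) \<longlonglongrightarrow> rep_l2 x w"
    have "(\<lambda>n. \<bar>rep_l2 (u (r n)) w\<bar> powr p) \<longlonglongrightarrow> \<bar>rep_l2 x w\<bar> powr p"
      using p by (intro tendsto_powr2 tendsto_rabs l tendsto_const) auto
    then have "(\<lambda>n. ennreal (\<bar>rep_l2 (u (r n)) w\<bar> powr p)) \<longlonglongrightarrow> ennreal (\<bar>rep_l2 x w\<bar> powr p)"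
      by (rule tendsto_ennrealI)
    then show "ennreal (\<bar>rep_l2 x w\<bar> powr p) = liminf (\<lambda>n. ennreal (\<bar>rep_l2 (u (r n)) w\<bar> powr p))"
      by (intro lim_imp_Liminf[symmetric]) auto
  qed
  also have "\<dots> \<le> liminf (\<lambda>n. Np p (u (r n)))"
    unfolding Np_def by (intro nn_integral_liminf) measurable
  also have "\<dots> \<le> C"
    by (rule order_trans[OF Liminf_le_Limsup Limsup_bounded]) (auto simp: le)
  finally show ?thesis .
qed

lemma Lp_iff_Np: "f \<in> L2 \<Longrightarrow> f \<in> Lp p leb01 \<longleftrightarrow> Np p (cls f) < \<infinity>"
  unfolding Lp_def[of p] Np_cls integrable_iff_bounded by (auto dest: L2_measurable)

lemma Lp_measurable: "f \<in> Lp p M \<Longrightarrow> f \<in> borel_measurable M"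
  by (simp add: Lp_def)

lemma (in finite_measure) Lp_imp_square_integrable:
  assumes p: "2 \<le> p" and f: "f \<in> Lp p M"
  shows "integrable M (\<lambda>x. (f x)\<^sup>2)"
proof (rule Bochner_Integration.integrable_bound)
  show "integrable M (\<lambda>x. 1 + \<bar>f x\<bar> powr p)" using f by (simp add: Lp_def)
  have "t\<^sup>2 \<le> 1 + \<bar>t\<bar> powr p" for t :: real
  proof (cases "\<bar>t\<bar> \<le> 1")
    case True
    then have "t\<^sup>2 \<le> 1" by (simp add: abs_square_le_1)
    then show ?thesis by (simp add: add_increasing2)
  next
    case False
    then have "\<bar>t\<bar> powr 2 \<le> \<bar>t\<bar> powr p" using p by (intro powr_mono) auto
    then show ?thesis by simp
  qed
  then show "AE x in M. norm ((f x)\<^sup>2) \<le> norm (1 + \<bar>f x\<bar> powr p)" by (auto intro!: AE_I2 order_trans[OF _ abs_ge_self])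
qed (use Lp_measurable[OF f] in measurable)

lemma Lp_subset_L2: "2 \<le> p \<Longrightarrow> f \<in> Lp p leb01 \<Longrightarrow> f \<in> L2"
  using leb01.Lp_imp_square_integrable[of p f] Lp_measurable[of f p leb01] by (simp add: L2_iff)

lemma Np_add_le:
  assumes "0 \<le> p"
  shows "Np p (u + v) \<le> ennreal (2 powr p) * (Np p u + Np p v)"
proof -
  note [measurable] = L2_measurable[OF rep_l2_in]
  have "Np p (u + v) \<le> (\<integral>\<^sup>+ w. ennreal (2 powr p) * (ennreal (\<bar>rep_l2 u w\<bar> powr p) + ennreal (\<bar>rep_l2 v w\<bar> powr p)) \<partial>leb01)"
    unfolding Np_cong_AE[OF rep_add]
  proof (rule nn_integral_mono)
    fix w
    have "\<bar>rep_l2 u w + rep_l2 v w\<bar> powr p \<le> (\<bar>rep_l2 u w\<bar> + \<bar>rep_l2 v w\<bar>) powr p" using assms by (intro powr_mono2) auto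
    also have "\<dots> \<le> 2 powr p * (\<bar>rep_l2 u w\<bar> powr p + \<bar>rep_l2 v w\<bar> powr p)" using assms by (intro powr_add_le) auto
    finally show "ennreal (\<bar>rep_l2 u w + rep_l2 v w\<bar> powr p) \<le> ennreal (2 powr p) * (ennreal (\<bar>rep_l2 u w\<bar> powr p) + ennreal (\<bar>rep_l2 v w\<bar> powr p))"
      by (simp add: ennreal_mult'[symmetric] ennreal_plus[symmetric] ennreal_leI del: ennreal_plus)
  qed
  also have "\<dots> = ennreal (2 powr p) * (Np p u + Np p v)"
    unfolding Np_def by (simp add: nn_integral_cmult nn_integral_add)
  finally show ?thesis .
qed

lemma Np_add_finite: "Np p u < \<infinity> \<Longrightarrow> Np p v < \<infinity> \<Longrightarrow> 0 \<le> p \<Longrightarrow> Np p (u + v) < \<infinity>"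
  using Np_add_le[of p u v] by (auto simp: ennreal_mult_less_top intro: le_less_trans)

text \<open>A subsequence staying away from 0 would have a further subsequence converging almost
  everywhere, and the bound on the norms is then the limsup hypothesis of
  \<open>riesz_convergence\<close>.\<close>

lemma Np_tendsto_if_norm_le:
  assumes p: "1 \<le> p" and lim: "u \<longlonglongrightarrow> x" and fin: "Np p x < \<infinity>" and le: "\<And>n. Np p (u n) \<le> Np p x"
  shows "(\<lambda>n. Np p (u n - x)) \<longlonglongrightarrow> 0"
proof (rule ccontr)
  assume no: "\<not> ?thesis"
  note [measurable] = L2_measurable[OF rep_l2_in]
  have int: "integrable leb01 (\<lambda>w. \<bar>rep_l2 y w\<bar> powr p)" if "Np p y \<le> Np p x" for y
    using that fin by (auto simp: Np_def integrable_iff_bounded intro: le_less_trans)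
  obtain e where e: "0 < e" "\<exists>\<^sub>F n in sequentially. e \<le> Np p (u n - x)"
    using no by (auto simp: order_tendsto_iff frequently_def not_le not_less)
  have "\<exists>r. \<forall>n. e \<le> Np p (u (r n) - x) \<and> r n < r (Suc n)"
  proof (rule dependent_nat_choice)
    show "\<exists>n. e \<le> Np p (u n - x)" using frequently_ex[OF e(2)] .
    show "\<exists>m. e \<le> Np p (u m - x) \<and> n < m" for n
      using e(2) unfolding frequently_sequentially by (metis Suc_le_lessD)
  qed
  then obtain r where r: "\<And>n. e \<le> Np p (u (r n) - x)" "\<And>n. r n < r (Suc n)" by blast
  have mono: "strict_mono r" using r(2) by (simp add: strict_mono_Suc_iff)
  have "(\<lambda>n. u (r n)) \<longlonglongrightarrow> x" using LIMSEQ_subseq_LIMSEQ[OF lim mono] by (simp add: o_def)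
  then obtain s where s: "AE w in leb01. (\<lambda>n. rep_l2 (u (r (s n))) w) \<longlonglongrightarrow> rep_l2 x w"
    using l2_convergent_AE_subseq by blast
  have "(\<lambda>n. \<integral>\<^sup>+ w. \<bar>rep_l2 (u (r (s n))) w - rep_l2 x w\<bar> powr p \<partial>leb01) \<longlonglongrightarrow> 0"
  proof (rule riesz_convergence[OF p _ _ _ _ s])
    show "limsup (\<lambda>n. \<integral>\<^sup>+ w. ennreal (\<bar>rep_l2 (u (r (s n))) w\<bar> powr p) \<partial>leb01) \<le> (\<integral>\<^sup>+ w. ennreal (\<bar>rep_l2 x w\<bar> powr p) \<partial>leb01)"
      by (rule Limsup_bounded) (use le in \<open>auto simp: Np_def\<close>)
  qed (use int le in auto)
  then have "(\<lambda>n. Np p (u (r (s n)) - x)) \<longlonglongrightarrow> 0" by (simp add: Np_cong_AE[OF rep_diff])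
  then have "\<forall>\<^sub>F n in sequentially. Np p (u (r (s n)) - x) < e" using e(1) by (rule order_tendstoD)
  then obtain n where "Np p (u (r (s n)) - x) < e" by (auto dest: eventually_happens)
  then show False using r(1)[of "s n"] by simp
qed

section \<open>Contractivity of the projection in L^p\<close>

lemma powr_lipschitz:
  fixes a b q M :: real
  assumes q: "1 \<le> q" and ab: "0 \<le> a" "a \<le> b" "b \<le> M"
  shows "b powr q - a powr q \<le> q * M powr (q - 1) * (b - a)"
proof (cases "a = b")
  case False
  then have "a < b" using ab by simp
  moreover have "continuous_on {a..b} (\<lambda>x. x powr q)"
    using q ab by (intro continuous_on_powr' continuous_intros) auto
  moreover have "((\<lambda>x. x powr q) has_derivative (\<lambda>h. q * z powr (q - 1) * h)) (at z)" if "a < z" "z < b" for z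
    using has_real_derivative_powr[of z q] ab that unfolding has_field_derivative_def by simp
  ultimately obtain z where z: "a < z" "z < b" "b powr q - a powr q = q * z powr (q - 1) * (b - a)"
    using mvt[of a b "\<lambda>x. x powr q" "\<lambda>z h. q * z powr (q - 1) * h"] by auto
  have "q * z powr (q - 1) * (b - a) \<le> q * M powr (q - 1) * (b - a)"
    using z ab q by (intro mult_right_mono mult_left_mono powr_mono2) auto
  then show ?thesis using z by simp
qed simp

lemma spow_lipschitz:
  fixes a b q M :: real
  assumes q: "1 \<le> q" and ab: "- M \<le> a" "a \<le> b" "b \<le> M"
  shows "0 \<le> spow q b - spow q a" "spow q b - spow q a \<le> q * M powr (q - 1) * (b - a)"
proof -
  have pos: "0 \<le> spow q b - spow q a \<and> spow q b - spow q a \<le> q * M powr (q - 1) * (b - a)"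
    if "0 \<le> a" "a \<le> b" "b \<le> M" for a b
    using powr_lipschitz[OF q that] that powr_mono2[of q a b] q by (simp add: spow_nonneg_eq)
  consider "0 \<le> a" | "b \<le> 0" | "a \<le> 0" "0 \<le> b" by linarith
  then have "0 \<le> spow q b - spow q a \<and> spow q b - spow q a \<le> q * M powr (q - 1) * (b - a)"
  proof cases
    case 1 then show ?thesis using pos ab by simp
  next
    case 2 then show ?thesis using pos[of "- b" "- a"] ab by (simp add: spow_minus)
  next
    case 3
    have "spow q 0 = 0" by (simp add: spow_def)
    then show ?thesis using pos[of 0 b] pos[of 0 "- a"] ab 3 by (simp add: spow_minus algebra_simps)
  qed
  then show "0 \<le> spow q b - spow q a" "spow q b - spow q a \<le> q * M powr (q - 1) * (b - a)" by auto
qed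

lemma powr_above_tangent:
  assumes p: "1 \<le> p"
  shows "\<bar>c\<bar> powr p + p * spow (p - 1) c * (x - c) \<le> \<bar>x\<bar> powr p"
proof -
  have pos: "c powr p + p * c powr (p - 1) * (x - c) \<le> \<bar>x\<bar> powr p" if c: "0 < c" for c x :: real
  proof -
    have cp: "c powr p = c powr (p - 1) * c" using c p by (simp add: powr_split)
    consider "x \<le> 0" | "0 < x" "x < c" | "x = c" | "c < x" by linarith
    then show ?thesis
    proof cases
      case 1
      have "c powr p + p * c powr (p - 1) * (x - c) = c powr (p - 1) * (c - p * c + p * x)"
        unfolding cp by (simp add: algebra_simps)
      also have "\<dots> \<le> 0"
      proof (rule mult_nonneg_nonpos)
        have "1 * c \<le> p * c" using c p by (intro mult_right_mono) auto
        moreover have "p * x \<le> 0" using 1 p by (intro mult_nonneg_nonpos) auto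
        ultimately show "c - p * c + p * x \<le> 0" by simp
      qed simp
      finally show ?thesis by (rule order_trans) simp
    next
      case 2
      have "c powr p - x powr p \<le> p * c powr (p - 1) * (c - x)" using 2 by (intro powr_lipschitz p) auto
      then show ?thesis using 2 by (simp add: algebra_simps)
    next
      case 4
      have "((\<lambda>x. x powr p) has_derivative (\<lambda>h. p * z powr (p - 1) * h)) (at z)" if "c < z" for z
        using has_real_derivative_powr[of z p] c that unfolding has_field_derivative_def by simp
      moreover have "continuous_on {c..x} (\<lambda>x. x powr p)" using c by (intro continuous_on_powr continuous_intros) auto
      ultimately obtain z where z: "c < z" "z < x" "x powr p - c powr p = p * z powr (p - 1) * (x - c)"
        using mvt[of c x "\<lambda>x. x powr p" "\<lambda>z h. p * z powr (p - 1) * h"] 4 by auto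
      have "p * c powr (p - 1) * (x - c) \<le> p * z powr (p - 1) * (x - c)"
        using z c p by (intro mult_right_mono mult_left_mono powr_mono2) auto
      then show ?thesis using z c by simp
    qed (use c in simp)
  qed
  consider "0 < c" | "c = 0" | "c < 0" by linarith
  then show ?thesis
  proof cases
    case 1 then show ?thesis using pos[of c x] by (simp add: spow_nonneg_eq)
  next
    case 3
    have "spow (p - 1) c = - ((- c) powr (p - 1))" using 3 by (simp add: spow_def)
    then show ?thesis using pos[of "- c" "- x"] 3 by (simp add: algebra_simps)
  qed (simp add: spow_def)
qed

text \<open>
  Contractivity of the projection in \<open>L\<^sup>p\<close>: a Lipschitz increasing function of \<open>X1 - X2\<close> is an
  admissible perturbation of \<open>X1\<close> and, with the opposite sign, of \<open>X2\<close>.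
\<close>

lemma proj_K2_Np_contraction:
  assumes p: "2 \<le> p"
  shows "Np p (proj K2 a - proj K2 b) \<le> Np p (a - b)"
proof (cases "Np p (a - b) < \<infinity>")
  case True
  let ?x = "proj K2 a" and ?y = "proj K2 b"
  obtain X where X: "mono_on {0<..<1} X" "X \<in> L2" "?x = cls X" "ae_eq (rep_l2 ?x) X"
    using proj_in[OF K2_closed_cone] by (rule K2_E)
  obtain Y where Y: "mono_on {0<..<1} Y" "Y \<in> L2" "?y = cls Y" "ae_eq (rep_l2 ?y) Y"
    using proj_in[OF K2_closed_cone] by (rule K2_E)
  define D where "D w = X w - Y w" for w
  define A where "A w = rep_l2 (a - b) w" for w
  have D2: "D \<in> L2" unfolding D_def by (intro L2_diff X Y)
  have A2: "A \<in> L2" by (simp add: A_def[abs_def])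
  note [measurable] = L2_measurable[OF D2] L2_measurable[OF A2] L2_measurable[OF X(2)] L2_measurable[OF Y(2)]
  have Ap: "integrable leb01 (\<lambda>w. \<bar>A w\<bar> powr p)"
    unfolding integrable_iff_bounded
  proof
    show "(\<lambda>w. \<bar>A w\<bar> powr p) \<in> borel_measurable leb01" by measurable
  qed (use True in \<open>simp add: Np_def A_def\<close>)
  \<comment> \<open>Truncation keeps the perturbation bounded and Lipschitz; it is removed at the
    end by Fatou.\<close>
  define c where "c M t = max (- real M) (min (real M) t)" for M :: nat and t
  have c_meas [measurable]: "c M \<in> borel_measurable borel" for M unfolding c_def by measurable
  have c_bound: "\<bar>c M t\<bar> \<le> real M" for M t unfolding c_def by linarith
  have main: "(\<integral>\<^sup>+ w. ennreal (\<bar>c M (D w)\<bar> powr p) \<partial>leb01) \<le> Np p (a - b)" if M: "0 < M" for M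
  proof -
    define F where "F w = spow (p - 1) (c M (D w))" for w
    have F_bound: "\<bar>F w\<bar> \<le> real M powr (p - 1)" for w
      unfolding F_def abs_spow using c_bound p by (intro powr_mono2) auto
    have F2: "F \<in> L2" by (rule L2_bounded[OF _ F_bound]) (simp add: F_def[abs_def])
    note [measurable] = L2_measurable[OF F2]
    \<comment> \<open>A Lipschitz constant of \<open>spow (p - 1)\<close> on [-M, M]; the exponent p
      - 1 \<ge> 1 keeps it finite near 0.\<close>
    define L where "L = (p - 1) * real M powr (p - 1 - 1)"
    have L: "0 < L" using p M by (simp add: L_def)
    have F_inc: "0 \<le> F t - F s \<and> F t - F s \<le> L * (D t - D s)" if "D s \<le> D t" for s t
    proof -
      have cc: "- real M \<le> c M (D s)" "c M (D s) \<le> c M (D t)" "c M (D t) \<le> real M" "c M (D t) - c M (D s) \<le> D t - D s"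
        using that unfolding c_def by linarith+
      have "F t - F s \<le> L * (c M (D t) - c M (D s))"
        unfolding F_def L_def using p cc by (intro spow_lipschitz) auto
      also have "\<dots> \<le> L * (D t - D s)" using L cc by (intro mult_left_mono) auto
      finally show ?thesis using spow_lipschitz(1)[of "p - 1" "real M" "c M (D s)" "c M (D t)"] p cc by (simp add: F_def)
    qed
    let ?f = "\<lambda>w. (1 / L) * F w"
    have f2: "?f \<in> L2" by (intro L2_cmult F2)
    \<comment> \<open>The perturbation rises only where D = X - Y does, and by no more; so both X -
      ?f and Y + ?f remain nondecreasing.\<close>
    have fi: "?f t - ?f s \<le> max 0 (D t - D s)" for s t
    proof -
      have eq: "?f t - ?f s = (F t - F s) / L" by (simp add: diff_divide_distrib)
      show ?thesis
      proof (cases "D s \<le> D t")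
        case True
        then have "(F t - F s) / L \<le> D t - D s" using F_inc[OF True] L by (simp add: divide_le_eq mult.commute)
        then show ?thesis unfolding eq by linarith
      next
        case False
        then have "F t - F s \<le> 0" using F_inc[of t s] by simp
        then have "(F t - F s) / L \<le> 0" using L by (simp add: divide_le_0_iff)
        then show ?thesis unfolding eq by linarith
      qed
    qed
    have K1: "cls (\<lambda>w. X w - ?f w) \<in> K2"
    proof (rule cls_in_K2[OF L2_diff[OF X(2) f2] mono_onI])
      fix s t :: real assume st: "s \<in> {0<..<1}" "t \<in> {0<..<1}" "s \<le> t"
      have "X s \<le> X t" "Y s \<le> Y t" using st mono_onD[OF X(1)] mono_onD[OF Y(1)] by auto
      then show "X s - ?f s \<le> X t - ?f t" using fi[of t s] unfolding D_def by linarith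
    qed
    have K2: "cls (\<lambda>w. Y w + ?f w) \<in> K2"
    proof (rule cls_in_K2[OF L2_add[OF Y(2) f2] mono_onI])
      fix s t :: real assume st: "s \<in> {0<..<1}" "t \<in> {0<..<1}" "s \<le> t"
      have "X s \<le> X t" "Y s \<le> Y t" using st mono_onD[OF X(1)] mono_onD[OF Y(1)] by auto
      then show "Y s + ?f s \<le> Y t + ?f t" using fi[of s t] unfolding D_def by linarith
    qed
    have n1: "a - ?x \<in> normal_cone K2 ?x" and n2: "b - ?y \<in> normal_cone K2 ?y"
      by (rule proj_normal[OF K2_closed_cone])+
    have "0 \<le> inner (a - ?x) (cls ?f)"
      using normal_coneD(2)[OF n1 K1] normal_coneD(1)[OF n1] unfolding cls_diff[OF X(2) f2, symmetric] X(3)[symmetric]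
      by (simp add: inner_diff_right)
    moreover have "inner (b - ?y) (cls ?f) \<le> 0"
      using normal_coneD(2)[OF n2 K2] normal_coneD(1)[OF n2] unfolding cls_add[OF Y(2) f2, symmetric] Y(3)[symmetric]
      by (simp add: inner_add_right)
    ultimately have "0 \<le> inner ((a - ?x) - (b - ?y)) (cls ?f)" by (simp add: inner_diff_left)
    also have "(a - ?x) - (b - ?y) = (a - b) - cls D" unfolding D_def cls_diff[OF X(2) Y(2), symmetric] X(3) Y(3) by simp
    also have "\<dots> = cls (\<lambda>w. A w - D w)" using cls_diff[OF A2 D2] by (simp add: A_def[abs_def])
    also have "inner \<dots> (cls ?f) = (1 / L) * (\<integral>w. (A w - D w) * F w \<partial>leb01)"
      unfolding inner_cls[OF L2_diff[OF A2 D2] f2]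
      by (subst integral_mult_right_zero[symmetric]) (simp add: mult.left_commute)
    finally have orth: "0 \<le> (\<integral>w. (A w - D w) * F w \<partial>leb01)"
      using L by (simp add: zero_le_divide_iff)
    \<comment> \<open>The tangent inequality at the truncated value. Replacing this value by
      \<open>D w\<close> in the linear term goes in the right direction, because \<open>F w\<close>
      and D w - c M (D w) never have opposite signs.\<close>
    have pt: "\<bar>c M (D w)\<bar> powr p + p * ((A w - D w) * F w) \<le> \<bar>A w\<bar> powr p" for w
    proof -
      have "\<bar>c M (D w)\<bar> powr p + p * F w * (A w - c M (D w)) \<le> \<bar>A w\<bar> powr p"
        unfolding F_def using p by (intro powr_above_tangent) auto
      moreover have "0 \<le> p * F w * (D w - c M (D w))"
      proof -
        have "0 \<le> F w * (D w - c M (D w))"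
        proof (cases "\<bar>D w\<bar> \<le> real M")
          case True
          then have "c M (D w) = D w" unfolding c_def by linarith
          then show ?thesis by simp
        next
          case False
          then consider "real M < D w" "c M (D w) = real M" | "D w < - real M" "c M (D w) = - real M"
            unfolding c_def by linarith
          then show ?thesis
            by cases (auto simp: F_def spow_def intro!: mult_nonneg_nonneg mult_nonneg_nonpos)
        qed
        then show ?thesis using p by (simp add: mult.assoc)
      qed
      ultimately show ?thesis by (simp add: algebra_simps)
    qed
    have i1: "integrable leb01 (\<lambda>w. (A w - D w) * F w)" by (intro L2_mult_integrable L2_diff A2 D2 F2)
    have i2: "integrable leb01 (\<lambda>w. \<bar>c M (D w)\<bar> powr p)"
      by (rule leb01.integrable_const_bound[where B = "real M powr p"])
        (use c_bound p in \<open>auto intro!: powr_mono2\<close>)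
    have "(\<integral>w. \<bar>c M (D w)\<bar> powr p \<partial>leb01) \<le> (\<integral>w. \<bar>c M (D w)\<bar> powr p \<partial>leb01) + p * (\<integral>w. (A w - D w) * F w \<partial>leb01)"
      using orth p by simp
    also have "\<dots> = (\<integral>w. \<bar>c M (D w)\<bar> powr p + p * ((A w - D w) * F w) \<partial>leb01)" using i1 i2 by simp
    also have "\<dots> \<le> (\<integral>w. \<bar>A w\<bar> powr p \<partial>leb01)" by (intro integral_mono Ap pt) (use i1 i2 in auto)
    finally have "ennreal (\<integral>w. \<bar>c M (D w)\<bar> powr p \<partial>leb01) \<le> ennreal (\<integral>w. \<bar>A w\<bar> powr p \<partial>leb01)" by (rule ennreal_leI)
    also have "\<dots> = Np p (a - b)" unfolding Np_def using Ap by (subst nn_integral_eq_integral) (auto simp: A_def)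
    finally show ?thesis using i2 by (subst nn_integral_eq_integral) auto
  qed
  have "Np p (?x - ?y) = (\<integral>\<^sup>+ w. ennreal (\<bar>D w\<bar> powr p) \<partial>leb01)"
    unfolding X(3) Y(3) cls_diff[OF X(2) Y(2)] D_def[symmetric] using Np_cls[OF D2] by simp
  also have "\<dots> = (\<integral>\<^sup>+ w. liminf (\<lambda>M. ennreal (\<bar>c (Suc M) (D w)\<bar> powr p)) \<partial>leb01)"
  proof (intro nn_integral_cong)
    fix w
    obtain N where N: "\<bar>D w\<bar> \<le> real N" using real_arch_simple by blast
    have "ennreal (\<bar>c (Suc M) (D w)\<bar> powr p) = ennreal (\<bar>D w\<bar> powr p)" if "N \<le> M" for M
    proof -
      have "\<bar>D w\<bar> \<le> real (Suc M)" using N that by linarith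
      then have "c (Suc M) (D w) = D w" unfolding c_def by linarith
      then show ?thesis by simp
    qed
    then have "(\<lambda>M. ennreal (\<bar>c (Suc M) (D w)\<bar> powr p)) \<longlonglongrightarrow> ennreal (\<bar>D w\<bar> powr p)"
      by (intro tendsto_eventually eventually_sequentiallyI[of N])
    then show "ennreal (\<bar>D w\<bar> powr p) = liminf (\<lambda>M. ennreal (\<bar>c (Suc M) (D w)\<bar> powr p))"
      by (intro lim_imp_Liminf[symmetric]) auto
  qed
  also have "\<dots> \<le> liminf (\<lambda>M. \<integral>\<^sup>+ w. ennreal (\<bar>c (Suc M) (D w)\<bar> powr p) \<partial>leb01)"
    by (intro nn_integral_liminf) measurable
  also have "\<dots> \<le> Np p (a - b)"
    by (rule order_trans[OF Liminf_le_Limsup Limsup_bounded]) (auto intro!: always_eventually main)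
  finally show ?thesis .
qed (simp add: not_less top_unique)

section \<open>The Lagrangian flow\<close>

lemma AE_leb01_countable: "countable C \<Longrightarrow> AE w in leb01. w \<notin> C"
proof -
  assume "countable C"
  then have "AE w in lborel. w \<notin> C" by (intro AE_not_in countable_imp_null_set_lborel)
  then show ?thesis unfolding leb01_def by (subst AE_restrict_space_iff) auto
qed

text \<open>Where \<open>Z\<close> is continuous the two bounds meet, and a monotone function has at
  most countably many other points.\<close>

lemma ae_eq_if_sandwiched:
  fixes X Z :: "real \<Rightarrow> real"
  assumes Z: "mono_on {0<..<1} Z" and low: "\<And>w. w \<in> {0<..<1} \<Longrightarrow> Z w \<le> X w"
    and up: "\<And>w w'. w \<in> {0<..<1} \<Longrightarrow> w < w' \<Longrightarrow> w' < 1 \<Longrightarrow> X w \<le> Z w'"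
  shows "ae_eq X Z"
proof -
  let ?C = "{w \<in> {0<..<1}. \<not> continuous (at w within {0<..<1}) Z}"
  have "AE w in leb01. w \<notin> ?C" by (intro AE_leb01_countable mono_on_ctble_discont Z)
  then show ?thesis
    unfolding ae_eq_def using AE_space
  proof eventually_elim
    fix w assume w: "w \<notin> ?C" "w \<in> space leb01"
    then have c: "(Z \<longlongrightarrow> Z w) (at w within {0<..<1})" and w01: "w \<in> {0<..<1}" by (auto simp: continuous_within)
    show "X w = Z w"
    proof (rule ccontr)
      assume "X w \<noteq> Z w"
      then have "Z w < X w" using low[OF w01] by simp
      from order_tendstoD(2)[OF c this] obtain d where d: "0 < d" "\<And>x. x \<in> {0<..<1} \<Longrightarrow> x \<noteq> w \<Longrightarrow> dist x w < d \<Longrightarrow> Z x < X w"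
        unfolding eventually_at by blast
      define x where "x = w + min (d / 2) ((1 - w) / 2)"
      have x: "w < x" "x < 1" "dist x w < d" using d w01 by (auto simp: x_def dist_real_def min_def field_simps)
      then show False using d(2)[of x] up[OF w01, of x] w01 by auto
    qed
  qed
qed

lemma right_continuous_version:
  fixes Z :: "real \<Rightarrow> real"
  assumes Z: "mono_on {0<..<1} Z"
  shows "\<exists>X. mono_on {0<..<1} X \<and> (\<forall>w\<in>{0<..<1}. continuous (at_right w) X) \<and> ae_eq X Z"
proof -
  define X where "X w = Inf (Z ` {w<..<1})" for w
  have bdd: "bdd_below (Z ` {w<..<1})" if "w \<in> {0<..<1}" for w
    using that by (intro bdd_belowI2[of _ "Z w"]) (auto intro!: mono_onD[OF Z])
  have low: "Z w \<le> X w" if "w \<in> {0<..<1}" for w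
    unfolding X_def using that by (intro cINF_greatest) (auto intro!: mono_onD[OF Z])
  have up: "X w \<le> Z w'" if "w \<in> {0<..<1}" "w < w'" "w' < 1" for w w'
    unfolding X_def using that by (intro cINF_lower bdd) auto
  have mono: "X w \<le> X w'" if "w \<in> {0<..<1}" "w' \<in> {0<..<1}" "w \<le> w'" for w w'
    unfolding X_def using that by (intro cINF_superset_mono bdd) auto
  have cont: "continuous (at_right w) X" if w: "w \<in> {0<..<1}" for w
    unfolding continuous_within
  proof (rule order_tendstoI)
    fix a assume "a < X w"
    then have "a < X w'" if "w < w'" "w' < 1" for w' using mono[of w w'] w that by simp
    then show "\<forall>\<^sub>F w' in at_right w. a < X w'" using w by (auto simp: eventually_at_right_field intro!: exI[of _ 1])
  next
    fix a assume "X w < a"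
    then obtain w1 where w1: "w < w1" "w1 < 1" "Z w1 < a"
      unfolding X_def using w by (subst (asm) cInf_less_iff) (auto simp: bdd)
    then have "X w' < a" if "w < w'" "w' < w1" for w' using up[of w' w1] w that by simp
    then show "\<forall>\<^sub>F w' in at_right w. X w' < a" using w1 by (auto simp: eventually_at_right_field)
  qed
  have "ae_eq X Z" by (rule ae_eq_if_sandwiched[OF Z low up])
  then show ?thesis using mono cont by (intro exI[of _ X]) (auto intro: mono_onI)
qed

text \<open>\<open>proj_K\<close> chooses a right-continuous nearest element, so one must exist: the
  right-continuous version of a representative of \<open>proj K2 (cls Y)\<close>. Every admissible
  choice lies in that class, since the nearest element is unique.\<close>

lemma proj_K_props:
  assumes Y: "Y \<in> L2"
  shows "proj_K Y \<in> cone_K" "mono_on {0<..<1} (proj_K Y)" "cls (proj_K Y) = proj K2 (cls Y)"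
proof -
  let ?P = "\<lambda>X. X \<in> cone_K \<and> mono_on {0<..<1} X \<and> (\<forall>w\<in>{0<..<1}. continuous (at_right w) X) \<and>
      (\<forall>Z\<in>cone_K. L2_dist Y X \<le> L2_dist Y Z)"
  obtain Z where Z: "mono_on {0<..<1} Z" "Z \<in> L2" "proj K2 (cls Y) = cls Z"
    using proj_in[OF K2_closed_cone] by (rule K2_E)
  obtain X where X: "mono_on {0<..<1} X" "\<forall>w\<in>{0<..<1}. continuous (at_right w) X" "ae_eq X Z"
    using right_continuous_version[OF Z(1)] by blast
  have X2: "X \<in> L2" using L2_cong_AE[OF Z(2) mono_on_measurable_leb01[OF X(1)] ae_eq_sym[OF X(3)]] .
  have XK: "X \<in> cone_K" using X X2 by (auto simp: cone_K_def)
  have eq: "cls X = proj K2 (cls Y)" using X(3) X2 Z by (simp add: cls_eq_iff)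
  have "L2_dist Y X \<le> L2_dist Y W" if W: "W \<in> cone_K" for W
    using proj_nearest[OF K2_closed_cone, of "cls W" "cls Y"] W
    by (simp add: L2_dist_cls Y X2 cone_K_L2 eq cls_K2_iff)
  then have "?P X" using X XK by blast
  then have P: "?P (proj_K Y)" unfolding proj_K_def by (rule someI[of ?P])
  then show "proj_K Y \<in> cone_K" "mono_on {0<..<1} (proj_K Y)" by auto
  then have pL2: "proj_K Y \<in> L2" by (simp add: cone_K_L2)
  show "cls (proj_K Y) = proj K2 (cls Y)"
  proof (rule nearest_imp_proj[OF K2_closed_cone])
    show "cls (proj_K Y) \<in> K2" using P by (simp add: cls_K2_iff pL2)
    fix z assume "z \<in> K2"
    then obtain W where "W \<in> cone_K" "z = cls W" by (auto simp: K2_def)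
    then show "norm (cls Y - cls (proj_K Y)) \<le> norm (cls Y - z)"
      using P by (auto simp: L2_dist_cls Y pL2 cone_K_L2)
  qed
qed

section \<open>Curves of functions as curves in the Hilbert space\<close>

lemma has_L2_deriv_iff:
  assumes Y: "Y t \<in> L2" "\<forall>\<^sub>F h in F. Y (t + h) \<in> L2"
  shows "has_L2_deriv Y D t F \<longleftrightarrow> D \<in> L2 \<and> ((\<lambda>h. (1/h) *\<^sub>R (cls (Y (t + h)) - cls (Y t))) \<longlongrightarrow> cls D) F"
proof (cases "D \<in> L2")
  case True
  have eq: "\<forall>\<^sub>F h in F. L2_dist (\<lambda>w. (Y (t + h) w - Y t w) / h) D = norm ((1/h) *\<^sub>R (cls (Y (t + h)) - cls (Y t)) - cls D)"
    using Y(2)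
  proof eventually_elim
    fix h assume h: "Y (t + h) \<in> L2"
    have d: "(\<lambda>w. Y (t + h) w - Y t w) \<in> L2" by (intro L2_diff h Y)
    have "cls (\<lambda>w. (Y (t + h) w - Y t w) / h) = (1/h) *\<^sub>R (cls (Y (t + h)) - cls (Y t))"
      unfolding cls_diff[OF h Y(1)] cls_scaleR[OF d] by simp
    then show "L2_dist (\<lambda>w. (Y (t + h) w - Y t w) / h) D = norm ((1/h) *\<^sub>R (cls (Y (t + h)) - cls (Y t)) - cls D)"
      by (simp only: L2_dist_cls[OF L2_divide[OF d] True])
  qed
  show ?thesis
    unfolding has_L2_deriv_def tendsto_cong[OF eq] tendsto_norm_zero_iff Lim_null[of _ "cls D"] using True by simp
qed (simp add: has_L2_deriv_def)

lemma has_vector_derivative_iff_quotient: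
  fixes y :: "real \<Rightarrow> 'a::real_normed_vector"
  shows "(y has_vector_derivative D) (at t) \<longleftrightarrow> ((\<lambda>h. (1/h) *\<^sub>R (y (t + h) - y t)) \<longlongrightarrow> D) (at 0)"
proof -
  have "norm (y (t + h) - y t - h *\<^sub>R D) / norm h = norm ((1/h) *\<^sub>R (y (t + h) - y t) - D)" if "h \<noteq> 0" for h
  proof -
    have "y (t + h) - y t - h *\<^sub>R D = h *\<^sub>R ((1/h) *\<^sub>R (y (t + h) - y t) - D)" using that by (simp add: scaleR_diff_right)
    then have "norm (y (t + h) - y t - h *\<^sub>R D) = \<bar>h\<bar> * norm ((1/h) *\<^sub>R (y (t + h) - y t) - D)" by (metis norm_scaleR)
    then show ?thesis using that by simp
  qed
  then have "\<forall>\<^sub>F h in at 0. norm (y (t + h) - y t - h *\<^sub>R D) / norm h = norm ((1/h) *\<^sub>R (y (t + h) - y t) - D)"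
    by (auto simp: eventually_at intro!: exI[of _ 1])
  note c = tendsto_cong[OF this]
  show ?thesis
    unfolding has_vector_derivative_def has_derivative_at c tendsto_norm_zero_iff Lim_null[of _ D]
    by (simp add: bounded_linear_scaleR_left)
qed

lemma subdiff_iff_normal_cone:
  assumes \<xi>: "\<xi> \<in> L2" and X: "X \<in> L2"
  shows "\<xi> \<in> subdiff_I_K X \<longleftrightarrow> cls X \<in> K2 \<and> cls \<xi> \<in> normal_cone K2 (cls X)"
proof -
  have i: "(\<integral>w. \<xi> w * (Z w - X w) \<partial>leb01) = inner (cls \<xi>) (cls Z - cls X)" if "Z \<in> L2" for Z
    using that by (simp add: cls_diff X inner_cls \<xi> L2_diff)
  have "\<xi> \<in> subdiff_I_K X \<longleftrightarrow> cls X \<in> K2 \<and> (\<forall>z\<in>K2. inner (cls \<xi>) (z - cls X) \<le> 0)"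
    using \<xi> by (auto simp: subdiff_I_K_def K2_def cls_K2_iff[OF X, unfolded K2_def] i cone_K_L2)
  also have "\<dots> \<longleftrightarrow> cls X \<in> K2 \<and> cls \<xi> \<in> normal_cone K2 (cls X)"
  proof (intro conj_cong refl iffI)
    assume x: "cls X \<in> K2" and le: "\<forall>z\<in>K2. inner (cls \<xi>) (z - cls X) \<le> 0"
    \<comment> \<open>Testing with 0 and 2 X extracts orthogonality from the inequality form of the
      subdifferential.\<close>
    have "0 \<in> K2" "2 *\<^sub>R cls X \<in> K2" using K2_closed_cone x by (auto simp: closed_cone_def)
    then have "inner (cls \<xi>) (0 - cls X) \<le> 0" "inner (cls \<xi>) (2 *\<^sub>R cls X - cls X) \<le> 0" using le by blast+
    then have "inner (cls \<xi>) (cls X) = 0" by (simp add: inner_diff_right)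
    moreover have "inner (cls \<xi>) z \<le> 0" if "z \<in> K2" for z
      using le that calculation by (fastforce simp: inner_diff_right)
    ultimately show "cls \<xi> \<in> normal_cone K2 (cls X)" by (simp add: normal_cone_def)
  qed (auto simp: normal_cone_def inner_diff_right)
  finally show ?thesis .
qed

lemma loc_abs_cont_L2_iff:
  "loc_abs_cont_L2 Y \<longleftrightarrow> (\<forall>t\<ge>0. Y t \<in> L2) \<and> abs_cont_curve (\<lambda>t. cls (Y t))"
proof (cases "\<forall>t\<ge>0. Y t \<in> L2")
  case True
  have eq: "(fine_intervals 0 T d n a b \<longrightarrow> (\<Sum>i<n. L2_dist (Y (b i)) (Y (a i))) < e) \<longleftrightarrow>
      (fine_intervals 0 T d n a b \<longrightarrow> (\<Sum>i<n. norm (cls (Y (b i)) - cls (Y (a i)))) < e)" for n a b T d e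
  proof (rule imp_cong[OF refl])
    assume "fine_intervals 0 T d n a b"
    then have "(\<Sum>i<n. L2_dist (Y (b i)) (Y (a i))) = (\<Sum>i<n. norm (cls (Y (b i)) - cls (Y (a i))))"
      using True by (intro sum.cong refl L2_dist_cls) (auto simp: fine_intervals_def)
    then show "(\<Sum>i<n. L2_dist (Y (b i)) (Y (a i))) < e \<longleftrightarrow> (\<Sum>i<n. norm (cls (Y (b i)) - cls (Y (a i)))) < e" by simp
  qed
  have "loc_abs_cont_L2 Y \<longleftrightarrow> (\<forall>T>0. \<forall>e>0. \<exists>d>0. \<forall>n a b. fine_intervals 0 T d n a b
      \<longrightarrow> (\<Sum>i<n. L2_dist (Y (b i)) (Y (a i))) < e)"
    using True by (simp add: loc_abs_cont_L2_def fine_intervals_def)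
  then show ?thesis unfolding abs_cont_curve_def eq using True by blast
qed (auto simp: loc_abs_cont_L2_def)

definition lag_data :: "(real \<Rightarrow> real) \<Rightarrow> (real \<Rightarrow> real) \<Rightarrow> bool" where
  "lag_data X V \<longleftrightarrow> X \<in> L2 \<and> V \<in> L2 \<and> cls X \<in> K2 \<and> cls V \<in> H2 (cls X)"

lemma H2_cls_iff:
  assumes "X \<in> L2" "V \<in> L2"
  shows "cls V \<in> H2 (cls X) \<longleftrightarrow> (\<exists>v\<in>borel_measurable borel. ae_eq V (v \<circ> X))"
proof -
  have "ae_eq (rep_l2 (cls V)) (v \<circ> rep_l2 (cls X)) \<longleftrightarrow> ae_eq V (v \<circ> X)" for v
  proof
    assume "ae_eq (rep_l2 (cls V)) (v \<circ> rep_l2 (cls X))"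
    with rep_cls[OF assms(1)] rep_cls[OF assms(2)] show "ae_eq V (v \<circ> X)"
      unfolding ae_eq_def by eventually_elim simp
  next
    assume "ae_eq V (v \<circ> X)"
    with rep_cls[OF assms(1)] rep_cls[OF assms(2)] show "ae_eq (rep_l2 (cls V)) (v \<circ> rep_l2 (cls X))"
      unfolding ae_eq_def by eventually_elim simp
  qed
  then show ?thesis by (simp add: H2_def)
qed

lemma X_space_iff:
  assumes p: "2 \<le> p"
  shows "(X, V) \<in> X_space p \<longleftrightarrow> lag_data X V \<and> Np p (cls X) < \<infinity> \<and> Np p (cls V) < \<infinity>"
proof
  assume *: "(X, V) \<in> X_space p"
  then have "X \<in> L2" "V \<in> L2" using Lp_subset_L2[OF p] by (auto simp: X_space_def)
  with * show "lag_data X V \<and> Np p (cls X) < \<infinity> \<and> Np p (cls V) < \<infinity>"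
    using Lp_iff_Np[of X p] Lp_iff_Np[of V p] by (auto simp: X_space_def lag_data_def cls_K2_iff H2_cls_iff)
next
  assume *: "lag_data X V \<and> Np p (cls X) < \<infinity> \<and> Np p (cls V) < \<infinity>"
  then have L: "X \<in> L2" "V \<in> L2" by (auto simp: lag_data_def)
  obtain v where v: "v \<in> borel_measurable borel" "ae_eq V (v \<circ> X)"
    using * H2_cls_iff[OF L] by (auto simp: lag_data_def)
  \<comment> \<open>The factorisation through \<open>X\<close> yields the constancy on intervals
    that \<open>H_space\<close> demands.\<close>
  have "\<exists>c. AE w in leb01. w \<in> {a<..<b} \<longrightarrow> V w = c" if c: "AE w in leb01. w \<in> {a<..<b} \<longrightarrow> X w = c" for a b c
  proof (rule exI[of _ "v c"])
    show "AE w in leb01. w \<in> {a<..<b} \<longrightarrow> V w = v c"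
      using c v(2) unfolding ae_eq_def by eventually_elim auto
  qed
  then have "V \<in> H_space X" using L(2) by (auto simp: H_space_def)
  then show "(X, V) \<in> X_space p"
    using * v L Lp_iff_Np[of X p] Lp_iff_Np[of V p] by (auto simp: X_space_def lag_data_def cls_K2_iff)
qed

context
  fixes X0 V0 assumes data: "lag_data X0 V0"
begin

lemma data_L2: "X0 \<in> L2" "V0 \<in> L2" and x0_K2: "cls X0 \<in> K2" and v0_H2: "cls V0 \<in> H2 (cls X0)"
  using data by (auto simp: lag_data_def)

lemma lag_X_props:
  "lag_X X0 V0 t \<in> cone_K" "lag_X X0 V0 t \<in> L2" "mono_on {0<..<1} (lag_X X0 V0 t)"
  "cls (lag_X X0 V0 t) = flow K2 (cls X0) (cls V0) t"
proof -
  have m: "(\<lambda>w. t * V0 w) \<in> L2" by (intro L2_cmult data_L2)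
  have Y: "(\<lambda>w. X0 w + t * V0 w) \<in> L2" by (intro L2_add m data_L2)
  show "lag_X X0 V0 t \<in> cone_K" "mono_on {0<..<1} (lag_X X0 V0 t)" unfolding lag_X_def by (rule proj_K_props[OF Y])+
  then show "lag_X X0 V0 t \<in> L2" by (simp add: cone_K_L2)
  have "(cls X0) + t *\<^sub>R (cls V0) = cls (\<lambda>w. X0 w + t * V0 w)"
    unfolding cls_scaleR[OF data_L2(2)] by (rule cls_add[OF data_L2(1) m])
  then show "cls (lag_X X0 V0 t) = flow K2 (cls X0) (cls V0) t"
    unfolding lag_X_def flow_def using proj_K_props(3)[OF Y] by simp
qed

lemma lag_X_deriv_iff:
  "has_L2_deriv (lag_X X0 V0) D t F \<longleftrightarrow> D \<in> L2 \<and>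
    ((\<lambda>h. (1/h) *\<^sub>R (flow K2 (cls X0) (cls V0) (t + h) - flow K2 (cls X0) (cls V0) t)) \<longlongrightarrow> cls D) F"
  by (subst has_L2_deriv_iff) (simp_all add: lag_X_props)

lemma lag_V_props:
  assumes t: "0 \<le> t"
  shows "has_L2_deriv (lag_X X0 V0) (lag_V X0 V0 t) t (at_right 0)" "lag_V X0 V0 t \<in> L2"
    "cls (lag_V X0 V0 t) = flow_vel K2 (cls X0) (cls V0) t"
proof -
  have "has_L2_deriv (lag_X X0 V0) (rep_l2 (flow_vel K2 (cls X0) (cls V0) t)) t (at_right 0)"
    unfolding lag_X_deriv_iff using sticky.flow_right_derivative[OF x0_K2 v0_H2 t] by simp
  then show d: "has_L2_deriv (lag_X X0 V0) (lag_V X0 V0 t) t (at_right 0)"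
    unfolding lag_V_def L2_right_deriv_def
    by (rule someI[of "\<lambda>D. has_L2_deriv (lag_X X0 V0) D t (at_right 0)"])
  then show "lag_V X0 V0 t \<in> L2" by (simp add: lag_X_deriv_iff)
  show "cls (lag_V X0 V0 t) = flow_vel K2 (cls X0) (cls V0) t"
    using d sticky.flow_right_derivative[OF x0_K2 v0_H2 t] unfolding lag_X_deriv_iff
    by (auto intro: tendsto_unique[OF trivial_limit_at_right_real])
qed

lemma lag_flow_data: "0 \<le> t \<Longrightarrow> lag_data (lag_X X0 V0 t) (lag_V X0 V0 t)"
  unfolding lag_data_def lag_X_props(4)
  using sticky.flow_in[OF x0_K2 v0_H2] sticky.flow_vel_in_H[OF x0_K2 v0_H2]
  by (simp add: lag_X_props lag_V_props)

lemma lag_X_loc_abs_cont: "loc_abs_cont_L2 (lag_X X0 V0)"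
  unfolding loc_abs_cont_L2_iff lag_X_props(4) abs_cont_curve_def
proof (intro conjI allI impI lag_X_props)
  fix T e :: real assume e: "0 < e"
  \<comment> \<open>One is added so that the division makes sense when the velocity
    vanishes.\<close>
  let ?C = "norm (cls V0) + 1"
  have C: "0 < ?C" using norm_ge_zero[of "cls V0"] by linarith
  have "(\<Sum>i<n. norm (flow K2 (cls X0) (cls V0) (b i) - flow K2 (cls X0) (cls V0) (a i))) < e"
    if f: "fine_intervals 0 T (e / ?C) n a b" for n a b
  proof -
    have "(\<Sum>i<n. norm (flow K2 (cls X0) (cls V0) (b i) - flow K2 (cls X0) (cls V0) (a i))) \<le> (\<Sum>i<n. (b i - a i) * ?C)"
    proof (rule sum_mono)
      fix i assume "i \<in> {..<n}"
      then have ab: "a i \<le> b i" using f by (auto simp: fine_intervals_def)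
      have "norm (flow K2 (cls X0) (cls V0) (b i) - flow K2 (cls X0) (cls V0) (a i)) \<le> (b i - a i) * norm (cls V0)"
        using sticky.flow_norm_diff[OF x0_K2 v0_H2, of "b i" "a i"] ab by simp
      also have "\<dots> \<le> (b i - a i) * ?C" using ab by (intro mult_left_mono) auto
      finally show "norm (flow K2 (cls X0) (cls V0) (b i) - flow K2 (cls X0) (cls V0) (a i)) \<le> (b i - a i) * ?C" .
    qed
    also have "\<dots> = (\<Sum>i<n. b i - a i) * ?C" by (simp add: sum_distrib_right)
    also have "\<dots> < (e / ?C) * ?C" using f C by (intro mult_strict_right_mono) (auto simp: fine_intervals_def)
    also have "\<dots> = e" using C by simp
    finally show ?thesis .
  qed
  then show "\<exists>d>0. \<forall>n a b. fine_intervals 0 T d n a b \<longrightarrow> (\<Sum>i<n. norm (flow K2 (cls X0) (cls V0) (b i) - flow K2 (cls X0) (cls V0) (a i))) < e"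
    using e C by (intro exI[of _ "e / ?C"]) auto
qed

lemma lag_X_AE_derivative:
  "AE t in lborel. 0 < t \<longrightarrow> has_L2_deriv (lag_X X0 V0) (lag_V X0 V0 t) t (at 0)"
proof -
  have "AE t in lborel. t \<notin> {t. 0 < t \<and> \<not> isCont (\<lambda>s. norm (flow_vel K2 (cls X0) (cls V0) s)) t}"
    by (intro AE_not_in countable_imp_null_set_lborel sticky.countable_discont_norm_flow_vel x0_K2 v0_H2)
  then show ?thesis
  proof eventually_elim
    fix t assume t: "t \<notin> {t. 0 < t \<and> \<not> isCont (\<lambda>s. norm (flow_vel K2 (cls X0) (cls V0) s)) t}"
    show "0 < t \<longrightarrow> has_L2_deriv (lag_X X0 V0) (lag_V X0 V0 t) t (at 0)"
      using sticky.flow_two_sided_derivative[OF x0_K2 v0_H2, of t] t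
      by (auto simp: lag_X_deriv_iff lag_V_props)
  qed
qed

lemma curve_derivative:
  assumes Y: "\<And>t. 0 \<le> t \<Longrightarrow> Y t \<in> L2" and t: "0 < t"
  shows "has_L2_deriv Y D t (at 0) \<longleftrightarrow> D \<in> L2 \<and> ((\<lambda>t. cls (Y t)) has_vector_derivative cls D) (at t)"
proof -
  have "\<forall>\<^sub>F h in at 0. Y (t + h) \<in> L2"
    unfolding eventually_at using t by (intro exI[of _ t]) (auto simp: dist_real_def intro!: Y)
  then show ?thesis
    unfolding has_vector_derivative_iff_quotient using t Y by (intro has_L2_deriv_iff) auto
qed

lemma lag_X_unique_cauchy: "unique_curve (strong_solution_cauchy X0 V0) (lag_X X0 V0)"
proof -
  have sol: "strong_solution_cauchy X0 V0 (lag_X X0 V0)"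
    unfolding strong_solution_cauchy_def
  proof (intro conjI lag_X_loc_abs_cont)
    show "ae_eq (lag_X X0 V0 0) X0"
      using cls_eq_iff[OF lag_X_props(2) data_L2(1)] lag_X_props(4)[of 0] sticky.flow_0[OF x0_K2 v0_H2] by simp
    show "AE t in lborel. 0 < t \<longrightarrow> (\<exists>D. has_L2_deriv (lag_X X0 V0) D t (at 0) \<and>
        (\<lambda>w. V0 w - D w) \<in> subdiff_I_K (lag_X X0 V0 t))"
      using lag_X_AE_derivative
    proof eventually_elim
      fix t assume d: "0 < t \<longrightarrow> has_L2_deriv (lag_X X0 V0) (lag_V X0 V0 t) t (at 0)"
      show "0 < t \<longrightarrow> (\<exists>D. has_L2_deriv (lag_X X0 V0) D t (at 0) \<and> (\<lambda>w. V0 w - D w) \<in> subdiff_I_K (lag_X X0 V0 t))"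
      proof (intro impI exI conjI)
        assume t: "0 < t"
        then show "has_L2_deriv (lag_X X0 V0) (lag_V X0 V0 t) t (at 0)" using d by simp
        have V: "lag_V X0 V0 t \<in> L2" using t by (simp add: lag_V_props)
        have "(cls V0) - flow_vel K2 (cls X0) (cls V0) t \<in> normal_cone K2 (flow K2 (cls X0) (cls V0) t)"
          using t by (intro sticky.flow_vel_normal x0_K2 v0_H2) simp
        then show "(\<lambda>w. V0 w - lag_V X0 V0 t w) \<in> subdiff_I_K (lag_X X0 V0 t)"
          using t sticky.flow_in[OF x0_K2 v0_H2]
          by (simp add: subdiff_iff_normal_cone L2_diff V data_L2 lag_X_props lag_V_props flip: cls_diff)
      qed
    qed
  qed
  have conv: "AE t in lborel. 0 < t \<longrightarrow> (\<exists>D. ((\<lambda>t. cls (Y t)) has_vector_derivative D) (at t) \<and> cls (Y t) \<in> K2 \<and>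
      (cls V0) - D \<in> normal_cone K2 (cls (Y t)))" if Y: "strong_solution_cauchy X0 V0 Y" for Y
  proof -
    have L: "\<And>t. 0 \<le> t \<Longrightarrow> Y t \<in> L2" using Y by (auto simp: strong_solution_cauchy_def loc_abs_cont_L2_iff)
    have "AE t in lborel. 0 < t \<longrightarrow> (\<exists>D. has_L2_deriv Y D t (at 0) \<and> (\<lambda>w. V0 w - D w) \<in> subdiff_I_K (Y t))"
      using Y by (simp add: strong_solution_cauchy_def)
    then show ?thesis
    proof eventually_elim
      fix t assume *: "0 < t \<longrightarrow> (\<exists>D. has_L2_deriv Y D t (at 0) \<and> (\<lambda>w. V0 w - D w) \<in> subdiff_I_K (Y t))"
      show "0 < t \<longrightarrow> (\<exists>D. ((\<lambda>t. cls (Y t)) has_vector_derivative D) (at t) \<and> cls (Y t) \<in> K2 \<and>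
          (cls V0) - D \<in> normal_cone K2 (cls (Y t)))"
      proof
        assume t: "0 < t"
        then obtain D where D: "has_L2_deriv Y D t (at 0)" "(\<lambda>w. V0 w - D w) \<in> subdiff_I_K (Y t)" using * by blast
        then have D': "D \<in> L2" "((\<lambda>t. cls (Y t)) has_vector_derivative cls D) (at t)" using curve_derivative[OF L t] by auto
        then have "cls (Y t) \<in> K2 \<and> (cls V0) - cls D \<in> normal_cone K2 (cls (Y t))"
          using D(2) t L[of t] by (simp add: subdiff_iff_normal_cone L2_diff data_L2 cls_diff)
        then show "\<exists>D. ((\<lambda>t. cls (Y t)) has_vector_derivative D) (at t) \<and> cls (Y t) \<in> K2 \<and>
          (cls V0) - D \<in> normal_cone K2 (cls (Y t))" using D'(2) by blast
      qed
    qed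
  qed
  have "ae_eq (Y t) (lag_X X0 V0 t)" if Y: "strong_solution_cauchy X0 V0 Y" and t: "0 \<le> t" for Y t
  proof -
    have L: "\<And>t. 0 \<le> t \<Longrightarrow> Y t \<in> L2" using Y by (auto simp: strong_solution_cauchy_def loc_abs_cont_L2_iff)
    have "cls (Y t) = cls (lag_X X0 V0 t)"
    proof (rule gradient_solutions_unique[OF K2_closed_cone _ _ _ _ t, of "\<lambda>t. cls (Y t)" "\<lambda>t. cls (lag_X X0 V0 t)" "cls V0"])
      show "abs_cont_curve (\<lambda>t. cls (Y t))" "abs_cont_curve (\<lambda>t. cls (lag_X X0 V0 t))"
        using Y sol by (auto simp: strong_solution_cauchy_def loc_abs_cont_L2_iff)
      have "ae_eq (Y 0) X0" "ae_eq (lag_X X0 V0 0) X0" using Y sol by (auto simp: strong_solution_cauchy_def)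
      then show "cls (Y 0) = cls (lag_X X0 V0 0)"
        unfolding cls_eq_iff[OF L[OF order_refl] lag_X_props(2)] by (blast intro: ae_eq_trans ae_eq_sym)
    qed (use conv Y sol in auto)
    then show ?thesis by (simp only: cls_eq_iff[OF L[OF t] lag_X_props(2)])
  qed
  then show ?thesis using sol by (simp add: unique_curve_def)
qed

lemma initial_quotient:
  assumes L: "\<And>t. 0 \<le> t \<Longrightarrow> Y t \<in> L2"
  shows "((\<lambda>t. L2_dist (\<lambda>w. (Y t w - X0 w) / t) V0) \<longlongrightarrow> 0) (at_right 0)
    \<longleftrightarrow> ((\<lambda>t. (1/t) *\<^sub>R (cls (Y t) - (cls X0))) \<longlongrightarrow> (cls V0)) (at_right 0)"
proof -
  have "L2_dist (\<lambda>w. (Y t w - X0 w) / t) V0 = norm ((1/t) *\<^sub>R (cls (Y t) - (cls X0)) - (cls V0))" if "0 < t" for t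
  proof -
    have Y: "Y t \<in> L2" using L that by simp
    have d: "(\<lambda>w. Y t w - X0 w) \<in> L2" by (intro L2_diff Y data_L2)
    show ?thesis
      unfolding L2_dist_cls[OF L2_divide[OF d] data_L2(2)] cls_diff[OF Y data_L2(1)] cls_scaleR[OF d] by simp
  qed
  then have "\<forall>\<^sub>F t in at_right 0. L2_dist (\<lambda>w. (Y t w - X0 w) / t) V0 = norm ((1/t) *\<^sub>R (cls (Y t) - (cls X0)) - (cls V0))"
    by (auto simp: eventually_at_right_field intro!: exI[of _ 1])
  note c = tendsto_cong[OF this]
  show ?thesis unfolding c tendsto_norm_zero_iff Lim_null[of _ "cls V0"] ..
qed

lemma lag_X_unique_scaled: "unique_curve (strong_solution_scaled X0 V0) (lag_X X0 V0)"
proof -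
  have sol: "strong_solution_scaled X0 V0 (lag_X X0 V0)"
    unfolding strong_solution_scaled_def
  proof (intro conjI lag_X_loc_abs_cont)
    show "((\<lambda>t. L2_dist (\<lambda>w. (lag_X X0 V0 t w - X0 w) / t) V0) \<longlongrightarrow> 0) (at_right 0)"
      using sticky.flow_right_derivative[OF x0_K2 v0_H2, of 0] sticky.flow_vel_0[OF x0_K2 v0_H2] sticky.flow_0[OF x0_K2 v0_H2]
      by (subst initial_quotient) (simp_all add: lag_X_props)
    show "AE t in lborel. 0 < t \<longrightarrow> (\<exists>D. has_L2_deriv (lag_X X0 V0) D t (at 0) \<and>
        (\<lambda>w. lag_X X0 V0 t w - X0 w - t * D w) \<in> subdiff_I_K (lag_X X0 V0 t))"
      using lag_X_AE_derivative
    proof eventually_elim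
      fix t assume d: "0 < t \<longrightarrow> has_L2_deriv (lag_X X0 V0) (lag_V X0 V0 t) t (at 0)"
      show "0 < t \<longrightarrow> (\<exists>D. has_L2_deriv (lag_X X0 V0) D t (at 0) \<and>
        (\<lambda>w. lag_X X0 V0 t w - X0 w - t * D w) \<in> subdiff_I_K (lag_X X0 V0 t))"
      proof (intro impI exI conjI)
        assume t: "0 < t"
        then show "has_L2_deriv (lag_X X0 V0) (lag_V X0 V0 t) t (at 0)" using d by simp
        have V: "lag_V X0 V0 t \<in> L2" using t by (simp add: lag_V_props)
        have "flow K2 (cls X0) (cls V0) t - (cls X0) - t *\<^sub>R flow_vel K2 (cls X0) (cls V0) t \<in> normal_cone K2 (flow K2 (cls X0) (cls V0) t)"
          using t by (intro sticky.flow_scaled_normal x0_K2 v0_H2) simp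
        also have "flow K2 (cls X0) (cls V0) t - (cls X0) - t *\<^sub>R flow_vel K2 (cls X0) (cls V0) t = cls (\<lambda>w. lag_X X0 V0 t w - X0 w - t * lag_V X0 V0 t w)"
          using t V by (simp add: lag_X_props(4)[symmetric] lag_V_props(3)[symmetric] cls_diff cls_scaleR data_L2 lag_X_props(2) L2_diff L2_cmult)
        finally show "(\<lambda>w. lag_X X0 V0 t w - X0 w - t * lag_V X0 V0 t w) \<in> subdiff_I_K (lag_X X0 V0 t)"
          using sticky.flow_in[OF x0_K2 v0_H2]
          by (subst subdiff_iff_normal_cone) (simp_all add: L2_diff L2_cmult V data_L2 lag_X_props)
      qed
    qed
  qed
  have conv: "AE t in lborel. 0 < t \<longrightarrow> (\<exists>D. ((\<lambda>t. cls (Y t)) has_vector_derivative D) (at t) \<and> cls (Y t) \<in> K2 \<and>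
      cls (Y t) - (cls X0) - t *\<^sub>R D \<in> normal_cone K2 (cls (Y t)))" if Y: "strong_solution_scaled X0 V0 Y" for Y
  proof -
    have L: "\<And>t. 0 \<le> t \<Longrightarrow> Y t \<in> L2" using Y by (auto simp: strong_solution_scaled_def loc_abs_cont_L2_iff)
    have "AE t in lborel. 0 < t \<longrightarrow> (\<exists>D. has_L2_deriv Y D t (at 0) \<and> (\<lambda>w. Y t w - X0 w - t * D w) \<in> subdiff_I_K (Y t))"
      using Y by (simp add: strong_solution_scaled_def)
    then show ?thesis
    proof eventually_elim
      fix t assume *: "0 < t \<longrightarrow> (\<exists>D. has_L2_deriv Y D t (at 0) \<and> (\<lambda>w. Y t w - X0 w - t * D w) \<in> subdiff_I_K (Y t))"
      show "0 < t \<longrightarrow> (\<exists>D. ((\<lambda>t. cls (Y t)) has_vector_derivative D) (at t) \<and> cls (Y t) \<in> K2 \<and>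
          cls (Y t) - (cls X0) - t *\<^sub>R D \<in> normal_cone K2 (cls (Y t)))"
      proof
        assume t: "0 < t"
        then obtain D where D: "has_L2_deriv Y D t (at 0)" "(\<lambda>w. Y t w - X0 w - t * D w) \<in> subdiff_I_K (Y t)" using * by blast
        then have D': "D \<in> L2" "((\<lambda>t. cls (Y t)) has_vector_derivative cls D) (at t)" using curve_derivative[OF L t] by auto
        then have "cls (Y t) \<in> K2 \<and> cls (Y t) - (cls X0) - t *\<^sub>R cls D \<in> normal_cone K2 (cls (Y t))"
          using D(2) t L[of t] by (simp add: subdiff_iff_normal_cone L2_diff L2_cmult data_L2 cls_diff cls_scaleR)
        then show "\<exists>D. ((\<lambda>t. cls (Y t)) has_vector_derivative D) (at t) \<and> cls (Y t) \<in> K2 \<and>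
          cls (Y t) - (cls X0) - t *\<^sub>R D \<in> normal_cone K2 (cls (Y t))" using D'(2) by blast
      qed
    qed
  qed
  have ac: "abs_cont_curve (\<lambda>t. cls (Y t))" if "strong_solution_scaled X0 V0 Y" for Y
    using that by (auto simp: strong_solution_scaled_def loc_abs_cont_L2_iff)
  have init: "((\<lambda>t. (1/t) *\<^sub>R (cls (Y t) - (cls X0))) \<longlongrightarrow> (cls V0)) (at_right 0)" if Y: "strong_solution_scaled X0 V0 Y" for Y
  proof -
    have L: "\<And>t. 0 \<le> t \<Longrightarrow> Y t \<in> L2" using Y by (auto simp: strong_solution_scaled_def loc_abs_cont_L2_iff)
    show ?thesis using Y initial_quotient[of Y, OF L] by (simp add: strong_solution_scaled_def)
  qed
  \<comment> \<open>The scaled problem prescribes no initial value. The limit of (Y t - X0) / t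
    forces it, by continuity of \<open>Y\<close> at 0; \<open>scaled_solutions_unique\<close> itself
    speaks of positive times only.\<close>
  have init0: "cls (Y 0) = (cls X0)" if Y: "strong_solution_scaled X0 V0 Y" for Y
  proof -
    have "((\<lambda>t. t *\<^sub>R ((1/t) *\<^sub>R (cls (Y t) - (cls X0)))) \<longlongrightarrow> 0 *\<^sub>R (cls V0)) (at_right 0)"
      by (intro tendsto_intros init Y)
    moreover have "\<forall>\<^sub>F t in at_right 0. t *\<^sub>R ((1/t) *\<^sub>R (cls (Y t) - (cls X0))) = cls (Y t) - (cls X0)"
      by (auto simp: eventually_at_right_field intro!: exI[of _ 1])
    ultimately have "((\<lambda>t. cls (Y t) - (cls X0)) \<longlongrightarrow> 0) (at_right 0)" using Lim_transform_eventually by fastforce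
    then have "((\<lambda>t. cls (Y t)) \<longlongrightarrow> (cls X0)) (at_right 0)" by (simp add: Lim_null[symmetric])
    moreover have "((\<lambda>t. cls (Y t)) \<longlongrightarrow> cls (Y 0)) (at_right 0)"
    proof -
      have "((\<lambda>t. cls (Y t)) \<longlongrightarrow> cls (Y 0)) (at 0 within {0..1})"
        using abs_cont_curve_continuous[OF ac[OF Y], of 1] by (auto simp: continuous_on_def)
      then show ?thesis by (simp add: at_within_Icc_at_right)
    qed
    ultimately show ?thesis by (auto intro: tendsto_unique[OF trivial_limit_at_right_real])
  qed
  have "ae_eq (Y t) (lag_X X0 V0 t)" if Y: "strong_solution_scaled X0 V0 Y" and t: "0 \<le> t" for Y t
  proof -
    have L: "\<And>t. 0 \<le> t \<Longrightarrow> Y t \<in> L2" using Y by (auto simp: strong_solution_scaled_def loc_abs_cont_L2_iff)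
    have "cls (Y t) = cls (lag_X X0 V0 t)"
    proof (cases "t = 0")
      case True then show ?thesis using init0[OF Y] init0[OF sol] by simp
    next
      case False
      then have "0 < t" using t by simp
      then show ?thesis
        by (rule scaled_solutions_unique[OF K2_closed_cone ac[OF Y] ac[OF sol], of "cls X0" "cls V0", rotated 2])
          (use conv init Y sol in auto)
    qed
    then show ?thesis by (simp only: cls_eq_iff[OF L[OF t] lag_X_props(2)])
  qed
  then show ?thesis using sol by (simp add: unique_curve_def)
qed

end

section \<open>Composition of the flow and its L^p estimates\<close>

context
  fixes x v assumes x: "x \<in> K2" and v: "v \<in> H2 x"
begin

lemma flow_compose:
  assumes "0 \<le> t" "0 \<le> s"
  shows "flow K2 (flow K2 x v t) (flow_vel K2 x v t) s = flow K2 x v (t + s)"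
  using sticky.flow_semigroup_vel[OF x v assms(1), of "t + s"] assms
  by (simp add: flow_def[of K2 "flow K2 x v t"])

lemma flow_vel_compose:
  assumes t: "0 \<le> t" and s: "0 \<le> s"
  shows "flow_vel K2 (flow K2 x v t) (flow_vel K2 x v t) s = flow_vel K2 x v (t + s)"
proof (rule tendsto_unique[OF trivial_limit_at_right_real])
  let ?y = "flow K2 x v t" and ?w = "flow_vel K2 x v t"
  have yw: "?y \<in> K2" "?w \<in> H2 ?y" using sticky.flow_in[OF x v] sticky.flow_vel_in_H[OF x v t] by auto
  show "((\<lambda>h. (1/h) *\<^sub>R (flow K2 ?y ?w (s + h) - flow K2 ?y ?w s)) \<longlongrightarrow> flow_vel K2 ?y ?w s) (at_right 0)"
    by (rule sticky.flow_right_derivative[OF yw s])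
  have "((\<lambda>h. (1/h) *\<^sub>R (flow K2 x v (t + s + h) - flow K2 x v (t + s))) \<longlongrightarrow> flow_vel K2 x v (t + s)) (at_right 0)"
    by (rule sticky.flow_right_derivative[OF x v]) (use t s in simp)
  moreover have "\<forall>\<^sub>F h in at_right 0. (1/h) *\<^sub>R (flow K2 x v (t + s + h) - flow K2 x v (t + s))
      = (1/h) *\<^sub>R (flow K2 ?y ?w (s + h) - flow K2 ?y ?w s)"
    using t s by (auto simp: eventually_at_right_field flow_compose add.assoc intro!: exI[of _ 1])
  ultimately show "((\<lambda>h. (1/h) *\<^sub>R (flow K2 ?y ?w (s + h) - flow K2 ?y ?w s)) \<longlongrightarrow> flow_vel K2 x v (t + s)) (at_right 0)"
    by (rule Lim_transform_eventually)
qed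

context
  fixes p :: real assumes p: "2 \<le> p"
begin

text \<open>Both positions are restarted from time s with the velocity at s, so the L^p contraction
  compares arguments that differ by h times that velocity.\<close>

lemma Np_flow_increment:
  assumes s: "0 \<le> s" "s \<le> t" "0 \<le> h"
  shows "Np p (flow K2 x v (t + h) - flow K2 x v t) \<le> ennreal (h powr p) * Np p (flow_vel K2 x v s)"
proof -
  let ?y = "flow K2 x v s" and ?w = "flow_vel K2 x v s"
  have "flow K2 x v (t + h) - flow K2 x v t = proj K2 (?y + (t + h - s) *\<^sub>R ?w) - proj K2 (?y + (t - s) *\<^sub>R ?w)"
    using sticky.flow_semigroup_vel[OF x v s(1), of "t + h"] sticky.flow_semigroup_vel[OF x v s(1,2)] s by simp
  also have "Np p \<dots> \<le> Np p ((?y + (t + h - s) *\<^sub>R ?w) - (?y + (t - s) *\<^sub>R ?w))"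
    by (rule proj_K2_Np_contraction[OF p])
  also have "(?y + (t + h - s) *\<^sub>R ?w) - (?y + (t - s) *\<^sub>R ?w) = h *\<^sub>R ?w" by (simp add: algebra_simps)
  finally show ?thesis using s by (simp add: Np_scaleR)
qed

text \<open>The difference quotients at t obey the bound by \<open>Np_flow_increment\<close>, and
  lower semicontinuity passes it to the right derivative.\<close>

lemma Np_flow_vel_antimono:
  assumes s: "0 \<le> s" "s \<le> t"
  shows "Np p (flow_vel K2 x v t) \<le> Np p (flow_vel K2 x v s)"
proof -
  have "(\<lambda>n. (1 / inverse (real (Suc n))) *\<^sub>R (flow K2 x v (t + inverse (real (Suc n))) - flow K2 x v t)) \<longlonglongrightarrow> flow_vel K2 x v t"
  proof (rule filterlim_compose[OF sticky.flow_right_derivative[OF x v]])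
    show "filterlim (\<lambda>n. inverse (real (Suc n))) (at_right 0) sequentially"
      using LIMSEQ_inverse_real_of_nat by (auto simp: filterlim_at)
  qed (use s in simp)
  then show ?thesis
  proof (rule Np_fatou)
    fix n
    let ?h = "inverse (real (Suc n))"
    have "Np p ((1 / ?h) *\<^sub>R (flow K2 x v (t + ?h) - flow K2 x v t))
        = ennreal ((1 / ?h) powr p) * Np p (flow K2 x v (t + ?h) - flow K2 x v t)"
      unfolding Np_scaleR by simp
    also have "\<dots> \<le> ennreal ((1 / ?h) powr p) * (ennreal (?h powr p) * Np p (flow_vel K2 x v s))"
      by (intro mult_left_mono Np_flow_increment s) auto
    also have "\<dots> = ennreal ((1 / ?h) powr p * ?h powr p) * Np p (flow_vel K2 x v s)"
      by (simp add: ennreal_mult mult.assoc)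
    also have "(1 / ?h) powr p * ?h powr p = 1" by (simp add: powr_mult[symmetric])
    finally show "Np p ((1 / ?h) *\<^sub>R (flow K2 x v (t + ?h) - flow K2 x v t)) \<le> Np p (flow_vel K2 x v s)" by simp
  qed (use p in simp)
qed

context
  assumes fin: "Np p x < \<infinity>" "Np p v < \<infinity>"
begin

lemma Np_flow_vel_finite: "0 \<le> t \<Longrightarrow> Np p (flow_vel K2 x v t) < \<infinity>"
  using Np_flow_vel_antimono[of 0 t] sticky.flow_vel_0[OF x v] fin(2) by (simp add: le_less_trans)

lemma Np_flow_finite: assumes "0 \<le> t" shows "Np p (flow K2 x v t) < \<infinity>"
proof -
  have "Np p (flow K2 x v t - flow K2 x v 0) \<le> ennreal (t powr p) * Np p (flow_vel K2 x v 0)"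
    using Np_flow_increment[of 0 0 t] assms by simp
  also have "\<dots> < \<infinity>" using fin(2) sticky.flow_vel_0[OF x v] by (simp add: ennreal_mult_less_top)
  finally have "Np p ((flow K2 x v t - flow K2 x v 0) + x) < \<infinity>" using fin(1) p by (intro Np_add_finite) auto
  then show ?thesis using sticky.flow_0[OF x v] by simp
qed

lemma Np_flow_right_continuous:
  assumes t: "0 \<le> t"
  shows "((\<lambda>r. Np p (flow K2 x v r - flow K2 x v t)) \<longlongrightarrow> 0) (at_right t)"
proof (rule tendsto_sandwich[OF _ _ tendsto_const])
  let ?C = "Np p (flow_vel K2 x v t)"
  have "((\<lambda>r. (r - t) powr p) \<longlongrightarrow> (t - t) powr p) (at_right t)"
    using p by (intro tendsto_powr2 tendsto_intros) (auto simp: eventually_at_right_field intro!: exI[of _ "t + 1"])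
  then have "((\<lambda>r. ennreal ((r - t) powr p)) \<longlongrightarrow> ennreal 0) (at_right t)" using p by (intro tendsto_ennrealI) simp
  then have "((\<lambda>r. ?C * ennreal ((r - t) powr p)) \<longlongrightarrow> ?C * ennreal 0) (at_right t)"
    using Np_flow_vel_finite[OF t] by (intro ennreal_tendsto_cmult) auto
  then show "((\<lambda>r. ?C * ennreal ((r - t) powr p)) \<longlongrightarrow> 0) (at_right t)" by simp
  have "Np p (flow K2 x v r - flow K2 x v t) \<le> ?C * ennreal ((r - t) powr p)" if "t < r" for r
    using Np_flow_increment[of t t "r - t"] t that by (simp add: mult.commute)
  then show "\<forall>\<^sub>F r in at_right t. Np p (flow K2 x v r - flow K2 x v t) \<le> ?C * ennreal ((r - t) powr p)"
    by (auto simp: eventually_at_right_field intro!: exI[of _ "t + 1"])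
qed simp

text \<open>Right continuity in L^2 is upgraded to L^p by \<open>Np_tendsto_if_norm_le\<close>,
  because the L^p norm of the velocity does not increase in time.\<close>

lemma Np_flow_vel_right_continuous:
  assumes t: "0 \<le> t"
  shows "((\<lambda>r. Np p (flow_vel K2 x v r - flow_vel K2 x v t)) \<longlongrightarrow> 0) (at_right t)"
  unfolding tendsto_at_iff_sequentially
proof (intro allI impI)
  fix r assume r: "\<forall>i. r i \<in> {t<..} - {t}" and lim: "r \<longlonglongrightarrow> t"
  have "\<forall>n. r n \<in> {t<..} \<and> r n \<noteq> t" using r by auto
  then have "filterlim r (at_right t) sequentially" unfolding filterlim_at using lim by (simp add: always_eventually)
  from filterlim_compose[OF sticky.flow_vel_right_continuous[OF x v t] this]
  have "(\<lambda>n. flow_vel K2 x v (r n)) \<longlonglongrightarrow> flow_vel K2 x v t" .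
  then have "(\<lambda>n. Np p (flow_vel K2 x v (r n) - flow_vel K2 x v t)) \<longlonglongrightarrow> 0"
  proof (rule Np_tendsto_if_norm_le[rotated])
    show "Np p (flow_vel K2 x v t) < \<infinity>" by (rule Np_flow_vel_finite[OF t])
    show "Np p (flow_vel K2 x v (r n)) \<le> Np p (flow_vel K2 x v t)" for n
      using r[rule_format, of n] t by (intro Np_flow_vel_antimono) auto
  qed (use p in simp)
  then show "((\<lambda>r. Np p (flow_vel K2 x v r - flow_vel K2 x v t)) \<circ> r) \<longlonglongrightarrow> 0" by (simp add: o_def)
qed

end

end

end

lemma lag_flow_X_space:
  assumes p: "2 \<le> p" and Z: "(X0, V0) \<in> X_space p" and t: "0 \<le> t"
  shows "(lag_X X0 V0 t, lag_V X0 V0 t) \<in> X_space p"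
proof -
  have d: "lag_data X0 V0" and fin: "Np p (cls X0) < \<infinity>" "Np p (cls V0) < \<infinity>"
    using Z by (auto simp: X_space_iff[OF p])
  show ?thesis
    unfolding X_space_iff[OF p] lag_X_props(4)[OF d] lag_V_props(3)[OF d t]
    by (intro conjI lag_flow_data d t Np_flow_finite Np_flow_vel_finite x0_K2[OF d] v0_H2[OF d] p fin)
qed

lemma lag_flow_semigroup:
  assumes d: "lag_data X0 V0" and t: "0 \<le> t" and s: "0 \<le> s"
  shows "pair_ae_eq (lag_flow (s + t) (X0, V0)) (lag_flow s (lag_flow t (X0, V0)))"
proof -
  let ?X = "lag_X X0 V0 t" and ?V = "lag_V X0 V0 t"
  have d': "lag_data ?X ?V" by (rule lag_flow_data[OF d t])
  have st: "0 \<le> s + t" using s t by simp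
  have "cls (lag_X X0 V0 (s + t)) = cls (lag_X ?X ?V s)"
    by (simp add: lag_X_props(4)[OF d] lag_X_props(4)[OF d'] lag_V_props(3)[OF d t]
        flow_compose[OF x0_K2[OF d] v0_H2[OF d] t s] add.commute)
  moreover have "cls (lag_V X0 V0 (s + t)) = cls (lag_V ?X ?V s)"
    by (simp add: lag_V_props(3)[OF d st] lag_V_props(3)[OF d' s] lag_V_props(3)[OF d t] lag_X_props(4)[OF d]
        flow_vel_compose[OF x0_K2[OF d] v0_H2[OF d] t s] add.commute)
  ultimately show ?thesis
    by (simp add: pair_ae_eq_def lag_flow_def cls_eq_iff lag_X_props(2)[OF d] lag_X_props(2)[OF d']
        lag_V_props(2)[OF d st] lag_V_props(2)[OF d' s])
qed

lemma Lp_norm_powr_eq: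
  assumes p: "0 < p" and f: "f \<in> L2" "g \<in> L2"
  shows "Lp_norm p leb01 (\<lambda>w. f w - g w) powr p = enn2real (Np p (cls f - cls g))"
proof -
  note [measurable] = L2_measurable[OF f(1)] L2_measurable[OF f(2)]
  have "Lp_norm p leb01 (\<lambda>w. f w - g w) powr p = (\<integral>w. \<bar>f w - g w\<bar> powr p \<partial>leb01)"
    using p by (simp add: Lp_norm_def powr_powr)
  also have "\<dots> = enn2real (\<integral>\<^sup>+ w. ennreal (\<bar>f w - g w\<bar> powr p) \<partial>leb01)"
    by (intro integral_eq_nn_integral) auto
  finally show ?thesis by (simp add: cls_diff f Np_cls L2_diff)
qed

lemma X_dist_tendsto_0:
  assumes p: "0 < p" and L: "X \<in> L2" "V \<in> L2" "\<forall>\<^sub>F r in F. Y r \<in> L2 \<and> W r \<in> L2"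
    and lim: "((\<lambda>r. Np p (cls (Y r) - cls X)) \<longlongrightarrow> 0) F" "((\<lambda>r. Np p (cls (W r) - cls V)) \<longlongrightarrow> 0) F"
  shows "((\<lambda>r. X_dist p (Y r, W r) (X, V)) \<longlongrightarrow> 0) F"
proof -
  have r: "((\<lambda>r. enn2real (f r)) \<longlongrightarrow> 0) F" if "(f \<longlongrightarrow> 0) F" for f
    using tendsto_enn2real[of f 0 F] that by simp
  have "((\<lambda>r. enn2real (Np p (cls (Y r) - cls X)) + enn2real (Np p (cls (W r) - cls V))) \<longlongrightarrow> 0 + 0) F"
    by (intro tendsto_add r lim)
  then have "((\<lambda>r. enn2real (Np p (cls (Y r) - cls X)) + enn2real (Np p (cls (W r) - cls V))) \<longlongrightarrow> 0) F" by simp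
  then have "((\<lambda>r. (enn2real (Np p (cls (Y r) - cls X)) + enn2real (Np p (cls (W r) - cls V))) powr (1 / p)) \<longlongrightarrow> 0) F"
    using p by (intro tendsto_zero_powrI[where b = "1 / p"] tendsto_const) auto
  then show ?thesis
  proof (rule Lim_transform_eventually)
    show "\<forall>\<^sub>F r in F. (enn2real (Np p (cls (Y r) - cls X)) + enn2real (Np p (cls (W r) - cls V))) powr (1 / p) = X_dist p (Y r, W r) (X, V)"
      using L(3) by eventually_elim (simp add: X_dist_def Lp_norm_powr_eq p L)
  qed
qed

lemma lag_flow_right_continuous_semigroup:
  assumes p: "2 \<le> p"
  shows "right_continuous_semigroup p lag_flow"
  unfolding right_continuous_semigroup_def
proof (intro conjI ballI allI impI)
  fix Z and s t :: real assume Z: "Z \<in> X_space p" and st: "0 \<le> s" "0 \<le> t"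
  then show "pair_ae_eq (lag_flow (s + t) Z) (lag_flow s (lag_flow t Z))"
    using lag_flow_semigroup[OF _ st(2,1), of "fst Z" "snd Z"] X_space_iff[OF p, of "fst Z" "snd Z"] by simp
next
  fix Z and t :: real assume Z: "Z \<in> X_space p" and t: "0 \<le> t"
  obtain X0 V0 where Z_eq: "Z = (X0, V0)" by (cases Z)
  have d: "lag_data X0 V0" and fin: "Np p (cls X0) < \<infinity>" "Np p (cls V0) < \<infinity>"
    using Z by (auto simp: X_space_iff[OF p] Z_eq)
  have ev: "\<forall>\<^sub>F r in at_right t. 0 \<le> r" using t by (auto simp: eventually_at_right_field intro!: exI[of _ "t + 1"])
  have "((\<lambda>r. X_dist p (lag_X X0 V0 r, lag_V X0 V0 r) (lag_X X0 V0 t, lag_V X0 V0 t)) \<longlongrightarrow> 0) (at_right t)"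
  proof (rule X_dist_tendsto_0)
    show "\<forall>\<^sub>F r in at_right t. lag_X X0 V0 r \<in> L2 \<and> lag_V X0 V0 r \<in> L2"
      using ev by eventually_elim (simp add: lag_X_props(2)[OF d] lag_V_props(2)[OF d])
    show "((\<lambda>r. Np p (cls (lag_X X0 V0 r) - cls (lag_X X0 V0 t))) \<longlongrightarrow> 0) (at_right t)"
      unfolding lag_X_props(4)[OF d] by (intro Np_flow_right_continuous x0_K2[OF d] v0_H2[OF d] p fin t)
    have "((\<lambda>r. Np p (flow_vel K2 (cls X0) (cls V0) r - flow_vel K2 (cls X0) (cls V0) t)) \<longlongrightarrow> 0) (at_right t)"
      by (intro Np_flow_vel_right_continuous x0_K2[OF d] v0_H2[OF d] p fin t)
    then show "((\<lambda>r. Np p (cls (lag_V X0 V0 r) - cls (lag_V X0 V0 t))) \<longlongrightarrow> 0) (at_right t)"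
    proof (rule Lim_transform_eventually)
      show "\<forall>\<^sub>F r in at_right t. Np p (flow_vel K2 (cls X0) (cls V0) r - flow_vel K2 (cls X0) (cls V0) t)
          = Np p (cls (lag_V X0 V0 r) - cls (lag_V X0 V0 t))"
        using ev by eventually_elim (simp add: lag_V_props(3)[OF d] t)
    qed
  qed (use p t in \<open>simp_all add: lag_X_props(2)[OF d] lag_V_props(2)[OF d]\<close>)
  then show "((\<lambda>r. X_dist p (lag_flow r Z) (lag_flow t Z)) \<longlongrightarrow> 0) (at_right t)"
    by (simp add: Z_eq lag_flow_def)
qed

section \<open>Quantile functions and the Wasserstein distance\<close>

lemma measure_lessThan_leb01: "0 < w \<Longrightarrow> w \<le> 1 \<Longrightarrow> measure leb01 {0<..<w} = w"
  using emeasure_leb01[of "{0<..<w}"] by (simp add: measure_def subset_iff)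

lemma cdf_bounds:
  fixes \<rho> :: "real measure"
  assumes "prob_space \<rho>" "sets \<rho> = sets borel"
  shows "(w::real) < 1 \<Longrightarrow> \<exists>x. w < measure \<rho> {..x}" "0 < w \<Longrightarrow> \<exists>y. measure \<rho> {..y} < w"
proof -
  interpret real_distribution \<rho> using assms by (simp add: real_distribution_def real_distribution_axioms_def)
  show "w < 1 \<Longrightarrow> \<exists>x. w < measure \<rho> {..x}"
    using order_tendstoD(1)[OF cdf_lim_at_top_prob, of w] by (auto simp: cdf_def dest!: eventually_happens)
  show "0 < w \<Longrightarrow> \<exists>y. measure \<rho> {..y} < w"
    using order_tendstoD(2)[OF cdf_lim_at_bot, of w] by (auto simp: cdf_def dest!: eventually_happens)
qed

lemma measure_atMost_mono:
  fixes \<rho> :: "real measure"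
  assumes "prob_space \<rho>" "sets \<rho> = sets borel" "x \<le> (y::real)"
  shows "measure \<rho> {..x} \<le> measure \<rho> {..y}"
proof -
  interpret prob_space \<rho> by fact
  show ?thesis using assms by (intro finite_measure_mono) auto
qed

lemma quantile_bdd_below:
  fixes \<rho> :: "real measure"
  assumes \<rho>: "prob_space \<rho>" "sets \<rho> = sets borel" and w: "0 < w"
  shows "bdd_below {x. measure \<rho> {..x} > w}"
proof -
  obtain y where y: "measure \<rho> {..y} < w" using cdf_bounds(2)[OF \<rho> w] by blast
  show ?thesis
  proof (rule bdd_belowI[of _ y])
    fix x assume "x \<in> {x. measure \<rho> {..x} > w}"
    then show "y \<le> x" using measure_atMost_mono[OF \<rho>, of x y] y by (cases "y \<le> x") auto
  qed
qed

lemma quantile_le: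
  assumes "prob_space \<rho>" "sets \<rho> = sets borel" "0 < w" "w < measure \<rho> {..x}"
  shows "quantile \<rho> w \<le> x"
  unfolding quantile_def using assms by (intro cInf_lower quantile_bdd_below) auto

lemma quantile_less_obtain:
  assumes \<rho>: "prob_space \<rho>" "sets \<rho> = sets borel" and "w < 1" "quantile \<rho> w < y"
  obtains x where "x < y" "w < measure \<rho> {..x}"
proof -
  have "{x. measure \<rho> {..x} > w} \<noteq> {}" using cdf_bounds(1)[OF \<rho>] assms(3) by blast
  from cInf_lessD[OF this] assms(4) that show ?thesis by (auto simp: quantile_def)
qed

lemma quantile_mono:
  assumes \<rho>: "prob_space \<rho>" "sets \<rho> = sets borel"
  shows "mono_on {0<..<1} (quantile \<rho>)"
proof (rule mono_onI)
  fix w w' :: real assume w: "w \<in> {0<..<1}" "w' \<in> {0<..<1}" "w \<le> w'"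
  obtain x where "w' < measure \<rho> {..x}" using cdf_bounds(1)[OF \<rho>, of w'] w by auto
  then have ne: "{x. measure \<rho> {..x} > w'} \<noteq> {}" by blast
  have sub: "{x. measure \<rho> {..x} > w'} \<subseteq> {x. measure \<rho> {..x} > w}" using w(3) by auto
  show "quantile \<rho> w \<le> quantile \<rho> w'"
    unfolding quantile_def by (rule cInf_superset_mono[OF ne quantile_bdd_below[OF \<rho>] sub]) (use w in simp)
qed

text \<open>The quantile function of the law lies between X w and X w' for every w' > w, hence
  equals \<open>X\<close> almost everywhere. This is how a measure remembers its Lagrangian
  position.\<close>

lemma quantile_distr:
  fixes X :: "real \<Rightarrow> real"
  assumes X: "mono_on {0<..<1} X"
  shows "ae_eq (quantile (distr leb01 borel X)) X"
proof -
  have [measurable]: "X \<in> borel_measurable leb01" by (rule mono_on_measurable_leb01[OF X])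
  let ?\<rho> = "distr leb01 borel X"
  have \<rho>: "prob_space ?\<rho>" "sets ?\<rho> = sets borel" by (auto intro: leb01.prob_space_distr)
  have m: "measure ?\<rho> {..x} = measure leb01 {w\<in>{0<..<1}. X w \<le> x}" for x
    by (simp add: measure_distr vimage_def Int_def conj_commute)
  have S: "{w\<in>{0<..<1}. X w \<le> x} \<in> sets leb01" for x
  proof -
    have "{w \<in> space leb01. X w \<le> x} \<in> sets leb01" by measurable
    then show ?thesis by simp
  qed
  have level: "w < measure ?\<rho> {..X w'}" if "0 < w" "w < w'" "w' < 1" for w w'
  proof -
    have "w' = measure leb01 {0<..<w'}" using that by (simp add: measure_lessThan_leb01)
    also have "\<dots> \<le> measure leb01 {w\<in>{0<..<1}. X w \<le> X w'}"
      using that mono_onD[OF X] by (intro leb01.finite_measure_mono S) auto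
    finally show ?thesis using that by (simp add: m)
  qed
  show ?thesis
  proof (rule ae_eq_if_sandwiched[OF X])
    fix w :: real assume w: "w \<in> {0<..<1}"
    have "w < measure ?\<rho> {..X ((w + 1) / 2)}" using w by (intro level) auto
    then show "X w \<le> quantile ?\<rho> w"
      unfolding quantile_def
    proof (intro cInf_greatest)
      fix x assume "x \<in> {x. w < measure ?\<rho> {..x}}"
      then have gt: "w < measure leb01 {w\<in>{0<..<1}. X w \<le> x}" by (simp add: m)
      show "X w \<le> x"
      proof (rule ccontr)
        assume "\<not> X w \<le> x"
        then have "{w\<in>{0<..<1}. X w \<le> x} \<subseteq> {0<..<w}" using mono_onD[OF X, of w] w by (force simp: not_le)
        then have "measure leb01 {w\<in>{0<..<1}. X w \<le> x} \<le> measure leb01 {0<..<w}"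
          using w by (intro leb01.finite_measure_mono) (auto simp: sets_leb01 sets_restrict_space_iff)
        then show False using gt w by (simp add: measure_lessThan_leb01)
      qed
    qed auto
    fix w' :: real assume "w < w'" "w' < 1"
    then show "quantile ?\<rho> w \<le> X w'" using w by (intro quantile_le[OF \<rho>] level) auto
  qed
qed

text \<open>The inverse \<open>I\<close> of \<open>cdf_distribution\<close> is nondecreasing with
  law \<open>\<rho>\<close>; by \<open>quantile_distr\<close> the quantile function agrees with it
  almost everywhere.\<close>

lemma distr_quantile:
  assumes \<rho>: "prob_space \<rho>" "sets \<rho> = sets borel"
  shows "distr leb01 borel (quantile \<rho>) = \<rho>"
proof -
  interpret cdf_distribution \<rho> using \<rho>
    by (simp add: cdf_distribution_def real_distribution_def real_distribution_axioms_def)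
  have I: "distr leb01 borel I = \<rho>" using distr_I_eq_M by (simp add: leb01_def)
  have [measurable]: "I \<in> borel_measurable leb01" "quantile \<rho> \<in> borel_measurable leb01"
    by (intro mono_on_measurable_leb01 mono_I quantile_mono \<rho>)+
  have "ae_eq (quantile \<rho>) I" using quantile_distr[OF mono_I] by (simp add: I)
  then have "distr leb01 borel (quantile \<rho>) = distr leb01 borel I"
    unfolding ae_eq_def by (intro distr_cong_AE) auto
  then show ?thesis by (simp add: I)
qed

lemma quantile_measurable: "\<rho> \<in> P_space p \<Longrightarrow> quantile \<rho> \<in> borel_measurable leb01"
  by (intro mono_on_measurable_leb01 quantile_mono) (auto simp: P_space_def)

lemma integral_quantile:
  fixes f :: "real \<Rightarrow> real"
  assumes "\<rho> \<in> P_space p" "f \<in> borel_measurable borel"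
  shows "(\<integral>w. f (quantile \<rho> w) \<partial>leb01) = (\<integral>x. f x \<partial>\<rho>)" (is ?A)
    "integrable leb01 (\<lambda>w. f (quantile \<rho> w)) \<longleftrightarrow> integrable \<rho> f"
proof -
  have d: "distr leb01 borel (quantile \<rho>) = \<rho>" using assms by (intro distr_quantile) (auto simp: P_space_def)
  show ?A using integral_distr[OF quantile_measurable[OF assms(1)] assms(2)] by (simp add: d)
  show "integrable leb01 (\<lambda>w. f (quantile \<rho> w)) \<longleftrightarrow> integrable \<rho> f"
    using integrable_distr_eq[OF quantile_measurable[OF assms(1)] assms(2)] by (simp add: d)
qed

lemma quantile_Lp: "\<rho> \<in> P_space p \<Longrightarrow> quantile \<rho> \<in> Lp p leb01"
  using integral_quantile(2)[of \<rho> p "\<lambda>x. \<bar>x\<bar> powr p"] quantile_measurable[of \<rho> p] by (simp add: Lp_def) (simp add: P_space_def)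

section \<open>Couplings and Wasserstein convergence\<close>

lemma coupling_integrable:
  assumes \<rho>: "\<rho>1 \<in> P_space p" "\<rho>2 \<in> P_space p" and p: "1 \<le> p" and \<gamma>: "\<gamma> \<in> couplings \<rho>1 \<rho>2"
  shows "integrable \<gamma> (\<lambda>z. \<bar>fst z - snd z\<bar> powr p)" "integrable \<gamma> (\<lambda>z. \<bar>fst z\<bar> powr p)"
    "integrable \<gamma> (\<lambda>z. \<bar>snd z\<bar> powr p)"
proof -
  have s: "sets \<gamma> = sets borel" and d: "distr \<gamma> borel fst = \<rho>1" "distr \<gamma> borel snd = \<rho>2"
    using \<gamma> by (auto simp: couplings_def)
  have m: "f \<in> borel_measurable \<gamma>" if "f \<in> borel_measurable borel" for f :: "real \<times> real \<Rightarrow> real"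
    using that measurable_cong_sets[OF s refl] by blast
  have "fst \<in> borel_measurable (borel :: (real \<times> real) measure)" "snd \<in> borel_measurable (borel :: (real \<times> real) measure)"
    by (auto intro!: borel_measurable_continuous_onI continuous_intros)
  note [measurable] = m[OF this(1)] m[OF this(2)]
  have "integrable (distr \<gamma> borel fst) (\<lambda>x. \<bar>x\<bar> powr p)" "integrable (distr \<gamma> borel snd) (\<lambda>x. \<bar>x\<bar> powr p)"
    using \<rho> by (auto simp: d P_space_def)
  then show i: "integrable \<gamma> (\<lambda>z. \<bar>fst z\<bar> powr p)" "integrable \<gamma> (\<lambda>z. \<bar>snd z\<bar> powr p)"
    using integrable_distr_eq[of fst \<gamma> borel "\<lambda>x. \<bar>x\<bar> powr p"] integrable_distr_eq[of snd \<gamma> borel "\<lambda>x. \<bar>x\<bar> powr p"]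
    by simp_all
  show "integrable \<gamma> (\<lambda>z. \<bar>fst z - snd z\<bar> powr p)"
  proof (rule Bochner_Integration.integrable_bound)
    show "integrable \<gamma> (\<lambda>z. 2 powr p * (\<bar>fst z\<bar> powr p + \<bar>snd z\<bar> powr p))" using i by auto
    have "\<bar>a - b\<bar> powr p \<le> 2 powr p * (\<bar>a\<bar> powr p + \<bar>b\<bar> powr p)" for a b :: real
    proof -
      have "\<bar>a - b\<bar> powr p \<le> (\<bar>a\<bar> + \<bar>b\<bar>) powr p" using p by (intro powr_mono2) auto
      also have "\<dots> \<le> 2 powr p * (\<bar>a\<bar> powr p + \<bar>b\<bar> powr p)" using p by (intro powr_add_le) auto
      finally show ?thesis .
    qed
    then show "AE z in \<gamma>. norm (\<bar>fst z - snd z\<bar> powr p) \<le> norm (2 powr p * (\<bar>fst z\<bar> powr p + \<bar>snd z\<bar> powr p))" by simp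
  qed measurable
qed

lemma coupling_of_maps:
  assumes [measurable]: "X \<in> borel_measurable leb01" "Y \<in> borel_measurable leb01"
  shows "distr leb01 borel (\<lambda>w. (X w, Y w)) \<in> couplings (distr leb01 borel X) (distr leb01 borel Y)"
proof -
  have [measurable]: "(\<lambda>w. (X w, Y w)) \<in> leb01 \<rightarrow>\<^sub>M borel" by (rule borel_measurable_Pair) auto
  have [measurable]: "fst \<in> borel_measurable (borel :: (real \<times> real) measure)" "snd \<in> borel_measurable (borel :: (real \<times> real) measure)"
    by (auto intro!: borel_measurable_continuous_onI continuous_intros)
  show ?thesis
    by (auto simp: couplings_def distr_distr o_def intro!: leb01.prob_space_distr)
qed

text \<open>The second disjunct sets apart the infimum over the empty set, of which nothing is
  known.\<close>

lemma W_dist_powr: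
  assumes "1 \<le> p"
  shows "W_dist p \<rho>1 \<rho>2 powr p = \<bar>INF \<gamma>\<in>couplings \<rho>1 \<rho>2. \<integral>z. \<bar>fst z - snd z\<bar> powr p \<partial>\<gamma>\<bar> \<or> couplings \<rho>1 \<rho>2 = {}"
proof (cases "couplings \<rho>1 \<rho>2 = {}")
  case False
  then have "0 \<le> (INF \<gamma>\<in>couplings \<rho>1 \<rho>2. \<integral>z. \<bar>fst z - snd z\<bar> powr p \<partial>\<gamma>)"
    by (intro cINF_greatest) auto
  then show ?thesis using assms by (simp add: W_dist_def powr_powr)
qed simp

lemma W_dist_powr_le:
  assumes p: "1 \<le> p" and [measurable]: "X \<in> borel_measurable leb01" "Y \<in> borel_measurable leb01"
  shows "W_dist p (distr leb01 borel X) (distr leb01 borel Y) powr p \<le> (\<integral>w. \<bar>X w - Y w\<bar> powr p \<partial>leb01)"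
proof -
  let ?C = "couplings (distr leb01 borel X) (distr leb01 borel Y)"
  let ?\<gamma> = "distr leb01 borel (\<lambda>w. (X w, Y w))"
  have [measurable]: "(\<lambda>w. (X w, Y w)) \<in> leb01 \<rightarrow>\<^sub>M borel" by (rule borel_measurable_Pair) auto
  have [measurable]: "fst \<in> borel_measurable (borel :: (real \<times> real) measure)" "snd \<in> borel_measurable (borel :: (real \<times> real) measure)"
    by (auto intro!: borel_measurable_continuous_onI continuous_intros)
  have \<gamma>: "?\<gamma> \<in> ?C" by (rule coupling_of_maps) auto
  have "0 \<le> (INF \<gamma>\<in>?C. \<integral>z. \<bar>fst z - snd z\<bar> powr p \<partial>\<gamma>)" using \<gamma> by (intro cINF_greatest) auto
  then have "W_dist p (distr leb01 borel X) (distr leb01 borel Y) powr p = (INF \<gamma>\<in>?C. \<integral>z. \<bar>fst z - snd z\<bar> powr p \<partial>\<gamma>)"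
    using W_dist_powr[OF p, of "distr leb01 borel X" "distr leb01 borel Y"] \<gamma> by auto
  also have "\<dots> \<le> (\<integral>z. \<bar>fst z - snd z\<bar> powr p \<partial>?\<gamma>)"
    by (rule cINF_lower[OF _ \<gamma>]) (auto intro!: bdd_belowI2[of _ 0])
  also have "\<dots> = (\<integral>w. \<bar>X w - Y w\<bar> powr p \<partial>leb01)" by (subst integral_distr) auto
  finally show ?thesis .
qed

text \<open>Couplings that are optimal up to 1/(n + 1) suffice, which avoids the existence of
  optimal plans.\<close>

lemma W_dist_tendsto_couplings:
  assumes p: "1 \<le> p" and \<rho>: "\<And>n. \<rho>n n \<in> P_space p" "\<rho> \<in> P_space p" and lim: "(\<lambda>n. W_dist p (\<rho>n n) \<rho>) \<longlonglongrightarrow> 0"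
  obtains \<gamma> where "\<And>n. \<gamma> n \<in> couplings (\<rho>n n) \<rho>" "(\<lambda>n. \<integral>z. \<bar>fst z - snd z\<bar> powr p \<partial>\<gamma> n) \<longlonglongrightarrow> 0"
proof -
  let ?J = "\<lambda>\<gamma>. \<integral>z. \<bar>fst z - snd z\<bar> powr p \<partial>(\<gamma> :: (real \<times> real) measure)"
  have ne: "couplings (\<rho>n n) \<rho> \<noteq> {}" for n
  proof -
    have "distr leb01 borel (quantile (\<rho>n n)) = \<rho>n n" "distr leb01 borel (quantile \<rho>) = \<rho>"
      using \<rho> by (auto simp: P_space_def intro!: distr_quantile)
    then show ?thesis using coupling_of_maps[OF quantile_measurable[OF \<rho>(1)] quantile_measurable[OF \<rho>(2)], of n] by auto
  qed
  define I where "I n = (INF \<gamma>\<in>couplings (\<rho>n n) \<rho>. ?J \<gamma>)" for n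
  have I0: "0 \<le> I n" for n unfolding I_def using ne by (intro cINF_greatest) auto
  have W: "W_dist p (\<rho>n n) \<rho> powr p = I n" for n
    using W_dist_powr[OF p, of "\<rho>n n" \<rho>] ne[of n] I0[of n] by (simp add: I_def)
  have "(\<lambda>n. W_dist p (\<rho>n n) \<rho> powr p) \<longlonglongrightarrow> 0"
    using p lim by (intro tendsto_zero_powrI[where b = p] tendsto_const) (auto simp: W_dist_def)
  then have I: "I \<longlonglongrightarrow> 0" by (simp add: W)
  have "\<exists>\<gamma>\<in>couplings (\<rho>n n) \<rho>. ?J \<gamma> < I n + inverse (real (Suc n))" for n
  proof -
    have "(INF \<gamma>\<in>couplings (\<rho>n n) \<rho>. ?J \<gamma>) < I n + inverse (real (Suc n))" by (simp add: I_def)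
    then show ?thesis using ne[of n] by (subst (asm) cInf_less_iff) (auto intro!: bdd_belowI2[of _ 0])
  qed
  then obtain \<gamma> where \<gamma>: "\<And>n. \<gamma> n \<in> couplings (\<rho>n n) \<rho>" "\<And>n. ?J (\<gamma> n) < I n + inverse (real (Suc n))" by metis
  have "(\<lambda>n. ?J (\<gamma> n)) \<longlonglongrightarrow> 0"
  proof (rule tendsto_sandwich[OF _ _ tendsto_const])
    have "(\<lambda>n. I n + inverse (real (Suc n))) \<longlonglongrightarrow> 0 + 0" by (intro tendsto_add I LIMSEQ_inverse_real_of_nat)
    then show "(\<lambda>n. I n + inverse (real (Suc n))) \<longlonglongrightarrow> 0" by simp
  qed (use \<gamma>(2) in \<open>auto intro!: always_eventually less_imp_le\<close>)
  with that \<gamma>(1) show ?thesis by blast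
qed

text \<open>A bound of Levy type: off a set of mass at most e the two coordinates differ by at most
  e.\<close>

lemma coupling_cdf_le:
  assumes \<gamma>: "\<gamma> \<in> couplings \<rho>1 \<rho>2" and tail: "measure \<gamma> {z. e < \<bar>fst z - snd z\<bar>} \<le> e"
  shows "measure \<rho>1 {..x} \<le> measure \<rho>2 {..x + e} + e" "measure \<rho>2 {..x} \<le> measure \<rho>1 {..x + e} + e"
proof -
  have s: "sets \<gamma> = sets borel" and d: "distr \<gamma> borel fst = \<rho>1" "distr \<gamma> borel snd = \<rho>2" and "prob_space \<gamma>"
    using \<gamma> by (auto simp: couplings_def)
  interpret prob_space \<gamma> by fact
  have sp: "space \<gamma> = UNIV" using sets_eq_imp_space_eq[OF s] by simp
  have m: "f \<in> borel_measurable \<gamma>" if "f \<in> borel_measurable borel" for f :: "real \<times> real \<Rightarrow> real"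
    using that measurable_cong_sets[OF s refl] by blast
  have "fst \<in> borel_measurable (borel :: (real \<times> real) measure)" "snd \<in> borel_measurable (borel :: (real \<times> real) measure)"
    by (auto intro!: borel_measurable_continuous_onI continuous_intros)
  note [measurable] = m[OF this(1)] m[OF this(2)]
  have T: "{z. e < \<bar>fst z - snd z\<bar>} \<in> events"
    using measurable_sets_Collect[of "\<lambda>z. e < \<bar>fst z - snd z\<bar>" \<gamma>] by (simp add: sp pred_def) measurable
  have F: "{z. fst z \<le> y} \<in> events" "{z. snd z \<le> y} \<in> events" for y
    using measurable_sets[of fst \<gamma> borel "{..y}"] measurable_sets[of snd \<gamma> borel "{..y}"] by (simp_all add: sp vimage_def)
  have r: "measure \<rho>1 {..y} = measure \<gamma> {z. fst z \<le> y}" "measure \<rho>2 {..y} = measure \<gamma> {z. snd z \<le> y}" for y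
    by (simp_all add: d(1)[symmetric] d(2)[symmetric] measure_distr sp vimage_def)
  have "measure \<gamma> {z. fst z \<le> x} \<le> measure \<gamma> ({z. snd z \<le> x + e} \<union> {z. e < \<bar>fst z - snd z\<bar>})"
    using T F by (intro finite_measure_mono) auto
  also have "\<dots> \<le> measure \<gamma> {z. snd z \<le> x + e} + measure \<gamma> {z. e < \<bar>fst z - snd z\<bar>}"
    using T F by (intro measure_Un_le) auto
  finally show "measure \<rho>1 {..x} \<le> measure \<rho>2 {..x + e} + e" using tail by (simp add: r)
  have "measure \<gamma> {z. snd z \<le> x} \<le> measure \<gamma> ({z. fst z \<le> x + e} \<union> {z. e < \<bar>fst z - snd z\<bar>})"
    using T F by (intro finite_measure_mono) auto
  also have "\<dots> \<le> measure \<gamma> {z. fst z \<le> x + e} + measure \<gamma> {z. e < \<bar>fst z - snd z\<bar>}"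
    using T F by (intro measure_Un_le) auto
  finally show "measure \<rho>2 {..x} \<le> measure \<rho>1 {..x + e} + e" using tail by (simp add: r)
qed

lemma quantile_shift_le:
  assumes \<rho>: "prob_space \<rho>1" "sets \<rho>1 = sets borel" "prob_space \<rho>2" "sets \<rho>2 = sets borel"
    and le: "\<And>x. measure \<rho>2 {..x} \<le> measure \<rho>1 {..x + e} + e"
    and w: "0 < w" "w + e < w'" "w' < 1"
  shows "quantile \<rho>1 w \<le> quantile \<rho>2 w' + e"
proof (rule field_le_epsilon)
  fix d :: real assume d: "0 < d"
  obtain x where x: "x < quantile \<rho>2 w' + d" "w' < measure \<rho>2 {..x}"
    using quantile_less_obtain[OF \<rho>(3,4) w(3), of "quantile \<rho>2 w' + d"] d by auto
  then have "w < measure \<rho>1 {..x + e}" using le[of x] w by linarith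
  then have "quantile \<rho>1 w \<le> x + e" by (intro quantile_le[OF \<rho>(1,2) w(1)])
  then show "quantile \<rho>1 w \<le> quantile \<rho>2 w' + e + d" using x by linarith
qed

text \<open>Markov's inequality for the p-th power at level e powr p; the integral is eventually
  below e times that level.\<close>

lemma coupling_tail_tendsto:
  assumes p: "1 \<le> p" and \<gamma>: "\<And>n. prob_space (\<gamma> n)" "\<And>n. sets (\<gamma> n) = sets (borel :: (real \<times> real) measure)"
    and int: "\<And>n. integrable (\<gamma> n) (\<lambda>z. \<bar>fst z - snd z\<bar> powr p)"
    and lim: "(\<lambda>n. \<integral>z. \<bar>fst z - snd z\<bar> powr p \<partial>\<gamma> n) \<longlonglongrightarrow> 0" and e: "0 < e"
  shows "\<forall>\<^sub>F n in sequentially. measure (\<gamma> n) {z. e < \<bar>fst z - snd z\<bar>} \<le> e"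
proof -
  have "\<forall>\<^sub>F n in sequentially. (\<integral>z. \<bar>fst z - snd z\<bar> powr p \<partial>\<gamma> n) < e * e powr p"
    using e by (intro order_tendstoD(2)[OF lim]) simp
  then show ?thesis
  proof eventually_elim
    fix n assume small: "(\<integral>z. \<bar>fst z - snd z\<bar> powr p \<partial>\<gamma> n) < e * e powr p"
    interpret prob_space "\<gamma> n" by (rule \<gamma>)
    have sp: "space (\<gamma> n) = UNIV" using sets_eq_imp_space_eq[OF \<gamma>(2)] by simp
    have "measure (\<gamma> n) {z. e < \<bar>fst z - snd z\<bar>} \<le> measure (\<gamma> n) {z \<in> space (\<gamma> n). e powr p \<le> \<bar>fst z - snd z\<bar> powr p}"
    proof (rule finite_measure_mono)
      show "{z. e < \<bar>fst z - snd z\<bar>} \<subseteq> {z \<in> space (\<gamma> n). e powr p \<le> \<bar>fst z - snd z\<bar> powr p}"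
        using e p by (auto simp: sp intro!: powr_mono2)
      show "{z \<in> space (\<gamma> n). e powr p \<le> \<bar>fst z - snd z\<bar> powr p} \<in> events"
        using borel_measurable_integrable[OF int[of n]] by measurable
    qed
    also have "\<dots> \<le> (\<integral>z. \<bar>fst z - snd z\<bar> powr p \<partial>\<gamma> n) / e powr p"
      by (rule integral_Markov_inequality_measure[OF int sets.top]) (use e in auto)
    also have "\<dots> \<le> e" using small e by (simp add: divide_le_eq)
    finally show "measure (\<gamma> n) {z. e < \<bar>fst z - snd z\<bar>} \<le> e" .
  qed
qed

text \<open>At a continuity point w of the limit, its values at w - r and w + r enclose the
  approximating quantiles up to \<epsilon>; choosing \<epsilon> < r absorbs the shift in
  mass.\<close>

lemma quantile_AE_tendsto:
  assumes \<rho>: "\<And>n. prob_space (\<rho>n n)" "\<And>n. sets (\<rho>n n) = sets borel" "prob_space \<rho>" "sets \<rho> = sets borel"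
    and close: "\<And>e. 0 < e \<Longrightarrow> \<forall>\<^sub>F n in sequentially. \<forall>x. measure (\<rho>n n) {..x} \<le> measure \<rho> {..x + e} + e \<and>
        measure \<rho> {..x} \<le> measure (\<rho>n n) {..x + e} + e"
  shows "AE w in leb01. (\<lambda>n. quantile (\<rho>n n) w) \<longlonglongrightarrow> quantile \<rho> w"
proof -
  let ?q = "quantile \<rho>"
  let ?C = "{w \<in> {0<..<1}. \<not> continuous (at w within {0<..<1}) ?q}"
  have "AE w in leb01. w \<notin> ?C" by (intro AE_leb01_countable mono_on_ctble_discont quantile_mono \<rho>)
  then show ?thesis
    using AE_space
  proof eventually_elim
    fix w assume w: "w \<notin> ?C" "w \<in> space leb01"
    then have w01: "0 < w" "w < 1" and "continuous (at w within {0<..<1}) ?q" by auto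
    then have c: "isCont ?q w" by (subst (asm) at_within_open) auto
    show "(\<lambda>n. quantile (\<rho>n n) w) \<longlonglongrightarrow> ?q w"
    proof (rule tendstoI)
      fix e :: real assume e: "0 < e"
      obtain d where d: "0 < d" "\<And>w'. dist w' w < d \<Longrightarrow> dist (?q w') (?q w) < e / 2"
        using c e unfolding continuous_at_eps_delta by (metis half_gt_zero)
      define r where "r = min (d / 2) (min (w / 2) ((1 - w) / 2))"
      have r: "0 < r" "r < d" "0 < w - r" "w + r < 1" using d w01 by (auto simp: r_def min_def field_simps)
      define \<epsilon> where "\<epsilon> = min (e / 4) (r / 2)"
      have \<epsilon>: "0 < \<epsilon>" "\<epsilon> < r" "\<epsilon> < e / 2" using e r by (auto simp: \<epsilon>_def min_def)
      show "\<forall>\<^sub>F n in sequentially. dist (quantile (\<rho>n n) w) (?q w) < e"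
        using close[OF \<epsilon>(1)]
      proof eventually_elim
        fix n assume cl: "\<forall>x. measure (\<rho>n n) {..x} \<le> measure \<rho> {..x + \<epsilon>} + \<epsilon> \<and> measure \<rho> {..x} \<le> measure (\<rho>n n) {..x + \<epsilon>} + \<epsilon>"
        have "quantile (\<rho>n n) w \<le> ?q (w + r) + \<epsilon>"
          using cl w01 r \<epsilon> by (intro quantile_shift_le \<rho>) auto
        moreover have "?q (w - r) \<le> quantile (\<rho>n n) w + \<epsilon>"
          using cl w01 r \<epsilon> by (intro quantile_shift_le \<rho>) auto
        moreover have "dist (?q (w + r)) (?q w) < e / 2" "dist (?q (w - r)) (?q w) < e / 2"
          using r by (intro d(2); simp add: dist_real_def)+
        ultimately show "dist (quantile (\<rho>n n) w) (?q w) < e" using \<epsilon> unfolding dist_real_def by linarith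
      qed
    qed
  qed
qed

text \<open>Convexity of the p-th power at a + b = (1 - \<theta>) (a / (1 - \<theta>)) + \<theta> (b
  / \<theta>). As \<theta> tends to 0 the factor of the first term tends to 1, which the cruder
  \<open>powr_add_le\<close> does not offer.\<close>

lemma powr_weighted_triangle:
  fixes a b p :: real
  assumes p: "1 \<le> p" and \<theta>: "0 < \<theta>" "\<theta> < 1"
  shows "\<bar>a + b\<bar> powr p \<le> (1 - \<theta>) powr (1 - p) * \<bar>a\<bar> powr p + \<theta> powr (1 - p) * \<bar>b\<bar> powr p"
proof -
  define c where "c = a + b"
  define s where "s = p * spow (p - 1) c"
  have t1: "\<bar>c\<bar> powr p + s * (a / (1 - \<theta>) - c) \<le> \<bar>a / (1 - \<theta>)\<bar> powr p" unfolding s_def by (rule powr_above_tangent[OF p])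
  have t2: "\<bar>c\<bar> powr p + s * (b / \<theta> - c) \<le> \<bar>b / \<theta>\<bar> powr p" unfolding s_def by (rule powr_above_tangent[OF p])
  have "(1 - \<theta>) * (\<bar>c\<bar> powr p + s * (a / (1 - \<theta>) - c)) + \<theta> * (\<bar>c\<bar> powr p + s * (b / \<theta> - c))
      \<le> (1 - \<theta>) * \<bar>a / (1 - \<theta>)\<bar> powr p + \<theta> * \<bar>b / \<theta>\<bar> powr p"
    using \<theta> by (intro add_mono mult_left_mono t1 t2) auto
  also have "(1 - \<theta>) * (\<bar>c\<bar> powr p + s * (a / (1 - \<theta>) - c)) + \<theta> * (\<bar>c\<bar> powr p + s * (b / \<theta> - c)) = \<bar>c\<bar> powr p"
  proof -
    have "(1 - \<theta>) * (a / (1 - \<theta>) - c) = a - (1 - \<theta>) * c" "\<theta> * (b / \<theta> - c) = b - \<theta> * c"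
      using \<theta> by (auto simp: right_diff_distrib)
    then have "(1 - \<theta>) * (s * (a / (1 - \<theta>) - c)) + \<theta> * (s * (b / \<theta> - c)) = s * (a - (1 - \<theta>) * c) + s * (b - \<theta> * c)"
      by (metis mult.left_commute)
    also have "\<dots> = 0" by (simp add: c_def algebra_simps)
    finally show ?thesis by (simp add: algebra_simps)
  qed
  also have "(1 - \<theta>) * \<bar>a / (1 - \<theta>)\<bar> powr p = (1 - \<theta>) powr (1 - p) * \<bar>a\<bar> powr p"
    using \<theta> by (simp add: abs_divide powr_divide powr_diff)
  also have "\<theta> * \<bar>b / \<theta>\<bar> powr p = \<theta> powr (1 - p) * \<bar>b\<bar> powr p"
    using \<theta> by (simp add: abs_divide powr_divide powr_diff)
  finally show ?thesis by (simp add: c_def)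
qed

text \<open>The limit in n is taken first, with \<theta> fixed; then \<theta> tends to 0.\<close>

lemma limsup_moment_le:
  fixes A J :: real and B :: "nat \<Rightarrow> real"
  assumes p: "1 \<le> p" and A: "0 \<le> A" and J: "Jn \<longlonglongrightarrow> 0"
    and le: "\<And>n \<theta>. 0 < \<theta> \<Longrightarrow> \<theta> < 1 \<Longrightarrow> B n \<le> (1 - \<theta>) powr (1 - p) * A + \<theta> powr (1 - p) * Jn n"
  shows "limsup (\<lambda>n. ennreal (B n)) \<le> ennreal A"
proof -
  have b: "limsup (\<lambda>n. ennreal (B n)) \<le> ennreal ((1 - \<theta>) powr (1 - p) * A)" if \<theta>: "0 < \<theta>" "\<theta> < 1" for \<theta>
  proof -
    have "(\<lambda>n. (1 - \<theta>) powr (1 - p) * A + \<theta> powr (1 - p) * Jn n) \<longlonglongrightarrow> (1 - \<theta>) powr (1 - p) * A + \<theta> powr (1 - p) * 0"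
      by (intro tendsto_intros J)
    then have "(\<lambda>n. ennreal ((1 - \<theta>) powr (1 - p) * A + \<theta> powr (1 - p) * Jn n)) \<longlonglongrightarrow> ennreal ((1 - \<theta>) powr (1 - p) * A)"
      by (intro tendsto_ennrealI) simp
    then have "limsup (\<lambda>n. ennreal ((1 - \<theta>) powr (1 - p) * A + \<theta> powr (1 - p) * Jn n)) = ennreal ((1 - \<theta>) powr (1 - p) * A)"
      by (intro lim_imp_Limsup) auto
    moreover have "limsup (\<lambda>n. ennreal (B n)) \<le> limsup (\<lambda>n. ennreal ((1 - \<theta>) powr (1 - p) * A + \<theta> powr (1 - p) * Jn n))"
      by (intro Limsup_mono always_eventually allI ennreal_leI le \<theta>)
    ultimately show ?thesis by simp
  qed
  have "((\<lambda>\<theta>. (1 - \<theta>) powr (1 - p) * A) \<longlongrightarrow> (1 - 0) powr (1 - p) * A) (at_right 0)"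
    by (intro tendsto_intros) auto
  then have "((\<lambda>\<theta>. ennreal ((1 - \<theta>) powr (1 - p) * A)) \<longlongrightarrow> ennreal A) (at_right 0)"
    by (intro tendsto_ennrealI) simp
  then show ?thesis
  proof (rule tendsto_lowerbound)
    show "\<forall>\<^sub>F \<theta> in at_right 0. limsup (\<lambda>n. ennreal (B n)) \<le> ennreal ((1 - \<theta>) powr (1 - p) * A)"
      using b by (auto simp: eventually_at_right_field intro!: exI[of _ 1])
  qed simp
qed

text \<open>
  Convergence of quantiles almost everywhere (by a bound for the Levy distance) and of the moments together
  give convergence in \<open>L\<^sup>p\<close>.
\<close>

lemma W_dist_tendsto_quantile:
  assumes p: "1 \<le> p" and \<rho>: "\<And>n. \<rho>n n \<in> P_space p" "\<rho> \<in> P_space p" and lim: "(\<lambda>n. W_dist p (\<rho>n n) \<rho>) \<longlonglongrightarrow> 0"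
  shows "AE w in leb01. (\<lambda>n. quantile (\<rho>n n) w) \<longlonglongrightarrow> quantile \<rho> w"
    "(\<lambda>n. \<integral>\<^sup>+ w. \<bar>quantile (\<rho>n n) w - quantile \<rho> w\<bar> powr p \<partial>leb01) \<longlonglongrightarrow> 0"
proof -
  obtain \<gamma> where \<gamma>: "\<And>n. \<gamma> n \<in> couplings (\<rho>n n) \<rho>" "(\<lambda>n. \<integral>z. \<bar>fst z - snd z\<bar> powr p \<partial>\<gamma> n) \<longlonglongrightarrow> 0"
    using W_dist_tendsto_couplings[OF p \<rho> lim] by blast
  have g: "prob_space (\<gamma> n)" "sets (\<gamma> n) = sets borel" "distr (\<gamma> n) borel fst = \<rho>n n" "distr (\<gamma> n) borel snd = \<rho>" for n
    using \<gamma>(1)[of n] by (auto simp: couplings_def)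
  note int = coupling_integrable[OF \<rho>(1) \<rho>(2) p \<gamma>(1)]
  show ae: "AE w in leb01. (\<lambda>n. quantile (\<rho>n n) w) \<longlonglongrightarrow> quantile \<rho> w"
  proof (rule quantile_AE_tendsto)
    fix e :: real assume "0 < e"
    from coupling_tail_tendsto[OF p g(1,2) int(1) \<gamma>(2) this]
    show "\<forall>\<^sub>F n in sequentially. \<forall>x. measure (\<rho>n n) {..x} \<le> measure \<rho> {..x + e} + e \<and>
        measure \<rho> {..x} \<le> measure (\<rho>n n) {..x + e} + e"
      by eventually_elim (blast intro: coupling_cdf_le[OF \<gamma>(1)])
  qed (use \<rho> in \<open>auto simp: P_space_def\<close>)
  have [measurable]: "quantile (\<rho>n n) \<in> borel_measurable leb01" "quantile \<rho> \<in> borel_measurable leb01" for n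
    using quantile_measurable \<rho> by auto
  have q: "integrable leb01 (\<lambda>w. \<bar>quantile (\<rho>n n) w\<bar> powr p)" "integrable leb01 (\<lambda>w. \<bar>quantile \<rho> w\<bar> powr p)" for n
    using quantile_Lp \<rho> by (auto simp: Lp_def)
  have mom: "(\<integral>x. \<bar>x\<bar> powr p \<partial>\<rho>n n) = (\<integral>z. \<bar>fst z\<bar> powr p \<partial>\<gamma> n)" "(\<integral>x. \<bar>x\<bar> powr p \<partial>\<rho>) = (\<integral>z. \<bar>snd z\<bar> powr p \<partial>\<gamma> n)" for n
  proof -
    have m: "f \<in> borel_measurable (\<gamma> n)" if "f \<in> borel_measurable borel" for f :: "real \<times> real \<Rightarrow> real"
      using that measurable_cong_sets[OF g(2) refl] by blast
    have f: "fst \<in> borel_measurable (borel :: (real \<times> real) measure)" "snd \<in> borel_measurable (borel :: (real \<times> real) measure)"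
      by (auto intro!: borel_measurable_continuous_onI continuous_intros)
    show "(\<integral>x. \<bar>x\<bar> powr p \<partial>\<rho>n n) = (\<integral>z. \<bar>fst z\<bar> powr p \<partial>\<gamma> n)"
      unfolding g(3)[of n, symmetric] by (subst integral_distr[OF m[OF f(1)]]) auto
    show "(\<integral>x. \<bar>x\<bar> powr p \<partial>\<rho>) = (\<integral>z. \<bar>snd z\<bar> powr p \<partial>\<gamma> n)"
      by (subst g(4)[of n, symmetric], subst integral_distr[OF m[OF f(2)]]) auto
  qed
  have "limsup (\<lambda>n. ennreal (\<integral>x. \<bar>x\<bar> powr p \<partial>\<rho>n n)) \<le> ennreal (\<integral>x. \<bar>x\<bar> powr p \<partial>\<rho>)"
  proof (rule limsup_moment_le[OF p _ \<gamma>(2)])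
    fix n and \<theta> :: real assume \<theta>: "0 < \<theta>" "\<theta> < 1"
    have "(\<integral>z. \<bar>fst z\<bar> powr p \<partial>\<gamma> n) \<le> (\<integral>z. (1 - \<theta>) powr (1 - p) * \<bar>snd z\<bar> powr p + \<theta> powr (1 - p) * \<bar>fst z - snd z\<bar> powr p \<partial>\<gamma> n)"
    proof (rule integral_mono)
      fix z show "\<bar>fst z\<bar> powr p \<le> (1 - \<theta>) powr (1 - p) * \<bar>snd z\<bar> powr p + \<theta> powr (1 - p) * \<bar>fst z - snd z\<bar> powr p"
        using powr_weighted_triangle[OF p \<theta>, of "snd z" "fst z - snd z"] by simp
    qed (use int[of n] in auto)
    also have "\<dots> = (1 - \<theta>) powr (1 - p) * (\<integral>z. \<bar>snd z\<bar> powr p \<partial>\<gamma> n) + \<theta> powr (1 - p) * (\<integral>z. \<bar>fst z - snd z\<bar> powr p \<partial>\<gamma> n)"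
      using int[of n] by simp
    finally show "(\<integral>x. \<bar>x\<bar> powr p \<partial>\<rho>n n) \<le> (1 - \<theta>) powr (1 - p) * (\<integral>x. \<bar>x\<bar> powr p \<partial>\<rho>) + \<theta> powr (1 - p) * (\<integral>z. \<bar>fst z - snd z\<bar> powr p \<partial>\<gamma> n)"
      by (simp add: mom(1) mom(2)[of n])
  qed simp
  then have le: "limsup (\<lambda>n. \<integral>\<^sup>+ w. \<bar>quantile (\<rho>n n) w\<bar> powr p \<partial>leb01) \<le> (\<integral>\<^sup>+ w. \<bar>quantile \<rho> w\<bar> powr p \<partial>leb01)"
    using q integral_quantile(1)[OF \<rho>(1), of "\<lambda>x. \<bar>x\<bar> powr p"] integral_quantile(1)[OF \<rho>(2), of "\<lambda>x. \<bar>x\<bar> powr p"]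
    by (simp add: nn_integral_eq_integral)
  show "(\<lambda>n. \<integral>\<^sup>+ w. \<bar>quantile (\<rho>n n) w - quantile \<rho> w\<bar> powr p \<partial>leb01) \<longlonglongrightarrow> 0"
    by (rule riesz_convergence[OF p _ _ q ae le]) auto
qed

section \<open>Measures and momenta\<close>

lemma momentum_eq_imp_AE:
  fixes v v' :: "real \<Rightarrow> real"
  assumes s: "sets \<rho> = sets borel" and int: "integrable \<rho> v" "integrable \<rho> v'" and eq: "momentum \<rho> v = momentum \<rho> v'"
  shows "AE x in \<rho>. v x = v' x"
proof (rule density_unique_real[OF int])
  fix A assume "A \<in> sets \<rho>"
  then show "(LINT x:A|\<rho>. v x) = (LINT x:A|\<rho>. v' x)"
    using fun_cong[OF eq, of A] s by (simp add: momentum_def)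
qed

lemma momentum_cong_AE:
  assumes s: "sets \<rho> = sets borel" and m: "v \<in> borel_measurable borel" "v' \<in> borel_measurable borel"
    and eq: "AE x in \<rho>. v x = v' x"
  shows "momentum \<rho> v = momentum \<rho> v'"
proof
  fix A
  have [measurable]: "v \<in> borel_measurable \<rho>" "v' \<in> borel_measurable \<rho>" using m measurable_cong_sets[OF s refl] by auto
  show "momentum \<rho> v A = momentum \<rho> v' A"
  proof (cases "A \<in> sets borel")
    case True
    then have [measurable]: "A \<in> sets \<rho>" using s by simp
    have "(LINT x:A|\<rho>. v x) = (LINT x:A|\<rho>. v' x)"
      unfolding set_lebesgue_integral_def
      by (rule integral_cong_AE) (use eq in \<open>measurable, eventually_elim, simp\<close>)
    then show ?thesis by (simp add: momentum_def)
  qed (simp add: momentum_def)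
qed

lemma momentum_signed_measure:
  assumes s: "sets \<rho> = sets borel" and v: "integrable \<rho> v"
  shows "momentum \<rho> v \<in> signed_measures"
proof -
  note [measurable] = borel_measurable_integrable[OF v]
  have iA: "integrable \<rho> (\<lambda>x. indicator A x * v x)" if "A \<in> sets borel" for A
    using integrable_mult_indicator[OF _ v, of A] that s by simp
  have bound: "(\<Sum>A\<in>P. \<bar>momentum \<rho> v A\<bar>) \<le> (\<integral>x. \<bar>v x\<bar> \<partial>\<rho>)"
    if P: "finite P" "P \<subseteq> sets borel" "disjoint P" for P
  proof -
    have "(\<Sum>A\<in>P. \<bar>momentum \<rho> v A\<bar>) \<le> (\<Sum>A\<in>P. \<integral>x. indicator A x * \<bar>v x\<bar> \<partial>\<rho>)"
    proof (rule sum_mono)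
      fix A assume A: "A \<in> P"
      then have "\<bar>momentum \<rho> v A\<bar> = \<bar>\<integral>x. indicator A x * v x \<partial>\<rho>\<bar>"
        using P by (auto simp: momentum_def set_lebesgue_integral_def)
      also have "\<dots> \<le> (\<integral>x. \<bar>indicator A x * v x\<bar> \<partial>\<rho>)" by (rule integral_abs_bound)
      also have "\<dots> = (\<integral>x. indicator A x * \<bar>v x\<bar> \<partial>\<rho>)" by (simp add: abs_mult)
      finally show "\<bar>momentum \<rho> v A\<bar> \<le> (\<integral>x. indicator A x * \<bar>v x\<bar> \<partial>\<rho>)" .
    qed
    also have "\<dots> = (\<integral>x. (\<Sum>A\<in>P. indicator A x * \<bar>v x\<bar>) \<partial>\<rho>)"
    proof (rule Bochner_Integration.integral_sum[symmetric])
      fix A assume "A \<in> P"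
      then show "integrable \<rho> (\<lambda>x. indicator A x * \<bar>v x\<bar>)"
        using integrable_mult_indicator[of A \<rho> "\<lambda>x. \<bar>v x\<bar>"] v P s by auto
    qed
    also have "\<dots> \<le> (\<integral>x. \<bar>v x\<bar> \<partial>\<rho>)"
    proof (rule integral_mono)
      fix x
      have "disjoint_family_on (\<lambda>A. A) P" using P(3) by (auto simp: disjoint_family_on_def disjoint_def)
      then have "(indicator (\<Union>A\<in>P. A) x :: real) = (\<Sum>A\<in>P. indicator A x)"
        by (rule indicator_UN_disjoint[OF P(1)])
      then have "(\<Sum>A\<in>P. indicator A x) = (indicator (\<Union>P) x :: real)" by simp
      then have "(\<Sum>A\<in>P. indicator A x * \<bar>v x\<bar>) = indicator (\<Union>P) x * \<bar>v x\<bar>"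
        by (simp add: sum_distrib_right[symmetric])
      then show "(\<Sum>A\<in>P. indicator A x * \<bar>v x\<bar>) \<le> \<bar>v x\<bar>" by (simp add: indicator_def)
    next
      show "integrable \<rho> (\<lambda>x. \<Sum>A\<in>P. indicator A x * \<bar>v x\<bar>)"
      proof (rule Bochner_Integration.integrable_sum)
        fix A assume "A \<in> P"
        then show "integrable \<rho> (\<lambda>x. indicator A x * \<bar>v x\<bar>)"
          using integrable_mult_indicator[of A \<rho> "\<lambda>x. \<bar>v x\<bar>"] v P s by auto
      qed
    qed (use v in simp)
    finally show ?thesis .
  qed
  have add: "(\<lambda>i. momentum \<rho> v (A i)) sums momentum \<rho> v (\<Union>i. A i)"
    if A: "range A \<subseteq> sets borel" "disjoint_family A" for A :: "nat \<Rightarrow> real set"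
  proof -
    have AB: "A i \<in> sets borel" for i using A(1) by auto
    have U: "(\<Union>i. A i) \<in> sets borel" using AB by auto
    have "summable (\<lambda>i. \<bar>momentum \<rho> v (A i)\<bar>)"
    proof (rule summableI_nonneg_bounded)
      fix n
      let ?P = "A ` {..<n} - {{}}"
      \<comment> \<open>Empty sets may recur in the sequence and are dropped; a disjoint sequence of
        nonempty sets is injective.\<close>
      have inj: "inj_on A {i\<in>{..<n}. A i \<noteq> {}}"
        using A(2) by (auto simp: inj_on_def disjoint_family_on_def)
      have "(\<Sum>i<n. \<bar>momentum \<rho> v (A i)\<bar>) = (\<Sum>i\<in>{i\<in>{..<n}. A i \<noteq> {}}. \<bar>momentum \<rho> v (A i)\<bar>)"
        by (rule sum.mono_neutral_right) (auto simp: momentum_def set_lebesgue_integral_def)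
      also have "\<dots> = (\<Sum>B\<in>A ` {i\<in>{..<n}. A i \<noteq> {}}. \<bar>momentum \<rho> v B\<bar>)" using sum.reindex[OF inj, of "\<lambda>B. \<bar>momentum \<rho> v B\<bar>"] by (simp add: o_def)
      also have "\<dots> \<le> (\<integral>x. \<bar>v x\<bar> \<partial>\<rho>)"
        using AB disjoint_family_on_disjoint_image[OF disjoint_family_on_mono[OF _ A(2)]] by (intro bound) auto
      finally show "(\<Sum>i<n. \<bar>momentum \<rho> v (A i)\<bar>) \<le> (\<integral>x. \<bar>v x\<bar> \<partial>\<rho>)" .
    qed simp
    then have "summable (\<lambda>i. momentum \<rho> v (A i))" by (rule summable_rabs_cancel)
    moreover have "(\<Sum>i. momentum \<rho> v (A i)) = momentum \<rho> v (\<Union>i. A i)"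
    proof -
      have "(LINT x:(\<Union>i. A i)|\<rho>. v x) = (\<Sum>i. (LINT x:(A i)|\<rho>. v x))"
      proof (rule lebesgue_integral_countable_add)
        show "A i \<in> sets \<rho>" for i using AB s by simp
        show "A i \<inter> A j = {}" if "i \<noteq> j" for i j using A(2) that by (auto simp: disjoint_family_on_def)
        show "set_integrable \<rho> (\<Union>i. A i) v" unfolding set_integrable_def using iA[OF U] by simp
      qed
      then show ?thesis using AB U by (simp add: momentum_def)
    qed
    ultimately show ?thesis by (simp add: sums_iff)
  qed
  show ?thesis
    unfolding signed_measures_def using add bound by (auto simp: momentum_def[of \<rho> v] intro!: exI[of _ "\<integral>x. \<bar>v x\<bar> \<partial>\<rho>"])
qed

lemma Lp_borel:
  assumes p: "2 \<le> p" and \<rho>: "\<rho> \<in> P_space p" and v: "v \<in> Lp p \<rho>"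
  shows "v \<in> borel_measurable borel" "integrable \<rho> v"
proof -
  interpret prob_space \<rho> using \<rho> by (simp add: P_space_def)
  have s: "sets \<rho> = sets borel" using \<rho> by (simp add: P_space_def)
  show "v \<in> borel_measurable borel" using Lp_measurable[OF v] measurable_cong_sets[OF s refl] by blast
  show "integrable \<rho> v"
    using square_integrable_imp_integrable[OF Lp_measurable[OF v]] Lp_imp_square_integrable[OF p v] by simp
qed

lemma V_space_iff:
  assumes p: "2 \<le> p"
  shows "\<mu> \<in> V_space p \<longleftrightarrow> fst \<mu> \<in> P_space p \<and> (\<exists>v\<in>Lp p (fst \<mu>). snd \<mu> = momentum (fst \<mu>) v)"
proof -
  have "momentum \<rho> v \<in> signed_measures" if "\<rho> \<in> P_space p" "v \<in> Lp p \<rho>" for \<rho> v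
    using that Lp_borel[OF p that] by (intro momentum_signed_measure) (auto simp: P_space_def)
  then show ?thesis unfolding V_space_def by (cases \<mu>) fastforce
qed

lemma velocity_props:
  assumes p: "2 \<le> p" and \<mu>: "\<mu> \<in> V_space p"
  shows "velocity \<mu> \<in> borel_measurable borel" "integrable (fst \<mu>) (velocity \<mu>)"
    "snd \<mu> = momentum (fst \<mu>) (velocity \<mu>)" "velocity \<mu> \<in> Lp p (fst \<mu>)"
proof -
  obtain v where v: "fst \<mu> \<in> P_space p" "v \<in> Lp p (fst \<mu>)" "snd \<mu> = momentum (fst \<mu>) v"
    using \<mu> by (auto simp: V_space_iff[OF p])
  have s: "sets (fst \<mu>) = sets borel" using v by (simp add: P_space_def)
  note b = Lp_borel[OF p v(1,2)]
  have *: "velocity \<mu> \<in> borel_measurable borel \<and> integrable (fst \<mu>) (velocity \<mu>) \<and> snd \<mu> = momentum (fst \<mu>) (velocity \<mu>)"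
    unfolding velocity_def
    by (rule someI[of "\<lambda>v. v \<in> borel_measurable borel \<and> integrable (fst \<mu>) v \<and> snd \<mu> = momentum (fst \<mu>) v" v])
      (use b v in simp)
  then show m: "velocity \<mu> \<in> borel_measurable borel" and i: "integrable (fst \<mu>) (velocity \<mu>)"
    and "snd \<mu> = momentum (fst \<mu>) (velocity \<mu>)" by auto
  \<comment> \<open>\<open>velocity\<close> is chosen merely integrable; agreement almost everywhere
    with the given L^p density restores p-integrability.\<close>
  then have ae: "AE x in fst \<mu>. v x = velocity \<mu> x" using v(3) by (intro momentum_eq_imp_AE[OF s b(2)]) simp_all
  have [measurable]: "velocity \<mu> \<in> borel_measurable (fst \<mu>)" "v \<in> borel_measurable (fst \<mu>)" using i b(2) by auto
  have "integrable (fst \<mu>) (\<lambda>x. \<bar>velocity \<mu> x\<bar> powr p) \<longleftrightarrow> integrable (fst \<mu>) (\<lambda>x. \<bar>v x\<bar> powr p)"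
    by (rule integrable_cong_AE) (use ae in \<open>measurable, eventually_elim, simp\<close>)
  then show "velocity \<mu> \<in> Lp p (fst \<mu>)" using v(2) by (simp add: Lp_def)
qed

text \<open>The push-forward by \<open>X\<close> of Lebesgue measure and of the signed measure with
  density \<open>V\<close>. No Eulerian velocity occurs, so the pair depends only on the classes of
  \<open>X\<close> and \<open>V\<close>; for V = v \<circ> X it is the law of \<open>X\<close> with
  its momentum, by \<open>eulerian_comp\<close>.\<close>

definition eulerian :: "(real \<Rightarrow> real) \<Rightarrow> (real \<Rightarrow> real) \<Rightarrow> real measure \<times> (real set \<Rightarrow> real)" where
  "eulerian X V = (distr leb01 borel X, \<lambda>A. if A \<in> sets borel then \<integral>w. V w * indicator A (X w) \<partial>leb01 else 0)"

definition lagrX :: "real measure \<times> (real set \<Rightarrow> real) \<Rightarrow> real \<Rightarrow> real" where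
  "lagrX \<mu> = quantile (fst \<mu>)"

definition lagrV :: "real measure \<times> (real set \<Rightarrow> real) \<Rightarrow> real \<Rightarrow> real" where
  "lagrV \<mu> = velocity \<mu> \<circ> quantile (fst \<mu>)"

lemma eulerian_cong_AE:
  assumes "X \<in> borel_measurable leb01" "X' \<in> borel_measurable leb01" "V \<in> borel_measurable leb01" "V' \<in> borel_measurable leb01"
    "ae_eq X X'" "ae_eq V V'"
  shows "eulerian X V = eulerian X' V'"
proof -
  note [measurable] = assms(1-4)
  have "distr leb01 borel X = distr leb01 borel X'"
    using assms(5) unfolding ae_eq_def by (intro distr_cong_AE) auto
  moreover have "(\<integral>w. V w * indicator A (X w) \<partial>leb01) = (\<integral>w. V' w * indicator A (X' w) \<partial>leb01)" if [measurable]: "A \<in> sets borel" for A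
  proof (rule integral_cong_AE)
    show "AE w in leb01. V w * indicator A (X w) = V' w * indicator A (X' w)"
      using assms(5,6) unfolding ae_eq_def by eventually_elim simp
  qed measurable
  ultimately show ?thesis by (auto simp: eulerian_def)
qed

lemma eulerian_comp:
  assumes [measurable]: "X \<in> borel_measurable leb01" "V \<in> borel_measurable leb01" "v \<in> borel_measurable borel"
    and V: "ae_eq V (v \<circ> X)"
  shows "eulerian X V = (distr leb01 borel X, momentum (distr leb01 borel X) v)"
proof -
  have "(\<integral>w. V w * indicator A (X w) \<partial>leb01) = (LINT x:A|distr leb01 borel X. v x)" if [measurable]: "A \<in> sets borel" for A
  proof -
    have "(LINT x:A|distr leb01 borel X. v x) = (\<integral>w. indicator A (X w) * v (X w) \<partial>leb01)"
      unfolding set_lebesgue_integral_def by (subst integral_distr) auto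
    also have "\<dots> = (\<integral>w. V w * indicator A (X w) \<partial>leb01)"
    proof (rule integral_cong_AE)
      show "AE w in leb01. indicator A (X w) * v (X w) = V w * indicator A (X w)"
        using V unfolding ae_eq_def by eventually_elim simp
    qed measurable
    finally show ?thesis by simp
  qed
  then show ?thesis by (auto simp: eulerian_def momentum_def)
qed

lemma X_space_comp:
  assumes p: "2 \<le> p" and Z: "(X, V) \<in> X_space p"
  obtains v where "X \<in> borel_measurable leb01" "V \<in> borel_measurable leb01" "v \<in> borel_measurable borel" "ae_eq V (v \<circ> X)"
proof -
  have "X \<in> Lp p leb01" "V \<in> Lp p leb01" "\<exists>v\<in>borel_measurable borel. ae_eq V (v \<circ> X)"
    using Z by (auto simp: X_space_def)
  then show ?thesis using that Lp_measurable by blast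
qed

lemma distr_P_space:
  assumes "X \<in> Lp p leb01" shows "distr leb01 borel X \<in> P_space p"
proof -
  have [measurable]: "X \<in> borel_measurable leb01" using assms by (rule Lp_measurable)
  have "integrable (distr leb01 borel X) (\<lambda>x. \<bar>x\<bar> powr p)"
    using assms by (subst integrable_distr_eq) (auto simp: Lp_def)
  then show ?thesis by (simp add: P_space_def leb01.prob_space_distr)
qed

lemma eulerian_V_space:
  assumes p: "2 \<le> p" and Z: "(X, V) \<in> X_space p"
  shows "eulerian X V \<in> V_space p"
proof -
  obtain v where v: "X \<in> borel_measurable leb01" "V \<in> borel_measurable leb01" "v \<in> borel_measurable borel" "ae_eq V (v \<circ> X)"
    using X_space_comp[OF p Z] .
  note [measurable] = v(1-3)
  have L: "X \<in> Lp p leb01" "V \<in> Lp p leb01" using Z by (auto simp: X_space_def)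
  have "AE w in leb01. \<bar>v (X w)\<bar> powr p = \<bar>V w\<bar> powr p" using v(4) unfolding ae_eq_def by eventually_elim simp
  then have "integrable leb01 (\<lambda>w. \<bar>v (X w)\<bar> powr p) \<longleftrightarrow> integrable leb01 (\<lambda>w. \<bar>V w\<bar> powr p)"
    by (intro integrable_cong_AE) auto
  then have "integrable (distr leb01 borel X) (\<lambda>x. \<bar>v x\<bar> powr p)"
    using L by (subst integrable_distr_eq) (auto simp: Lp_def)
  then have "v \<in> Lp p (distr leb01 borel X)" by (simp add: Lp_def)
  then show ?thesis unfolding eulerian_comp[OF v] V_space_iff[OF p] using distr_P_space[OF L(1)] by auto
qed

lemma cone_K_quantile:
  assumes X: "X \<in> cone_K" shows "ae_eq (quantile (distr leb01 borel X)) X"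
proof -
  obtain Z where Z: "mono_on {0<..<1} Z" "ae_eq X Z" using X by (auto simp: cone_K_def)
  have [measurable]: "X \<in> borel_measurable leb01" "Z \<in> borel_measurable leb01"
    using cone_K_L2[OF X] mono_on_measurable_leb01[OF Z(1)] by (auto intro: L2_measurable)
  have "distr leb01 borel X = distr leb01 borel Z" using Z(2) unfolding ae_eq_def by (intro distr_cong_AE) auto
  then show ?thesis using quantile_distr[OF Z(1)] Z(2) by (auto intro: ae_eq_trans ae_eq_sym)
qed

text \<open>The Eulerian density is determined up to a null set for the law of \<open>X\<close>, so
  its composition with \<open>X\<close> is determined almost everywhere on (0,1).\<close>

lemma velocity_eulerian:
  assumes p: "2 \<le> p" and Z: "(X, V) \<in> X_space p"
  shows "ae_eq (velocity (eulerian X V) \<circ> X) V"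
proof -
  obtain v where v: "X \<in> borel_measurable leb01" "V \<in> borel_measurable leb01" "v \<in> borel_measurable borel" "ae_eq V (v \<circ> X)"
    using X_space_comp[OF p Z] .
  note [measurable] = v(1-3)
  note vp = velocity_props[OF p eulerian_V_space[OF p Z]]
  have [measurable]: "velocity (eulerian X V) \<in> borel_measurable borel" by (rule vp)
  have f: "fst (eulerian X V) = distr leb01 borel X" by (simp add: eulerian_def)
  have V: "integrable leb01 V" using Z Lp_subset_L2[OF p] L2_integrable by (auto simp: X_space_def)
  have "AE w in leb01. v (X w) = V w" using v(4) unfolding ae_eq_def by eventually_elim simp
  then have "integrable leb01 (\<lambda>w. v (X w)) \<longleftrightarrow> integrable leb01 V"
    by (intro integrable_cong_AE) auto
  then have "integrable (distr leb01 borel X) v" using V by (subst integrable_distr_eq) auto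
  then have "AE x in distr leb01 borel X. velocity (eulerian X V) x = v x"
    using vp(2,3) eulerian_comp[OF v] by (intro momentum_eq_imp_AE) (auto simp: f)
  then have "AE w in leb01. velocity (eulerian X V) (X w) = v (X w)"
    by (subst (asm) AE_distr_iff) auto
  then show ?thesis using v(4) unfolding ae_eq_def by eventually_elim simp
qed

lemma lagrX_eulerian: "(X, V) \<in> X_space p \<Longrightarrow> ae_eq (lagrX (eulerian X V)) X"
  by (auto simp: lagrX_def eulerian_def X_space_def intro: cone_K_quantile)

lemma lagrV_eulerian:
  assumes p: "2 \<le> p" and Z: "(X, V) \<in> X_space p"
  shows "ae_eq (lagrV (eulerian X V)) V"
  using velocity_eulerian[OF p Z] lagrX_eulerian[OF Z] unfolding ae_eq_def lagrV_def lagrX_def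
  by eventually_elim simp

lemma lagr_X_space:
  assumes p: "2 \<le> p" and \<mu>: "\<mu> \<in> V_space p"
  shows "(lagrX \<mu>, lagrV \<mu>) \<in> X_space p"
proof -
  have \<rho>: "fst \<mu> \<in> P_space p" using \<mu> by (simp add: V_space_iff[OF p])
  note vp = velocity_props[OF p \<mu>]
  have X: "lagrX \<mu> \<in> Lp p leb01" unfolding lagrX_def by (rule quantile_Lp[OF \<rho>])
  have [measurable]: "velocity \<mu> \<in> borel_measurable borel" "quantile (fst \<mu>) \<in> borel_measurable leb01"
    by (rule vp) (rule quantile_measurable[OF \<rho>])
  have "integrable leb01 (\<lambda>w. \<bar>velocity \<mu> (quantile (fst \<mu>) w)\<bar> powr p)"
    using vp(4) by (subst integral_quantile(2)[OF \<rho>, of "\<lambda>x. \<bar>velocity \<mu> x\<bar> powr p"]) (auto simp: Lp_def)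
  then have V: "lagrV \<mu> \<in> Lp p leb01" by (simp add: Lp_def lagrV_def)
  note L = Lp_subset_L2[OF p X] Lp_subset_L2[OF p V]
  have "mono_on {0<..<1} (lagrX \<mu>)" unfolding lagrX_def using \<rho> by (intro quantile_mono) (auto simp: P_space_def)
  then have "cls (lagrX \<mu>) \<in> K2" by (intro cls_in_K2 L)
  moreover have "cls (lagrV \<mu>) \<in> H2 (cls (lagrX \<mu>))"
    unfolding H2_cls_iff[OF L] by (rule bexI[of _ "velocity \<mu>"]) (auto simp: lagrV_def lagrX_def)
  ultimately show ?thesis
    unfolding X_space_iff[OF p] lag_data_def using X V L by (simp add: Lp_iff_Np)
qed

lemma eulerian_lagr:
  assumes p: "2 \<le> p" and \<mu>: "\<mu> \<in> V_space p"
  shows "eulerian (lagrX \<mu>) (lagrV \<mu>) = \<mu>"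
proof -
  have \<rho>: "fst \<mu> \<in> P_space p" using \<mu> by (simp add: V_space_iff[OF p])
  have d: "distr leb01 borel (lagrX \<mu>) = fst \<mu>" unfolding lagrX_def using \<rho> by (intro distr_quantile) (auto simp: P_space_def)
  note vp = velocity_props[OF p \<mu>]
  have [measurable]: "velocity \<mu> \<in> borel_measurable borel" "quantile (fst \<mu>) \<in> borel_measurable leb01"
    by (rule vp) (rule quantile_measurable[OF \<rho>])
  have "eulerian (lagrX \<mu>) (lagrV \<mu>) = (distr leb01 borel (lagrX \<mu>), momentum (distr leb01 borel (lagrX \<mu>)) (velocity \<mu>))"
    by (rule eulerian_comp) (auto simp: lagrX_def lagrV_def)
  then show ?thesis using vp(3) by (simp add: d prod_eq_iff)
qed

text \<open>Quantile function and velocity recover the pair from its image. This gives the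
  implication from measures to functions in the equivalence.\<close>

lemma eulerian_inj:
  assumes p: "2 \<le> p" and Z: "(X, V) \<in> X_space p" "(X', V') \<in> X_space p" and eq: "eulerian X V = eulerian X' V'"
  shows "ae_eq X X'" "ae_eq V V'"
  using ae_eq_trans[OF ae_eq_sym[OF lagrX_eulerian[OF Z(1)]] lagrX_eulerian[OF Z(2), folded eq]]
    ae_eq_trans[OF ae_eq_sym[OF lagrV_eulerian[OF p Z(1)]] lagrV_eulerian[OF p Z(2), folded eq]] .

text \<open>The Lagrangian flow conjugated by quantile functions; it is the candidate for
  \<open>sticky_semigroup\<close>.\<close>

definition euler_flow :: "real \<Rightarrow> real measure \<times> (real set \<Rightarrow> real) \<Rightarrow> real measure \<times> (real set \<Rightarrow> real)" where
  "euler_flow t \<mu> = eulerian (lag_X (lagrX \<mu>) (lagrV \<mu>) t) (lag_V (lagrX \<mu>) (lagrV \<mu>) t)"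

lemma lag_flow_cong:
  assumes d: "lag_data X V" "lag_data X' V'" and eq: "ae_eq X X'" "ae_eq V V'" and t: "0 \<le> t"
  shows "ae_eq (lag_X X V t) (lag_X X' V' t)" "ae_eq (lag_V X V t) (lag_V X' V' t)"
proof -
  have "cls X = cls X'" "cls V = cls V'" using d eq by (auto simp: lag_data_def cls_eq_iff)
  then have "cls (lag_X X V t) = cls (lag_X X' V' t)" "cls (lag_V X V t) = cls (lag_V X' V' t)"
    by (simp_all add: lag_X_props(4)[OF d(1)] lag_X_props(4)[OF d(2)] lag_V_props(3)[OF d(1) t] lag_V_props(3)[OF d(2) t])
  then show "ae_eq (lag_X X V t) (lag_X X' V' t)" "ae_eq (lag_V X V t) (lag_V X' V' t)"
    by (simp_all add: cls_eq_iff lag_X_props(2)[OF d(1)] lag_X_props(2)[OF d(2)] lag_V_props(2)[OF d(1) t] lag_V_props(2)[OF d(2) t])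
qed

lemma euler_flow_eulerian:
  assumes p: "2 \<le> p" and Z: "(X, V) \<in> X_space p" and t: "0 \<le> t"
  shows "euler_flow t (eulerian X V) = eulerian (lag_X X V t) (lag_V X V t)"
proof -
  let ?\<mu> = "eulerian X V"
  have d: "lag_data X V" "lag_data (lagrX ?\<mu>) (lagrV ?\<mu>)"
    using Z lagr_X_space[OF p eulerian_V_space[OF p Z]] by (auto simp: X_space_iff[OF p])
  note c = lag_flow_cong[OF d(2,1) lagrX_eulerian[OF Z] lagrV_eulerian[OF p Z] t]
  show ?thesis unfolding euler_flow_def
    by (rule eulerian_cong_AE[OF _ _ _ _ c])
      (auto intro!: L2_measurable lag_X_props(2)[OF d(1)] lag_X_props(2)[OF d(2)] lag_V_props(2)[OF d(1) t] lag_V_props(2)[OF d(2) t])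
qed

lemma euler_flow_V_space:
  assumes p: "2 \<le> p" and \<mu>: "\<mu> \<in> V_space p" and t: "0 \<le> t"
  shows "euler_flow t \<mu> \<in> V_space p"
  unfolding euler_flow_def by (rule eulerian_V_space[OF p lag_flow_X_space[OF p lagr_X_space[OF p \<mu>] t]])

section \<open>Continuity of the flow of measures\<close>

lemma Np_add_tendsto:
  assumes p: "0 \<le> p" and lim: "(\<lambda>n. Np p (u n)) \<longlonglongrightarrow> 0" "(\<lambda>n. Np p (v n)) \<longlonglongrightarrow> 0"
  shows "(\<lambda>n. Np p (u n + v n)) \<longlonglongrightarrow> 0"
proof (rule tendsto_sandwich[OF _ _ tendsto_const])
  have "(\<lambda>n. ennreal (2 powr p) * (Np p (u n) + Np p (v n))) \<longlonglongrightarrow> ennreal (2 powr p) * (0 + 0)"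
    by (intro ennreal_tendsto_cmult tendsto_add lim) auto
  then show "(\<lambda>n. ennreal (2 powr p) * (Np p (u n) + Np p (v n))) \<longlonglongrightarrow> 0" by simp
qed (use Np_add_le[OF p] in auto)

lemma Np_scaleR_tendsto:
  assumes lim: "(\<lambda>n. Np p (u n)) \<longlonglongrightarrow> 0"
  shows "(\<lambda>n. Np p (c *\<^sub>R u n)) \<longlonglongrightarrow> 0"
proof -
  have "(\<lambda>n. ennreal (\<bar>c\<bar> powr p) * Np p (u n)) \<longlonglongrightarrow> ennreal (\<bar>c\<bar> powr p) * 0"
    by (intro ennreal_tendsto_cmult lim) auto
  then show ?thesis by (simp add: Np_scaleR)
qed

text \<open>A substitute for Hoelder's inequality: values of modulus at most \<open>d\<close>
  contribute at most d squared, larger ones are dominated by the p-th power as p \<ge> 2. With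
  \<open>d\<close> free this is enough for convergence.\<close>

lemma power2_norm_le_Np:
  assumes p: "2 \<le> p" and d: "0 < d"
  shows "ennreal ((norm u)\<^sup>2) \<le> ennreal (d\<^sup>2) + ennreal (d powr (2 - p)) * Np p u"
proof -
  note [measurable] = L2_measurable[OF rep_l2_in]
  have pt: "t\<^sup>2 \<le> d\<^sup>2 + d powr (2 - p) * \<bar>t\<bar> powr p" for t
  proof (cases "\<bar>t\<bar> \<le> d")
    case True
    then have "t\<^sup>2 \<le> d\<^sup>2" using d by (simp add: abs_le_square_iff[symmetric])
    then show ?thesis by (simp add: add_increasing2)
  next
    case False
    have "t\<^sup>2 = \<bar>t\<bar> powr (2 - p) * \<bar>t\<bar> powr p" using False d by (simp add: powr_add[symmetric])
    also have "\<dots> \<le> d powr (2 - p) * \<bar>t\<bar> powr p"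
      using False d p by (intro mult_right_mono powr_mono2') auto
    finally show ?thesis by (simp add: add_increasing)
  qed
  have "ennreal ((norm u)\<^sup>2) = (\<integral>\<^sup>+ w. ennreal ((rep_l2 u w)\<^sup>2) \<partial>leb01)"
    using power2_norm_cls[of "rep_l2 u"] rep_l2_in[of u] unfolding L2_iff
    by (subst nn_integral_eq_integral) auto
  also have "\<dots> \<le> (\<integral>\<^sup>+ w. ennreal (d\<^sup>2) + ennreal (d powr (2 - p)) * ennreal (\<bar>rep_l2 u w\<bar> powr p) \<partial>leb01)"
    using pt by (intro nn_integral_mono) (simp add: ennreal_mult'[symmetric] ennreal_plus[symmetric] ennreal_leI del: ennreal_plus)
  also have "\<dots> = ennreal (d\<^sup>2) + ennreal (d powr (2 - p)) * Np p u"
    unfolding Np_def by (simp add: nn_integral_add nn_integral_cmult leb01.emeasure_space_1[simplified])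
  finally show ?thesis .
qed

lemma Np_tendsto_imp_tendsto:
  assumes p: "2 \<le> p" and lim: "(\<lambda>n. Np p (u n - x)) \<longlonglongrightarrow> 0"
  shows "u \<longlonglongrightarrow> x"
proof (rule metric_LIMSEQ_I)
  fix e :: real assume e: "0 < e"
  let ?d = "e / 2"
  have "(\<lambda>n. ennreal (?d\<^sup>2) + ennreal (?d powr (2 - p)) * Np p (u n - x)) \<longlonglongrightarrow> ennreal (?d\<^sup>2) + ennreal (?d powr (2 - p)) * 0"
    by (intro tendsto_add tendsto_const ennreal_tendsto_cmult lim) auto
  moreover have "ennreal (?d\<^sup>2) + ennreal (?d powr (2 - p)) * 0 < ennreal (e\<^sup>2)"
    using e by (simp add: ennreal_less_iff power2_eq_square)
  ultimately have "\<forall>\<^sub>F n in sequentially. ennreal (?d\<^sup>2) + ennreal (?d powr (2 - p)) * Np p (u n - x) < ennreal (e\<^sup>2)"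
    by (rule order_tendstoD(2))
  then have "\<forall>\<^sub>F n in sequentially. dist (u n) x < e"
  proof eventually_elim
    fix n assume "ennreal (?d\<^sup>2) + ennreal (?d powr (2 - p)) * Np p (u n - x) < ennreal (e\<^sup>2)"
    then have "ennreal ((norm (u n - x))\<^sup>2) < ennreal (e\<^sup>2)"
      using power2_norm_le_Np[OF p, of ?d "u n - x"] e by (simp add: le_less_trans)
    then have "(norm (u n - x))\<^sup>2 < e\<^sup>2" by (simp add: ennreal_less_iff)
    then show "dist (u n) x < e" using e by (simp add: dist_norm power2_less_imp_less)
  qed
  then show "\<exists>no. \<forall>n\<ge>no. dist (u n) x < e" by (simp add: eventually_sequentially)
qed

lemma tendsto_if_subseq_tendsto:
  fixes u :: "nat \<Rightarrow> 'a::metric_space"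
  assumes "\<And>r. strict_mono (r :: nat \<Rightarrow> nat) \<Longrightarrow> \<exists>s :: nat \<Rightarrow> nat. strict_mono s \<and> (\<lambda>n. u (r (s n))) \<longlonglongrightarrow> l"
  shows "u \<longlonglongrightarrow> l"
proof (rule ccontr)
  assume "\<not> ?thesis"
  then obtain e where e: "0 < e" "\<exists>\<^sub>F n in sequentially. e \<le> dist (u n) l"
    by (auto simp: tendsto_iff frequently_def not_le not_less)
  have "\<exists>r. \<forall>n. e \<le> dist (u (r n)) l \<and> r n < r (Suc n)"
  proof (rule dependent_nat_choice)
    show "\<exists>n. e \<le> dist (u n) l" using frequently_ex[OF e(2)] .
    show "\<exists>m. e \<le> dist (u m) l \<and> n < m" for n
      using e(2) unfolding frequently_sequentially by (metis Suc_le_lessD)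
  qed
  then obtain r :: "nat \<Rightarrow> nat" where r: "\<And>n. e \<le> dist (u (r n)) l" "\<And>n. r n < r (Suc n)" by blast
  have "strict_mono r" using r(2) by (simp add: strict_mono_Suc_iff)
  from assms[OF this] obtain s :: "nat \<Rightarrow> nat" where "(\<lambda>n. u (r (s n))) \<longlonglongrightarrow> l" by blast
  from tendstoD[OF this e(1)] obtain n where "dist (u (r (s n))) l < e" by (auto dest: eventually_happens)
  then show False using r(1)[of "s n"] by simp
qed

lemma bounded_continuous_measurable:
  fixes \<phi> :: "real \<Rightarrow> real"
  assumes "continuous_on UNIV \<phi>" shows "\<phi> \<in> borel_measurable borel"
  using assms by (rule borel_measurable_continuous_onI)

text \<open>Norm convergence gives almost everywhere convergence only along subsequences, which
  suffices by \<open>tendsto_if_subseq_tendsto\<close>; the bound on \<open>\<phi>\<close> provides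
  the domination.\<close>

lemma composition_tendsto:
  assumes \<phi>: "continuous_on UNIV \<phi>" "\<And>t. \<bar>\<phi> t\<bar> \<le> (B::real)" and lim: "u \<longlonglongrightarrow> x"
  shows "(\<lambda>n. cls (\<phi> \<circ> rep_l2 (u n))) \<longlonglongrightarrow> cls (\<phi> \<circ> rep_l2 x)"
proof (rule tendsto_if_subseq_tendsto)
  fix r :: "nat \<Rightarrow> nat" assume r: "strict_mono r"
  note [measurable] = L2_measurable[OF rep_l2_in] bounded_continuous_measurable[OF \<phi>(1)]
  have L: "\<phi> \<circ> rep_l2 y \<in> L2" for y by (rule H2_bounded_comp(1)[OF bounded_continuous_measurable[OF \<phi>(1)] \<phi>(2)])
  have "(\<lambda>n. u (r n)) \<longlonglongrightarrow> x" using LIMSEQ_subseq_LIMSEQ[OF lim r] by (simp add: o_def)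
  then obtain s where s: "strict_mono s" "AE w in leb01. (\<lambda>n. rep_l2 (u (r (s n))) w) \<longlonglongrightarrow> rep_l2 x w"
    using l2_convergent_AE_subseq by blast
  have "(\<lambda>n. \<integral>w. (\<phi> (rep_l2 (u (r (s n))) w) - \<phi> (rep_l2 x w))\<^sup>2 \<partial>leb01) \<longlonglongrightarrow> (\<integral>w. 0 \<partial>leb01)"
  proof (rule integral_dominated_convergence[where w = "\<lambda>_. (2 * B)\<^sup>2"])
    show "AE w in leb01. (\<lambda>n. (\<phi> (rep_l2 (u (r (s n))) w) - \<phi> (rep_l2 x w))\<^sup>2) \<longlonglongrightarrow> 0"
      using s(2)
    proof eventually_elim
      fix w assume l: "(\<lambda>n. rep_l2 (u (r (s n))) w) \<longlonglongrightarrow> rep_l2 x w"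
      have "isCont \<phi> (rep_l2 x w)" using \<phi>(1) by (simp add: continuous_on_eq_continuous_at)
      then have "(\<lambda>n. \<phi> (rep_l2 (u (r (s n))) w)) \<longlonglongrightarrow> \<phi> (rep_l2 x w)" using l by (rule isCont_tendsto_compose)
      then have "(\<lambda>n. (\<phi> (rep_l2 (u (r (s n))) w) - \<phi> (rep_l2 x w))\<^sup>2) \<longlonglongrightarrow> (\<phi> (rep_l2 x w) - \<phi> (rep_l2 x w))\<^sup>2"
        by (intro tendsto_intros)
      then show "(\<lambda>n. (\<phi> (rep_l2 (u (r (s n))) w) - \<phi> (rep_l2 x w))\<^sup>2) \<longlonglongrightarrow> 0" by simp
    qed
    show "AE w in leb01. norm ((\<phi> (rep_l2 (u (r (s n))) w) - \<phi> (rep_l2 x w))\<^sup>2) \<le> (2 * B)\<^sup>2" for n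
    proof (rule AE_I2)
      fix w
      have "\<bar>\<phi> (rep_l2 (u (r (s n))) w) - \<phi> (rep_l2 x w)\<bar> \<le> 2 * B"
        using \<phi>(2)[of "rep_l2 (u (r (s n))) w"] \<phi>(2)[of "rep_l2 x w"] by linarith
      then show "norm ((\<phi> (rep_l2 (u (r (s n))) w) - \<phi> (rep_l2 x w))\<^sup>2) \<le> (2 * B)\<^sup>2"
        using power_mono[of "\<bar>\<phi> (rep_l2 (u (r (s n))) w) - \<phi> (rep_l2 x w)\<bar>" "2 * B" 2] by simp
    qed
  qed (simp_all, measurable)
  moreover have "(norm (cls (\<phi> \<circ> rep_l2 y) - cls (\<phi> \<circ> rep_l2 x)))\<^sup>2 = (\<integral>w. (\<phi> (rep_l2 y w) - \<phi> (rep_l2 x w))\<^sup>2 \<partial>leb01)" for y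
    unfolding cls_diff[OF L L] power2_norm_cls[OF L2_diff[OF L L]] by simp
  ultimately have "(\<lambda>n. (norm (cls (\<phi> \<circ> rep_l2 (u (r (s n)))) - cls (\<phi> \<circ> rep_l2 x)))\<^sup>2) \<longlonglongrightarrow> 0" by simp
  then have "(\<lambda>n. sqrt ((norm (cls (\<phi> \<circ> rep_l2 (u (r (s n)))) - cls (\<phi> \<circ> rep_l2 x)))\<^sup>2)) \<longlonglongrightarrow> sqrt 0"
    by (rule tendsto_real_sqrt)
  then have "(\<lambda>n. cls (\<phi> \<circ> rep_l2 (u (r (s n)))) - cls (\<phi> \<circ> rep_l2 x)) \<longlonglongrightarrow> 0"
    by (simp add: tendsto_norm_zero_iff)
  then have "(\<lambda>n. cls (\<phi> \<circ> rep_l2 (u (r (s n))))) \<longlonglongrightarrow> cls (\<phi> \<circ> rep_l2 x)" by (simp add: Lim_null[symmetric])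
  then show "\<exists>s. strict_mono s \<and> (\<lambda>n. cls (\<phi> \<circ> rep_l2 (u (r (s n))))) \<longlonglongrightarrow> cls (\<phi> \<circ> rep_l2 x)" using s(1) by blast
qed

lemma Lp_norm_Np_tendsto:
  assumes L: "\<And>n. f n \<in> Lp p leb01" "g \<in> Lp p leb01" and p: "2 \<le> p"
    and lim: "(\<lambda>n. \<integral>w. \<bar>f n w - g w\<bar> powr p \<partial>leb01) \<longlonglongrightarrow> 0"
  shows "(\<lambda>n. Np p (cls (f n) - cls g)) \<longlonglongrightarrow> 0"
proof -
  note L2 = Lp_subset_L2[OF p L(1)] Lp_subset_L2[OF p L(2)]
  have "Np p (cls (f n) + (-1) *\<^sub>R cls g) < \<infinity>" for n
    using L p by (intro Np_add_finite) (auto simp: Lp_iff_Np[OF L2(1)] Lp_iff_Np[OF L2(2)] Np_scaleR[of p "-1" "cls g", simplified])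
  then have fin: "Np p (cls (f n) - cls g) < \<infinity>" for n by simp
  have eq: "Np p (cls (f n) - cls g) = ennreal (\<integral>w. \<bar>f n w - g w\<bar> powr p \<partial>leb01)" for n
  proof -
    have d: "(\<lambda>w. f n w - g w) \<in> L2" by (intro L2_diff L2)
    note [measurable] = L2_measurable[OF d]
    have N: "Np p (cls (f n) - cls g) = (\<integral>\<^sup>+ w. ennreal (\<bar>f n w - g w\<bar> powr p) \<partial>leb01)"
      unfolding cls_diff[OF L2] by (rule Np_cls[OF d])
    have "integrable leb01 (\<lambda>w. \<bar>f n w - g w\<bar> powr p)"
      unfolding integrable_iff_bounded using fin[of n] N by simp
    then show ?thesis unfolding N by (intro nn_integral_eq_integral) auto
  qed
  show ?thesis unfolding eq using tendsto_ennrealI[OF lim] by simp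
qed

text \<open>Both summands of \<open>D_dist\<close> are nonnegative, so each tends to 0. For the
  positions, the Wasserstein distance must still be turned into the distance of the quantile
  functions.\<close>

lemma D_dist_tendsto:
  assumes p: "2 \<le> p" and \<mu>: "\<And>n. \<mu>n n \<in> V_space p" "\<mu> \<in> V_space p" and lim: "(\<lambda>n. D_dist p (\<mu>n n) \<mu>) \<longlonglongrightarrow> 0"
  shows "(\<lambda>n. Np p (cls (lagrX (\<mu>n n)) - cls (lagrX \<mu>))) \<longlonglongrightarrow> 0"
    "(\<lambda>n. Np p (cls (lagrV (\<mu>n n)) - cls (lagrV \<mu>))) \<longlonglongrightarrow> 0"
proof -
  let ?W = "\<lambda>n. W_dist p (fst (\<mu>n n)) (fst \<mu>)" and ?I = "\<lambda>n. \<integral>w. \<bar>lagrV (\<mu>n n) w - lagrV \<mu> w\<bar> powr p \<partial>leb01"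
  have W0: "0 \<le> ?W n" and I0: "0 \<le> ?I n" for n by (simp_all add: W_dist_def)
  have sum: "D_dist p (\<mu>n n) \<mu> powr p = ?W n powr p + ?I n" for n
    using p I0[of n] by (simp add: D_dist_def lagrV_def powr_powr)
  have "(\<lambda>n. D_dist p (\<mu>n n) \<mu> powr p) \<longlonglongrightarrow> 0"
    using p lim by (intro tendsto_zero_powrI[where b = p] tendsto_const) (auto simp: D_dist_def)
  then have s: "(\<lambda>n. ?W n powr p + ?I n) \<longlonglongrightarrow> 0" by (simp add: sum)
  have Wp: "(\<lambda>n. ?W n powr p) \<longlonglongrightarrow> 0" by (rule tendsto_sandwich[OF _ _ tendsto_const s]) (use I0 in auto)
  have I: "?I \<longlonglongrightarrow> 0" by (rule tendsto_sandwich[OF _ _ tendsto_const s]) (use I0 in auto)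
  have "(\<lambda>n. (?W n powr p) powr (1 / p)) \<longlonglongrightarrow> 0"
    using p by (intro tendsto_zero_powrI[where b = "1 / p"] tendsto_const Wp) auto
  then have W: "?W \<longlonglongrightarrow> 0" using p W0 by (simp add: powr_powr)
  have \<rho>: "\<And>n. fst (\<mu>n n) \<in> P_space p" "fst \<mu> \<in> P_space p" using \<mu> by (auto simp: V_space_iff[OF p])
  have L: "lagrX (\<mu>n n) \<in> Lp p leb01" "lagrX \<mu> \<in> Lp p leb01" "lagrV (\<mu>n n) \<in> Lp p leb01" "lagrV \<mu> \<in> Lp p leb01" for n
    using lagr_X_space[OF p \<mu>(1)] lagr_X_space[OF p \<mu>(2)] by (auto simp: X_space_def)
  show "(\<lambda>n. Np p (cls (lagrV (\<mu>n n)) - cls (lagrV \<mu>))) \<longlonglongrightarrow> 0" by (rule Lp_norm_Np_tendsto[OF L(3,4) p I])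
  have "(\<lambda>n. \<integral>\<^sup>+ w. \<bar>quantile (fst (\<mu>n n)) w - quantile (fst \<mu>) w\<bar> powr p \<partial>leb01) \<longlonglongrightarrow> 0"
    using p by (intro W_dist_tendsto_quantile(2)[OF _ \<rho> W]) simp
  moreover have "Np p (cls (lagrX (\<mu>n n)) - cls (lagrX \<mu>)) = (\<integral>\<^sup>+ w. \<bar>quantile (fst (\<mu>n n)) w - quantile (fst \<mu>) w\<bar> powr p \<partial>leb01)" for n
    unfolding cls_diff[OF Lp_subset_L2[OF p L(1)] Lp_subset_L2[OF p L(2)]]
      Np_cls[OF L2_diff[OF Lp_subset_L2[OF p L(1)] Lp_subset_L2[OF p L(2)]]] by (simp add: lagrX_def)
  ultimately show "(\<lambda>n. Np p (cls (lagrX (\<mu>n n)) - cls (lagrX \<mu>))) \<longlonglongrightarrow> 0" by simp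
qed

lemma Np_flow_tendsto:
  assumes p: "2 \<le> p" and lim: "(\<lambda>n. Np p (xn n - x)) \<longlonglongrightarrow> 0" "(\<lambda>n. Np p (vn n - v)) \<longlonglongrightarrow> 0"
  shows "(\<lambda>n. Np p (flow K2 (xn n) (vn n) t - flow K2 x v t)) \<longlonglongrightarrow> 0"
proof (rule tendsto_sandwich[OF _ _ tendsto_const])
  have "(\<lambda>n. Np p ((xn n - x) + t *\<^sub>R (vn n - v))) \<longlonglongrightarrow> 0"
    using p by (intro Np_add_tendsto Np_scaleR_tendsto lim) simp
  then show "(\<lambda>n. Np p ((xn n + t *\<^sub>R vn n) - (x + t *\<^sub>R v))) \<longlonglongrightarrow> 0"
    by (simp add: algebra_simps)
  show "\<forall>\<^sub>F n in sequentially. Np p (flow K2 (xn n) (vn n) t - flow K2 x v t) \<le> Np p ((xn n + t *\<^sub>R vn n) - (x + t *\<^sub>R v))"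
    unfolding flow_def by (intro always_eventually allI proj_K2_Np_contraction p)
qed simp

text \<open>
  The velocity at time \<open>t\<close> is the projection of the initial one onto the functions of \<open>X(t)\<close>, so
  that the momentum is tested against the initial velocity.
\<close>

lemma integral_momentum_euler_flow:
  assumes p: "2 \<le> p" and \<mu>: "\<mu> \<in> V_space p" and t: "0 \<le> t"
    and \<phi>: "continuous_on UNIV \<phi>" "\<And>s. \<bar>\<phi> s\<bar> \<le> (B::real)"
  shows "(\<integral>x. \<phi> x * velocity (euler_flow t \<mu>) x \<partial>fst (euler_flow t \<mu>))
    = inner (cls (lagrV \<mu>)) (cls (\<phi> \<circ> rep_l2 (flow K2 (cls (lagrX \<mu>)) (cls (lagrV \<mu>)) t)))"
proof -
  let ?x = "cls (lagrX \<mu>)" and ?v = "cls (lagrV \<mu>)"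
  define X where "X = lag_X (lagrX \<mu>) (lagrV \<mu>) t"
  define V where "V = lag_V (lagrX \<mu>) (lagrV \<mu>) t"
  have d: "lag_data (lagrX \<mu>) (lagrV \<mu>)" using lagr_X_space[OF p \<mu>] by (simp add: X_space_iff[OF p])
  have Z: "(X, V) \<in> X_space p" unfolding X_def V_def by (intro lag_flow_X_space p t lagr_X_space \<mu>)
  have XL: "X \<in> L2" "cls X = flow K2 ?x ?v t" and VL: "V \<in> L2" "cls V = flow_vel K2 ?x ?v t"
    unfolding X_def V_def by (simp_all add: lag_X_props[OF d] lag_V_props[OF d t])
  have e: "euler_flow t \<mu> = eulerian X V" by (simp add: euler_flow_def X_def V_def)
  note vm = velocity_props(1)[OF p eulerian_V_space[OF p Z]]
  note [measurable] = L2_measurable[OF XL(1)] L2_measurable[OF VL(1)] bounded_continuous_measurable[OF \<phi>(1)] vm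
  have L: "\<phi> \<circ> rep_l2 (cls X) \<in> L2" by (rule H2_bounded_comp(1)[OF bounded_continuous_measurable[OF \<phi>(1)] \<phi>(2)])
  note [measurable] = L2_measurable[OF L]
  have "(\<integral>x. \<phi> x * velocity (euler_flow t \<mu>) x \<partial>fst (euler_flow t \<mu>)) = (\<integral>w. \<phi> (X w) * velocity (eulerian X V) (X w) \<partial>leb01)"
  proof -
    define u where "u = velocity (eulerian X V)"
    have [measurable]: "u \<in> borel_measurable borel" unfolding u_def by (rule vm)
    have "fst (eulerian X V) = distr leb01 borel X" by (simp add: eulerian_def)
    then show ?thesis unfolding e u_def[symmetric] by (simp, subst integral_distr) auto
  qed
  also have "\<dots> = (\<integral>w. V w * (\<phi> \<circ> rep_l2 (cls X)) w \<partial>leb01)"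
  proof (rule integral_cong_AE)
    show "AE w in leb01. \<phi> (X w) * velocity (eulerian X V) (X w) = V w * (\<phi> \<circ> rep_l2 (cls X)) w"
      using velocity_eulerian[OF p Z] rep_cls[OF XL(1)] unfolding ae_eq_def by eventually_elim simp
  qed measurable
  also have "\<dots> = inner (flow_vel K2 ?x ?v t) (cls (\<phi> \<circ> rep_l2 (flow K2 ?x ?v t)))"
    using inner_cls[OF VL(1) L] VL(2) XL(2) by simp
  also have "\<dots> = inner ?v (cls (\<phi> \<circ> rep_l2 (flow K2 ?x ?v t)))"
    by (intro sticky.flow_vel_orth[OF x0_K2[OF d] v0_H2[OF d] t] H2_bounded_comp(2)[OF bounded_continuous_measurable[OF \<phi>(1)] \<phi>(2)])
  finally show ?thesis .
qed

text \<open>The joint law of two Lagrangian positions is an admissible coupling, so the measures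
  inherit the L^p contraction. The tested momentum is an inner product of the initial velocity with
  \<open>\<phi>\<close> of the position, and each of these factors converges strongly, whereas the
  velocity at time t need not.\<close>

lemma euler_flow_continuous:
  assumes p: "2 \<le> p" and t: "0 \<le> t" and \<mu>: "\<And>n. \<mu>n n \<in> V_space p" "\<mu> \<in> V_space p"
    and lim: "(\<lambda>n. D_dist p (\<mu>n n) \<mu>) \<longlonglongrightarrow> 0"
  shows "(\<lambda>n. W_dist p (fst (euler_flow t (\<mu>n n))) (fst (euler_flow t \<mu>))) \<longlonglongrightarrow> 0"
    "weak_momentum_conv (\<lambda>n. euler_flow t (\<mu>n n)) (euler_flow t \<mu>)"
proof -
  let ?x = "\<lambda>\<mu>. cls (lagrX \<mu>)" and ?v = "\<lambda>\<mu>. cls (lagrV \<mu>)"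
  let ?X = "\<lambda>\<mu>. lag_X (lagrX \<mu>) (lagrV \<mu>) t"
  have d: "lag_data (lagrX \<nu>) (lagrV \<nu>)" if "\<nu> \<in> V_space p" for \<nu>
    using lagr_X_space[OF p that] by (simp add: X_space_iff[OF p])
  note lims = D_dist_tendsto[OF p \<mu> lim]
  have fl: "(\<lambda>n. Np p (flow K2 (?x (\<mu>n n)) (?v (\<mu>n n)) t - flow K2 (?x \<mu>) (?v \<mu>) t)) \<longlonglongrightarrow> 0"
    by (rule Np_flow_tendsto[OF p lims])
  show "(\<lambda>n. W_dist p (fst (euler_flow t (\<mu>n n))) (fst (euler_flow t \<mu>))) \<longlonglongrightarrow> 0"
  proof -
    have L: "?X (\<mu>n n) \<in> L2" "?X \<mu> \<in> L2" for n using lag_X_props(2)[OF d] \<mu> by auto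
    note [measurable] = L2_measurable[OF L(1)] L2_measurable[OF L(2)]
    have "W_dist p (fst (euler_flow t (\<mu>n n))) (fst (euler_flow t \<mu>)) powr p
        \<le> enn2real (Np p (flow K2 (?x (\<mu>n n)) (?v (\<mu>n n)) t - flow K2 (?x \<mu>) (?v \<mu>) t))" for n
    proof -
      have "W_dist p (fst (euler_flow t (\<mu>n n))) (fst (euler_flow t \<mu>)) powr p \<le> (\<integral>w. \<bar>?X (\<mu>n n) w - ?X \<mu> w\<bar> powr p \<partial>leb01)"
        unfolding euler_flow_def eulerian_def using p by (simp, intro W_dist_powr_le) auto
      also have "\<dots> = enn2real (\<integral>\<^sup>+ w. ennreal (\<bar>?X (\<mu>n n) w - ?X \<mu> w\<bar> powr p) \<partial>leb01)"
        by (intro integral_eq_nn_integral) auto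
      also have "(\<integral>\<^sup>+ w. ennreal (\<bar>?X (\<mu>n n) w - ?X \<mu> w\<bar> powr p) \<partial>leb01) = Np p (cls (?X (\<mu>n n)) - cls (?X \<mu>))"
        unfolding cls_diff[OF L] by (rule Np_cls[OF L2_diff[OF L], symmetric])
      finally show ?thesis by (simp add: lag_X_props(4)[OF d[OF \<mu>(1)]] lag_X_props(4)[OF d[OF \<mu>(2)]])
    qed
    moreover have "(\<lambda>n. enn2real (Np p (flow K2 (?x (\<mu>n n)) (?v (\<mu>n n)) t - flow K2 (?x \<mu>) (?v \<mu>) t))) \<longlonglongrightarrow> 0"
      using tendsto_enn2real[of _ 0] fl by simp
    ultimately have "(\<lambda>n. W_dist p (fst (euler_flow t (\<mu>n n))) (fst (euler_flow t \<mu>)) powr p) \<longlonglongrightarrow> 0"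
      by (rule_tac tendsto_sandwich[OF _ _ tendsto_const]) auto
    then have "(\<lambda>n. (W_dist p (fst (euler_flow t (\<mu>n n))) (fst (euler_flow t \<mu>)) powr p) powr (1 / p)) \<longlonglongrightarrow> 0"
      using p tendsto_zero_powrI[OF _ tendsto_const, of _ sequentially "1 / p"] by simp
    moreover have "0 \<le> W_dist p \<rho> \<rho>'" for \<rho> \<rho>' by (simp add: W_dist_def)
    ultimately show ?thesis using p by (simp add: powr_powr)
  qed
  show "weak_momentum_conv (\<lambda>n. euler_flow t (\<mu>n n)) (euler_flow t \<mu>)"
    unfolding weak_momentum_conv_def
  proof (intro allI impI, elim conjE)
    fix \<phi> :: "real \<Rightarrow> real" assume \<phi>: "continuous_on UNIV \<phi>" "bounded (range \<phi>)"
    obtain B where B: "\<And>s. \<bar>\<phi> s\<bar> \<le> B" using \<phi>(2) by (auto simp: bounded_iff)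
    have "(\<lambda>n. inner (?v (\<mu>n n)) (cls (\<phi> \<circ> rep_l2 (flow K2 (?x (\<mu>n n)) (?v (\<mu>n n)) t))))
        \<longlonglongrightarrow> inner (?v \<mu>) (cls (\<phi> \<circ> rep_l2 (flow K2 (?x \<mu>) (?v \<mu>) t)))"
      by (intro tendsto_inner composition_tendsto[OF \<phi>(1) B] Np_tendsto_imp_tendsto[OF p] fl lims)
    then show "(\<lambda>n. \<integral>x. \<phi> x * velocity (euler_flow t (\<mu>n n)) x \<partial>fst (euler_flow t (\<mu>n n)))
        \<longlonglongrightarrow> (\<integral>x. \<phi> x * velocity (euler_flow t \<mu>) x \<partial>fst (euler_flow t \<mu>))"
      by (simp add: integral_momentum_euler_flow[OF p _ t \<phi>(1) B] \<mu>)
  qed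
qed

section \<open>Step functions\<close>

locale masses =
  fixes N :: nat and m :: "nat \<Rightarrow> real"
  assumes mass_pos: "i < N \<Longrightarrow> 0 < m i" and mass_total: "(\<Sum>i<N. m i) = 1"
begin

text \<open>Half-open cells of lengths \<open>m i\<close> partition [0,1), so that every w lies in
  exactly one of them.\<close>

definition cell :: "nat \<Rightarrow> real set" where "cell i = {(\<Sum>j<i. m j)..<(\<Sum>j<Suc i. m j)}"

definition step :: "(nat \<Rightarrow> real) \<Rightarrow> real \<Rightarrow> real" where "step a w = (\<Sum>i<N. a i * indicator (cell i) w)"

lemma partial_mass_mono: "i \<le> j \<Longrightarrow> j \<le> N \<Longrightarrow> (\<Sum>k<i. m k) \<le> (\<Sum>k<j. m k)"
  by (intro sum_mono2) (auto intro!: less_imp_le[OF mass_pos])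

lemma partial_mass_bounds: "i \<le> N \<Longrightarrow> 0 \<le> (\<Sum>k<i. m k)" "i \<le> N \<Longrightarrow> (\<Sum>k<i. m k) \<le> 1"
  using partial_mass_mono[of 0 i] partial_mass_mono[of i N] mass_total by auto

lemma cell_disjoint:
  assumes "i < N" "j < N" "w \<in> cell i" "w' \<in> cell j" "w \<le> w'"
  shows "i \<le> j"
proof (rule ccontr)
  assume "\<not> i \<le> j"
  then have "(\<Sum>k<Suc j. m k) \<le> (\<Sum>k<i. m k)" using assms by (intro partial_mass_mono) auto
  then show False using assms by (auto simp: cell_def)
qed

lemma cell_exists:
  assumes "0 < w" "w < 1"
  obtains i where "i < N" "w \<in> cell i"
proof -
  define i where "i = (LEAST i. w < (\<Sum>j<Suc i. m j))"
  have "N \<noteq> 0" using mass_total by (cases N) auto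
  then obtain N' where N: "N = Suc N'" by (cases N) auto
  then have w: "w < (\<Sum>j<Suc N'. m j)" using assms mass_total by simp
  have "w < (\<Sum>j<Suc i. m j)" unfolding i_def by (rule LeastI[of "\<lambda>i. w < (\<Sum>j<Suc i. m j)", OF w])
  moreover have "i \<le> N'" unfolding i_def by (rule Least_le[of "\<lambda>i. w < (\<Sum>j<Suc i. m j)", OF w])
  moreover have "(\<Sum>j<i. m j) \<le> w"
  proof (cases i)
    case (Suc k)
    then have "\<not> w < (\<Sum>j<Suc k. m j)" unfolding i_def by (intro not_less_Least) simp
    then show ?thesis using Suc by simp
  qed (use assms in simp)
  ultimately show ?thesis using that[of i] N by (simp add: cell_def)
qed

lemma step_cell: assumes "i < N" "w \<in> cell i" shows "step a w = a i"
proof -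
  have "indicator (cell j) w = (if j = i then 1 else 0 :: real)" if "j < N" for j
    using cell_disjoint[OF that assms(1), of w w] cell_disjoint[OF assms(1) that, of w w] assms(2)
    by (auto simp: indicator_def)
  then have "step a w = (\<Sum>j<N. if j = i then a j else 0)" unfolding step_def by (intro sum.cong) auto
  then show ?thesis using assms(1) by simp
qed

lemma step_eqI:
  assumes "w \<in> {0<..<1}" "\<And>i. i < N \<Longrightarrow> w \<in> cell i \<Longrightarrow> P"
  shows P
proof -
  have "0 < w" "w < 1" using assms(1) by auto
  then show P using assms(2) by (rule cell_exists)
qed

lemma step_comp2: "w \<in> {0<..<1} \<Longrightarrow> F (step a w) (step b w) = step (\<lambda>i. F (a i) (b i)) w"
proof (erule step_eqI)
  fix i assume "i < N" "w \<in> cell i"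
  note step_cell[OF this]
  then show ?thesis by simp
qed

lemma step_comp: "w \<in> {0<..<1} \<Longrightarrow> F (step a w) = step (\<lambda>i. F (a i)) w"
proof (erule step_eqI)
  fix i assume "i < N" "w \<in> cell i"
  note step_cell[OF this]
  then show ?thesis by simp
qed

lemma step_measurable [measurable]: "step a \<in> borel_measurable leb01"
proof (rule borel_measurable_leb01)
  show "step a \<in> borel_measurable borel" unfolding step_def[abs_def] cell_def by measurable
qed

lemma step_bounded: "\<bar>step a w\<bar> \<le> (\<Sum>i<N. \<bar>a i\<bar>)"
proof -
  have "\<bar>step a w\<bar> \<le> (\<Sum>i<N. \<bar>a i * indicator (cell i) w\<bar>)" unfolding step_def by (rule sum_abs)
  also have "\<dots> \<le> (\<Sum>i<N. \<bar>a i\<bar>)" by (intro sum_mono) (simp add: indicator_def)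
  finally show ?thesis .
qed

lemma step_L2 [simp]: "step a \<in> L2" by (rule L2_bounded[OF step_measurable step_bounded])

lemma emeasure_cell: assumes i: "i < N" shows "emeasure leb01 (cell i \<inter> {0<..<1}) = ennreal (m i)"
proof -
  let ?a = "\<Sum>j<i. m j" and ?b = "\<Sum>j<Suc i. m j"
  have ab: "0 \<le> ?a" "?b \<le> 1" "?b - ?a = m i" using i partial_mass_bounds(1)[of i] partial_mass_bounds(2)[of "Suc i"] by auto
  \<comment> \<open>The first cell contains 0, which is outside (0,1); an open and a closed interval
    of the same length enclose the intersection.\<close>
  have "{?a<..<?b} \<subseteq> cell i \<inter> {0<..<1}" "cell i \<inter> {0<..<1} \<subseteq> {?a..?b}" using ab by (auto simp: cell_def)
  then have "emeasure lborel {?a<..<?b} \<le> emeasure lborel (cell i \<inter> {0<..<1})"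
      "emeasure lborel (cell i \<inter> {0<..<1}) \<le> emeasure lborel {?a..?b}"
    by (auto intro!: emeasure_mono simp: cell_def)
  then have "emeasure lborel (cell i \<inter> {0<..<1}) = ennreal (m i)"
    using ab mass_pos[OF i] by (intro antisym) (simp_all del: sum.lessThan_Suc)
  then show ?thesis by (subst emeasure_leb01) (auto simp: cell_def)
qed

lemma integrable_cell: assumes "f \<in> L2" shows "integrable leb01 (\<lambda>w. f w * indicator (cell i) w)"
proof -
  have "integrable leb01 (\<lambda>w. f w * indicator (cell i) w)"
  proof (rule Bochner_Integration.integrable_bound[OF L2_integrable[OF assms]])
    have [measurable]: "f \<in> borel_measurable leb01" "indicator (cell i) \<in> borel_measurable leb01"
      using L2_measurable[OF assms] by (auto intro!: borel_measurable_leb01 simp: cell_def)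
    show "(\<lambda>w. f w * indicator (cell i) w) \<in> borel_measurable leb01" by measurable
  qed (simp add: indicator_def)
  then show ?thesis .
qed

lemma integral_step: "(\<integral>w. step a w \<partial>leb01) = (\<Sum>i<N. m i * a i)"
proof -
  have "(\<integral>w. step a w \<partial>leb01) = (\<Sum>i<N. \<integral>w. a i * indicator (cell i) w \<partial>leb01)"
    unfolding step_def by (rule Bochner_Integration.integral_sum) (rule integrable_cell[OF L2_const])
  also have "\<dots> = (\<Sum>i<N. m i * a i)"
  proof (rule sum.cong[OF refl])
    fix i assume "i \<in> {..<N}"
    then have i: "i < N" by simp
    have "(\<integral>w. indicator (cell i) w \<partial>leb01) = measure leb01 (cell i \<inter> {0<..<1})" by simp
    also have "\<dots> = m i" unfolding measure_def emeasure_cell[OF i] using mass_pos[OF i] by simp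
    finally show "(\<integral>w. a i * indicator (cell i) w \<partial>leb01) = m i * a i" by simp
  qed
  finally show ?thesis .
qed

lemma inner_step: "inner (cls (step a)) (cls (step b)) = (\<Sum>i<N. m i * (a i * b i))"
proof -
  have "(\<integral>w. step a w * step b w \<partial>leb01) = (\<integral>w. step (\<lambda>i. a i * b i) w \<partial>leb01)"
    by (rule Bochner_Integration.integral_cong) (use step_comp2[of _ "(*)"] in auto)
  then show ?thesis by (simp add: inner_cls integral_step)
qed

text \<open>Test elements \<open>u\<close> of the cone need not be step functions. Linearity in the
  finitely many coefficients is what allows the pairing to be differentiated in time.\<close>

lemma inner_step_linear: "\<exists>c. \<forall>a. inner (cls (step a)) u = (\<Sum>i<N. a i * c i)"
proof (intro exI allI)
  fix a
  have "inner (cls (step a)) u = (\<integral>w. step a w * rep_l2 u w \<partial>leb01)" using inner_cls[of "step a" "rep_l2 u"] by simp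
  also have "\<dots> = (\<integral>w. (\<Sum>i<N. a i * (rep_l2 u w * indicator (cell i) w)) \<partial>leb01)"
    by (intro Bochner_Integration.integral_cong refl) (simp only: step_def sum_distrib_left sum_distrib_right mult_ac)
  also have "\<dots> = (\<Sum>i<N. \<integral>w. a i * (rep_l2 u w * indicator (cell i) w) \<partial>leb01)"
    by (intro Bochner_Integration.integral_sum integrable_mult_right integrable_cell) simp
  finally show "inner (cls (step a)) u = (\<Sum>i<N. a i * (\<integral>w. rep_l2 u w * indicator (cell i) w \<partial>leb01))" by simp
qed

lemma step_linear:
  "cls (step a) + cls (step b) = cls (step (\<lambda>i. a i + b i))"
  "cls (step a) - cls (step b) = cls (step (\<lambda>i. a i - b i))"
  "c *\<^sub>R cls (step a) = cls (step (\<lambda>i. c * a i))"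
proof -
  have eq: "cls f = cls (step c)" if "f \<in> L2" "\<And>w. w \<in> {0<..<1} \<Longrightarrow> f w = step c w" for f c
    unfolding cls_eq_iff[OF that(1) step_L2] ae_eq_def by (rule AE_I2) (simp add: that(2))
  show "cls (step a) + cls (step b) = cls (step (\<lambda>i. a i + b i))"
    unfolding cls_add[OF step_L2 step_L2] by (rule eq[OF L2_add[OF step_L2 step_L2]]) (rule step_comp2)
  show "cls (step a) - cls (step b) = cls (step (\<lambda>i. a i - b i))"
    unfolding cls_diff[OF step_L2 step_L2] by (rule eq[OF L2_diff[OF step_L2 step_L2]]) (rule step_comp2)
  show "c *\<^sub>R cls (step a) = cls (step (\<lambda>i. c * a i))"
    unfolding cls_scaleR[OF step_L2] by (rule eq[OF L2_cmult[OF step_L2]]) (rule step_comp)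
qed

lemma AE_cell_exists:
  assumes "AE w in leb01. P w" and i: "i < N"
  obtains w where "w \<in> cell i" "0 < w" "w < 1" "P w"
proof -
  have "0 \<le> (\<Sum>j<i. m j)" "(\<Sum>j<i. m j) < (\<Sum>j<Suc i. m j)" "(\<Sum>j<Suc i. m j) \<le> 1"
    using i partial_mass_bounds(1)[of i] partial_mass_bounds(2)[of "Suc i"] mass_pos[OF i] by auto
  from AE_leb01_ex[OF assms(1) this] obtain w where w: "(\<Sum>j<i. m j) < w" "w < (\<Sum>j<Suc i. m j)" "P w" by blast
  have "w \<in> cell i" "0 < w" "w < 1"
    using w \<open>0 \<le> (\<Sum>j<i. m j)\<close> \<open>(\<Sum>j<Suc i. m j) \<le> 1\<close> by (auto simp: cell_def)
  then show ?thesis using that w(3) by blast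
qed

lemma cls_step_eq_iff: "cls (step a) = cls (step b) \<longleftrightarrow> (\<forall>i<N. a i = b i)"
proof
  assume "cls (step a) = cls (step b)"
  then have ae: "AE w in leb01. step a w = step b w" by (simp add: cls_eq_iff ae_eq_def)
  show "\<forall>i<N. a i = b i"
  proof (intro allI impI)
    fix i assume i: "i < N"
    obtain w where "w \<in> cell i" "step a w = step b w" using AE_cell_exists[OF ae i] by blast
    then show "a i = b i" using i by (simp add: step_cell)
  qed
next
  assume "\<forall>i<N. a i = b i"
  then have "step a = step b" unfolding step_def by (intro ext sum.cong) auto
  then show "cls (step a) = cls (step b)" by simp
qed

lemma step_mono: assumes "\<And>i j. i \<le> j \<Longrightarrow> j < N \<Longrightarrow> a i \<le> a j" shows "mono_on {0<..<1} (step a)"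
proof (rule mono_onI)
  fix w w' :: real assume w: "w \<in> {0<..<1}" "w' \<in> {0<..<1}" "w \<le> w'"
  show "step a w \<le> step a w'"
    using w(1)
  proof (rule step_eqI)
    fix i assume i: "i < N" "w \<in> cell i"
    show ?thesis using w(2)
    proof (rule step_eqI)
      fix j assume j: "j < N" "w' \<in> cell j"
      then show ?thesis using assms[OF cell_disjoint[OF i(1) j(1) i(2) j(2) w(3)] j(1)] i by (simp add: step_cell)
    qed
  qed
qed

lemma cls_step_K2_iff: "cls (step a) \<in> K2 \<longleftrightarrow> (\<forall>i j. i \<le> j \<longrightarrow> j < N \<longrightarrow> a i \<le> a j)"
proof
  assume "\<forall>i j. i \<le> j \<longrightarrow> j < N \<longrightarrow> a i \<le> a j"
  then show "cls (step a) \<in> K2" by (intro cls_in_K2 step_L2 step_mono) auto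
next
  assume "cls (step a) \<in> K2"
  then obtain Z where Z: "mono_on {0<..<1} Z" "Z \<in> L2" "cls (step a) = cls Z" by (elim K2_E)
  then have ae: "AE w in leb01. step a w = Z w" by (simp add: cls_eq_iff ae_eq_def)
  show "\<forall>i j. i \<le> j \<longrightarrow> j < N \<longrightarrow> a i \<le> a j"
  proof (intro allI impI)
    fix i j :: nat assume ij: "i \<le> j" "j < N"
    show "a i \<le> a j"
    proof (cases "i = j")
      case False
      then have i: "i < N" "\<not> j \<le> i" using ij by auto
      obtain w where w: "w \<in> cell i" "0 < w" "w < 1" "step a w = Z w" using AE_cell_exists[OF ae i(1)] by blast
      obtain w' where w': "w' \<in> cell j" "0 < w'" "w' < 1" "step a w' = Z w'" using AE_cell_exists[OF ae ij(2)] by blast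
      have "w \<le> w'" using cell_disjoint[OF ij(2) i(1) w'(1) w(1)] i(2) by linarith
      then have "Z w \<le> Z w'" using w w' by (intro mono_onD[OF Z(1)]) auto
      then show ?thesis using w w' i ij by (simp add: step_cell)
    qed simp
  qed
qed

lemma cls_step_H2_iff: "cls (step b) \<in> H2 (cls (step a)) \<longleftrightarrow> (\<forall>i<N. \<forall>j<N. a i = a j \<longrightarrow> b i = b j)"
proof
  assume "cls (step b) \<in> H2 (cls (step a))"
  then obtain v where v: "AE w in leb01. step b w = (v \<circ> step a) w"
    unfolding H2_cls_iff[OF step_L2 step_L2] ae_eq_def by blast
  have "b i = v (a i)" if i: "i < N" for i
  proof -
    obtain w where "w \<in> cell i" "step b w = (v \<circ> step a) w" using AE_cell_exists[OF v i] by blast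
    then show ?thesis using i by (simp add: step_cell)
  qed
  then show "\<forall>i<N. \<forall>j<N. a i = a j \<longrightarrow> b i = b j" by simp
next
  assume eq: "\<forall>i<N. \<forall>j<N. a i = a j \<longrightarrow> b i = b j"
  \<comment> \<open>One index for each value of \<open>a\<close>; by \<open>eq\<close> the choice
    does not affect \<open>b\<close>, and a finite combination of indicators of points is
    Borel.\<close>
  define s where "s z = (SOME i. i < N \<and> a i = z)" for z
  define g where "g y = (\<Sum>z\<in>a ` {..<N}. b (s z) * indicator {z} y)" for y
  have g: "g (a i) = b i" if i: "i < N" for i
  proof -
    have "s (a i) < N \<and> a (s (a i)) = a i" unfolding s_def using someI[of "\<lambda>j. j < N \<and> a j = a i" i] i by simp
    then have "b (s (a i)) = b i" using eq i by blast
    moreover have "g (a i) = (\<Sum>z\<in>a ` {..<N}. if z = a i then b (s z) else 0)"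
      unfolding g_def by (intro sum.cong) (auto simp: indicator_def)
    ultimately show ?thesis using i by simp
  qed
  have "g \<in> borel_measurable borel" unfolding g_def[abs_def] by measurable
  moreover have "step b w = g (step a w)" if "w \<in> {0<..<1}" for w
    using that by (rule step_eqI) (simp add: step_cell g)
  then have "ae_eq (step b) (g \<circ> step a)" unfolding ae_eq_def by (intro AE_I2) simp
  ultimately show "cls (step b) \<in> H2 (cls (step a))" unfolding H2_cls_iff[OF step_L2 step_L2] by blast
qed

lemma H2_step_exists:
  assumes "u \<in> H2 (cls (step a))" obtains b where "u = cls (step b)"
proof -
  have "cls (rep_l2 u) \<in> H2 (cls (step a))" using assms by simp
  then obtain v where "ae_eq (rep_l2 u) (v \<circ> step a)"
    unfolding H2_cls_iff[OF step_L2 rep_l2_in] by blast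
  moreover have "ae_eq (v \<circ> step a) (step (\<lambda>i. v (a i)))"
    unfolding ae_eq_def by (intro AE_I2) (simp add: step_comp)
  ultimately have "ae_eq (rep_l2 u) (step (\<lambda>i. v (a i)))" by (rule ae_eq_trans)
  then have "cls (rep_l2 u) = cls (step (\<lambda>i. v (a i)))" by (subst cls_eq_iff) auto
  then show ?thesis using that by simp
qed

lemma eulerian_step: "eulerian (step a) (step b) = discrete_pair N m a b"
proof -
  have "distr leb01 borel (step a) = distr (point_measure {..<N} (\<lambda>i. ennreal (m i))) borel a"
  proof (rule measure_eqI)
    fix A :: "real set" assume "A \<in> sets (distr leb01 borel (step a))"
    then have A [measurable]: "A \<in> sets borel" by simp
    have "(\<integral>w. indicator A (step a w) \<partial>leb01) = (\<integral>w. step (\<lambda>i. indicator A (a i)) w \<partial>leb01)"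
      by (rule Bochner_Integration.integral_cong) (simp_all add: step_comp)
    then have "(\<integral>x. indicator A x \<partial>distr leb01 borel (step a)) = (\<Sum>i<N. m i * indicator A (a i))"
      by (subst integral_distr) (simp_all add: integral_step)
    then have l: "measure (distr leb01 borel (step a)) A = (\<Sum>i<N. m i * indicator A (a i))" by simp
    interpret d: prob_space "distr leb01 borel (step a)" by (rule leb01.prob_space_distr) simp
    have "emeasure (distr (point_measure {..<N} (\<lambda>i. ennreal (m i))) borel a) A = emeasure (point_measure {..<N} (\<lambda>i. ennreal (m i))) {i\<in>{..<N}. a i \<in> A}"
      by (subst emeasure_distr) (auto simp: space_point_measure intro!: arg_cong[where f = "emeasure _"])
    also have "\<dots> = (\<Sum>i\<in>{i\<in>{..<N}. a i \<in> A}. ennreal (m i))" by (subst emeasure_point_measure_finite) auto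
    also have "\<dots> = ennreal (\<Sum>i\<in>{i\<in>{..<N}. a i \<in> A}. m i)" by (intro sum_ennreal) (auto intro!: less_imp_le[OF mass_pos])
    also have "(\<Sum>i\<in>{i\<in>{..<N}. a i \<in> A}. m i) = (\<Sum>i<N. m i * indicator A (a i))"
      by (rule sum.mono_neutral_cong_left) (auto simp: indicator_def)
    finally show "emeasure (distr leb01 borel (step a)) A = emeasure (distr (point_measure {..<N} (\<lambda>i. ennreal (m i))) borel a) A"
      by (simp add: d.emeasure_eq_measure l)
  qed simp
  moreover have "(\<integral>w. step b w * indicator A (step a w) \<partial>leb01) = (\<Sum>i<N. m i * b i * indicator A (a i))" for A :: "real set"
  proof -
    have "(\<integral>w. step b w * indicator A (step a w) \<partial>leb01) = (\<integral>w. step (\<lambda>i. b i * indicator A (a i)) w \<partial>leb01)"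
      by (rule Bochner_Integration.integral_cong) (use step_comp2[of _ "\<lambda>x y. y * indicator A x" a b] in auto)
    then show ?thesis by (simp add: integral_step mult.assoc)
  qed
  ultimately show ?thesis unfolding eulerian_def discrete_pair_def by (simp only:)
qed

lemma step_X_space:
  assumes p: "2 \<le> p" and a: "\<And>i j. i \<le> j \<Longrightarrow> j < N \<Longrightarrow> a i \<le> a j"
    and b: "\<And>i j. i < N \<Longrightarrow> j < N \<Longrightarrow> a i = a j \<Longrightarrow> b i = b j"
  shows "(step a, step b) \<in> X_space p"
proof -
  have "Np p (cls (step c)) < \<infinity>" for c
  proof -
    have "Np p (cls (step c)) \<le> (\<integral>\<^sup>+ w. ennreal ((\<Sum>i<N. \<bar>c i\<bar>) powr p) \<partial>leb01)"
      unfolding Np_cls[OF step_L2] using step_bounded[of c] p by (intro nn_integral_mono ennreal_leI powr_mono2) auto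
    then show ?thesis by (simp add: leb01.emeasure_space_1[simplified] le_less_trans)
  qed
  moreover have "cls (step a) \<in> K2" unfolding cls_step_K2_iff using a by blast
  moreover have "cls (step b) \<in> H2 (cls (step a))" unfolding cls_step_H2_iff using b by blast
  ultimately show ?thesis unfolding X_space_iff[OF p] lag_data_def by simp
qed

end

section \<open>Sticky evolutions\<close>

text \<open>Tilting by the slope \<open>e\<close> makes \<open>g\<close> end above 0. At the last
  point \<open>c\<close> with g c \<le> 0 the right derivative of \<open>g\<close> is at most -e, so
  \<open>g\<close> remains below 0 a little further, a contradiction.\<close>

lemma nonincreasing_if_right_derivative:
  fixes f :: "real \<Rightarrow> real"
  assumes ab: "a \<le> b" and cont: "continuous_on {a..b} f"
    and der: "\<And>s. a \<le> s \<Longrightarrow> s < b \<Longrightarrow> \<exists>D\<le>0. (f has_real_derivative D) (at_right s)"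
  shows "f b \<le> f a"
proof (rule ccontr)
  assume no: "\<not> f b \<le> f a"
  then have lt: "a < b" using ab by (cases "a = b") auto
  \<comment> \<open>Half of the mean slope, so that \<open>g b\<close> is still positive.\<close>
  define e where "e = ((f b - f a) / 2) / (b - a)"
  have e: "0 < e" using no lt by (simp add: e_def)
  define g where "g s = f s - f a - e * (s - a)" for s
  define B where "B = {s \<in> {a..b}. g s \<le> 0}"
  have gc: "continuous_on {a..b} g" unfolding g_def by (intro continuous_intros cont)
  have eb: "e * (b - a) = (f b - f a) / 2" unfolding e_def using lt by (intro nonzero_eq_divide_eq[THEN iffD1]) auto
  have gb: "0 < g b" unfolding g_def eb using no by (simp add: field_simps)
  have "closed B" unfolding B_def using continuous_on_closed_Collect_le[OF gc continuous_on_const[of _ 0]] by simp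
  moreover have "bounded B" by (rule bounded_subset[of "{a..b}"]) (auto simp: B_def)
  ultimately have "compact B" by (simp add: compact_eq_bounded_closed)
  moreover have "a \<in> B" using lt by (simp add: B_def g_def)
  ultimately obtain c where c: "c \<in> B" "\<And>s. s \<in> B \<Longrightarrow> s \<le> c" using compact_attains_sup[of B] by blast
  have cb: "a \<le> c" "c < b" using c(1) gb by (auto simp: B_def less_le)
  obtain D where D: "D \<le> 0" "(f has_real_derivative D) (at_right c)" using der[OF cb] by blast
  have "(g has_real_derivative D - e) (at_right c)"
    unfolding g_def by (auto intro!: derivative_eq_intros D(2))
  from has_real_derivative_neg_dec_right[OF this] D(1) e obtain d
    where d: "0 < d" "\<And>h. 0 < h \<Longrightarrow> h < d \<Longrightarrow> g (c + h) < g c" by auto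
  define h where "h = min (d / 2) (b - c)"
  have h: "0 < h" "h < d" "c + h \<le> b" using d(1) cb by (auto simp: h_def)
  have "g (c + h) \<le> 0" using d(2)[OF h(1,2)] c(1) by (simp add: B_def)
  then have "c + h \<in> B" using h cb by (simp add: B_def)
  then show False using c(2)[of "c + h"] h by simp
qed

text \<open>A pair of particles meets for the first time at most once, so assigning such a pair to
  every collision time is injective.\<close>

lemma finite_collision_times: "finite (collision_times N xt)"
proof -
  let ?P = "\<lambda>t ij. fst ij < N \<and> snd ij \<in> cluster N xt (fst ij) t \<and> (\<forall>s. 0 \<le> s \<and> s < t \<longrightarrow> snd ij \<notin> cluster N xt (fst ij) s)"
  have "\<forall>t\<in>collision_times N xt. \<exists>ij. ?P t ij" by (force simp: collision_times_def)
  from bchoice[OF this] obtain f where f: "\<And>t. t \<in> collision_times N xt \<Longrightarrow> ?P t (f t)" by blast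
  have "\<not> t < t'" if "t \<in> collision_times N xt" "t' \<in> collision_times N xt" "f t = f t'" for t t'
    using f[OF that(1)] f[OF that(2)] that by (auto simp: collision_times_def)
  then have "inj_on f (collision_times N xt)" unfolding inj_on_def by (metis linorder_less_linear)
  moreover have "f ` collision_times N xt \<subseteq> {..<N} \<times> {..<N}"
  proof (rule image_subsetI)
    fix t assume "t \<in> collision_times N xt"
    from f[OF this] show "f t \<in> {..<N} \<times> {..<N}" by (simp add: cluster_def mem_Times_iff)
  qed
  ultimately show ?thesis by (rule inj_on_finite) simp
qed

lemma next_free_interval:
  fixes C :: "real set"
  assumes "finite C"
  obtains b where "t < b" "{t<..<b} \<inter> C = {}"
proof (cases "C \<inter> {t<..} = {}")
  case True
  have "{t<..<t + 1} \<inter> C \<subseteq> C \<inter> {t<..}" by auto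
  then have "{t<..<t + 1} \<inter> C = {}" using True by simp
  then show ?thesis using that[of "t + 1"] by simp
next
  case False
  have f: "finite (C \<inter> {t<..})" using assms by simp
  show ?thesis
  proof (rule that[of "Min (C \<inter> {t<..})"])
    show "t < Min (C \<inter> {t<..})" using Min_in[OF f False] by simp
    show "{t<..<Min (C \<inter> {t<..})} \<inter> C = {}" using Min_le[OF f] by fastforce
  qed
qed

lemma previous_free_interval:
  fixes C :: "real set"
  assumes "finite C" "0 < t"
  obtains a where "0 \<le> a" "a < t" "{a<..<t} \<inter> C = {}"
proof -
  let ?A = "insert 0 (C \<inter> {0<..<t})"
  have f: "finite ?A" using assms by simp
  show ?thesis
  proof (rule that[of "Max ?A"])
    show "0 \<le> Max ?A" using Max_ge[OF f] by simp
    show "Max ?A < t" using Max_in[OF f] assms by auto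
    show "{Max ?A<..<t} \<inter> C = {}"
    proof (rule ccontr)
      assume "{Max ?A<..<t} \<inter> C \<noteq> {}"
      then obtain s where s: "Max ?A < s" "s < t" "s \<in> C" by auto
      then have "0 < s" using Max_ge[OF f, of 0] by simp
      then show False using s Max_ge[OF f, of s] by simp
    qed
  qed
qed

lemma proj_H2_eqI:
  assumes y: "y \<in> H2 x" and x: "x \<in> K2" and orth: "\<And>w. w \<in> H2 x \<Longrightarrow> inner (y - z) w = 0"
  shows "proj (H2 x) z = y"
proof -
  let ?d = "proj (H2 x) z - y"
  have d: "?d \<in> H2 x" by (intro subspace_diff H2_subspace proj_H2_mem y)
  have "inner ?d ?d = inner z ?d - inner y ?d" using proj_H2_orth[OF d] by (simp add: inner_diff_left)
  also have "\<dots> = 0" using orth[OF d] by (simp add: inner_diff_left)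
  finally show ?thesis by simp
qed

context masses begin

abbreviation curve :: "(nat \<Rightarrow> real \<Rightarrow> real) \<Rightarrow> real \<Rightarrow> l2" where
  "curve f t \<equiv> cls (step (\<lambda>i. f i t))"

context
  fixes x v xt vt
  assumes ev: "sticky_evolution N m x v xt vt"
begin

lemma evolution_initial: "i < N \<Longrightarrow> xt i 0 = x i" "i < N \<Longrightarrow> vt i 0 = v i"
  and evolution_continuous: "i < N \<Longrightarrow> continuous_on {0..} (xt i)"
  and evolution_derivative: "i < N \<Longrightarrow> 0 \<le> t \<Longrightarrow> (xt i has_real_derivative vt i t) (at_right t)"
  and evolution_right_continuous: "i < N \<Longrightarrow> 0 \<le> t \<Longrightarrow> (vt i \<longlongrightarrow> vt i t) (at_right t)"
  and evolution_ordered: "0 \<le> t \<Longrightarrow> i \<le> j \<Longrightarrow> j < N \<Longrightarrow> xt i t \<le> xt j t"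
  and evolution_cluster: "i < N \<Longrightarrow> 0 \<le> s \<Longrightarrow> s \<le> t \<Longrightarrow> cluster N xt i s \<subseteq> cluster N xt i t"
  and evolution_constant: "i < N \<Longrightarrow> 0 \<le> a \<Longrightarrow> a < b \<Longrightarrow> {a<..<b} \<inter> collision_times N xt = {} \<Longrightarrow> \<exists>c. \<forall>t\<in>{a<..<b}. vt i t = c"
  and evolution_collision: "t \<in> collision_times N xt \<Longrightarrow> i < N \<Longrightarrow>
      vt i t = (\<Sum>j\<in>cluster N xt i t. m j * Lim (at_left t) (vt j)) / (\<Sum>j\<in>cluster N xt i t. m j)"
proof -
  note E = ev[unfolded sticky_evolution_def]
  note E1 = E[THEN conjunct1] and E2 = E[THEN conjunct2, THEN conjunct1] and E3 = E[THEN conjunct2, THEN conjunct2, THEN conjunct1]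
    and E4 = E[THEN conjunct2, THEN conjunct2, THEN conjunct2, THEN conjunct1]
    and E5 = E[THEN conjunct2, THEN conjunct2, THEN conjunct2, THEN conjunct2]
  show "i < N \<Longrightarrow> xt i 0 = x i" "i < N \<Longrightarrow> vt i 0 = v i" "i < N \<Longrightarrow> continuous_on {0..} (xt i)"
    "i < N \<Longrightarrow> 0 \<le> t \<Longrightarrow> (xt i has_real_derivative vt i t) (at_right t)"
    "i < N \<Longrightarrow> 0 \<le> t \<Longrightarrow> (vt i \<longlongrightarrow> vt i t) (at_right t)"
    using E1 by (simp_all add: continuous_within)
  show "0 \<le> t \<Longrightarrow> i \<le> j \<Longrightarrow> j < N \<Longrightarrow> xt i t \<le> xt j t" using E2 by (meson le_less_trans)
  show "i < N \<Longrightarrow> 0 \<le> s \<Longrightarrow> s \<le> t \<Longrightarrow> cluster N xt i s \<subseteq> cluster N xt i t" using E3 by blast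
  show "i < N \<Longrightarrow> 0 \<le> a \<Longrightarrow> a < b \<Longrightarrow> {a<..<b} \<inter> collision_times N xt = {} \<Longrightarrow> \<exists>c. \<forall>t\<in>{a<..<b}. vt i t = c" using E4 by blast
  show "t \<in> collision_times N xt \<Longrightarrow> i < N \<Longrightarrow>
      vt i t = (\<Sum>j\<in>cluster N xt i t. m j * Lim (at_left t) (vt j)) / (\<Sum>j\<in>cluster N xt i t. m j)" using E5 by blast
qed

lemma evolution_velocity_const:
  assumes i: "i < N" and a: "0 \<le> a" and free: "{a<..<b} \<inter> collision_times N xt = {}" and s: "a \<le> s" "s < b"
  shows "vt i s = vt i a"
proof (cases "s = a")
  case False
  obtain c where c: "\<And>t. a < t \<Longrightarrow> t < b \<Longrightarrow> vt i t = c" using evolution_constant[OF i a _ free] s by fastforce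
  have "\<forall>\<^sub>F t in at_right a. vt i t = c"
    using c s by (auto simp: eventually_at_right_field intro!: exI[of _ b])
  then have "(vt i \<longlongrightarrow> c) (at_right a)" by (rule tendsto_eventually)
  then have "vt i a = c" using evolution_right_continuous[OF i a] by (rule_tac tendsto_unique[of "at_right a"]) auto
  then show ?thesis using c[of s] s False by simp
qed simp

lemma evolution_linear:
  assumes i: "i < N" and a: "0 \<le> a" and free: "{a<..<b} \<inter> collision_times N xt = {}" and s: "a \<le> s" "s \<le> b"
  shows "xt i s = xt i a + (s - a) * vt i a"
proof -
  have c: "continuous_on {a..s} (xt i)" by (rule continuous_on_subset[OF evolution_continuous[OF i]]) (use a in auto)
  have d: "(xt i has_real_derivative vt i a) (at_right r)" if "a \<le> r" "r < s" for r
    using evolution_derivative[OF i, of r] evolution_velocity_const[OF i a free that(1)] a that s by simp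
  have "xt i s - s * vt i a \<le> xt i a - a * vt i a"
    by (rule nonincreasing_if_right_derivative[OF s(1)])
      (auto intro!: continuous_intros c derivative_eq_intros exI[of _ 0] d)
  moreover have "s * vt i a - xt i s \<le> a * vt i a - xt i a"
    by (rule nonincreasing_if_right_derivative[OF s(1)])
      (auto intro!: continuous_intros c derivative_eq_intros exI[of _ 0] d)
  ultimately show ?thesis by (simp add: left_diff_distrib)
qed

lemma evolution_stick:
  assumes "i < N" "j < N" "0 \<le> s" "s \<le> t" "xt i s = xt j s" shows "xt i t = xt j t"
proof -
  have "j \<in> cluster N xt i s" using assms by (simp add: cluster_def)
  then have "j \<in> cluster N xt i t" using evolution_cluster[OF assms(1,3,4)] by blast
  then show ?thesis by (simp add: cluster_def)
qed

text \<open>Particles that coincide at t coincide afterwards and thus have the same difference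
  quotients to the right.\<close>

lemma evolution_velocity_stick:
  assumes ij: "i < N" "j < N" and t: "0 \<le> t" and eq: "xt i t = xt j t"
  shows "vt i t = vt j t"
proof (rule tendsto_unique)
  show "((\<lambda>s. (xt i s - xt i t) / (s - t)) \<longlongrightarrow> vt i t) (at_right t)"
    using evolution_derivative[OF ij(1) t] unfolding has_field_derivative_iff .
  have e: "\<forall>\<^sub>F s in at_right t. (xt j s - xt j t) / (s - t) = (xt i s - xt i t) / (s - t)"
    using evolution_stick[OF ij t _ eq] eq by (auto simp: eventually_at_right_field intro!: exI[of _ "t + 1"])
  have "((\<lambda>s. (xt j s - xt j t) / (s - t)) \<longlongrightarrow> vt j t) (at_right t)"
    using evolution_derivative[OF ij(2) t] unfolding has_field_derivative_iff .
  then show "((\<lambda>s. (xt i s - xt i t) / (s - t)) \<longlongrightarrow> vt j t) (at_right t)"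
    by (rule tendsto_cong[OF e, THEN iffD1])
qed simp

lemma evolution_K2: "0 \<le> t \<Longrightarrow> curve xt t \<in> K2"
  unfolding cls_step_K2_iff by (intro allI impI) (rule evolution_ordered)

lemma evolution_H2: "0 \<le> t \<Longrightarrow> curve vt t \<in> H2 (curve xt t)"
  unfolding cls_step_H2_iff by (intro allI impI) (rule evolution_velocity_stick)

lemma evolution_H2_antimono: "0 \<le> s \<Longrightarrow> s \<le> t \<Longrightarrow> H2 (curve xt t) \<subseteq> H2 (curve xt s)"
  by (rule H2_mono, unfold cls_step_H2_iff, intro allI impI) (rule evolution_stick)

lemma evolution_initial_cls: "curve xt 0 = cls (step x)" "curve vt 0 = cls (step v)"
  unfolding cls_step_eq_iff by (simp_all add: evolution_initial)

text \<open>Conservation of momentum: the new velocity is the mass-weighted mean of the old one over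
  each cluster, and \<open>w\<close>, being a function of the position at c, is constant on
  clusters.\<close>

lemma collision_orth:
  assumes c: "c \<in> collision_times N xt" and a: "0 \<le> a" "a < c" and free: "{a<..<c} \<inter> collision_times N xt = {}"
    and w: "w \<in> H2 (curve xt c)"
  shows "inner (curve vt a - curve vt c) w = 0"
proof -
  obtain b where b: "w = cls (step b)" using H2_step_exists[OF w] .
  have bc: "b i = b j" if "i < N" "j < N" "xt i c = xt j c" for i j
    using w that unfolding b cls_step_H2_iff by blast
  let ?C = "\<lambda>i. cluster N xt i c"
  let ?M = "\<lambda>i. \<Sum>j\<in>?C i. m j"
  have lim: "Lim (at_left c) (vt j) = vt j a" if j: "j < N" for j
  proof (rule tendsto_Lim)
    have "\<forall>\<^sub>F s in at_left c. vt j s = vt j a"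
      unfolding eventually_at_left_field
      by (intro exI[of _ a] conjI allI impI a(2) evolution_velocity_const[OF j a(1) free]) auto
    then show "(vt j \<longlongrightarrow> vt j a) (at_left c)" by (rule tendsto_eventually)
  qed simp
  have Mpos: "0 < ?M i" if "i < N" for i
    using that mass_pos by (intro sum_pos) (auto simp: cluster_def)
  have vc: "?M i * vt i c = (\<Sum>j\<in>?C i. m j * vt j a)" if i: "i < N" for i
  proof -
    have "vt i c = (\<Sum>j\<in>?C i. m j * vt j a) / ?M i"
      unfolding evolution_collision[OF c i] using lim by (simp add: cluster_def)
    then show ?thesis using Mpos[OF i] by simp
  qed
  \<comment> \<open>The means become a double sum over pairs in contact; after exchanging the sums
    the weights m i / ?M i of each cluster add up to 1.\<close>
  have "(\<Sum>i<N. m i * (vt i c * b i)) = (\<Sum>i<N. \<Sum>j<N. if xt j c = xt i c then m i * b i / ?M i * (m j * vt j a) else 0)"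
  proof (rule sum.cong[OF refl])
    fix i assume "i \<in> {..<N}"
    then have i: "i < N" by simp
    have "m i * (vt i c * b i) = m i * b i / ?M i * (?M i * vt i c)" using Mpos[OF i] by simp
    also have "\<dots> = (\<Sum>j\<in>?C i. m i * b i / ?M i * (m j * vt j a))" unfolding vc[OF i] by (rule sum_distrib_left)
    also have "\<dots> = (\<Sum>j<N. if xt j c = xt i c then m i * b i / ?M i * (m j * vt j a) else 0)"
      by (rule sum.mono_neutral_cong_left) (auto simp: cluster_def)
    finally show "m i * (vt i c * b i) = \<dots>" .
  qed
  also have "\<dots> = (\<Sum>j<N. \<Sum>i<N. if xt j c = xt i c then m i * b i / ?M i * (m j * vt j a) else 0)"
    by (rule sum.swap)
  also have "\<dots> = (\<Sum>j<N. m j * (vt j a * b j))"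
  proof (rule sum.cong[OF refl])
    fix j assume "j \<in> {..<N}"
    then have j: "j < N" by simp
    have "(\<Sum>i<N. if xt j c = xt i c then m i * b i / ?M i * (m j * vt j a) else 0) = (\<Sum>i\<in>?C j. m i * (b j / ?M j * (m j * vt j a)))"
    proof (rule sum.mono_neutral_cong_right)
      show "\<forall>i\<in>{..<N} - ?C j. (if xt j c = xt i c then m i * b i / ?M i * (m j * vt j a) else 0) = 0"
        by (auto simp: cluster_def)
      fix i assume i: "i \<in> ?C j"
      then have "b i = b j" "?C i = ?C j" using bc[of i j] j by (auto simp: cluster_def)
      then show "(if xt j c = xt i c then m i * b i / ?M i * (m j * vt j a) else 0) = m i * (b j / ?M j * (m j * vt j a))"
        using i by (simp add: cluster_def)
    qed (auto simp: cluster_def)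
    also have "\<dots> = ?M j * (b j / ?M j * (m j * vt j a))" by (rule sum_distrib_right[symmetric])
    also have "\<dots> = m j * (vt j a * b j)" using Mpos[OF j] by simp
    finally show "(\<Sum>i<N. if xt j c = xt i c then m i * b i / ?M i * (m j * vt j a) else 0) = m j * (vt j a * b j)" .
  qed
  finally show ?thesis unfolding b by (simp add: inner_diff_left inner_step)
qed

text \<open>
  At a collision the incoming velocity \<open>V(a)\<close> is \<open>(X(c) - X(a)) / (c - a)\<close> and the outgoing one is
  its projection onto the functions of \<open>X(c)\<close>, which is larger than \<open>V(a)\<close> on the cone because
  the projection of \<open>X(a)\<close> is smaller than \<open>X(a)\<close>.
\<close>

lemma evolution_velocity_residual:
  assumes "0 \<le> t"
  shows "(\<forall>u\<in>K2. inner (cls (step v) - curve vt t) u \<le> 0) \<and> (\<forall>w\<in>H2 (curve xt t). inner (cls (step v) - curve vt t) w = 0)"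
  using assms
proof (induction "card (collision_times N xt \<inter> {0<..t})" arbitrary: t rule: less_induct)
  case less
  let ?C = "collision_times N xt"
  have fin: "finite ?C" by (rule finite_collision_times)
  obtain b where b: "t < b" "{t<..<b} \<inter> ?C = {}" using next_free_interval[OF fin] .
  show ?case
  proof (cases "?C \<inter> {0<..t} = {}")
    case True
    then have free: "{0<..<b} \<inter> ?C = {}" using b by (force simp: set_eq_iff not_less)
    have "curve vt t = curve vt 0"
      unfolding cls_step_eq_iff by (intro allI impI, rule evolution_velocity_const[OF _ _ free]) (use less.prems b in auto)
    then show ?thesis by (simp add: evolution_initial_cls)
  next
    case False
    have finC: "finite (?C \<inter> {0<..t})" using fin by simp
    \<comment> \<open>The last collision up to t. At the earlier time \<open>a\<close> fewer
      collisions have occurred, which is the induction measure, and the motion on [a, c) is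
      free.\<close>
    define c where "c = Max (?C \<inter> {0<..t})"
    have c: "c \<in> ?C" "0 < c" "c \<le> t" using Max_in[OF finC False] by (auto simp: c_def)
    have free: "{c<..<b} \<inter> ?C = {}"
    proof (rule ccontr)
      assume "{c<..<b} \<inter> ?C \<noteq> {}"
      then obtain s where s: "c < s" "s < b" "s \<in> ?C" by auto
      then have "s \<le> t" using b by (force simp: set_eq_iff not_less)
      then have "s \<le> c" unfolding c_def using s c by (intro Max_ge[OF finC]) auto
      then show False using s by simp
    qed
    obtain a where a: "0 \<le> a" "a < c" "{a<..<c} \<inter> ?C = {}" using previous_free_interval[OF fin c(2)] .
    have "c \<notin> ?C \<inter> {0<..a}" "c \<in> ?C \<inter> {0<..t}" "?C \<inter> {0<..a} \<subseteq> ?C \<inter> {0<..t}" using a c by auto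
    then have "card (?C \<inter> {0<..a}) < card (?C \<inter> {0<..t})" by (intro psubset_card_mono finC) blast
    note IH = less.hyps[OF this a(1)]
    have Vt: "curve vt t = curve vt c"
      unfolding cls_step_eq_iff by (intro allI impI, rule evolution_velocity_const[OF _ _ free]) (use c b in auto)
    have orth: "inner (curve vt a - curve vt c) w = 0" if "w \<in> H2 (curve xt c)" for w
      by (rule collision_orth[OF c(1) a that])
    \<comment> \<open>The position reached by going back from X(c) with the outgoing velocity. It
      turns out to be the projection of X(a) onto the functions of X(c), so that y - X(a) is a
      positive multiple of the drop in velocity.\<close>
    define y where "y = curve xt c - (c - a) *\<^sub>R curve vt c"
    have Kc: "curve xt c \<in> K2" "curve xt a \<in> K2" using evolution_K2 a c by auto
    have "\<forall>i<N. xt i c = xt i a + (c - a) * vt i a"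
      using evolution_linear[OF _ a(1,3), of _ c] a c by simp
    then have Xc: "curve xt c = curve xt a + (c - a) *\<^sub>R curve vt a"
      by (simp add: step_linear cls_step_eq_iff)
    then have diff: "y - curve xt a = (c - a) *\<^sub>R (curve vt a - curve vt c)" by (simp add: y_def scaleR_diff_right)
    have "y \<in> H2 (curve xt c)" unfolding y_def using c
      by (intro subspace_diff H2_subspace subspace_scale H2_self evolution_H2) simp
    then have "proj (H2 (curve xt c)) (curve xt a) = y"
      by (rule proj_H2_eqI[OF _ Kc(1)]) (simp add: diff orth)
    then have polar: "inner (y - curve xt a) u \<le> 0" if "u \<in> K2" for u
      using proj_H2_polar[OF Kc that] by simp
    have pol: "inner (curve vt a - curve vt c) u \<le> 0" if "u \<in> K2" for u
      using polar[OF that] a unfolding diff by (simp add: mult_le_0_iff)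
    have split: "inner (cls (step v) - curve vt t) u = inner (cls (step v) - curve vt a) u + inner (curve vt a - curve vt c) u" for u
      by (simp add: Vt inner_diff_left)
    show ?thesis
    proof (intro conjI ballI)
      fix u assume u: "u \<in> K2"
      show "inner (cls (step v) - curve vt t) u \<le> 0" unfolding split using IH pol[OF u] u by (simp add: add_nonpos_nonpos)
    next
      fix w assume w: "w \<in> H2 (curve xt t)"
      then have "w \<in> H2 (curve xt c)" "w \<in> H2 (curve xt a)" using evolution_H2_antimono[of c t] evolution_H2_antimono[of a t] a c by auto
      then show "inner (cls (step v) - curve vt t) w = 0" unfolding split using IH orth by simp
    qed
  qed
qed

text \<open>The residual is the time integral of the differences v - V(s); the inequality is
  integrated through the right derivative of the pairing with \<open>u\<close>.\<close>

lemma evolution_residual_nonpos: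
  assumes t: "0 \<le> t" and u: "\<And>s. 0 \<le> s \<Longrightarrow> s < t \<Longrightarrow> inner (cls (step v) - curve vt s) u \<le> 0"
  shows "inner (cls (step x) + t *\<^sub>R cls (step v) - curve xt t) u \<le> 0"
proof -
  obtain c where c: "\<And>a. inner (cls (step a)) u = (\<Sum>i<N. a i * c i)" using inner_step_linear by blast
  define f where "f s = s * inner (cls (step v)) u - (\<Sum>i<N. xt i s * c i)" for s
  have "f t \<le> f 0"
  proof (rule nonincreasing_if_right_derivative[OF t])
    show "continuous_on {0..t} f" unfolding f_def
      by (intro continuous_intros continuous_on_subset[OF evolution_continuous]) auto
    fix s assume s: "0 \<le> s" "s < t"
    have "((\<lambda>r. r * inner (cls (step v)) u - (\<Sum>i<N. xt i r * c i)) has_real_derivative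
        1 * inner (cls (step v)) u - (\<Sum>i<N. vt i s * c i)) (at_right s)"
      by (intro DERIV_diff DERIV_sum DERIV_cmult_right DERIV_ident evolution_derivative s) auto
    then show "\<exists>D\<le>0. (f has_real_derivative D) (at_right s)"
      unfolding f_def[abs_def] using u[OF s] by (intro exI[of _ "inner (cls (step v)) u - (\<Sum>i<N. vt i s * c i)"]) (simp add: c inner_diff_left)
  qed
  moreover have "f 0 = - inner (cls (step x)) u" using evolution_initial by (simp add: f_def c)
  ultimately show ?thesis by (simp add: f_def c inner_diff_left inner_add_left)
qed

text \<open>The residual passes the optimality test for the projection: it is nonpositive on
  \<open>K2\<close> and, by testing with w and -w, orthogonal to the functions of X(t). So every
  sticky evolution is the projected flow.\<close>

lemma evolution_flow:
  assumes t: "0 \<le> t"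
  shows "flow K2 (cls (step x)) (cls (step v)) t = curve xt t" (is ?X)
    and "cls (step v) \<in> H2 (cls (step x)) \<Longrightarrow> flow_vel K2 (cls (step x)) (cls (step v)) t = curve vt t"
proof -
  let ?r = "cls (step x) + t *\<^sub>R cls (step v) - curve xt t"
  have orth: "inner ?r w = 0" if w: "w \<in> H2 (curve xt t)" for w
  proof -
    have 0: "inner (cls (step v) - curve vt s) w = 0" if "0 \<le> s" "s < t" for s
      using evolution_velocity_residual[OF that(1)] evolution_H2_antimono[of s t] that w by auto
    have "inner ?r w \<le> 0" by (rule evolution_residual_nonpos[OF t]) (simp add: 0)
    moreover have "inner ?r (- w) \<le> 0" by (rule evolution_residual_nonpos[OF t]) (simp add: 0)
    ultimately show ?thesis by simp
  qed
  have "?r \<in> normal_cone K2 (curve xt t)"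
    unfolding normal_cone_def
  proof (intro CollectI conjI ballI)
    show "inner ?r (curve xt t) = 0" by (rule orth[OF H2_self])
    fix u assume u: "u \<in> K2"
    show "inner ?r u \<le> 0" by (rule evolution_residual_nonpos[OF t]) (use evolution_velocity_residual u in blast)
  qed
  then show X: ?X unfolding flow_def by (rule proj_eqI[OF K2_closed_cone evolution_K2[OF t]])
  assume H: "cls (step v) \<in> H2 (cls (step x))"
  let ?V = "flow_vel K2 (cls (step x)) (cls (step v)) t"
  have K: "cls (step x) \<in> K2" using evolution_K2[of 0] by (simp add: evolution_initial_cls)
  have d: "?V - curve vt t \<in> H2 (curve xt t)"
    using sticky.flow_vel_in_H[OF K H t] evolution_H2[OF t] unfolding X by (intro subspace_diff H2_subspace) auto
  have "inner (?V - curve vt t) (?V - curve vt t) = inner (cls (step v) - curve vt t) (?V - curve vt t)"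
    using sticky.flow_vel_orth[OF K H t, unfolded X, OF d] by (simp add: inner_diff_left)
  also have "\<dots> = 0" using evolution_velocity_residual[OF t] d by blast
  finally show "?V = curve vt t" by simp
qed

end

text \<open>The trajectories are the coordinates of the projected flow of the step functions, on
  which the rules of sticky motion are verified. Strict ordering of \<open>x\<close> puts every step
  function into \<open>H2 (cls (step x))\<close>, so that arbitrary velocities are
  admissible.\<close>

lemma evolution_exists:
  assumes x: "strict_mono_on {..<N} x"
  obtains xt vt where "sticky_evolution N m x v xt vt"
proof -
  let ?x = "cls (step x)" and ?v = "cls (step v)"
  have xle: "x i \<le> x j" if "i \<le> j" "j < N" for i j
    using strict_mono_onD[OF x, of i j] that by (cases "i = j") auto
  have xeq: "i = j" if "i < N" "j < N" "x i = x j" for i j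
    using strict_mono_onD[OF x, of i j] strict_mono_onD[OF x, of j i] that by (cases i j rule: linorder_cases) auto
  have K: "?x \<in> K2" unfolding cls_step_K2_iff using xle by blast
  have H: "?v \<in> H2 ?x" unfolding cls_step_H2_iff using xeq by blast
  define X where "X t = flow K2 ?x ?v t" for t
  define V where "V t = flow_vel K2 ?x ?v t" for t
  \<comment> \<open>Dual to the cells: 1 / m i cancels the mass in \<open>inner_step\<close>, so
    pairing with \<open>e i\<close> reads off the coefficient i.\<close>
  define e where "e i = cls (step (\<lambda>j. if j = i then 1 / m i else 0))" for i
  define xt where "xt i t = inner (X t) (e i)" for i t
  define vt where "vt i t = inner (V t) (e i)" for i t
  have coord: "inner (cls (step a)) (e i) = a i" if i: "i < N" for a i
  proof -
    have "inner (cls (step a)) (e i) = (\<Sum>j<N. if j = i then a j else 0)"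
      unfolding e_def inner_step using mass_pos[OF i] by (intro sum.cong) auto
    then show ?thesis using i by simp
  qed
  have XH: "X t \<in> H2 ?x" if "0 \<le> t" for t
    using sticky.flow_in_H[OF K H _ that] sticky.flow_0[OF K H] by (simp add: X_def)
  have X: "X t = curve xt t" if t: "0 \<le> t" for t
  proof -
    obtain b where b: "X t = cls (step b)" using H2_step_exists[OF XH[OF t]] .
    then have "\<forall>i<N. b i = xt i t" using coord by (simp add: xt_def)
    then show ?thesis unfolding b cls_step_eq_iff .
  qed
  have VH: "V t \<in> H2 (X t)" if "0 \<le> t" for t unfolding X_def V_def by (rule sticky.flow_vel_in_H[OF K H that])
  have V: "V t = curve vt t" if t: "0 \<le> t" for t
  proof -
    have "V t \<in> H2 ?x" using VH[OF t] H2_mono[OF XH[OF t]] by blast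
    then obtain b where b: "V t = cls (step b)" using H2_step_exists by blast
    then have "\<forall>i<N. b i = vt i t" using coord by (simp add: vt_def)
    then show ?thesis unfolding b cls_step_eq_iff .
  qed
  have X0: "xt i 0 = x i" and V0: "vt i 0 = v i" if "i < N" for i
    using coord[OF that] sticky.flow_0[OF K H] sticky.flow_vel_0[OF K H] by (simp_all add: xt_def vt_def X_def V_def)
  have cont: "continuous_on {0..} (xt i)" for i
  proof -
    have "(X \<longlongrightarrow> X s) (at s within {0..})" for s unfolding X_def by (rule sticky.flow_tendsto[OF K H])
    then show ?thesis unfolding xt_def continuous_on_def by (auto intro!: tendsto_intros)
  qed
  have der: "(xt i has_real_derivative vt i t) (at_right t)" if t: "0 \<le> t" for i t
  proof -
    have "((\<lambda>h. (1/h) *\<^sub>R (X (t + h) - X t)) \<longlongrightarrow> V t) (at_right 0)"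
      unfolding X_def V_def by (rule sticky.flow_right_derivative[OF K H t])
    then have "((\<lambda>h. inner ((1/h) *\<^sub>R (X (t + h) - X t)) (e i)) \<longlongrightarrow> vt i t) (at_right 0)"
      unfolding vt_def by (intro tendsto_intros)
    then have "((\<lambda>h. (xt i (t + h) - xt i t) / h) \<longlongrightarrow> vt i t) (at_right 0)"
      by (simp add: xt_def inner_diff_left)
    then have "((\<lambda>s. (xt i s - xt i t) / (s - t)) \<longlongrightarrow> vt i t) (at_right t)"
      by (subst filterlim_at_right_to_0) (simp add: add.commute)
    then show ?thesis unfolding has_field_derivative_iff .
  qed
  have rc: "continuous (at_right t) (vt i)" if t: "0 \<le> t" for i t
  proof -
    have "(V \<longlongrightarrow> V t) (at_right t)" unfolding V_def by (rule sticky.flow_vel_right_continuous[OF K H t])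
    then show ?thesis unfolding vt_def continuous_within by (intro tendsto_intros)
  qed
  have ord: "xt i t \<le> xt j t" if "0 \<le> t" "i \<le> j" "j < N" for i j t
  proof -
    have "curve xt t \<in> K2" using sticky.flow_in[OF K H, of t] X[OF that(1)] by (simp add: X_def)
    then show ?thesis unfolding cls_step_K2_iff using that by blast
  qed
  have stick: "xt i t = xt j t" if st: "0 \<le> s" "s \<le> t" and ij: "i < N" "j < N" "xt i s = xt j s" for i j s t
  proof -
    have "X t \<in> H2 (X s)" unfolding X_def by (rule sticky.flow_in_H[OF K H st])
    then have "curve xt t \<in> H2 (curve xt s)" using X st by simp
    then show ?thesis unfolding cls_step_H2_iff using ij by blast
  qed
  have clus: "cluster N xt i s \<subseteq> cluster N xt i t" if "i < N" "0 \<le> s" "s \<le> t" for i s t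
  proof
    fix j assume "j \<in> cluster N xt i s"
    then have "j < N" "xt i s = xt j s" by (simp_all add: cluster_def)
    then show "j \<in> cluster N xt i t" using stick[OF that(2,3,1)] by (simp add: cluster_def)
  qed
  have orth: "inner (V s - V t) w = 0" if st: "0 \<le> s" "s \<le> t" and w: "w \<in> H2 (X t)" for s t w
  proof -
    have "w \<in> H2 (X s)" using sticky.H_flow_antimono[OF K H st] w by (auto simp: X_def)
    then show ?thesis
      using sticky.flow_vel_orth[OF K H _ w[unfolded X_def]] sticky.flow_vel_orth[OF K H st(1), of w] st
      by (simp add: X_def V_def inner_diff_left)
  qed
  \<comment> \<open>If two particles first met in (s, t], that time would be a collision time inside
    the free interval. Hence X(s) is a function of X(t), both velocities lie in
    \<open>H2 (X t)\<close>, and \<open>orth\<close> makes them equal.\<close>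
  have const: "vt i s = vt i t" if ab: "0 \<le> a" "{a<..<b} \<inter> collision_times N xt = {}" and st: "a < s" "s \<le> t" "t < b" for i a b s t
  proof -
    have unstuck: "xt i s = xt j s" if ij: "i < N" "j < N" "xt i t = xt j t" for i j
    proof (rule ccontr)
      assume ne: "\<not> xt i s = xt j s"
      define B where "B = {r \<in> {s..t}. xt i r - xt j r = 0}"
      have c: "continuous_on {s..t} (\<lambda>r. xt i r - xt j r)"
        by (intro continuous_intros continuous_on_subset[OF cont]) (use ab st in auto)
      have "closed B" unfolding B_def using continuous_closed_preimage_constant[OF c, of 0] by (simp add: vimage_def)
      moreover have "bounded B" by (rule bounded_subset[of "{s..t}"]) (auto simp: B_def)
      ultimately have "compact B" by (simp add: compact_eq_bounded_closed)
      moreover have "t \<in> B" using ij st by (simp add: B_def)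
      ultimately obtain c where c: "c \<in> B" "\<And>r. r \<in> B \<Longrightarrow> c \<le> r" using compact_attains_inf[of B] by blast
      have ct: "s \<le> c" "c \<le> t" "xt i c = xt j c" using c(1) by (auto simp: B_def)
      have apart: "xt i r \<noteq> xt j r" if "0 \<le> r" "r < c" for r
      proof
        assume eq: "xt i r = xt j r"
        show False
        proof (cases "r \<le> s")
          case True
          then show False using stick[OF that(1) True ij(1,2) eq] ne by simp
        next
          case False
          then have "r \<in> B" using eq that ct by (simp add: B_def)
          then show False using c(2)[of r] that by simp
        qed
      qed
      have "c \<in> collision_times N xt"
        unfolding collision_times_def
      proof (intro CollectI conjI exI[of _ i] bexI[of _ j] allI impI ij(1))
        show "0 < c" using ct ab st by simp
        show "j \<in> cluster N xt i c" using ij ct by (simp add: cluster_def)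
        fix r assume "0 \<le> r \<and> r < c"
        then show "j \<notin> cluster N xt i r" using apart[of r] by (simp add: cluster_def)
      qed
      moreover have "c \<in> {a<..<b}" using ct st by auto
      ultimately show False using ab by blast
    qed
    have st': "0 \<le> s" "0 \<le> t" using ab st by auto
    have "X s \<in> H2 (X t)" unfolding X[OF st'(1)] X[OF st'(2)] cls_step_H2_iff using unstuck by blast
    then have "V s \<in> H2 (X t)" using VH[OF st'(1)] H2_mono by blast
    then have "V s - V t \<in> H2 (X t)" using VH[OF st'(2)] by (intro subspace_diff H2_subspace)
    from orth[OF st'(1) st(2) this] show ?thesis by (simp add: vt_def)
  qed
  have coll: "vt i t = (\<Sum>j\<in>cluster N xt i t. m j * Lim (at_left t) (vt j)) / (\<Sum>j\<in>cluster N xt i t. m j)"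
    if t: "t \<in> collision_times N xt" and i: "i < N" for t i
  proof -
    let ?C = "cluster N xt i t"
    have t0: "0 < t" using t by (simp add: collision_times_def)
    obtain a where a: "0 \<le> a" "a < t" "{a<..<t} \<inter> collision_times N xt = {}"
      using previous_free_interval[OF finite_collision_times t0] .
    define s where "s = (a + t) / 2"
    have s: "a < s" "s < t" "0 \<le> s" using a by (auto simp: s_def)
    have "\<forall>\<^sub>F r in at_left t. vt j r = vt j s" for j
      unfolding eventually_at_left_field
      by (intro exI[of _ s] conjI allI impI s(2) const[OF a(1,3), symmetric] s(1)) auto
    then have lim: "Lim (at_left t) (vt j) = vt j s" for j by (intro tendsto_Lim tendsto_eventually) auto
    \<comment> \<open>Testing with the indicator of one cluster gives the conservation of its
      momentum.\<close>
    define w where "w = cls (step (indicator ?C))"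
    have "w \<in> H2 (curve xt t)" unfolding w_def cls_step_H2_iff by (auto simp: cluster_def indicator_def)
    then have "w \<in> H2 (X t)" using X t0 by simp
    then have "inner (V s - V t) w = 0" using orth[of s t w] s by simp
    then have "(\<Sum>j<N. m j * (vt j s * indicator ?C j)) = (\<Sum>j<N. m j * (vt j t * indicator ?C j))"
      using V[of s] V[of t] s t0 by (simp only: inner_diff_left w_def inner_step less_imp_le)
    moreover have "(\<Sum>j<N. m j * (vt j r * indicator ?C j)) = (\<Sum>j\<in>?C. m j * vt j r)" for r
      by (rule sum.mono_neutral_cong_right) (auto simp: cluster_def indicator_def)
    ultimately have "(\<Sum>j\<in>?C. m j * vt j s) = (\<Sum>j\<in>?C. m j * vt j t)" by simp
    also have "\<dots> = (\<Sum>j\<in>?C. m j * vt i t)"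
    proof (rule sum.cong[OF refl])
      fix j assume j: "j \<in> ?C"
      have "curve vt t \<in> H2 (curve xt t)" using VH[of t] V[of t] X[of t] t0 by simp
      moreover have "j < N" "xt j t = xt i t" using j by (simp_all add: cluster_def)
      ultimately have "vt j t = vt i t" unfolding cls_step_H2_iff using i by blast
      then show "m j * vt j t = m j * vt i t" by simp
    qed
    finally have "(\<Sum>j\<in>?C. m j * vt j s) = (\<Sum>j\<in>?C. m j) * vt i t" by (simp add: sum_distrib_right)
    moreover have "0 < (\<Sum>j\<in>?C. m j)" using i mass_pos by (intro sum_pos) (auto simp: cluster_def)
    ultimately show ?thesis by (simp add: lim)
  qed
  have "\<exists>c. \<forall>t\<in>{a<..<b}. vt i t = c" if "0 \<le> a" "{a<..<b} \<inter> collision_times N xt = {}" for i a b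
  proof (rule exI[of _ "vt i ((a + b) / 2)"], rule ballI)
    fix t assume t: "t \<in> {a<..<b}"
    define r where "r = (a + b) / 2"
    have r: "a < r" "r < b" using t by (auto simp: r_def)
    have "vt i t = vt i r"
    proof (cases "t \<le> r")
      case True
      then show ?thesis using t r by (intro const[OF that]) auto
    next
      case False
      then show ?thesis using t r by (intro const[OF that, symmetric]) auto
    qed
    then show "vt i t = vt i ((a + b) / 2)" by (simp add: r_def)
  qed
  then have "sticky_evolution N m x v xt vt"
    unfolding sticky_evolution_def
    using X0 V0 cont der rc ord clus coll by (intro conjI allI impI ballI) simp_all
  then show ?thesis using that by blast
qed

lemma euler_flow_discrete:
  assumes p: "2 \<le> p" and x: "strict_mono_on {..<N} x" and ev: "sticky_evolution N m x v xt vt" and t: "0 \<le> t"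
  shows "discrete_pair N m x v \<in> V_space p"
    "euler_flow t (discrete_pair N m x v) = discrete_pair N m (\<lambda>i. xt i t) (\<lambda>i. vt i t)"
proof -
  have "x i \<le> x j" if "i \<le> j" "j < N" for i j
    using strict_mono_onD[OF x, of i j] that by (cases "i = j") auto
  moreover have "v i = v j" if "i < N" "j < N" "x i = x j" for i j
    using strict_mono_onD[OF x, of i j] strict_mono_onD[OF x, of j i] that by (cases i j rule: linorder_cases) auto
  ultimately have Z: "(step x, step v) \<in> X_space p" by (rule step_X_space[OF p])
  then show "discrete_pair N m x v \<in> V_space p" unfolding eulerian_step[symmetric] by (rule eulerian_V_space[OF p])
  have d: "lag_data (step x) (step v)" using Z by (simp add: X_space_iff[OF p])
  have "cls (lag_X (step x) (step v) t) = curve xt t" "cls (lag_V (step x) (step v) t) = curve vt t"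
    using evolution_flow(1)[OF ev t] evolution_flow(2)[OF ev t v0_H2[OF d]]
    by (simp_all add: lag_X_props(4)[OF d] lag_V_props(3)[OF d t])
  then have "ae_eq (lag_X (step x) (step v) t) (step (\<lambda>i. xt i t))" "ae_eq (lag_V (step x) (step v) t) (step (\<lambda>i. vt i t))"
    by (simp_all add: cls_eq_iff lag_X_props(2)[OF d] lag_V_props(2)[OF d t])
  then have "eulerian (lag_X (step x) (step v) t) (lag_V (step x) (step v) t) = eulerian (step (\<lambda>i. xt i t)) (step (\<lambda>i. vt i t))"
    by (intro eulerian_cong_AE L2_measurable lag_X_props(2)[OF d] lag_V_props(2)[OF d t] step_L2)
  then show "euler_flow t (discrete_pair N m x v) = discrete_pair N m (\<lambda>i. xt i t) (\<lambda>i. vt i t)"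
    unfolding eulerian_step[symmetric] euler_flow_eulerian[OF p Z t] .
qed

end

section \<open>Density of the discrete data\<close>

lemma Np_dominated:
  assumes p: "0 < p" and L: "\<And>n. f n \<in> L2" "g \<in> L2" and G: "G \<in> borel_measurable leb01" "(\<integral>\<^sup>+ w. ennreal (\<bar>G w\<bar> powr p) \<partial>leb01) < \<infinity>"
    and bound: "\<And>n. AE w in leb01. \<bar>f n w - g w\<bar> \<le> \<bar>G w\<bar>"
    and lim: "AE w in leb01. (\<lambda>n. f n w) \<longlonglongrightarrow> g w"
  shows "(\<lambda>n. Np p (cls (f n) - cls g)) \<longlonglongrightarrow> 0"
proof -
  note [measurable] = L2_measurable[OF L(1)] L2_measurable[OF L(2)] G(1)
  have "(\<lambda>n. \<integral>\<^sup>+ w. ennreal (\<bar>f n w - g w\<bar> powr p) \<partial>leb01) \<longlonglongrightarrow> (\<integral>\<^sup>+ w. 0 \<partial>leb01)"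
  proof (rule nn_integral_dominated_convergence[OF _ _ _ _ G(2)])
    show "AE w in leb01. ennreal (\<bar>f n w - g w\<bar> powr p) \<le> ennreal (\<bar>G w\<bar> powr p)" for n
      using bound[of n] by eventually_elim (use p in \<open>auto intro!: ennreal_leI powr_mono2\<close>)
    show "AE w in leb01. (\<lambda>n. ennreal (\<bar>f n w - g w\<bar> powr p)) \<longlonglongrightarrow> 0"
      using lim
    proof eventually_elim
      fix w assume "(\<lambda>n. f n w) \<longlonglongrightarrow> g w"
      then have "(\<lambda>n. \<bar>f n w - g w\<bar>) \<longlonglongrightarrow> 0" by (simp add: LIM_zero_iff tendsto_rabs_zero)
      then have "(\<lambda>n. \<bar>f n w - g w\<bar> powr p) \<longlonglongrightarrow> 0" using p by (intro tendsto_zero_powrI[where b = p]) auto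
      then show "(\<lambda>n. ennreal (\<bar>f n w - g w\<bar> powr p)) \<longlonglongrightarrow> 0" using tendsto_ennrealI by fastforce
    qed
  qed measurable
  then show ?thesis by (simp add: cls_diff[OF L] Np_cls[OF L2_diff[OF L]])
qed

definition clamp_real :: "real \<Rightarrow> real \<Rightarrow> real" where "clamp_real M t = max (- M) (min M t)"

lemma clamp_real_bound: "0 \<le> M \<Longrightarrow> \<bar>clamp_real M t\<bar> \<le> M"
  and clamp_real_diff: "0 \<le> M \<Longrightarrow> \<bar>clamp_real M t - t\<bar> \<le> \<bar>t\<bar>"
  and clamp_real_id: "\<bar>t\<bar> \<le> M \<Longrightarrow> clamp_real M t = t"
  and clamp_real_mono: "s \<le> t \<Longrightarrow> clamp_real M s \<le> clamp_real M t"
  by (auto simp: clamp_real_def max_def min_def)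

lemma clamp_real_continuous: "continuous_on A f \<Longrightarrow> continuous_on A (\<lambda>x. clamp_real M (f x))"
  unfolding clamp_real_def by (intro continuous_intros)

lemma clamp_real_measurable [measurable]: "clamp_real M \<in> borel_measurable borel"
  unfolding clamp_real_def[abs_def] by measurable

lemma clamp_L2: assumes "f \<in> borel_measurable leb01" "0 \<le> M" shows "(\<lambda>w. clamp_real M (f w)) \<in> L2"
proof (rule L2_bounded)
  show "(\<lambda>w. clamp_real M (f w)) \<in> borel_measurable leb01" using assms(1) by measurable
qed (rule clamp_real_bound[OF assms(2)])

lemma Np_clamp_tendsto:
  assumes p: "2 \<le> p" and f: "f \<in> Lp p leb01"
  shows "(\<lambda>n. Np p (cls (\<lambda>w. clamp_real (real n) (f w)) - cls f)) \<longlonglongrightarrow> 0"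
proof (rule Np_dominated[where G = f])
  have L: "f \<in> L2" by (rule Lp_subset_L2[OF p f])
  show "(\<integral>\<^sup>+ w. ennreal (\<bar>f w\<bar> powr p) \<partial>leb01) < \<infinity>" using f unfolding Lp_iff_Np[OF L] Np_cls[OF L] .
  show "AE w in leb01. (\<lambda>n. clamp_real (real n) (f w)) \<longlonglongrightarrow> f w"
  proof (rule AE_I2)
    fix w
    obtain k where "\<bar>f w\<bar> \<le> real k" using real_arch_simple by blast
    then have "clamp_real (real n) (f w) = f w" if "k \<le> n" for n using that by (intro clamp_real_id) simp
    then have "\<forall>\<^sub>F n in sequentially. clamp_real (real n) (f w) = f w" by (auto simp: eventually_sequentially)
    then show "(\<lambda>n. clamp_real (real n) (f w)) \<longlonglongrightarrow> f w" by (rule tendsto_eventually)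
  qed
qed (use p Lp_measurable[OF f] Lp_subset_L2[OF p f] in \<open>auto intro!: clamp_L2 clamp_real_diff\<close>)

text \<open>The extension of \<open>f\<close> by zero is Lebesgue measurable, hence
  \<open>measurable_on\<close> the line, which by definition is a limit of continuous functions off
  a negligible set.\<close>

lemma AE_limit_of_continuous:
  fixes f :: "real \<Rightarrow> real"
  assumes f: "f \<in> borel_measurable leb01"
  obtains g where "\<And>n. continuous_on UNIV (g n)" "AE w in leb01. (\<lambda>n. g n w) \<longlonglongrightarrow> f w"
proof -
  let ?f = "\<lambda>w. indicator {0<..<1} w *\<^sub>R f w"
  have "?f \<in> borel_measurable lborel"
    using f unfolding leb01_def by (subst (asm) borel_measurable_restrict_space_iff) auto
  then have "?f \<in> borel_measurable lebesgue" by (rule measurable_completion)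
  then have "?f measurable_on UNIV" by (rule lebesgue_measurable_imp_measurable_on) simp
  then obtain N g where N: "negligible N" and g: "\<And>n. continuous_on UNIV (g n)"
    and lim: "\<And>x. x \<notin> N \<Longrightarrow> (\<lambda>n. g n x) \<longlonglongrightarrow> ?f x"
    by (auto simp: measurable_on_def)
  have "AE x in lebesgue. x \<notin> N" using N by (intro AE_not_in) (simp add: negligible_iff_null_sets)
  then have "AE x in lborel. x \<notin> N" by (simp add: AE_completion_iff)
  then have "AE w in leb01. w \<notin> N" unfolding leb01_def by (subst AE_restrict_space_iff) (auto elim: eventually_mono)
  moreover have "AE w in leb01. w \<in> {0<..<1}" by (rule AE_I2) simp
  ultimately have "AE w in leb01. (\<lambda>n. g n w) \<longlonglongrightarrow> f w"
  proof eventually_elim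
    fix w assume "w \<notin> N" "w \<in> {0<..<1::real}"
    then show "(\<lambda>n. g n w) \<longlonglongrightarrow> f w" using lim[of w] by simp
  qed
  then show ?thesis using that g by blast
qed

lemma integral_const_finite: "(\<integral>\<^sup>+ w. ennreal (\<bar>c::real\<bar> powr p) \<partial>leb01) < \<infinity>"
  by (simp add: leb01.emeasure_space_1[simplified])

text \<open>The truncation level M is fixed first; the truncated function is then approximated by
  truncated continuous functions, for which dominated convergence applies. The factor 2 powr p comes
  from \<open>Np_add_le\<close>.\<close>

lemma Lp_approx_bounded_continuous:
  assumes p: "2 \<le> p" and f: "f \<in> Lp p leb01" and e: "0 < (e :: ennreal)"
  obtains g M where "continuous_on UNIV g" "\<And>w. \<bar>g w\<bar> \<le> (M::real)" "g \<in> L2" "Np p (cls g - cls f) < e"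
proof -
  have fm: "f \<in> borel_measurable leb01" by (rule Lp_measurable[OF f])
  obtain g where g: "\<And>n. continuous_on UNIV (g n)" "AE w in leb01. (\<lambda>n. g n w) \<longlonglongrightarrow> f w"
    using AE_limit_of_continuous[OF fm] by blast
  have gm: "g n \<in> borel_measurable leb01" for n by (rule borel_measurable_leb01[OF bounded_continuous_measurable[OF g(1)]])
  let ?h = "\<lambda>M n w. clamp_real (real M) (g n w)" and ?F = "\<lambda>M w. clamp_real (real M) (f w)"
  have L: "?h M n \<in> L2" "?F M \<in> L2" for M n using fm gm by (auto intro: clamp_L2)
  have inner: "(\<lambda>n. Np p (cls (?h M n) - cls (?F M))) \<longlonglongrightarrow> 0" for M
  proof (rule Np_dominated[OF _ L, where G = "\<lambda>_. 2 * real M"])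
    show "AE w in leb01. \<bar>?h M n w - ?F M w\<bar> \<le> \<bar>2 * real M\<bar>" for n
    proof (rule AE_I2)
      fix w
      show "\<bar>?h M n w - ?F M w\<bar> \<le> \<bar>2 * real M\<bar>"
        using clamp_real_bound[of "real M" "g n w"] clamp_real_bound[of "real M" "f w"] by linarith
    qed
    show "AE w in leb01. (\<lambda>n. ?h M n w) \<longlonglongrightarrow> ?F M w" using g(2)
    proof eventually_elim
      fix w assume l: "(\<lambda>n. g n w) \<longlonglongrightarrow> f w"
      then show "(\<lambda>n. ?h M n w) \<longlonglongrightarrow> ?F M w" unfolding clamp_real_def by (intro tendsto_intros)
    qed
    show "(\<integral>\<^sup>+ w. ennreal (\<bar>2 * real M\<bar> powr p) \<partial>leb01) < \<infinity>" by (rule integral_const_finite)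
  qed (use p in auto)
  let ?c = "ennreal (2 powr p)"
  have "(\<lambda>M. ?c * (Np p (cls (?F M) - cls f) + 0)) \<longlonglongrightarrow> ?c * (0 + 0)"
    by (intro ennreal_tendsto_cmult tendsto_add tendsto_const Np_clamp_tendsto p f) auto
  then have "\<forall>\<^sub>F M in sequentially. ?c * (Np p (cls (?F M) - cls f) + 0) < e"
    using e by (intro order_tendstoD(2)[where y = "?c * (0 + 0)"]) auto
  then obtain M where M: "?c * (Np p (cls (?F M) - cls f) + 0) < e" by (auto simp: eventually_sequentially)
  have "(\<lambda>n. ?c * (Np p (cls (?F M) - cls f) + Np p (cls (?h M n) - cls (?F M)))) \<longlonglongrightarrow> ?c * (Np p (cls (?F M) - cls f) + 0)"
    by (intro ennreal_tendsto_cmult tendsto_add tendsto_const inner) auto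
  then have "\<forall>\<^sub>F n in sequentially. ?c * (Np p (cls (?F M) - cls f) + Np p (cls (?h M n) - cls (?F M))) < e"
    using M by (rule order_tendstoD(2))
  then obtain n where n: "?c * (Np p (cls (?F M) - cls f) + Np p (cls (?h M n) - cls (?F M))) < e" by (auto simp: eventually_sequentially)
  have "Np p (cls (?h M n) - cls f) \<le> ?c * (Np p (cls (?F M) - cls f) + Np p (cls (?h M n) - cls (?F M)))"
    using Np_add_le[of p "cls (?F M) - cls f" "cls (?h M n) - cls (?F M)"] p by simp
  then have "Np p (cls (?h M n) - cls f) < e" using n by (rule le_less_trans)
  then show ?thesis
    using that[of "?h M n" "real M"] clamp_real_continuous[OF g(1)] clamp_real_bound[of "real M"] L(1) by simp
qed

lemma masses_uniform: "masses (Suc n) (\<lambda>_. 1 / real (Suc n))"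
  by unfold_locales auto

abbreviation ustep :: "nat \<Rightarrow> (nat \<Rightarrow> real) \<Rightarrow> real \<Rightarrow> real" where
  "ustep n \<equiv> masses.step (Suc n) (\<lambda>_. 1 / real (Suc n))"

definition midpoint_of :: "nat \<Rightarrow> nat \<Rightarrow> real" where "midpoint_of n i = (real i + 1/2) / real (Suc n)"

lemma midpoint_in: "i < Suc n \<Longrightarrow> midpoint_of n i \<in> {0<..<1}"
  by (auto simp: midpoint_of_def field_simps)

lemma midpoint_mono: "i \<le> j \<Longrightarrow> midpoint_of n i \<le> midpoint_of n j"
  by (auto simp: midpoint_of_def divide_right_mono)

lemma ustep_midpoint_ex:
  assumes "w \<in> {0<..<1}"
  obtains i where "i < Suc n" "\<And>a. ustep n a w = a i" "\<bar>midpoint_of n i - w\<bar> \<le> 1 / real (Suc n)"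
proof -
  interpret masses "Suc n" "\<lambda>_. 1 / real (Suc n)" by (rule masses_uniform)
  obtain i where i: "i < Suc n" "w \<in> cell i" using cell_exists[of w] assms by auto
  have "\<bar>midpoint_of n i - w\<bar> \<le> 1 / real (Suc n)"
  proof -
    define a d where "a = real i / real (Suc n)" and "d = 1 / real (Suc n)"
    have c: "cell i = {a..<a + d}" unfolding cell_def a_def d_def by (simp add: add_divide_distrib add.commute)
    moreover have "midpoint_of n i = a + d / 2" by (simp add: midpoint_of_def a_def d_def add_divide_distrib)
    moreover have "0 < d" by (simp add: d_def)
    moreover have "a \<le> w" "w < a + d" using i(2) unfolding c by auto
    ultimately show ?thesis unfolding d_def[symmetric] by (simp add: abs_le_iff)
  qed
  then show ?thesis using that[OF i(1)] step_cell[OF i] by blast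
qed

lemma ustep_L2: "ustep n a \<in> L2"
  by (rule masses.step_L2[OF masses_uniform])

text \<open>The midpoint of the cell of w is within 1/(n + 1) of w, so the sampled values converge
  wherever \<open>f\<close> is continuous.\<close>

lemma ustep_midpoint_tendsto:
  assumes p: "2 \<le> p" and f: "f \<in> L2" "\<And>w. \<bar>f w\<bar> \<le> B" and cont: "AE w in leb01. isCont f w"
  shows "(\<lambda>n. Np p (cls (ustep n (\<lambda>i. f (midpoint_of n i))) - cls f)) \<longlonglongrightarrow> 0"
proof (rule Np_dominated[OF _ ustep_L2 f(1), where G = "\<lambda>_. 2 * B"])
  show "AE w in leb01. \<bar>ustep n (\<lambda>i. f (midpoint_of n i)) w - f w\<bar> \<le> \<bar>2 * B\<bar>" for n
  proof (rule AE_I2)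
    fix w assume "w \<in> space leb01"
    then obtain i where "ustep n (\<lambda>i. f (midpoint_of n i)) w = f (midpoint_of n i)"
      using ustep_midpoint_ex[of w n] by auto
    then show "\<bar>ustep n (\<lambda>i. f (midpoint_of n i)) w - f w\<bar> \<le> \<bar>2 * B\<bar>"
      using f(2)[of w] f(2)[of "midpoint_of n i"] by linarith
  qed
  have "AE w in leb01. w \<in> {0<..<1}" by (rule AE_I2) simp
  with cont show "AE w in leb01. (\<lambda>n. ustep n (\<lambda>i. f (midpoint_of n i)) w) \<longlonglongrightarrow> f w"
  proof eventually_elim
    fix w assume c: "isCont f w" and w: "w \<in> {0<..<1::real}"
    have "\<forall>n. \<exists>y. ustep n (\<lambda>i. f (midpoint_of n i)) w = f y \<and> \<bar>y - w\<bar> \<le> 1 / real (Suc n)"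
      using ustep_midpoint_ex[OF w] by metis
    from choice[OF this] obtain y where y: "\<And>n. ustep n (\<lambda>i. f (midpoint_of n i)) w = f (y n)"
      "\<And>n. \<bar>y n - w\<bar> \<le> 1 / real (Suc n)" by blast
    have "(\<lambda>n. y n - w) \<longlonglongrightarrow> 0"
      by (rule Lim_null_comparison[OF always_eventually LIMSEQ_Suc[OF lim_1_over_n]]) (use y(2) in simp)
    then have "y \<longlonglongrightarrow> w" by (simp add: LIM_zero_iff)
    then have "(\<lambda>n. f (y n)) \<longlonglongrightarrow> f w" by (rule isCont_tendsto_compose[OF c])
    then show "(\<lambda>n. ustep n (\<lambda>i. f (midpoint_of n i)) w) \<longlonglongrightarrow> f w" unfolding y(1) .
  qed
  show "(\<integral>\<^sup>+ w. ennreal (\<bar>2 * B\<bar> powr p) \<partial>leb01) < \<infinity>" by (rule integral_const_finite)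
qed (use p in auto)

lemma mono_AE_isCont:
  fixes f :: "real \<Rightarrow> real"
  assumes "mono_on {0<..<1} f" shows "AE w in leb01. isCont f w"
proof -
  have "AE w in leb01. w \<notin> {a \<in> {0<..<1}. \<not> continuous (at a within {0<..<1}) f}"
    by (intro AE_leb01_countable mono_on_ctble_discont assms)
  moreover have "AE w in leb01. w \<in> {0<..<1}" by (rule AE_I2) simp
  ultimately show ?thesis
  proof eventually_elim
    fix w assume "w \<notin> {a \<in> {0<..<1}. \<not> continuous (at a within {0<..<1}) f}" "w \<in> {0<..<1}"
    then have "continuous (at w within {0<..<1}) f" by blast
    then show "isCont f w" using \<open>w \<in> {0<..<1}\<close> at_within_open[of w "{0<..<1}"] by simp
  qed
qed

text \<open>The samples \<open>s n\<close> may differ from those of \<open>h\<close> by 1/(n + 1),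
  which leaves room to make positions strictly increasing. The 0 in \<open>close\<close> stands for
  the limit of the sampling error.\<close>

lemma ustep_Np_approx:
  assumes p: "2 \<le> p" and f: "f \<in> L2" and h: "h \<in> L2" "\<And>w. \<bar>h w\<bar> \<le> B" "AE w in leb01. isCont h w"
    and close: "ennreal (2 powr p) * (Np p (cls h - cls f) + 0) < e"
    and s: "\<And>n i. i < Suc n \<Longrightarrow> \<bar>s n i - h (midpoint_of n i)\<bar> \<le> 1 / real (Suc n)"
  shows "\<forall>\<^sub>F n in sequentially. Np p (cls (ustep n (s n)) - cls f) < e"
proof -
  let ?c = "ennreal (2 powr p)" and ?h = "\<lambda>n. ustep n (\<lambda>i. h (midpoint_of n i))"
  have "(\<lambda>n. Np p ((cls (ustep n (s n)) - cls (?h n)) + (cls (?h n) - cls h))) \<longlonglongrightarrow> 0"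
  proof (rule Np_add_tendsto)
    show "0 \<le> p" using p by simp
    show "(\<lambda>n. Np p (cls (?h n) - cls h)) \<longlonglongrightarrow> 0" by (rule ustep_midpoint_tendsto[OF p h])
    have d: "(\<lambda>w. ustep n (s n) w - ?h n w) \<in> L2" for n by (intro L2_diff ustep_L2)
    have "(\<lambda>n. Np p (cls (\<lambda>w. ustep n (s n) w - ?h n w) - cls (\<lambda>_. 0))) \<longlonglongrightarrow> 0"
    proof (rule Np_dominated[OF _ d L2_const, where G = "\<lambda>_. 1"])
      have b: "\<bar>ustep n (s n) w - ?h n w\<bar> \<le> 1 / real (Suc n)" if w: "w \<in> {0<..<1}" for n w
      proof -
        obtain i where i: "i < Suc n" "\<And>a. ustep n a w = a i" using ustep_midpoint_ex[OF w, of n] by blast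
        show ?thesis using s[OF i(1)] unfolding i(2) .
      qed
      show "AE w in leb01. \<bar>ustep n (s n) w - ?h n w - 0\<bar> \<le> \<bar>1\<bar>" for n
      proof (rule AE_I2)
        fix w assume "w \<in> space leb01"
        then have "\<bar>ustep n (s n) w - ?h n w\<bar> \<le> 1 / real (Suc n)" by (intro b) simp
        also have "\<dots> \<le> 1" by simp
        finally show "\<bar>ustep n (s n) w - ?h n w - 0\<bar> \<le> \<bar>1\<bar>" by simp
      qed
      show "AE w in leb01. (\<lambda>n. ustep n (s n) w - ?h n w) \<longlonglongrightarrow> 0"
      proof (rule AE_I2)
        fix w assume "w \<in> space leb01"
        then show "(\<lambda>n. ustep n (s n) w - ?h n w) \<longlonglongrightarrow> 0"
          by (intro Lim_null_comparison[OF always_eventually LIMSEQ_Suc[OF lim_1_over_n]]) (use b in simp)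
      qed
      show "(\<integral>\<^sup>+ w. ennreal (\<bar>1\<bar> powr p) \<partial>leb01) < \<infinity>" by (rule integral_const_finite)
    qed (use p in auto)
    then show "(\<lambda>n. Np p (cls (ustep n (s n)) - cls (?h n))) \<longlonglongrightarrow> 0"
      unfolding cls_diff[OF ustep_L2 ustep_L2] cls_zero[symmetric] diff_zero .
  qed
  then have lim: "(\<lambda>n. Np p (cls (ustep n (s n)) - cls h)) \<longlonglongrightarrow> 0" by simp
  have "(\<lambda>n. ?c * (Np p (cls h - cls f) + Np p (cls (ustep n (s n)) - cls h))) \<longlonglongrightarrow> ?c * (Np p (cls h - cls f) + 0)"
    by (intro ennreal_tendsto_cmult tendsto_add tendsto_const lim) auto
  then have "\<forall>\<^sub>F n in sequentially. ?c * (Np p (cls h - cls f) + Np p (cls (ustep n (s n)) - cls h)) < e"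
    using close by (rule order_tendstoD(2))
  then show ?thesis
  proof eventually_elim
    fix n assume n: "?c * (Np p (cls h - cls f) + Np p (cls (ustep n (s n)) - cls h)) < e"
    have "Np p (cls (ustep n (s n)) - cls f) \<le> ?c * (Np p (cls h - cls f) + Np p (cls (ustep n (s n)) - cls h))"
      using Np_add_le[of p "cls h - cls f" "cls (ustep n (s n)) - cls h"] p by simp
    then show "Np p (cls (ustep n (s n)) - cls f) < e" using n by (rule le_less_trans)
  qed
qed

lemma discrete_Np_approx:
  assumes p: "2 \<le> p" and X: "X \<in> Lp p leb01" "mono_on {0<..<1} X" and V: "V \<in> Lp p leb01" and e: "0 < (e :: real)"
  obtains n x v where "discrete_data (Suc n) (\<lambda>_. 1 / real (Suc n)) x"
    "Np p (cls (ustep n x) - cls X) < ennreal e" "Np p (cls (ustep n v) - cls V) < ennreal e"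
proof -
  let ?c = "ennreal (2 powr p)"
  note XL = Lp_subset_L2[OF p X(1)] and VL = Lp_subset_L2[OF p V]
  have "(\<lambda>M. ?c * (Np p (cls (\<lambda>w. clamp_real (real M) (X w)) - cls X) + 0)) \<longlonglongrightarrow> ?c * (0 + 0)"
    by (intro ennreal_tendsto_cmult tendsto_add tendsto_const Np_clamp_tendsto p X) auto
  then have "\<forall>\<^sub>F M in sequentially. ?c * (Np p (cls (\<lambda>w. clamp_real (real M) (X w)) - cls X) + 0) < ennreal e"
    using e by (intro order_tendstoD(2)[where y = "?c * (0 + 0)"]) auto
  then obtain M where M: "?c * (Np p (cls (\<lambda>w. clamp_real (real M) (X w)) - cls X) + 0) < ennreal e"
    by (auto simp: eventually_sequentially)
  define h where "h w = clamp_real (real M) (X w)" for w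
  have hm: "mono_on {0<..<1} h" unfolding h_def by (intro mono_onI clamp_real_mono mono_onD[OF X(2)])
  have h: "h \<in> L2" "\<And>w. \<bar>h w\<bar> \<le> real M" "AE w in leb01. isCont h w"
    using clamp_L2[OF L2_measurable[OF XL], of "real M"] clamp_real_bound[of "real M"] mono_AE_isCont[OF hm]
    by (simp_all add: h_def[abs_def])
  \<comment> \<open>the second term makes the positions strictly increasing\<close>
  define x where "x n i = h (midpoint_of n i) + real i / (real (Suc n))\<^sup>2" for n i
  have xs: "\<bar>x n i - h (midpoint_of n i)\<bar> \<le> 1 / real (Suc n)" if "i < Suc n" for n i
  proof -
    have "real i / (real (Suc n))\<^sup>2 \<le> real (Suc n) / (real (Suc n))\<^sup>2" using that by (intro divide_right_mono) auto
    then show ?thesis by (simp add: x_def power2_eq_square)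
  qed
  have ex: "\<forall>\<^sub>F n in sequentially. Np p (cls (ustep n (x n)) - cls X) < ennreal e"
    by (rule ustep_Np_approx[OF p XL h _ xs]) (use M in \<open>simp add: h_def[abs_def]\<close>)
  \<comment> \<open>Chosen so that the factor 2 powr p of \<open>Np_add_le\<close> turns it into e /
    2.\<close>
  define d where "d = ennreal (e / (2 * 2 powr p))"
  have d: "0 < d" unfolding d_def using e by simp
  obtain g B where g: "continuous_on UNIV g" "\<And>w. \<bar>g w\<bar> \<le> (B::real)" "g \<in> L2" "Np p (cls g - cls V) < d"
    using Lp_approx_bounded_continuous[OF p V d] by metis
  have "?c * (Np p (cls g - cls V) + 0) \<le> ?c * d" using g(4) by (intro mult_left_mono) auto
  also have "?c * d = ennreal (e / 2)" unfolding d_def using e by (subst ennreal_mult[symmetric]) (auto simp: field_simps)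
  also have "\<dots> < ennreal e" using e by (simp add: ennreal_less_iff)
  finally have cg: "?c * (Np p (cls g - cls V) + 0) < ennreal e" .
  have "AE w in leb01. isCont g w" using g(1) by (simp add: continuous_on_eq_continuous_at)
  then have "\<forall>\<^sub>F n in sequentially. Np p (cls (ustep n (\<lambda>i. g (midpoint_of n i))) - cls V) < ennreal e"
    by (rule ustep_Np_approx[OF p VL g(3,2) _ cg]) simp
  from eventually_conj[OF ex this] obtain n
    where n: "Np p (cls (ustep n (x n)) - cls X) < ennreal e" "Np p (cls (ustep n (\<lambda>i. g (midpoint_of n i))) - cls V) < ennreal e"
    by (auto simp: eventually_sequentially)
  have "strict_mono_on {..<Suc n} (x n)"
  proof (rule strict_mono_onI)
    fix i j assume ij: "i \<in> {..<Suc n}" "j \<in> {..<Suc n}" "i < j"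
    have "h (midpoint_of n i) \<le> h (midpoint_of n j)"
      using ij by (intro mono_onD[OF hm] midpoint_in midpoint_mono) auto
    moreover have "real i / (real (Suc n))\<^sup>2 < real j / (real (Suc n))\<^sup>2" using ij by (intro divide_strict_right_mono) auto
    ultimately show "x n i < x n j" by (simp add: x_def)
  qed
  then have "discrete_data (Suc n) (\<lambda>_. 1 / real (Suc n)) (x n)"
    unfolding discrete_data_def by simp
  then show ?thesis using that n by blast
qed

lemma discrete_data_masses: "discrete_data N m x \<Longrightarrow> masses N m"
  by (simp add: discrete_data_def masses_def)

text \<open>One \<open>e\<close> bounds the transport cost, through the coupling by
  \<open>X'\<close> and \<open>lagrX \<mu>\<close>, the other the velocities.\<close>

lemma D_dist_eulerian_le:
  assumes p: "2 \<le> p" and Z: "(X', V') \<in> X_space p" and \<mu>: "\<mu> \<in> V_space p"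
    and le: "Np p (cls X' - cls (lagrX \<mu>)) < ennreal e" "Np p (cls V' - cls (lagrV \<mu>)) < ennreal e"
  shows "D_dist p (eulerian X' V') \<mu> \<le> (2 * e) powr (1 / p)"
proof -
  let ?X = "lagrX \<mu>" and ?V = "lagrV \<mu>"
  have Z': "(?X, ?V) \<in> X_space p" by (rule lagr_X_space[OF p \<mu>])
  have L: "X' \<in> L2" "V' \<in> L2" "?X \<in> L2" "?V \<in> L2" using Z Z' by (auto simp: X_space_iff[OF p] lag_data_def)
  note [measurable] = L[THEN L2_measurable]
  have LV: "lagrV (eulerian X' V') \<in> borel_measurable leb01"
    using lagr_X_space[OF p eulerian_V_space[OF p Z]] by (auto simp: X_space_iff[OF p] lag_data_def intro: L2_measurable)
  note [measurable] = LV
  have int: "(\<integral>w. \<bar>f w - g w\<bar> powr p \<partial>leb01) \<le> e" if "f \<in> L2" "g \<in> L2" "Np p (cls f - cls g) < ennreal e" for f g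
  proof -
    have [measurable]: "f \<in> borel_measurable leb01" "g \<in> borel_measurable leb01" using that by (auto intro: L2_measurable)
    have "(\<integral>w. \<bar>f w - g w\<bar> powr p \<partial>leb01) = enn2real (\<integral>\<^sup>+ w. ennreal (\<bar>f w - g w\<bar> powr p) \<partial>leb01)"
      by (intro integral_eq_nn_integral) auto
    also have "\<dots> = enn2real (Np p (cls f - cls g))" by (simp add: cls_diff that Np_cls L2_diff)
    also have "\<dots> \<le> enn2real (ennreal e)" using that(3) by (intro enn2real_mono) auto
    also have "\<dots> = e" using that(3) by (cases "0 \<le> e") (auto simp: ennreal_neg)
    finally show ?thesis .
  qed
  have "W_dist p (fst (eulerian X' V')) (fst \<mu>) powr p \<le> (\<integral>w. \<bar>X' w - ?X w\<bar> powr p \<partial>leb01)"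
  proof -
    have "fst \<mu> = distr leb01 borel ?X" using arg_cong[OF eulerian_lagr[OF p \<mu>], of fst] by (simp add: eulerian_def)
    then show ?thesis using p W_dist_powr_le[of p X' ?X] by (simp add: eulerian_def)
  qed
  also have "\<dots> \<le> e" by (rule int[OF L(1,3) le(1)])
  finally have W: "W_dist p (fst (eulerian X' V')) (fst \<mu>) powr p \<le> e" .
  have "(\<integral>w. \<bar>lagrV (eulerian X' V') w - ?V w\<bar> powr p \<partial>leb01) = (\<integral>w. \<bar>V' w - ?V w\<bar> powr p \<partial>leb01)"
  proof (rule integral_cong_AE)
    show "AE w in leb01. \<bar>lagrV (eulerian X' V') w - ?V w\<bar> powr p = \<bar>V' w - ?V w\<bar> powr p"
      using lagrV_eulerian[OF p Z] unfolding ae_eq_def by eventually_elim simp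
  qed measurable
  also have "\<dots> \<le> e" by (rule int[OF L(2,4) le(2)])
  finally have I: "(\<integral>w. \<bar>lagrV (eulerian X' V') w - ?V w\<bar> powr p \<partial>leb01) \<le> e" .
  have "D_dist p (eulerian X' V') \<mu> = (W_dist p (fst (eulerian X' V')) (fst \<mu>) powr p +
      (\<integral>w. \<bar>lagrV (eulerian X' V') w - ?V w\<bar> powr p \<partial>leb01)) powr (1 / p)"
    by (simp add: D_dist_def lagrV_def)
  also have "\<dots> \<le> (2 * e) powr (1 / p)"
    using W I p by (intro powr_mono2 add_nonneg_nonneg) auto
  finally show ?thesis .
qed

lemma discrete_dense:
  assumes p: "2 \<le> p" and \<mu>: "\<mu> \<in> V_space p"
  obtains \<mu>n where "\<And>n. \<exists>N m x v. discrete_data N m x \<and> \<mu>n n = discrete_pair N m x v"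
    "(\<lambda>n. D_dist p (\<mu>n n) \<mu>) \<longlonglongrightarrow> 0"
proof -
  have Z: "lagrX \<mu> \<in> Lp p leb01" "lagrV \<mu> \<in> Lp p leb01" using lagr_X_space[OF p \<mu>] by (auto simp: X_space_def)
  have mono: "mono_on {0<..<1} (lagrX \<mu>)"
    using \<mu> unfolding lagrX_def by (intro quantile_mono) (auto simp: V_space_iff[OF p] P_space_def)
  have "\<forall>n. \<exists>\<nu>. (\<exists>N m x v. discrete_data N m x \<and> \<nu> = discrete_pair N m x v) \<and> D_dist p \<nu> \<mu> \<le> (2 * (1 / real (Suc n))) powr (1 / p)"
  proof
    fix n
    have e: "0 < 1 / real (Suc n)" by simp
    obtain k x v where d: "discrete_data (Suc k) (\<lambda>_. 1 / real (Suc k)) x"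
      and N: "Np p (cls (ustep k x) - cls (lagrX \<mu>)) < ennreal (1 / real (Suc n))" "Np p (cls (ustep k v) - cls (lagrV \<mu>)) < ennreal (1 / real (Suc n))"
      using discrete_Np_approx[OF p Z(1) mono Z(2) e] by metis
    interpret masses "Suc k" "\<lambda>_. 1 / real (Suc k)" by (rule masses_uniform)
    have x: "strict_mono_on {..<Suc k} x" using d by (simp add: discrete_data_def)
    have "(step x, step v) \<in> X_space p"
    proof (rule step_X_space[OF p])
      show "x i \<le> x j" if "i \<le> j" "j < Suc k" for i j
        using strict_mono_onD[OF x, of i j] that by (cases "i = j") auto
      show "v i = v j" if "i < Suc k" "j < Suc k" "x i = x j" for i j
        using strict_mono_onD[OF x, of i j] strict_mono_onD[OF x, of j i] that by (cases i j rule: linorder_cases) auto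
    qed
    from D_dist_eulerian_le[OF p this \<mu> N]
    show "\<exists>\<nu>. (\<exists>N m x v. discrete_data N m x \<and> \<nu> = discrete_pair N m x v) \<and> D_dist p \<nu> \<mu> \<le> (2 * (1 / real (Suc n))) powr (1 / p)"
      unfolding eulerian_step using d by blast
  qed
  from choice[OF this] obtain \<mu>n where \<mu>n: "\<And>n. \<exists>N m x v. discrete_data N m x \<and> \<mu>n n = discrete_pair N m x v"
    "\<And>n. D_dist p (\<mu>n n) \<mu> \<le> (2 * (1 / real (Suc n))) powr (1 / p)" by blast
  have "(\<lambda>n. 2 * (1 / real (Suc n))) \<longlonglongrightarrow> 2 * 0"
    by (intro tendsto_mult tendsto_const LIMSEQ_Suc[OF lim_1_over_n])
  then have l: "(\<lambda>n. (2 * (1 / real (Suc n))) powr (1 / p)) \<longlonglongrightarrow> 0"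
    using p by (intro tendsto_zero_powrI[where b = "1 / p"]) auto
  have "(\<lambda>n. D_dist p (\<mu>n n) \<mu>) \<longlonglongrightarrow> 0"
  proof (rule tendsto_sandwich[OF _ _ tendsto_const l])
    show "\<forall>\<^sub>F n in sequentially. 0 \<le> D_dist p (\<mu>n n) \<mu>" by (simp add: D_dist_def)
    show "\<forall>\<^sub>F n in sequentially. D_dist p (\<mu>n n) \<mu> \<le> (2 * (1 / real (Suc n))) powr (1 / p)"
      by (intro always_eventually allI \<mu>n(2))
  qed
  then show ?thesis using that \<mu>n(1) by blast
qed

section \<open>The semigroup on measures\<close>

text \<open>Continuous ramps approximate half-lines, and these determine the density by
  \<open>integral_level_sets_zero\<close>, applied with the identity as level function.\<close>

lemma AE_zero_if_continuous_tests_zero: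
  fixes d :: "real \<Rightarrow> real"
  assumes s: "sets \<rho> = sets borel" and d: "integrable \<rho> d"
    and test: "\<And>\<phi>. continuous_on UNIV \<phi> \<Longrightarrow> bounded (range \<phi>) \<Longrightarrow> (\<integral>x. \<phi> x * d x \<partial>\<rho>) = 0"
  shows "AE x in \<rho>. d x = 0"
proof -
  have mb: "f \<in> borel_measurable \<rho> \<longleftrightarrow> f \<in> borel_measurable borel" for f :: "real \<Rightarrow> real"
    using measurable_cong_sets[OF s refl] by blast
  note [measurable] = borel_measurable_integrable[OF d]
  have [measurable]: "(\<lambda>x. x) \<in> borel_measurable \<rho>" unfolding mb by simp
  define \<theta> where "\<theta> c n x = max 0 (min 1 (real n * (x - c)))" for c x :: real and n :: nat
  have \<theta>c: "continuous_on UNIV (\<theta> c n)" for c n unfolding \<theta>_def by (intro continuous_intros)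
  have \<theta>b: "\<bar>\<theta> c n x\<bar> \<le> 1" for c n x by (auto simp: \<theta>_def)
  have [measurable]: "\<theta> c n \<in> borel_measurable \<rho>" for c n unfolding mb by (rule bounded_continuous_measurable[OF \<theta>c])
  have level: "(\<integral>x. d x * indicator {c<..} x \<partial>\<rho>) = 0" for c
  proof (rule LIMSEQ_unique)
    show "(\<lambda>n. \<integral>x. \<theta> c n x * d x \<partial>\<rho>) \<longlonglongrightarrow> (\<integral>x. d x * indicator {c<..} x \<partial>\<rho>)"
    proof (rule integral_dominated_convergence[where w = "\<lambda>x. \<bar>d x\<bar>"])
      have "{c<..} \<in> sets \<rho>" using s by simp
      then show "(\<lambda>x. d x * indicator {c<..} x) \<in> borel_measurable \<rho>" by measurable
      show "AE x in \<rho>. norm (\<theta> c n x * d x) \<le> \<bar>d x\<bar>" for n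
        using \<theta>b by (intro AE_I2) (simp add: abs_mult mult_left_le_one_le)
      show "AE x in \<rho>. (\<lambda>n. \<theta> c n x * d x) \<longlonglongrightarrow> d x * indicator {c<..} x"
      proof (rule AE_I2)
        fix x
        have "(\<lambda>n. \<theta> c n x) \<longlonglongrightarrow> indicator {c<..} x"
        proof (cases "c < x")
          case True
          obtain k where k: "1 / (x - c) \<le> real k" using real_arch_simple by blast
          have "\<theta> c n x = 1" if "k \<le> n" for n
          proof -
            have "1 / (x - c) \<le> real n" using k that by linarith
            then have "1 \<le> real n * (x - c)" using True by (simp add: divide_le_eq)
            then show ?thesis by (simp add: \<theta>_def)
          qed
          then have "\<forall>\<^sub>F n in sequentially. \<theta> c n x = indicator {c<..} x" using True by (auto simp: eventually_sequentially)
          then show ?thesis by (rule tendsto_eventually)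
        next
          case False
          then have "real n * (x - c) \<le> 0" for n by (intro mult_nonneg_nonpos) auto
          then have "\<theta> c n x = 0" for n unfolding \<theta>_def by (meson max.absorb1 min.coboundedI2)
          then show ?thesis using False by simp
        qed
        then have "(\<lambda>n. \<theta> c n x * d x) \<longlonglongrightarrow> indicator {c<..} x * d x" by (intro tendsto_intros)
        then show "(\<lambda>n. \<theta> c n x * d x) \<longlonglongrightarrow> d x * indicator {c<..} x" by (simp add: mult.commute)
      qed
    qed (use d in auto)
    have "bounded (range (\<theta> c n))" for n unfolding bounded_iff using \<theta>b[of c n] by auto
    then show "(\<lambda>n. \<integral>x. \<theta> c n x * d x \<partial>\<rho>) \<longlonglongrightarrow> 0" using test[OF \<theta>c] by simp
  qed
  have total: "(\<integral>x. d x \<partial>\<rho>) = 0" using test[of "\<lambda>_. 1"] by simp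
  show ?thesis
  proof (rule density_unique_real[OF d])
    fix A assume "A \<in> sets \<rho>"
    then have "A \<in> sets borel" using s by simp
    from integral_level_sets_zero[OF d _ total level this]
    show "(LINT x:A|\<rho>. d x) = (LINT x:A|\<rho>. 0)" by (simp add: set_lebesgue_integral_def mult.commute)
  qed simp
qed

text \<open>The quantile functions of both limits are the almost everywhere limit of the same
  sequence, so no triangle inequality for \<open>W_dist\<close> enters.\<close>

lemma W_dist_limit_unique:
  assumes p: "1 \<le> p" and \<rho>: "\<And>n. \<rho>n n \<in> P_space p" "\<rho> \<in> P_space p" "\<rho>' \<in> P_space p"
    and lim: "(\<lambda>n. W_dist p (\<rho>n n) \<rho>) \<longlonglongrightarrow> 0" "(\<lambda>n. W_dist p (\<rho>n n) \<rho>') \<longlonglongrightarrow> 0"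
  shows "\<rho> = \<rho>'"
proof -
  have "AE w in leb01. quantile \<rho> w = quantile \<rho>' w"
    using W_dist_tendsto_quantile(1)[OF p \<rho>(1,2) lim(1)] W_dist_tendsto_quantile(1)[OF p \<rho>(1,3) lim(2)]
    by eventually_elim (rule LIMSEQ_unique)
  then have "distr leb01 borel (quantile \<rho>) = distr leb01 borel (quantile \<rho>')"
    using quantile_measurable \<rho> by (intro distr_cong_AE) auto
  then show ?thesis using distr_quantile \<rho> by (simp add: P_space_def)
qed

lemma V_space_eqI:
  assumes p: "2 \<le> p" and \<mu>: "\<mu> \<in> V_space p" "\<nu> \<in> V_space p" and fst: "fst \<mu> = fst \<nu>"
    and test: "\<And>\<phi>. continuous_on UNIV \<phi> \<Longrightarrow> bounded (range \<phi>) \<Longrightarrow>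
      (\<integral>x. \<phi> x * velocity \<mu> x \<partial>fst \<mu>) = (\<integral>x. \<phi> x * velocity \<nu> x \<partial>fst \<nu>)"
  shows "\<mu> = \<nu>"
proof -
  let ?\<rho> = "fst \<nu>"
  have s: "sets ?\<rho> = sets borel" using \<mu>(2) by (auto simp: V_space_iff[OF p] P_space_def)
  note v = velocity_props[OF p \<mu>(1), unfolded fst] and w = velocity_props[OF p \<mu>(2)]
  have "AE x in ?\<rho>. velocity \<mu> x - velocity \<nu> x = 0"
  proof (rule AE_zero_if_continuous_tests_zero[OF s])
    show "integrable ?\<rho> (\<lambda>x. velocity \<mu> x - velocity \<nu> x)" using v(2) w(2) by simp
    fix \<phi> :: "real \<Rightarrow> real" assume \<phi>: "continuous_on UNIV \<phi>" "bounded (range \<phi>)"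
    obtain B where B: "\<And>x. \<bar>\<phi> x\<bar> \<le> B" using \<phi>(2) by (auto simp: bounded_iff)
    have m: "\<phi> \<in> borel_measurable ?\<rho>"
      using bounded_continuous_measurable[OF \<phi>(1)] measurable_cong_sets[OF s refl] by blast
    have int: "integrable ?\<rho> (\<lambda>x. \<phi> x * u x)" if u: "integrable ?\<rho> u" for u
    proof (rule Bochner_Integration.integrable_bound)
      show "integrable ?\<rho> (\<lambda>x. B * u x)" using u by simp
      show "(\<lambda>x. \<phi> x * u x) \<in> borel_measurable ?\<rho>" using m borel_measurable_integrable[OF u] by measurable
      show "AE x in ?\<rho>. norm (\<phi> x * u x) \<le> norm (B * u x)"
      proof (rule AE_I2)
        fix x
        have "\<bar>\<phi> x\<bar> \<le> \<bar>B\<bar>" using B[of x] by linarith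
        then show "norm (\<phi> x * u x) \<le> norm (B * u x)" by (simp add: abs_mult mult_right_mono)
      qed
    qed
    show "(\<integral>x. \<phi> x * (velocity \<mu> x - velocity \<nu> x) \<partial>?\<rho>) = 0"
      using test[OF \<phi>] int[OF v(2)] int[OF w(2)] by (simp add: right_diff_distrib fst)
  qed
  then have "AE x in ?\<rho>. velocity \<mu> x = velocity \<nu> x" by simp
  then have "momentum ?\<rho> (velocity \<mu>) = momentum ?\<rho> (velocity \<nu>)" by (rule momentum_cong_AE[OF s v(1) w(1)])
  then show ?thesis using v(3) w(3) fst by (simp add: prod_eq_iff)
qed

lemma euler_flow_sticky_semigroup:
  assumes p: "2 \<le> p" shows "sticky_semigroup_on p euler_flow"
  unfolding sticky_semigroup_on_def
proof (intro conjI allI impI ballI)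
  show "euler_flow t \<mu> \<in> V_space p" if "0 \<le> t" "\<mu> \<in> V_space p" for t \<mu>
    by (rule euler_flow_V_space[OF p that(2,1)])
  show "euler_flow t (discrete_pair N m x v) = discrete_pair N m (\<lambda>i. xt i t) (\<lambda>i. vt i t)"
    if "discrete_data N m x \<and> sticky_evolution N m x v xt vt" "0 \<le> t" for N m x v xt vt t
    using that by (intro masses.euler_flow_discrete(2)[OF discrete_data_masses p]) (auto simp: discrete_data_def)
  show "(\<lambda>n. W_dist p (fst (euler_flow t (\<mu>n n))) (fst (euler_flow t \<mu>))) \<longlonglongrightarrow> 0"
    "weak_momentum_conv (\<lambda>n. euler_flow t (\<mu>n n)) (euler_flow t \<mu>)"
    if "0 \<le> t" "\<mu> \<in> V_space p" "(\<forall>n. \<mu>n n \<in> V_space p) \<and> (\<lambda>n. D_dist p (\<mu>n n) \<mu>) \<longlonglongrightarrow> 0" for t \<mu> \<mu>n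
    using euler_flow_continuous[OF p that(1) _ that(2), of \<mu>n] that(3) by auto
qed

text \<open>On discrete data \<open>S\<close> is prescribed and agrees with
  \<open>euler_flow\<close>. Along an approximating sequence the two continuity properties identify
  the limit: the measure through \<open>W_dist\<close>, then the momentum through its weak
  limit.\<close>

lemma sticky_semigroup_on_unique:
  assumes p: "2 \<le> p" and S: "sticky_semigroup_on p S" and \<mu>: "\<mu> \<in> V_space p" and t: "0 \<le> t"
  shows "S t \<mu> = euler_flow t \<mu>"
proof -
  obtain \<mu>n where d: "\<And>n. \<exists>N m x v. discrete_data N m x \<and> \<mu>n n = discrete_pair N m x v"
    and lim: "(\<lambda>n. D_dist p (\<mu>n n) \<mu>) \<longlonglongrightarrow> 0" using discrete_dense[OF p \<mu>] by blast
  have n: "\<mu>n n \<in> V_space p \<and> S t (\<mu>n n) = euler_flow t (\<mu>n n)" for n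
  proof -
    obtain N m x v where x: "discrete_data N m x" and \<mu>n: "\<mu>n n = discrete_pair N m x v" using d by blast
    interpret masses N m by (rule discrete_data_masses[OF x])
    have sm: "strict_mono_on {..<N} x" using x by (simp add: discrete_data_def)
    obtain xt vt where ev: "sticky_evolution N m x v xt vt" using evolution_exists[OF sm] .
    have "S t (\<mu>n n) = discrete_pair N m (\<lambda>i. xt i t) (\<lambda>i. vt i t)"
      using S x ev t unfolding sticky_semigroup_on_def \<mu>n by blast
    then show ?thesis using euler_flow_discrete[OF p sm ev t] by (simp add: \<mu>n)
  qed
  have SV: "S t \<mu> \<in> V_space p" using S t \<mu> unfolding sticky_semigroup_on_def by blast
  have EV: "euler_flow t \<mu> \<in> V_space p" by (rule euler_flow_V_space[OF p \<mu> t])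
  have lims: "(\<lambda>n. W_dist p (fst (T t (\<mu>n n))) (fst (T t \<mu>))) \<longlonglongrightarrow> 0"
    "weak_momentum_conv (\<lambda>n. T t (\<mu>n n)) (T t \<mu>)" if "sticky_semigroup_on p T" for T
    using that \<mu> t n lim unfolding sticky_semigroup_on_def by blast+
  note SL = lims[OF S] and EL = lims[OF euler_flow_sticky_semigroup[OF p]]
  have nS: "S t (\<mu>n n) = euler_flow t (\<mu>n n)" for n using n by blast
  have P: "fst (euler_flow t (\<mu>n n)) \<in> P_space p" for n
    using euler_flow_V_space[OF p _ t, of "\<mu>n n"] n by (auto simp: V_space_iff[OF p])
  have fst: "fst (S t \<mu>) = fst (euler_flow t \<mu>)"
  proof (rule W_dist_limit_unique[of p "\<lambda>n. fst (euler_flow t (\<mu>n n))"])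
    show "fst (S t \<mu>) \<in> P_space p" "fst (euler_flow t \<mu>) \<in> P_space p"
      using SV EV by (auto simp: V_space_iff[OF p])
  qed (use p P SL(1) EL(1) in \<open>auto simp: nS\<close>)
  show ?thesis
  proof (rule V_space_eqI[OF p SV EV fst])
    fix \<phi> :: "real \<Rightarrow> real" assume "continuous_on UNIV \<phi>" "bounded (range \<phi>)"
    then show "(\<integral>x. \<phi> x * velocity (S t \<mu>) x \<partial>fst (S t \<mu>)) = (\<integral>x. \<phi> x * velocity (euler_flow t \<mu>) x \<partial>fst (euler_flow t \<mu>))"
      using SL(2) EL(2) unfolding weak_momentum_conv_def nS by (blast intro: LIMSEQ_unique)
  qed
qed

text \<open>\<open>euler_flow\<close> shows that the choice by \<open>SOME\<close> is not empty, and
  uniqueness evaluates it.\<close>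

lemma sticky_semigroup_eq: "2 \<le> p \<Longrightarrow> \<mu> \<in> V_space p \<Longrightarrow> 0 \<le> t \<Longrightarrow> sticky_semigroup p t \<mu> = euler_flow t \<mu>"
  using sticky_semigroup_on_unique[of p "sticky_semigroup p"] euler_flow_sticky_semigroup[of p]
    someI[of "sticky_semigroup_on p" euler_flow] by (simp add: sticky_semigroup_def)

theorem corollary2p7:
  fixes p :: real
  assumes "2 \<le> p"
  shows
    "(\<forall>X0 V0. (X0, V0) \<in> X_space p \<longrightarrow>
        unique_curve (strong_solution_cauchy X0 V0) (lag_X X0 V0) \<and>
        unique_curve (strong_solution_scaled X0 V0) (lag_X X0 V0) \<and>
        (\<forall>t\<ge>0. has_L2_deriv (lag_X X0 V0) (lag_V X0 V0 t) t (at_right 0)) \<and>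
        (\<forall>t\<ge>0. lag_flow t (X0, V0) \<in> X_space p))
     \<and> right_continuous_semigroup p lag_flow
     \<and> (\<forall>t\<ge>0. \<forall>X0 V0 X V v0 v.
          (X0, V0) \<in> X_space p \<and> (X, V) \<in> X_space p \<and>
          v0 \<in> borel_measurable borel \<and> v \<in> borel_measurable borel \<and>
          ae_eq V0 (v0 \<circ> X0) \<and> ae_eq V (v \<circ> X) \<longrightarrow>
          (pair_ae_eq (X, V) (lag_flow t (X0, V0)) \<longleftrightarrow>
           (distr leb01 borel X, momentum (distr leb01 borel X) v) =
             sticky_semigroup p t (distr leb01 borel X0, momentum (distr leb01 borel X0) v0)))"
proof (intro conjI allI impI)
  fix X0 V0 assume Z: "(X0, V0) \<in> X_space p"
  then have d: "lag_data X0 V0" by (simp add: X_space_iff[OF assms])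
  show "unique_curve (strong_solution_cauchy X0 V0) (lag_X X0 V0)" by (rule lag_X_unique_cauchy[OF d])
  show "unique_curve (strong_solution_scaled X0 V0) (lag_X X0 V0)" by (rule lag_X_unique_scaled[OF d])
  show "has_L2_deriv (lag_X X0 V0) (lag_V X0 V0 t) t (at_right 0)" if "0 \<le> t" for t
    by (rule lag_V_props(1)[OF d that])
  show "lag_flow t (X0, V0) \<in> X_space p" if "0 \<le> t" for t
    unfolding lag_flow_def using lag_flow_X_space[OF assms Z that] by simp
next
  show "right_continuous_semigroup p lag_flow" by (rule lag_flow_right_continuous_semigroup[OF assms])
next
  fix t :: real and X0 V0 X V v0 v
  assume t: "0 \<le> t" and *: "(X0, V0) \<in> X_space p \<and> (X, V) \<in> X_space p \<and>
      v0 \<in> borel_measurable borel \<and> v \<in> borel_measurable borel \<and> ae_eq V0 (v0 \<circ> X0) \<and> ae_eq V (v \<circ> X)"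
  then have Z0: "(X0, V0) \<in> X_space p" and Z: "(X, V) \<in> X_space p" by auto
  let ?Y = "lag_X X0 V0 t" and ?W = "lag_V X0 V0 t"
  have ZY: "(?Y, ?W) \<in> X_space p" by (rule lag_flow_X_space[OF assms Z0 t])
  have meas: "A \<in> borel_measurable leb01 \<and> B \<in> borel_measurable leb01" if "(A, B) \<in> X_space p" for A B
    using that by (auto simp: X_space_def dest: Lp_measurable)
  \<comment> \<open>The given velocities \<open>v0\<close> and \<open>v\<close> enter only through
    the momenta, hence through \<open>eulerian\<close>, which no longer mentions them.\<close>
  have e0: "eulerian X0 V0 = (distr leb01 borel X0, momentum (distr leb01 borel X0) v0)"
    using * meas[OF Z0] by (intro eulerian_comp) auto
  have e: "eulerian X V = (distr leb01 borel X, momentum (distr leb01 borel X) v)"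
    using * meas[OF Z] by (intro eulerian_comp) auto
  have "sticky_semigroup p t (eulerian X0 V0) = eulerian ?Y ?W"
    using sticky_semigroup_eq[OF assms eulerian_V_space[OF assms Z0] t] euler_flow_eulerian[OF assms Z0 t] by simp
  moreover have "pair_ae_eq (X, V) (lag_flow t (X0, V0)) \<longleftrightarrow> eulerian X V = eulerian ?Y ?W"
  proof
    assume "pair_ae_eq (X, V) (lag_flow t (X0, V0))"
    then have "ae_eq X ?Y" "ae_eq V ?W" by (simp_all add: pair_ae_eq_def lag_flow_def)
    then show "eulerian X V = eulerian ?Y ?W" using meas[OF Z] meas[OF ZY] by (intro eulerian_cong_AE) auto
  next
    assume eq: "eulerian X V = eulerian ?Y ?W"
    show "pair_ae_eq (X, V) (lag_flow t (X0, V0))"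
      using eulerian_inj[OF assms Z ZY eq] by (simp add: pair_ae_eq_def lag_flow_def)
  qed
  ultimately show "pair_ae_eq (X, V) (lag_flow t (X0, V0)) \<longleftrightarrow>
      (distr leb01 borel X, momentum (distr leb01 borel X) v) =
        sticky_semigroup p t (distr leb01 borel X0, momentum (distr leb01 borel X0) v0)"
    by (simp add: e0 e)
qed

end
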